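(* Let $P=k[x_1,\dots,x_n]$ with $k$ a field, and let $P/J$ be a standard graded Artinian Gorenstein algebra with inverse polynomial $\varphi$ of degree $s$. For every integer $m\ge1$, put $t=s-m$. Then, with the notation of the context, the mapping cone of the following chain map is a $P$-free resolution of the quotient $P/J_{\ge m}$ of $P$ by the truncated ideal $J_{\ge m}$. The source is the complex $$0\to L_{n-1,m}\xrightarrow{\partial^{\mathbb L}}L_{n-2,m}\xrightarrow{\partial^{\mathbb L}}\cdots\xrightarrow{\partial^{\mathbb L}}L_{1,m}\xrightarrow{\partial^{\mathbb L}}L_{0,m}\xrightarrow{\varepsilon}P\to0,$$ the target is the complex $$0\to P\xrightarrow{\begin{bmatrix}\pi\circ\varepsilon^*\\ *\end{bmatrix}}K'_{n-1,t}\oplus W_{n-1,t-1}\xrightarrow{\begin{bmatrix}\partial^{\mathbb K}&*\\0&\partial^{\mathbb K}\end{bmatrix}}\cdots\xrightarrow{\begin{bmatrix}\partial^{\mathbb K}&*\\0&\partial^{\mathbb K}\end{bmatrix}}K'_{1,t}\oplus W_{1,t-1}\xrightarrow{\begin{bmatrix}\partial^{\mathbb K}&*\\0&\partial^{\mathbb K}\end{bmatrix}}K'_{0,t}\oplus W_{0,t-1}\to0,$$ and the chain map is $(1\otimes\Phi_m,0)\colon L_{i,m}\to K'_{i,t}\oplus W_{i,t-1}$ for $0\le i\le n-1$ (and zero on the $P$ at the right end of the source). Here $\partial^{\mathbb L},\partial^{\mathbb K}$ are the maps induced by $\operatorname{kos}\otimes1$, $\pi\colon K_{n-1,t}\to K'_{n-1,t}$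 is any chosen projection onto the direct summand $K'_{n-1,t}$, and the entries denoted $*$ are certain $P$-linear maps, not specified explicitly. In the cone, the last $P$ of the source has homological degree $0$, $L_{i,m}$ has degree $i+1$, $K'_{i,t}\oplus W_{i,t-1}$ has degree $i$, and the left-most $P$ of the target has degree $n$.
   Context: $J_{\ge m}$ is the ideal of $P$ obtained by truncating $J$ to degrees $\ge m$. Inverse polynomial: let $D_k$ be the divided power algebra over $k$ with $k$-basis the monomials $x_1^{(i_1)}\cdots x_n^{(i_n)}$, a $P$-module via $x_1^{j_1}\cdots x_n^{j_n}\cdot x_1^{(i_1)}\cdots x_n^{(i_n)}=x_1^{(i_1-j_1)}\cdots x_n^{(i_n-j_n)}$ if all $i_l\ge j_l$ and $0$ otherwise. For a homogeneous Artinian Gorenstein ideal $J$ there is a homogeneous $\varphi\in D_k$, the inverse polynomial, with $J=\{r\in P: r\varphi=0\}$; its degree $s$ is the socle degree of $P/J$. Let $F$ be a free $P$-module with basis $X_1,\dots,X_n$; $S=P[X_1,\dots,X_n]$ its symmetric algebra over $P$, $D$ the divided power $P$-algebra on $F^*$ (with $P$-basis the $X_1^{(i_1)}\cdots X_n^{(i_n)}$, an $S$-module via the $P$-bilinear extension of the rule $X_1^{j_1}\cdots X_n^{j_n}\cdot X_1^{(i_1)}\cdots X_n^{(i_n)}=X_1^{(i_1-j_1)}\cdots X_n^{(i_n-j_n)}$ if all $i_l\ge j_l$ and $0$ otherwise), $\Lambda$ the exterior $P$-algebra on $F$; all tensor products are over $P$. View $\varphi$ in $D$ by replacing $x_i$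 by $X_i$. Let $\Phi_i\colon S_i\to D_{s-i}$, $g\mapsto g\varphi$ ($D_j=0$ for $j<0$), and $D'_{s-i}=\operatorname{im}\Phi_i$. Let $\kappa\colon\Lambda^a\otimes S_b\to\Lambda^{a-1}\otimes S_{b+1}$ and $\eta\colon\Lambda^a\otimes D_b\to\Lambda^{a-1}\otimes D_{b-1}$ be the Koszul differentials of $X_1,\dots,X_n$ on $S$ and $D$. Put $L_{a,b}=\ker(\kappa$ on $\Lambda^a\otimes S_b)$ (so $L_{0,b}=S_b$), $K_{a,b}=\ker(\eta$ on $\Lambda^a\otimes D_b)$. Let $\eta'\colon\Lambda^a\otimes D'_b\to\Lambda^{a-1}\otimes D'_{b-1}$ be the restriction of $\eta$, $K'_{a,b}=\ker(\eta'$ on $\Lambda^a\otimes D'_b)$ (a free direct summand of $K_{a,b}$), $C_{a,b}=\operatorname{coker}(\Lambda^{a+1}\otimes D'_{b+1}\xrightarrow{\eta'}K'_{a,b})$, and $W_{a,b}=\bigoplus_{j=0}^{b}C_{a,j}$ (so $W_{a,b}=0$ for $b<0$). The map $1\otimes\Phi_m$ sends $L_{i,m}$ to $K'_{i,s-m}$. $\operatorname{kos}$ is the differential of the Koszul complex $\Lambda=K(x_1,\dots,x_n;P)$ (sending $X_i\mapsto x_i$); $\operatorname{kos}\otimes 1$ commutes up to sign with $\kappa,\eta,\eta'$ and so induces maps $L_{a,b}\to L_{a-1,b}$, $K'_{a,b}\to K'_{a-1,b}$, $C_{a,b}\to C_{a-1,b}$. $\varepsilon\colon S\to P$ is the $P$-algebra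 map $X_i\mapsto x_i$, restricted to $L_{0,m}=S_m$. The map $\varepsilon^*\colon P\to K_{n-1,t}$ is the $P$-dual of $\varepsilon\colon S_{t+1}\to P$, using $\operatorname{Hom}_P(S_{t+1},P)\cong D_{t+1}\cong\Lambda^n\otimes D_{t+1}\cong K_{n-1,t}$, the last isomorphism being $\eta$. Convention: if $m>s$ the whole target complex (including its left-most $P$) is taken to be zero.
   Formalization: The block ∂^K from W_{i,t-1} to W_{i-1,t-1} is not just the sum of the maps C_{i,j}→C_{i-1,j} induced by kos⊗1: further unspecified maps C_{i,j}→C_{i-1,j'} with j<j' are allowed. Without them the claim fails for n=3, J=(x^3,y^3,z^3), m=1. *)

theory Defs
  imports "HOL-Algebra.Algebraic_Closure_Type" "HOL-Library.Poly_Mapping" "HOL-Library.Cardinality"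
begin

section \<open>Modules, complexes, mapping cones and resolutions\<close>

definition mod_hom ::
  "('r, 'z) ring_scheme \<Rightarrow> ('r, 'a) module \<Rightarrow> ('r, 'b) module \<Rightarrow> ('a \<Rightarrow> 'b) set" where
  "mod_hom R M N = {f \<in> carrier M \<rightarrow> carrier N.
     (\<forall>x\<in>carrier M. \<forall>y\<in>carrier M. f (x \<oplus>\<^bsub>M\<^esub> y) = f x \<oplus>\<^bsub>N\<^esub> f y) \<and>
     (\<forall>r\<in>carrier R. \<forall>x\<in>carrier M. f (r \<odot>\<^bsub>M\<^esub> x) = r \<odot>\<^bsub>N\<^esub> f x)}"

(* B is a basis: every element is a unique finitely supported combination of elements of B *)
definition free_module :: "('r, 'z) ring_scheme \<Rightarrow> ('r, 'a) module \<Rightarrow> bool" where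
  "free_module R M \<longleftrightarrow> module R M \<and>
     (\<exists>B \<subseteq> carrier M. \<forall>x\<in>carrier M. \<exists>!c. c \<in> B \<rightarrow>\<^sub>E carrier R \<and>
        finite {b\<in>B. c b \<noteq> \<zero>\<^bsub>R\<^esub>} \<and> x = (\<Oplus>\<^bsub>M\<^esub>b\<in>{b\<in>B. c b \<noteq> \<zero>\<^bsub>R\<^esub>}. c b \<odot>\<^bsub>M\<^esub> b))"

(* The ring fields mult and one of a module record are irrelevant and left undefined. *)
definition dsum :: "('r, 'a) module \<Rightarrow> ('r, 'b) module \<Rightarrow> ('r, 'a \<times> 'b) module" where
  "dsum M N = \<lparr>carrier = carrier M \<times> carrier N, monoid.mult = undefined, one = undefined,
     zero = (\<zero>\<^bsub>M\<^esub>, \<zero>\<^bsub>N\<^esub>),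
     add = (\<lambda>x y. (fst x \<oplus>\<^bsub>M\<^esub> fst y, snd x \<oplus>\<^bsub>N\<^esub> snd y)),
     module.smult = (\<lambda>r x. (r \<odot>\<^bsub>M\<^esub> fst x, r \<odot>\<^bsub>N\<^esub> snd x))\<rparr>"

(* direct sum over a finite index set *)
definition Dsum :: "'i set \<Rightarrow> ('i \<Rightarrow> ('r, 'a) module) \<Rightarrow> ('r, 'i \<Rightarrow> 'a) module" where
  "Dsum I M = \<lparr>carrier = (\<Pi>\<^sub>E i\<in>I. carrier (M i)), monoid.mult = undefined, one = undefined,
     zero = (\<lambda>i\<in>I. \<zero>\<^bsub>M i\<^esub>),
     add = (\<lambda>x y. \<lambda>i\<in>I. x i \<oplus>\<^bsub>M i\<^esub> y i),
     module.smult = (\<lambda>r x. \<lambda>i\<in>I. r \<odot>\<^bsub>M i\<^esub> x i)\<rparr>"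

definition quot_module :: "('r, 'a) module \<Rightarrow> 'a set \<Rightarrow> ('r, 'a set) module" where
  "quot_module M B = \<lparr>carrier = a_rcosets\<^bsub>M\<^esub> B, monoid.mult = undefined, one = undefined,
     zero = B, add = set_add M, module.smult = (\<lambda>r Y. \<Union>x\<in>Y. B +>\<^bsub>M\<^esub> (r \<odot>\<^bsub>M\<^esub> x))\<rparr>"

(* the map into quot_module N B induced by f on cosets *)
definition quot_map :: "('r, 'b) module \<Rightarrow> 'b set \<Rightarrow> ('a \<Rightarrow> 'b) \<Rightarrow> 'a set \<Rightarrow> 'b set" where
  "quot_map N B f Y = (\<Union>x\<in>Y. B +>\<^bsub>N\<^esub> f x)"

(* M if c holds, and the zero module otherwise *)
definition if_module :: "bool \<Rightarrow> ('r, 'a) module \<Rightarrow> ('r, 'a) module" where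
  "if_module c M = (if c then M else M\<lparr>carrier := {\<zero>\<^bsub>M\<^esub>}\<rparr>)"

(* d i : C i \<rightarrow> C (i - 1) *)
definition is_complex ::
  "('r, 'z) ring_scheme \<Rightarrow> (int \<Rightarrow> ('r, 'a) module) \<Rightarrow> (int \<Rightarrow> 'a \<Rightarrow> 'a) \<Rightarrow> bool" where
  "is_complex R C d \<longleftrightarrow> (\<forall>i. module R (C i) \<and> d i \<in> mod_hom R (C i) (C (i - 1)) \<and>
     (\<forall>x\<in>carrier (C i). d (i - 1) (d i x) = \<zero>\<^bsub>C (i - 2)\<^esub>))"

definition is_chain_map ::
  "('r, 'z) ring_scheme \<Rightarrow> (int \<Rightarrow> ('r, 'a) module) \<Rightarrow> (int \<Rightarrow> 'a \<Rightarrow> 'a) \<Rightarrow>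
   (int \<Rightarrow> ('r, 'b) module) \<Rightarrow> (int \<Rightarrow> 'b \<Rightarrow> 'b) \<Rightarrow> (int \<Rightarrow> 'a \<Rightarrow> 'b) \<Rightarrow> bool" where
  "is_chain_map R C d C' d' f \<longleftrightarrow> (\<forall>i. f i \<in> mod_hom R (C i) (C' i) \<and>
     (\<forall>x\<in>carrier (C i). f (i - 1) (d i x) = d' i (f i x)))"

definition cone :: "(int \<Rightarrow> ('r, 'a) module) \<Rightarrow> (int \<Rightarrow> ('r, 'b) module) \<Rightarrow>
    int \<Rightarrow> ('r, 'a \<times> 'b) module" where
  "cone C C' i = dsum (C (i - 1)) (C' i)"

definition cone_diff :: "(int \<Rightarrow> ('r, 'a) module) \<Rightarrow> (int \<Rightarrow> 'a \<Rightarrow> 'a) \<Rightarrow>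
    (int \<Rightarrow> ('r, 'b) module) \<Rightarrow> (int \<Rightarrow> 'b \<Rightarrow> 'b) \<Rightarrow> (int \<Rightarrow> 'a \<Rightarrow> 'b) \<Rightarrow>
    int \<Rightarrow> 'a \<times> 'b \<Rightarrow> 'a \<times> 'b" where
  "cone_diff C d C' d' f i = (\<lambda>(x, y). (\<ominus>\<^bsub>C (i - 2)\<^esub> d (i - 1) x, f (i - 1) x \<oplus>\<^bsub>C' (i - 1)\<^esub> d' i y))"

(* \<dots> \<rightarrow> F 1 \<rightarrow> F 0 \<rightarrow> N \<rightarrow> 0 is exact, with all F i free *)
definition free_resolution ::
  "('r, 'z) ring_scheme \<Rightarrow> (int \<Rightarrow> ('r, 'a) module) \<Rightarrow> (int \<Rightarrow> 'a \<Rightarrow> 'a) \<Rightarrow>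
   ('r, 'b) module \<Rightarrow> ('a \<Rightarrow> 'b) \<Rightarrow> bool" where
  "free_resolution R F d N aug \<longleftrightarrow> is_complex R F d \<and> module R N \<and>
     (\<forall>i. free_module R (F i)) \<and> (\<forall>i<0. carrier (F i) = {\<zero>\<^bsub>F i\<^esub>}) \<and>
     (\<forall>i>0. {x\<in>carrier (F i). d i x = \<zero>\<^bsub>F (i - 1)\<^esub>} = d (i + 1) ` carrier (F (i + 1))) \<and>
     aug \<in> mod_hom R (F 0) N \<and> aug ` carrier (F 0) = carrier N \<and>
     {x\<in>carrier (F 0). aug x = \<zero>\<^bsub>N\<^esub>} = d 1 ` carrier (F 1)"


section \<open>The polynomial ring, its ideals and inverse polynomials\<close>

(* The variables are indexed by a finite linearly ordered type 'n, so n = CARD('n);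
   the order only fixes the signs in the exterior algebra. *)
type_synonym 'n mon = "'n \<Rightarrow>\<^sub>0 nat"
type_synonym ('n, 'k) pol = "'n mon \<Rightarrow>\<^sub>0 'k"

definition PR :: "('n, 'k::field) pol ring" where
  "PR = ring_of_type_algebra"

definition mdeg :: "'n::finite mon \<Rightarrow> nat" where
  "mdeg u = (\<Sum>l\<in>UNIV. Poly_Mapping.lookup u l)"

(* exponent of the single variable number i *)
definition evar :: "'n \<Rightarrow> 'n mon" where
  "evar i = Poly_Mapping.single i 1"

definition const :: "'k \<Rightarrow> ('n, 'k::field) pol" where
  "const c = Poly_Mapping.single 0 c"

definition var :: "'n \<Rightarrow> ('n, 'k::field) pol" where
  "var i = Poly_Mapping.single (evar i) 1"

(* Degree-b component of a polynomial or divided power algebra in n variables with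
   coefficients in 'a; it is zero for b < 0. *)
definition homog :: "int \<Rightarrow> ('n::finite mon \<Rightarrow>\<^sub>0 'a::zero) set" where
  "homog b = {f. \<forall>u\<in>Poly_Mapping.keys f. int (mdeg u) = b}"

(* Divided power algebras have the same underlying free modules as polynomial rings, with
   Poly_Mapping.single u c standing for c times the divided power monomial of exponent u.
   contract g f is the action of the polynomial g on the divided power element f, over any
   ring of coefficients. *)
definition contract ::
  "('n mon \<Rightarrow>\<^sub>0 'a::comm_ring_1) \<Rightarrow> ('n mon \<Rightarrow>\<^sub>0 'a) \<Rightarrow> ('n mon \<Rightarrow>\<^sub>0 'a)" where
  "contract g f = (\<Sum>u\<in>Poly_Mapping.keys g. \<Sum>v\<in>Poly_Mapping.keys f.
     if \<forall>l. Poly_Mapping.lookup u l \<le> Poly_Mapping.lookup v l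
     then Poly_Mapping.single (v - u) (Poly_Mapping.lookup g u * Poly_Mapping.lookup f v) else 0)"

definition homogeneous_ideal :: "('n::finite, 'k::field) pol set \<Rightarrow> bool" where
  "homogeneous_ideal J \<longleftrightarrow> ideal J PR \<and>
     (\<forall>r\<in>J. \<forall>d. (\<Sum>u\<in>{u\<in>Poly_Mapping.keys r. mdeg u = d}. Poly_Mapping.single u (Poly_Mapping.lookup r u)) \<in> J)"

definition artinian_ring :: "('a, 'z) ring_scheme \<Rightarrow> bool" where
  "artinian_ring A \<longleftrightarrow> ring A \<and>
     (\<forall>I :: nat \<Rightarrow> 'a set. (\<forall>i. ideal (I i) A \<and> I (Suc i) \<subseteq> I i) \<longrightarrow> (\<exists>N. \<forall>i\<ge>N. I i = I N))"

(* The preimage in P of the socle of P/J. *)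
definition socle :: "('n, 'k::field) pol set \<Rightarrow> ('n, 'k) pol set" where
  "socle J = {r. \<forall>i. var i * r \<in> J}"

(* For Artinian graded algebras, Gorenstein means: the socle is one-dimensional over k. *)
definition artinian_gorenstein :: "('n::finite, 'k::field) pol set \<Rightarrow> bool" where
  "artinian_gorenstein J \<longleftrightarrow> homogeneous_ideal J \<and> artinian_ring (PR Quot J) \<and>
     (\<exists>a\<in>socle J - J. \<forall>r\<in>socle J. \<exists>c. r - const c * a \<in> J)"

definition inverse_polynomial ::
  "('n::finite, 'k::field) pol set \<Rightarrow> ('n mon \<Rightarrow>\<^sub>0 'k) \<Rightarrow> int \<Rightarrow> bool" where
  "inverse_polynomial J \<phi> s \<longleftrightarrow> \<phi> \<noteq> 0 \<and> \<phi> \<in> homog s \<and> J = {r. contract r \<phi> = 0}"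

definition truncation :: "('n::finite, 'k::field) pol set \<Rightarrow> int \<Rightarrow> ('n, 'k) pol set" where
  "truncation J m = {r\<in>J. \<forall>u\<in>Poly_Mapping.keys r. m \<le> int (mdeg u)}"


section \<open>The algebras S, D and the Koszul differentials\<close>

(* Elements of S = P[X_1,...,X_n] or of D. *)
type_synonym ('n, 'k) xpol = "'n mon \<Rightarrow>\<^sub>0 ('n, 'k) pol"

(* Elements of \<Lambda> \<otimes> S or of \<Lambda> \<otimes> D: the coefficient at A is that of the wedge product, in
   increasing order, of the basis elements X_i of F with i in A. *)
type_synonym ('n, 'k) xform = "'n set \<Rightarrow>\<^sub>0 ('n, 'k) xpol"

definition xscale :: "('n, 'k::field) pol \<Rightarrow> ('n, 'k) xpol \<Rightarrow> ('n, 'k) xpol" where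
  "xscale p f = Poly_Mapping.map ((*) p) f"

definition pol_mod :: "(('n, 'k::field) pol, ('n, 'k) pol) module" where
  "pol_mod = \<lparr>carrier = UNIV, monoid.mult = undefined, one = undefined, zero = 0, add = (+),
     module.smult = (*)\<rparr>"

(* A submodule V of \<Lambda> \<otimes> S or \<Lambda> \<otimes> D as a module over P. *)
definition xmod :: "('n, 'k::field) xform set \<Rightarrow> (('n, 'k) pol, ('n, 'k) xform) module" where
  "xmod V = \<lparr>carrier = V, monoid.mult = undefined, one = undefined, zero = 0, add = (+),
     module.smult = (\<lambda>p w. Poly_Mapping.map (xscale p) w)\<rparr>"

(* \<Lambda>^a \<otimes> V for a submodule V of S or D *)
definition ext :: "int \<Rightarrow> ('n, 'k::field) xpol set \<Rightarrow> ('n, 'k) xform set" where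
  "ext a V = {w. \<forall>A\<in>Poly_Mapping.keys w. int (card A) = a \<and> Poly_Mapping.lookup w A \<in> V}"

(* Koszul differential of commuting operators act i. *)
definition koszul ::
  "('n::linorder \<Rightarrow> ('n, 'k::field) xpol \<Rightarrow> ('n, 'k) xpol) \<Rightarrow> ('n, 'k) xform \<Rightarrow> ('n, 'k) xform" where
  "koszul act w = (\<Sum>A\<in>Poly_Mapping.keys w. \<Sum>i\<in>A. Poly_Mapping.single (A - {i})
     ((-1) ^ card {j\<in>A. j < i} * act i (Poly_Mapping.lookup w A)))"

definition Xvar :: "'n \<Rightarrow> ('n, 'k::field) xpol" where
  "Xvar i = Poly_Mapping.single (evar i) 1"

definition kappa :: "('n::{finite,linorder}, 'k::field) xform \<Rightarrow> ('n, 'k) xform" where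
  "kappa = koszul (\<lambda>i f. Xvar i * f)"

definition eta :: "('n::{finite,linorder}, 'k::field) xform \<Rightarrow> ('n, 'k) xform" where
  "eta = koszul (\<lambda>i f. contract (Xvar i) f)"

(* kos \<otimes> 1, on both \<Lambda> \<otimes> S and \<Lambda> \<otimes> D *)
definition kos :: "('n::{finite,linorder}, 'k::field) xform \<Rightarrow> ('n, 'k) xform" where
  "kos = koszul (\<lambda>i f. xscale (var i) f)"

(* \<phi> viewed in D *)
definition inD :: "('n mon \<Rightarrow>\<^sub>0 'k::field) \<Rightarrow> ('n, 'k) xpol" where
  "inD \<phi> = Poly_Mapping.map const \<phi>"

(* The maps \<Phi>_i are the restrictions of \<Phi> \<phi> to the graded pieces of S. *)
definition \<Phi> :: "('n mon \<Rightarrow>\<^sub>0 'k::field) \<Rightarrow> ('n, 'k) xpol \<Rightarrow> ('n, 'k) xpol" where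
  "\<Phi> \<phi> g = contract g (inD \<phi>)"

(* D'_b is the image of \<Phi>_{s-b} *)
definition D' :: "('n::finite mon \<Rightarrow>\<^sub>0 'k::field) \<Rightarrow> int \<Rightarrow> int \<Rightarrow> ('n, 'k) xpol set" where
  "D' \<phi> s b = \<Phi> \<phi> ` homog (s - b)"

definition L :: "int \<Rightarrow> int \<Rightarrow> ('n::{finite,linorder}, 'k::field) xform set" where
  "L a b = {w \<in> ext a (homog b). kappa w = 0}"

definition K :: "int \<Rightarrow> int \<Rightarrow> ('n::{finite,linorder}, 'k::field) xform set" where
  "K a b = {w \<in> ext a (homog b). eta w = 0}"

definition K' :: "('n mon \<Rightarrow>\<^sub>0 'k) \<Rightarrow> int \<Rightarrow> int \<Rightarrow> int \<Rightarrow>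
    ('n::{finite,linorder}, 'k::field) xform set" where
  "K' \<phi> s a b = {w \<in> ext a (D' \<phi> s b). eta w = 0}"

definition B' :: "('n mon \<Rightarrow>\<^sub>0 'k) \<Rightarrow> int \<Rightarrow> int \<Rightarrow> int \<Rightarrow>
    ('n::{finite,linorder}, 'k::field) xform set" where
  "B' \<phi> s a b = eta ` ext (a + 1) (D' \<phi> s (b + 1))"

definition C :: "('n mon \<Rightarrow>\<^sub>0 'k) \<Rightarrow> int \<Rightarrow> int \<Rightarrow> int \<Rightarrow>
    (('n::{finite,linorder}, 'k::field) pol, ('n, 'k) xform set) module" where
  "C \<phi> s a b = quot_module (xmod (K' \<phi> s a b)) (B' \<phi> s a b)"

definition W :: "('n mon \<Rightarrow>\<^sub>0 'k) \<Rightarrow> int \<Rightarrow> int \<Rightarrow> int \<Rightarrow>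
    (('n::{finite,linorder}, 'k::field) pol, int \<Rightarrow> ('n, 'k) xform set) module" where
  "W \<phi> s a b = Dsum {0..b} (\<lambda>j. C \<phi> s a j)"

(* the map C_{a,b} \<rightarrow> C_{a-1,b} induced by kos \<otimes> 1 *)
definition kosC :: "('n mon \<Rightarrow>\<^sub>0 'k) \<Rightarrow> int \<Rightarrow> int \<Rightarrow> int \<Rightarrow>
    ('n::{finite,linorder}, 'k::field) xform set \<Rightarrow> ('n, 'k) xform set" where
  "kosC \<phi> s a b = quot_map (xmod (K' \<phi> s (a - 1) b)) (B' \<phi> s (a - 1) b) kos"

definition eps :: "('n, 'k::field) xpol \<Rightarrow> ('n, 'k) pol" where
  "eps f = (\<Sum>u\<in>Poly_Mapping.keys f. Poly_Mapping.lookup f u * Poly_Mapping.single u 1)"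

(* Hom_P(S_b, P) \<rightarrow> D_b, using that the divided power monomials are dual to the monomials *)
definition dual_to_D :: "int \<Rightarrow> (('n::finite, 'k::field) xpol \<Rightarrow> ('n, 'k) pol) \<Rightarrow> ('n, 'k) xpol" where
  "dual_to_D b l = (\<Sum>u | int (mdeg u) = b. Poly_Mapping.single u (l (Poly_Mapping.single u 1)))"

(* \<epsilon>^* : P \<rightarrow> K_{n-1,t}. Under P = Hom_P(P,P), p is sent to the functional p \<epsilon> on S_{t+1}, then
   to \<Lambda>^n \<otimes> D_{t+1}, where \<Lambda>^n has the basis element with index set UNIV. *)
definition eps_dual :: "int \<Rightarrow> ('n::{finite,linorder}, 'k::field) pol \<Rightarrow> ('n, 'k) xform" where
  "eps_dual t p = eta (Poly_Mapping.single UNIV (dual_to_D (t + 1) (\<lambda>f. p * eps f)))"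

(* \<pi> is a projection of K_{n-1,t} onto its submodule K'_{n-1,t} *)
definition is_projection :: "('n mon \<Rightarrow>\<^sub>0 'k) \<Rightarrow> int \<Rightarrow> int \<Rightarrow>
    (('n::{finite,linorder}, 'k::field) xform \<Rightarrow> ('n, 'k) xform) \<Rightarrow> bool" where
  "is_projection \<phi> s t \<pi> \<longleftrightarrow>
     \<pi> \<in> mod_hom PR (xmod (K (int CARD('n) - 1) t)) (xmod (K' \<phi> s (int CARD('n) - 1) t)) \<and>
     (\<forall>y \<in> K' \<phi> s (int CARD('n) - 1) t. \<pi> y = y)"


section \<open>The source and target complexes\<close>

(* Source: L_{i,m} in degree i for 0 \<le> i \<le> n-1 and P in degree -1. To have one carrier type in all
   degrees, degree i is P \<oplus> \<Lambda> \<otimes> S with the summands not occurring replaced by 0. In degree 0, kos w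
   vanishes and the coefficient at {} identifies L_{0,m} with S_m. *)
definition source :: "int \<Rightarrow> int \<Rightarrow>
    (('n::{finite,linorder}, 'k::field) pol, ('n, 'k) pol \<times> ('n, 'k) xform) module" where
  "source m i = dsum (if_module (i = -1) pol_mod)
                     (if_module (0 \<le> i \<and> i \<le> int CARD('n) - 1) (xmod (L i m)))"

definition source_diff :: "int \<Rightarrow> ('n::{finite,linorder}, 'k::field) pol \<times> ('n, 'k) xform \<Rightarrow>
    ('n, 'k) pol \<times> ('n, 'k) xform" where
  "source_diff i = (\<lambda>(p, w). (if i = 0 then eps (Poly_Mapping.lookup w {}) else 0, kos w))"

(* Target: K'_{i,t} \<oplus> W_{i,t-1} in degree i for 0 \<le> i \<le> n-1, and P in degree n, the latter only if
   t = s - m \<ge> 0. If t < 0, all K'_{i,t} and W_{i,t-1} vanish. *)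
type_synonym ('n, 'k) tgt =
  "(('n, 'k) xform \<times> (int \<Rightarrow> ('n, 'k) xform set)) \<times> ('n, 'k) pol"

definition target :: "('n mon \<Rightarrow>\<^sub>0 'k) \<Rightarrow> int \<Rightarrow> int \<Rightarrow> int \<Rightarrow>
    (('n::{finite,linorder}, 'k::field) pol, ('n, 'k) tgt) module" where
  "target \<phi> s t i = dsum
     (if_module (0 \<le> i \<and> i \<le> int CARD('n) - 1) (dsum (xmod (K' \<phi> s i t)) (W \<phi> s i (t - 1))))
     (if_module (i = int CARD('n) \<and> t \<ge> 0) pol_mod)"

(* The diagonal block W_{i,t-1} \<rightarrow> W_{i-1,t-1}. Like the block matrix on K' \<oplus> W, it is read as upper
   triangular for the ordering C_{i,t-1}, ..., C_{i,0} of the summands of W_{i,t-1}: the diagonal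
   entries C_{i,j} \<rightarrow> C_{i-1,j} are induced by kos \<otimes> 1, and the entries \<tau> i j j' from C_{i,j}
   to C_{i-1,j'}, j < j', are among the unspecified maps. These cannot be dropped: for
   n = 3, J = (x^3,y^3,z^3) and m = 1 the maps C_{2,j} \<rightarrow> C_{1,j} with j \<le> t-1 are all zero, and with zero
   block W_{2,t-1} \<rightarrow> W_{1,t-1} the target is not exact in degree 1. *)
definition W_diff :: "('n mon \<Rightarrow>\<^sub>0 'k) \<Rightarrow> int \<Rightarrow> int \<Rightarrow>
    (int \<Rightarrow> int \<Rightarrow> int \<Rightarrow> ('n, 'k) xform set \<Rightarrow> ('n, 'k) xform set) \<Rightarrow> int \<Rightarrow>
    (int \<Rightarrow> ('n::{finite,linorder}, 'k::field) xform set) \<Rightarrow> int \<Rightarrow> ('n, 'k) xform set" where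
  "W_diff \<phi> s t \<tau> i w = (\<lambda>j'\<in>{0..t - 1}. kosC \<phi> s i j' (w j') \<oplus>\<^bsub>C \<phi> s (i - 1) j'\<^esub>
     (\<Oplus>\<^bsub>C \<phi> s (i - 1) j'\<^esub>j\<in>{0..<j'}. \<tau> i j j' (w j)))"

definition target_diff :: "('n mon \<Rightarrow>\<^sub>0 'k) \<Rightarrow> int \<Rightarrow> int \<Rightarrow>
    (('n, 'k) xform \<Rightarrow> ('n, 'k) xform) \<Rightarrow>
    (('n, 'k) pol \<Rightarrow> int \<Rightarrow> ('n, 'k) xform set) \<Rightarrow>
    (int \<Rightarrow> (int \<Rightarrow> ('n, 'k) xform set) \<Rightarrow> ('n, 'k) xform) \<Rightarrow>
    (int \<Rightarrow> int \<Rightarrow> int \<Rightarrow> ('n, 'k) xform set \<Rightarrow> ('n, 'k) xform set) \<Rightarrow> int \<Rightarrow>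
    ('n::{finite,linorder}, 'k::field) tgt \<Rightarrow> ('n, 'k) tgt" where
  "target_diff \<phi> s t \<pi> \<omega> \<sigma> \<tau> i = (\<lambda>((y, w), p).
     if i = int CARD('n) then ((\<pi> (eps_dual t p), \<omega> p), 0)
     else if 1 \<le> i \<and> i \<le> int CARD('n) - 1 then ((kos y + \<sigma> i w, W_diff \<phi> s t \<tau> i w), 0)
     else \<zero>\<^bsub>target \<phi> s t (i - 1)\<^esub>)"

(* The entries denoted by a star: \<omega> : P \<rightarrow> W_{n-1,t-1}, \<sigma> i : W_{i,t-1} \<rightarrow> K'_{i-1,t}, and \<tau> i j j'. *)
definition star_maps :: "('n mon \<Rightarrow>\<^sub>0 'k) \<Rightarrow> int \<Rightarrow> int \<Rightarrow>
    (('n, 'k) pol \<Rightarrow> int \<Rightarrow> ('n, 'k) xform set) \<Rightarrow>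
    (int \<Rightarrow> (int \<Rightarrow> ('n, 'k) xform set) \<Rightarrow> ('n, 'k) xform) \<Rightarrow>
    (int \<Rightarrow> int \<Rightarrow> int \<Rightarrow> ('n::{finite,linorder}, 'k::field) xform set \<Rightarrow> ('n, 'k) xform set) \<Rightarrow>
    bool" where
  "star_maps \<phi> s t \<omega> \<sigma> \<tau> \<longleftrightarrow>
     \<omega> \<in> mod_hom PR pol_mod (W \<phi> s (int CARD('n) - 1) (t - 1)) \<and>
     (\<forall>i\<in>{1..int CARD('n) - 1}.
        \<sigma> i \<in> mod_hom PR (W \<phi> s i (t - 1)) (xmod (K' \<phi> s (i - 1) t)) \<and>
        (\<forall>j\<in>{0..t - 1}. \<forall>j'\<in>{0..t - 1}. j < j' \<longrightarrow>
           \<tau> i j j' \<in> mod_hom PR (C \<phi> s i j) (C \<phi> s (i - 1) j')))"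

(* the chain map (1 \<otimes> \<Phi>_m, 0), zero on the P in degree -1 *)
definition comparison :: "('n mon \<Rightarrow>\<^sub>0 'k) \<Rightarrow> int \<Rightarrow> int \<Rightarrow> int \<Rightarrow>
    ('n, 'k) pol \<times> ('n::{finite,linorder}, 'k::field) xform \<Rightarrow> ('n, 'k) tgt" where
  "comparison \<phi> s t i = (\<lambda>(p, w). ((Poly_Mapping.map (\<Phi> \<phi>) w, \<zero>\<^bsub>W \<phi> s i (t - 1)\<^esub>), 0))"

end

theory Submission
  imports Defs
begin

text \<open>Let $A$ be the polynomial ring or the divided power algebra in $X_1,\dots,X_n$ over $k$, and $V$ a graded
$k$-subspace of $A$ closed under the operators $X_i$. The Koszul complex of the operators $x_i - X_i$ on
$P \otimes_k V$ is exact in positive degrees, because \<open>kos\<close> alone is contractible in positive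
$P$-degree; its homology in degree $0$ is $V$, with $x_i$ acting as $X_i$. A graded $k$-linear splitting of the
Koszul complex of the $X_i$ on $V$, extended to $P$, turns this by homological perturbation into a smaller free
complex, on the homology of the $X$-direction. If $V$ consists of the polynomials of degree at least $m$, the
smaller complex is that of the $L_{i,m}$. If $V$ is the part of degree at most $t$ of the inverse system of
$\varphi$, which is $P_{\ge m}\varphi$, it is that of the $K'_{i,t} \oplus W_{i,t-1}$ with one copy of $P$ on top;
its differential is triangular for degree reasons. Hence the cone of multiplication by $\varphi$ resolves
$P/J_{\ge m}$. The top generator goes to $\varepsilon^*(1)$ modulo the ideal of the coordinates of its
component in $W$, and so a change of basis \<open>\<theta>\<close> adapts the complex to any projection $\pi$.\<close>

text \<open>The cone realises P/J_{>=m} as an extension of P/P_{>=m} by P_{>=m}/J_{>=m}: the source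
  resolves the first module, the target the second, which multiplication by \<phi> identifies with
  the truncated inverse system. Two obstacles shape the proof. Sections of linear maps are available
  over k, while the statement lives over P; hence forms are cut into slices at the monomials of P,
  and k-linear maps act slice by slice. And the perturbation series has to stop: the splittings are
  homogeneous and shift the X-degree by one in a fixed direction, downwards for polynomials and
  upwards for divided powers, while \<open>kos\<close> preserves it. The upward shift also explains
  the shape of the target: in the largest degree t nothing lies above, so all of K'_{a,t} survives,
  whereas in lower degrees j only the homology C_{a,j} of the truncated Koszul complex does.\<close>

abbreviation lk :: "('a \<Rightarrow>\<^sub>0 'b::zero) \<Rightarrow> 'a \<Rightarrow> 'b" where
  "lk \<equiv> Poly_Mapping.lookup"

section \<open>Additive maps between groups of finitely supported functions\<close>

lemma lookup_map0: "f 0 = 0 \<Longrightarrow> lk (Poly_Mapping.map f p) k = f (lk p k)"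
  by transfer (auto simp: when_def)

definition additive_fn :: "('a::ab_group_add \<Rightarrow> 'b::ab_group_add) \<Rightarrow> bool" where
  "additive_fn f \<longleftrightarrow> (\<forall>x y. f (x + y) = f x + f y)"

lemma additive_fnI: "(\<And>x y. f (x + y) = f x + f y) \<Longrightarrow> additive_fn f"
  by (simp add: additive_fn_def)

lemma additive_fn_add: "additive_fn f \<Longrightarrow> f (x + y) = f x + f y"
  by (simp add: additive_fn_def)

lemma additive_fn_0: "additive_fn f \<Longrightarrow> f 0 = 0"
  by (metis additive_fn_def add_cancel_right_right)

lemma additive_fn_minus: "additive_fn f \<Longrightarrow> f (- x) = - f x"
  using additive_fn_add[of f x "- x"] additive_fn_0[of f] by (simp add: eq_neg_iff_add_eq_0 add.commute)

lemma additive_fn_diff: "additive_fn f \<Longrightarrow> f (x - y) = f x - f y"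
  using additive_fn_add[of f x "- y"] additive_fn_minus[of f y] by simp

lemma additive_fn_sum: "additive_fn f \<Longrightarrow> f (sum g S) = (\<Sum>x\<in>S. f (g x))"
  by (induction S rule: infinite_finite_induct) (simp_all add: additive_fn_0 additive_fn_add)

lemma additive_fn_comp: "additive_fn f \<Longrightarrow> additive_fn g \<Longrightarrow> additive_fn (\<lambda>x. f (g x))"
  by (simp add: additive_fn_def)

lemma sum_single_keys: "(\<Sum>k\<in>Poly_Mapping.keys p. Poly_Mapping.single k (lk p k)) = p"
proof (rule poly_mapping_eqI)
  fix k
  have "lk (\<Sum>k\<in>Poly_Mapping.keys p. Poly_Mapping.single k (lk p k)) k =
      (\<Sum>l\<in>Poly_Mapping.keys p. if l = k then lk p k else 0)"
    by (simp add: lookup_sum lookup_single when_def cong: if_cong)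
  also have "\<dots> = lk p k"
    by (simp add: in_keys_iff)
  finally show "lk (\<Sum>k\<in>Poly_Mapping.keys p. Poly_Mapping.single k (lk p k)) k = lk p k" .
qed

text \<open>Terms generate the group, so additive maps are determined on them; the identities for
  contraction, \<open>eps\<close> and \<open>ev1\<close> below are reduced to monomials in this
  way.\<close>

lemma additive_fn_eqI:
  assumes "additive_fn f" "additive_fn g" "\<And>k c. f (Poly_Mapping.single k c) = g (Poly_Mapping.single k c)"
  shows "f p = g p"
proof -
  have "f (\<Sum>k\<in>Poly_Mapping.keys p. Poly_Mapping.single k (lk p k)) = g (\<Sum>k\<in>Poly_Mapping.keys p. Poly_Mapping.single k (lk p k))"
    using assms by (simp add: additive_fn_sum)
  then show ?thesis
    by (simp add: sum_single_keys)
qed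

text \<open>A sign acting on an arbitrary abelian group: the same computations serve coefficients in
  k, in P and in modules over them, and every additive map commutes with it.\<close>

definition sg :: "nat \<Rightarrow> 'a::ab_group_add \<Rightarrow> 'a" where
  "sg n x = (if even n then x else - x)"

lemma sg_0 [simp]: "sg 0 x = x" by (simp add: sg_def)
lemma sg_zero [simp]: "sg n 0 = 0" by (simp add: sg_def)
lemma sg_add: "sg n (x + y) = sg n x + sg n y" by (simp add: sg_def)
lemma sg_sg: "sg m (sg n x) = sg (m + n) x" by (simp add: sg_def)
lemma sg_Suc: "sg (Suc n) x = - sg n x" by (simp add: sg_def)
lemma sg_sum: "sg n (sum f S) = (\<Sum>x\<in>S. sg n (f x))" by (simp add: sg_def sum_negf)
lemma sg_eq_0 [simp]: "sg n x = 0 \<longleftrightarrow> x = 0" by (simp add: sg_def)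
lemma sg_mult: "(-1) ^ n * x = sg n (x :: 'a::comm_ring_1)" by (simp add: sg_def)
lemma additive_sg: "additive_fn f \<Longrightarrow> f (sg n x) = sg n (f x)" by (simp add: sg_def additive_fn_minus)
lemma lookup_sg: "lk (sg n f) u = sg n (lk f u)" by (simp add: sg_def)

section \<open>Koszul differentials of commuting operators\<close>

definition below :: "'n::linorder \<Rightarrow> 'n set \<Rightarrow> nat" where
  "below i A = card {j\<in>A. j < i}"

lemma below_insert_less: "finite A \<Longrightarrow> j \<notin> A \<Longrightarrow> j < i \<Longrightarrow> below i (insert j A) = Suc (below i A)"
proof -
  assume a: "finite A" "j \<notin> A" "j < i"
  have "{x \<in> insert j A. x < i} = insert j {x\<in>A. x < i}" using a by auto
  then show ?thesis using a by (simp add: below_def)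
qed

lemma below_insert_ge: "\<not> j < i \<Longrightarrow> below i (insert j A) = below i A"
  unfolding below_def by (rule arg_cong[of _ _ card]) auto

lemma below_remove: "below i (A - {i}) = below i A"
  unfolding below_def by (rule arg_cong[of _ _ card]) auto

text \<open>Read from the receiving side: the coefficient at A collects the sets
  \<open>insert i A\<close>, whereas \<open>koszul\<close> sends A to the sets
  \<open>A - {i}\<close>. Plain functions on sets keep this independent of the coefficients.\<close>

definition kz :: "('n::{finite,linorder} \<Rightarrow> 'v \<Rightarrow> 'v) \<Rightarrow> ('n set \<Rightarrow> 'v::ab_group_add) \<Rightarrow> 'n set \<Rightarrow> 'v" where
  "kz act F A = (\<Sum>i\<in>-A. sg (below i A) (act i (F (insert i A))))"

lemma lookup_koszul:
  assumes "\<And>i. act i 0 = 0"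
  shows "lk (koszul act w) B = kz act (lk w) B"
proof -
  have "koszul act w = (\<Sum>A\<in>UNIV. \<Sum>i\<in>A. Poly_Mapping.single (A - {i}) (sg (below i A) (act i (lk w A))))"
    unfolding koszul_def below_def sg_mult
    by (rule sum.mono_neutral_left) (auto simp: in_keys_iff assms)
  also have "\<dots> = (\<Sum>(A, i)\<in>Sigma UNIV (\<lambda>A. A). Poly_Mapping.single (A - {i}) (sg (below i A) (act i (lk w A))))"
    by (rule sum.Sigma) auto
  finally have "lk (koszul act w) B = (\<Sum>(A, i)\<in>Sigma UNIV (\<lambda>A. A). if A - {i} = B then sg (below i A) (act i (lk w A)) else 0)"
    by (simp add: lookup_sum lookup_single when_def case_prod_unfold)
  also have "\<dots> = (\<Sum>(A, i)\<in>{(A, i). i \<in> A \<and> A - {i} = B}. sg (below i A) (act i (lk w A)))"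
    by (rule sum.mono_neutral_cong_right) (auto split: if_splits)
  also have "\<dots> = (\<Sum>i\<in>-B. sg (below i B) (act i (lk w (insert i B))))"
    by (rule sum.reindex_bij_witness[where j = snd and i = "\<lambda>i. (insert i B, i)"])
       (auto simp: below_remove insert_absorb)
  finally show ?thesis by (simp add: kz_def)
qed

text \<open>Inserting the smaller index first raises the count for the larger one by one; inserting
  the larger first changes nothing. The two orders of a pair therefore carry opposite signs.\<close>

lemma kz_swap_sum:
  fixes g :: "'n::{finite,linorder} \<Rightarrow> 'n \<Rightarrow> 'v::ab_group_add"
  shows "(\<Sum>i\<in>-A. \<Sum>j\<in>-insert i A. sg (below i A + below j (insert i A)) (g i j)) =
     (\<Sum>(i,j)\<in>{(i,j). i \<notin> A \<and> j \<notin> A \<and> i < j}. sg (below i A + below j A) (g j i - g i j))"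
proof -
  let ?S = "{(i,j). i \<notin> A \<and> j \<notin> A \<and> i < j}" and ?S' = "{(i,j). i \<notin> A \<and> j \<notin> A \<and> j < i}"
  let ?f = "\<lambda>(i,j). sg (below i A + below j (insert i A)) (g i j)"
  have "(\<Sum>i\<in>-A. \<Sum>j\<in>-insert i A. sg (below i A + below j (insert i A)) (g i j)) = sum ?f (Sigma (-A) (\<lambda>i. -insert i A))"
    by (subst sum.Sigma) auto
  also have "Sigma (-A) (\<lambda>i. -insert i A) = ?S \<union> ?S'" by auto
  also have "sum ?f (?S \<union> ?S') = sum ?f ?S + sum ?f ?S'"
    by (rule sum.union_disjoint) auto
  also have "sum ?f ?S = (\<Sum>(i,j)\<in>?S. - sg (below i A + below j A) (g i j))"
    by (rule sum.cong) (auto simp: below_insert_less sg_Suc)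
  also have "sum ?f ?S' = (\<Sum>(i,j)\<in>?S. sg (below i A + below j A) (g j i))"
    by (rule sum.reindex_bij_witness[where j = "\<lambda>(i,j). (j,i)" and i = "\<lambda>(i,j). (j,i)"])
       (auto simp: below_insert_ge add.commute)
  finally show ?thesis
    by (simp add: sum.distrib[symmetric] case_prod_unfold sg_def if_distrib algebra_simps cong: if_cong)
qed

text \<open>Anticommutation of two differentials and vanishing of a square are both read off from
  this antisymmetrised form.\<close>

lemma kz_kz:
  assumes "\<And>i. additive_fn (a i)"
  shows "kz a (kz b F) A = (\<Sum>(i,j)\<in>{(i,j). i \<notin> A \<and> j \<notin> A \<and> i < j}.
     sg (below i A + below j A) (a j (b i (F (insert i (insert j A)))) - a i (b j (F (insert i (insert j A))))))"
proof -
  have "kz a (kz b F) A = (\<Sum>i\<in>-A. \<Sum>j\<in>-insert i A. sg (below i A + below j (insert i A)) (a i (b j (F (insert j (insert i A))))))"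
    unfolding kz_def by (simp add: additive_fn_sum[OF assms] additive_sg[OF assms] sg_sum sg_sg)
  also have "\<dots> = (\<Sum>(i,j)\<in>{(i,j). i \<notin> A \<and> j \<notin> A \<and> i < j}. sg (below i A + below j A) (a j (b i (F (insert i (insert j A)))) - a i (b j (F (insert j (insert i A))))))"
    by (rule kz_swap_sum)
  finally show ?thesis by (simp add: insert_commute)
qed

lemma kz_anticommute:
  assumes "\<And>i. additive_fn (a i)" "\<And>i. additive_fn (b i)" "\<And>i j x. a i (b j x) = b j (a i x)"
  shows "kz a (kz b F) A + kz b (kz a F) A = 0"
  unfolding kz_kz[OF assms(1)] kz_kz[OF assms(2)]
  by (simp add: sum.distrib[symmetric] case_prod_unfold sg_add[symmetric] assms(3))

lemma kz_square:
  assumes "\<And>i. additive_fn (a i)" "\<And>i j x. a i (a j x) = a j (a i x)"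
  shows "kz a (kz a F) A = 0"
  unfolding kz_kz[OF assms(1)] using assms(2) by (simp add: case_prod_unfold)

lemma koszul_lookup_eq:
  fixes act :: "'n::{finite,linorder} \<Rightarrow> ('n, 'k::field) xpol \<Rightarrow> ('n, 'k) xpol"
  assumes "\<And>i. act i 0 = 0"
  shows "lk (koszul act w) = kz act (lk w)"
  by (rule ext) (rule lookup_koszul, rule assms)

lemma koszul_add:
  fixes act :: "'n::{finite,linorder} \<Rightarrow> ('n, 'k::field) xpol \<Rightarrow> ('n, 'k) xpol"
  assumes "\<And>i. additive_fn (act i)"
  shows "koszul act (v + w) = koszul act v + koszul act w"
proof (rule poly_mapping_eqI)
  fix A
  have 0: "\<And>i. act i 0 = 0" using assms by (simp add: additive_fn_0)
  show "lk (koszul act (v + w)) A = lk (koszul act v + koszul act w) A"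
    by (simp add: lookup_koszul[where act = act, OF 0] lookup_add kz_def additive_fn_add[OF assms] sg_add sum.distrib)
qed

lemma koszul_anticommute:
  fixes a b :: "'n::{finite,linorder} \<Rightarrow> ('n, 'k::field) xpol \<Rightarrow> ('n, 'k) xpol"
  assumes "\<And>i. additive_fn (a i)" "\<And>i. additive_fn (b i)" "\<And>i j x. a i (b j x) = b j (a i x)"
  shows "koszul a (koszul b w) + koszul b (koszul a w) = 0"
  by (rule poly_mapping_eqI)
     (simp add: lookup_add koszul_lookup_eq additive_fn_0 assms kz_anticommute[OF assms])

lemma koszul_square:
  fixes a :: "'n::{finite,linorder} \<Rightarrow> ('n, 'k::field) xpol \<Rightarrow> ('n, 'k) xpol"
  assumes "\<And>i. additive_fn (a i)" "\<And>i j x. a i (a j x) = a j (a i x)"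
  shows "koszul a (koszul a w) = 0"
  by (rule poly_mapping_eqI) (simp add: koszul_lookup_eq additive_fn_0 assms kz_square[OF assms])

subsection \<open>A contracting homotopy\<close>

text \<open>The Koszul differential of multiplication by the variables, on coefficients:
  \<open>F A u\<close> belongs to the wedge A and the monomial u. Both \<open>kos\<close> and
  \<open>kappa\<close> are instances.\<close>

definition df :: "('n::{finite,linorder} set \<Rightarrow> 'n mon \<Rightarrow> 'c::ab_group_add) \<Rightarrow> 'n set \<Rightarrow> 'n mon \<Rightarrow> 'c" where
  "df F A u = (\<Sum>i\<in>-A. if 0 < lk u i then sg (below i A) (F (insert i A) (u - evar i)) else 0)"

text \<open>On basis elements: if the lowest variable of a monomial lies below all indices of the
  wedge, it moves from the monomial into the wedge; otherwise the result is 0. No division by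
  degrees occurs, so the characteristic of k is arbitrary.\<close>

definition hf :: "('n::{finite,linorder} set \<Rightarrow> 'n mon \<Rightarrow> 'c::zero) \<Rightarrow> 'n set \<Rightarrow> 'n mon \<Rightarrow> 'c" where
  "hf F A u = (if A \<noteq> {} \<and> (\<forall>l<Min A. lk u l = 0) then F (A - {Min A}) (u + evar (Min A)) else 0)"

lemma lookup_evar: "lk (evar i) j = (if i = j then 1 else 0)"
  by (simp add: evar_def lookup_single when_def)

text \<open>After one move the smallest index is in the wedge, so no second move is
  possible.\<close>

lemma hf_hf: "hf (hf F) A u = 0"
proof (cases "A \<noteq> {} \<and> A - {Min A} \<noteq> {}")
  case True
  then have "Min (A - {Min A}) \<in> A - {Min A}" by (intro Min_in) auto
  then have "Min A < Min (A - {Min A})"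
    using Min_le[of A "Min (A - {Min A})"] by (auto simp: less_le)
  moreover have "lk (u + evar (Min A)) (Min A) \<noteq> 0"
    by (simp add: lookup_add lookup_evar)
  ultimately have "\<exists>l<Min (A - {Min A}). lk (u + evar (Min A)) l \<noteq> 0"
    by (intro exI[of _ "Min A"] conjI)
  then show ?thesis unfolding hf_def by (metis (no_types, lifting))
qed (auto simp: hf_def)

lemma evar_minus_plus: "0 < lk u i \<Longrightarrow> u - evar i + evar i = u"
  by (rule poly_mapping_eqI) (auto simp: lookup_add lookup_minus lookup_evar)

lemma evar_plus_minus: "u + evar i - evar i = u"
  by (rule poly_mapping_eqI) (auto simp: lookup_add lookup_minus lookup_evar)

lemma evar_swap: "i \<noteq> j \<Longrightarrow> u + evar j - evar i = u - evar i + evar j"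
  by (rule poly_mapping_eqI) (auto simp: lookup_add lookup_minus lookup_evar)

text \<open>Only the smallest index i0 of A and u matters. If it is outside A,
  \<open>hf (df F)\<close> vanishes and \<open>df (hf F)\<close> has one term; if it is inside A,
  the two summands cancel except for the term that restores i0.\<close>

lemma hf_homotopy:
  assumes ne: "\<not> (A = {} \<and> u = 0)"
  shows "df (hf F) A u + hf (df F) A u = F A u"
proof -
  let ?S = "A \<union> Poly_Mapping.keys u"
  define i0 where "i0 = Min ?S"
  have S: "finite ?S" "?S \<noteq> {}" using ne by auto
  have i0: "i0 \<in> ?S" "\<And>l. l \<in> ?S \<Longrightarrow> i0 \<le> l"
    unfolding i0_def using S by (rule Min_in, simp add: Min_le[OF S(1)])
  have lo: "lk u l = 0" if "l < i0" for l
    using i0(2)[of l] that by (meson UnCI in_keys_iff leD)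
  show ?thesis
  proof (cases "i0 \<in> A")
    case False
    then have u: "0 < lk u i0" using i0(1) by (auto simp: in_keys_iff)
    have Min1: "i0 < Min A" if "A \<noteq> {}"
    proof -
      have "Min A \<in> A" using that by (intro Min_in) auto
      then show ?thesis using i0(2)[of "Min A"] False by (auto simp: less_le)
    qed
    have 1: "hf (df F) A u = 0"
    proof (cases "A = {}")
      case False
      then show ?thesis using Min1 u unfolding hf_def by (metis not_less_zero)
    qed (simp add: hf_def)
    have 2: "(if 0 < lk u i then sg (below i A) (hf F (insert i A) (u - evar i)) else 0) =
        (if i = i0 then F A u else 0)" if i: "i \<in> -A" for i
    proof (cases "i = i0")
      case True
      have M: "Min (insert i0 A) = i0"
        using Min1 by (cases "A = {}") auto
      have "below i0 A = 0"
        unfolding below_def using i0(2) by (force simp: card_eq_0_iff not_less)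
      moreover have "insert i0 A - {i0} = A" using False by auto
      ultimately show ?thesis
        using True u M by (simp add: hf_def evar_minus_plus lookup_minus lo)
    next
      case ni: False
      show ?thesis
      proof (cases "0 < lk u i")
        case True
        then have "i0 < i" using i0(2)[of i] ni by (simp add: in_keys_iff)
        then have "i0 < Min (insert i A)" using Min1 by (cases "A = {}") auto
        moreover have "lk (u - evar i) i0 \<noteq> 0" using ni u by (simp add: lookup_minus lookup_evar)
        ultimately have "hf F (insert i A) (u - evar i) = 0" unfolding hf_def by metis
        then show ?thesis using ni by simp
      qed (use ni in simp)
    qed
    have "df (hf F) A u = (\<Sum>i\<in>-A. if i = i0 then F A u else 0)"
      unfolding df_def by (rule sum.cong[OF refl 2])
    also have "\<dots> = F A u" using False by simp
    finally show ?thesis using 1 by simp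
  next
    case True
    then have M: "Min A = i0"
      using i0(2) by (intro Min_eqI) auto
    have 1: "hf (df F) A u = df F (A - {i0}) (u + evar i0)"
      using True lo by (auto simp: hf_def M)
    have "-(A - {i0}) = insert i0 (-A)" using True by auto
    then have "df F (A - {i0}) (u + evar i0) = sg (below i0 (A - {i0})) (F A u) +
       (\<Sum>i\<in>-A. if 0 < lk (u + evar i0) i then sg (below i (A - {i0})) (F (insert i (A - {i0})) (u + evar i0 - evar i)) else 0)"
      using True by (simp add: df_def lookup_add lookup_evar evar_plus_minus insert_absorb)
    moreover have "below i0 (A - {i0}) = 0"
      unfolding below_def using i0(2) by (force simp: card_eq_0_iff not_less)
    moreover have "(\<Sum>i\<in>-A. if 0 < lk (u + evar i0) i then sg (below i (A - {i0})) (F (insert i (A - {i0})) (u + evar i0 - evar i)) else 0)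
       = (\<Sum>i\<in>-A. - (if 0 < lk u i then sg (below i A) (hf F (insert i A) (u - evar i)) else 0))"
    proof (rule sum.cong[OF refl])
      fix i assume i: "i \<in> -A"
      then have ne: "i \<noteq> i0" using True by auto
      show "(if 0 < lk (u + evar i0) i then sg (below i (A - {i0})) (F (insert i (A - {i0})) (u + evar i0 - evar i)) else 0) =
         - (if 0 < lk u i then sg (below i A) (hf F (insert i A) (u - evar i)) else 0)"
      proof (cases "0 < lk u i")
        case u: True
        then have less: "i0 < i" using i0(2)[of i] ne by (simp add: in_keys_iff)
        have "below i (insert i0 (A - {i0})) = Suc (below i (A - {i0}))"
          by (rule below_insert_less) (use less in auto)
        then have b: "below i A = Suc (below i (A - {i0}))" using True by (simp add: insert_absorb)
        have "Min (insert i A) = i0" using True less i0(2) by (intro Min_eqI) auto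
        moreover have "insert i A - {i0} = insert i (A - {i0})" using ne by auto
        ultimately have "hf F (insert i A) (u - evar i) = F (insert i (A - {i0})) (u + evar i0 - evar i)"
          using lo by (simp add: hf_def lookup_minus evar_swap[OF ne])
        then show ?thesis using u ne b by (simp add: lookup_add lookup_evar sg_Suc)
      qed (use ne in \<open>simp add: lookup_add lookup_evar\<close>)
    qed
    moreover have "\<dots> = - df (hf F) A u" by (simp add: df_def sum_negf)
    ultimately show ?thesis using 1 by simp
  qed
qed

section \<open>Slices of forms at the monomials of P\<close>

type_synonym ('n, 'k) kform = "'n set \<Rightarrow>\<^sub>0 'n mon \<Rightarrow>\<^sub>0 'k"

abbreviation pm :: "('n, 'k::field) pol \<Rightarrow> ('n, 'k) xform \<Rightarrow> ('n, 'k) xform" where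
  "pm p w \<equiv> Poly_Mapping.map (xscale p) w"

text \<open>An element of $\Lambda \otimes S$ or $\Lambda \otimes D$ is a polynomial in the $x_i$ with coefficients in the
same construction over $k$: \<open>sl v w\<close> is its coefficient at $x^v$, and \<open>ins v z\<close> is $x^v z$.\<close>

definition ks1 :: "'k::field \<Rightarrow> ('n mon \<Rightarrow>\<^sub>0 'k) \<Rightarrow> ('n mon \<Rightarrow>\<^sub>0 'k)" where
  "ks1 c f = Poly_Mapping.map ((*) c) f"

definition ks :: "'k::field \<Rightarrow> ('n, 'k) kform \<Rightarrow> ('n, 'k) kform" where
  "ks c z = Poly_Mapping.map (ks1 c) z"

definition sl1 :: "'n mon \<Rightarrow> ('n, 'k::field) xpol \<Rightarrow> ('n mon \<Rightarrow>\<^sub>0 'k)" where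
  "sl1 v f = Poly_Mapping.map (\<lambda>p. lk p v) f"

definition sl :: "'n mon \<Rightarrow> ('n, 'k::field) xform \<Rightarrow> ('n, 'k) kform" where
  "sl v w = Poly_Mapping.map (sl1 v) w"

definition in1 :: "'n mon \<Rightarrow> ('n mon \<Rightarrow>\<^sub>0 'k::field) \<Rightarrow> ('n, 'k) xpol" where
  "in1 v f = Poly_Mapping.map (Poly_Mapping.single v) f"

definition ins :: "'n mon \<Rightarrow> ('n, 'k::field) kform \<Rightarrow> ('n, 'k) xform" where
  "ins v z = Poly_Mapping.map (in1 v) z"

lemma lk_xscale [simp]: "lk (xscale p f) u = p * lk f u"
  by (simp add: xscale_def lookup_map0)

lemma xscale_0 [simp]: "xscale p 0 = 0" "xscale 0 f = 0"
  by (rule poly_mapping_eqI, simp)+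

lemma lk_pm [simp]: "lk (pm p w) A = xscale p (lk w A)"
  by (simp add: lookup_map0)

lemma lk_ks1 [simp]: "lk (ks1 c f) u = c * lk f u"
  by (simp add: ks1_def lookup_map0)

lemma ks1_0 [simp]: "ks1 c 0 = 0"
  by (rule poly_mapping_eqI) simp

lemma lk_ks [simp]: "lk (ks c z) A = ks1 c (lk z A)"
  by (simp add: ks_def lookup_map0)

lemma lk_sl1 [simp]: "lk (sl1 v f) u = lk (lk f u) v"
  by (simp add: sl1_def lookup_map0)

lemma sl1_0 [simp]: "sl1 v 0 = 0"
  by (rule poly_mapping_eqI) simp

lemma lk_sl [simp]: "lk (sl v w) A = sl1 v (lk w A)"
  by (simp add: sl_def lookup_map0)

lemma sl_0 [simp]: "sl v 0 = 0"
  by (rule poly_mapping_eqI) simp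

lemma lk_in1 [simp]: "lk (in1 v f) u = Poly_Mapping.single v (lk f u)"
  by (simp add: in1_def lookup_map0)

lemma in1_0 [simp]: "in1 v 0 = 0"
  by (rule poly_mapping_eqI) simp

lemma lk_ins [simp]: "lk (ins v z) A = in1 v (lk z A)"
  by (simp add: ins_def lookup_map0)

lemma ins_0 [simp]: "ins v 0 = 0"
  by (rule poly_mapping_eqI) simp

lemma xpol_eqI: "(\<And>v. sl1 v f = sl1 v g) \<Longrightarrow> f = g"
  by (rule poly_mapping_eqI, rule poly_mapping_eqI) (metis lk_sl1)

lemma xform_eqI: "(\<And>v. sl v f = sl v g) \<Longrightarrow> f = g"
  by (rule poly_mapping_eqI, rule xpol_eqI) (metis lk_sl)

lemma additive_sl1: "additive_fn (sl1 v)"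
  by (rule additive_fnI, rule poly_mapping_eqI) (simp add: lookup_add)

lemma additive_sl: "additive_fn (sl v)"
  by (rule additive_fnI, rule poly_mapping_eqI) (simp add: lookup_add additive_fn_add[OF additive_sl1])

lemma additive_in1: "additive_fn (in1 v)"
  by (rule additive_fnI, rule poly_mapping_eqI) (simp add: lookup_add single_add)

lemma additive_ins: "additive_fn (ins v)"
  by (rule additive_fnI, rule poly_mapping_eqI) (simp add: lookup_add additive_fn_add[OF additive_in1])

lemmas sl1_simps = additive_fn_add[OF additive_sl1] additive_fn_diff[OF additive_sl1] additive_fn_minus[OF additive_sl1] additive_fn_sum[OF additive_sl1]
lemmas sl_simps = additive_fn_add[OF additive_sl] additive_fn_diff[OF additive_sl] additive_fn_minus[OF additive_sl] additive_fn_sum[OF additive_sl]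

lemma sl1_in1: "sl1 v (in1 v' f) = (if v = v' then f else 0)"
  by (rule poly_mapping_eqI) (simp add: lookup_single)

lemma sl_ins: "sl v (ins v' z) = (if v = v' then z else 0)"
  by (rule poly_mapping_eqI) (simp add: sl1_in1)

lemma lk_nonzero: "p \<noteq> 0 \<Longrightarrow> \<exists>k. lk p k \<noteq> 0"
proof (rule ccontr)
  assume "p \<noteq> 0" "\<nexists>k. lk p k \<noteq> 0"
  then have "p = 0" by (intro poly_mapping_eqI) simp
  with \<open>p \<noteq> 0\<close> show False ..
qed

lemma finite_sl1: "finite {v. sl1 v f \<noteq> 0}"
proof (rule finite_subset)
  show "{v. sl1 v f \<noteq> 0} \<subseteq> (\<Union>u\<in>Poly_Mapping.keys f. Poly_Mapping.keys (lk f u))"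
  proof
    fix v assume "v \<in> {v. sl1 v f \<noteq> 0}"
    then obtain u where "lk (sl1 v f) u \<noteq> 0" using lk_nonzero by blast
    then show "v \<in> (\<Union>u\<in>Poly_Mapping.keys f. Poly_Mapping.keys (lk f u))"
      by (intro UN_I[of u]) (auto simp: in_keys_iff)
  qed
qed auto

lemma finite_sl: "finite {v. sl v w \<noteq> 0}"
proof (rule finite_subset)
  show "{v. sl v w \<noteq> 0} \<subseteq> (\<Union>A\<in>Poly_Mapping.keys w. {v. sl1 v (lk w A) \<noteq> 0})"
  proof
    fix v assume "v \<in> {v. sl v w \<noteq> 0}"
    then obtain A where "lk (sl v w) A \<noteq> 0" using lk_nonzero by blast
    then show "v \<in> (\<Union>A\<in>Poly_Mapping.keys w. {v. sl1 v (lk w A) \<noteq> 0})"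
      by (intro UN_I[of A]) (auto simp: in_keys_iff)
  qed
qed (auto simp: finite_sl1)

lemma glue1:
  assumes "finite {v. Z v \<noteq> 0}"
  shows "sl1 v (\<Sum>v\<in>{v. Z v \<noteq> 0}. in1 v (Z v)) = Z v"
  using assms by (simp add: sl1_simps sl1_in1 sum.delta' cong: if_cong)

lemma glue:
  assumes "finite {v. Z v \<noteq> 0}"
  shows "sl v (\<Sum>v\<in>{v. Z v \<noteq> 0}. ins v (Z v)) = Z v"
  using assms by (simp add: sl_simps sl_ins sum.delta' cong: if_cong)

text \<open>Extension of scalars of H from k to P. The sum is finite when H vanishes at 0, since w
  has finitely many nonzero slices.\<close>

definition Pext :: "(('n, 'k::field) kform \<Rightarrow> ('n, 'k) kform) \<Rightarrow> ('n, 'k) xform \<Rightarrow> ('n, 'k) xform" where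
  "Pext H w = (\<Sum>v\<in>{v. H (sl v w) \<noteq> 0}. ins v (H (sl v w)))"

lemma sl_Pext:
  assumes "H 0 = 0"
  shows "sl v (Pext H w) = H (sl v w)"
  unfolding Pext_def
  by (rule glue, rule finite_subset[OF _ finite_sl[of w]]) (use assms in auto)

subsection \<open>Multiplication by monomials\<close>

definition mle :: "'n mon \<Rightarrow> 'n mon \<Rightarrow> bool" where
  "mle u v \<longleftrightarrow> (\<forall>l. lk u l \<le> lk v l)"

lemma mle_minus_eq: "mle u v \<Longrightarrow> v - u = x \<longleftrightarrow> v = u + x"
proof -
  assume m: "mle u v"
  have "u + (v - u) = v" by (rule poly_mapping_eqI) (use m in \<open>simp add: lookup_add lookup_minus mle_def\<close>)
  moreover have "u + x - u = x" by (rule poly_mapping_eqI) (simp add: lookup_add lookup_minus)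
  ultimately show ?thesis by metis
qed

lemma mle_add: "mle u (u + x)"
  by (simp add: mle_def lookup_add)

lemma lk_monomial_mult:
  "lk (Poly_Mapping.single u c * (q :: 'n mon \<Rightarrow>\<^sub>0 'a::comm_ring_1)) v = (if mle u v then c * lk q (v - u) else 0)"
proof (rule additive_fn_eqI[where p = q])
  fix k d
  show "lk (Poly_Mapping.single u c * Poly_Mapping.single k d) v = (if mle u v then c * lk (Poly_Mapping.single k d) (v - u) else 0)"
    using mle_minus_eq[of u v k] mle_add[of u k] by (auto simp: mult_single lookup_single when_def)
qed (auto intro!: additive_fnI simp: lookup_add algebra_simps)

lemma mle_evar: "mle (evar i) v \<longleftrightarrow> 0 < lk v i"
  by (auto simp: mle_def lookup_evar)

lemma lk_var_mult: "lk (var i * p) v = (if 0 < lk v i then lk p (v - evar i) else 0)"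
  by (simp add: var_def lk_monomial_mult mle_evar)

lemma lk_Xvar_mult: "lk (Xvar i * p) v = (if 0 < lk v i then lk p (v - evar i) else 0)"
  by (simp add: Xvar_def lk_monomial_mult mle_evar)

lemma additive_xscale: "additive_fn (xscale p)"
  by (rule additive_fnI, rule poly_mapping_eqI) (simp add: lookup_add algebra_simps)

lemma additive_pm: "additive_fn (pm p)"
  by (rule additive_fnI, rule poly_mapping_eqI) (simp add: lookup_add additive_fn_add[OF additive_xscale])

lemma additive_xscale_left: "additive_fn (\<lambda>p. xscale p f)"
  by (rule additive_fnI, rule poly_mapping_eqI) (simp add: lookup_add algebra_simps)

lemma additive_pm_left: "additive_fn (\<lambda>p. pm p w)"
  by (rule additive_fnI, rule poly_mapping_eqI) (simp add: lookup_add additive_fn_add[OF additive_xscale_left])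

lemma pm_pm: "pm p (pm q w) = pm (p * q) w"
  by (rule poly_mapping_eqI, simp, rule poly_mapping_eqI) (simp add: mult.assoc)

lemma pm_1 [simp]: "pm 1 w = w"
  by (rule poly_mapping_eqI, simp, rule poly_mapping_eqI) simp

lemma pm_0 [simp]: "pm 0 w = 0" "pm p 0 = 0"
  by (rule poly_mapping_eqI, simp)+

lemma sl1_xscale: "sl1 v (xscale (Poly_Mapping.single u c) f) = (if mle u v then ks1 c (sl1 (v - u) f) else 0)"
  by (rule poly_mapping_eqI) (simp add: lk_monomial_mult)

lemma sl_pm: "sl v (pm (Poly_Mapping.single u c) w) = (if mle u v then ks c (sl (v - u) w) else 0)"
  by (rule poly_mapping_eqI) (simp add: sl1_xscale)

subsection \<open>Linear maps over the polynomial ring\<close>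

definition plin :: "(('n, 'k::field) xform \<Rightarrow> ('n, 'k) xform) \<Rightarrow> bool" where
  "plin F \<longleftrightarrow> additive_fn F \<and> (\<forall>p x. F (pm p x) = pm p (F x))"

definition klin :: "(('n, 'k::field) kform \<Rightarrow> ('n, 'k) kform) \<Rightarrow> bool" where
  "klin F \<longleftrightarrow> additive_fn F \<and> (\<forall>c x. F (ks c x) = ks c (F x))"

lemma plin_additive: "plin F \<Longrightarrow> additive_fn F" by (simp add: plin_def)
lemma plin_pm: "plin F \<Longrightarrow> F (pm p x) = pm p (F x)" by (simp add: plin_def)
lemma klin_additive: "klin F \<Longrightarrow> additive_fn F" by (simp add: klin_def)

lemmas plin_simps = additive_fn_add[OF plin_additive] additive_fn_diff[OF plin_additive] additive_fn_minus[OF plin_additive]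
  additive_fn_sum[OF plin_additive] additive_fn_0[OF plin_additive] plin_pm

text \<open>Both sides are additive in the scalar, so single terms suffice as scalars; for these,
  slices are merely shifted and scaled.\<close>

lemma plinI:
  assumes "additive_fn F" "\<And>u c x. F (pm (Poly_Mapping.single u c) x) = pm (Poly_Mapping.single u c) (F x)"
  shows "plin F"
  unfolding plin_def
proof (intro conjI allI)
  fix p x
  show "F (pm p x) = pm p (F x)"
    by (rule additive_fn_eqI[where p = p])
       (use assms in \<open>auto intro!: additive_fn_comp[OF assms(1) additive_pm_left] additive_pm_left\<close>)
qed (rule assms)

lemma klin_0: "klin F \<Longrightarrow> F 0 = 0" by (simp add: klin_def additive_fn_0)

text \<open>Multiplication by a monomial of P shifts the slices, so a map acting in the same
  k-linear way on every slice commutes with it.\<close>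

lemma plin_sl:
  assumes F: "\<And>v w. sl v (F w) = H (sl v w)" and H: "klin H"
  shows "plin F"
proof (rule plinI)
  show "additive_fn F"
    by (rule additive_fnI, rule xform_eqI) (simp add: F sl_simps additive_fn_add[OF klin_additive[OF H]])
  show "F (pm (Poly_Mapping.single u c) x) = pm (Poly_Mapping.single u c) (F x)" for u c x
    using H by (intro xform_eqI) (simp add: F sl_pm klin_0 klin_def)
qed

lemma plin_Pext: "klin H \<Longrightarrow> plin (Pext H)"
  by (rule plin_sl) (simp_all add: sl_Pext klin_0)

lemma plin_comp: "plin F \<Longrightarrow> plin G \<Longrightarrow> plin (\<lambda>x. F (G x))"
  by (simp add: plin_def additive_fn_comp)

lemma plin_id: "plin (\<lambda>x. x)" by (simp add: plin_def additive_fn_def)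
lemma plin_0: "plin (\<lambda>x. 0)" by (simp add: plin_def additive_fn_def)

lemma plin_add: "plin F \<Longrightarrow> plin G \<Longrightarrow> plin (\<lambda>x. F x + G x)"
  by (simp add: plin_def additive_fn_def additive_fn_add[OF additive_pm] algebra_simps)

lemma plin_minus: "plin F \<Longrightarrow> plin (\<lambda>x. - F x)"
  by (simp add: plin_def additive_fn_def additive_fn_minus[OF additive_pm])

lemma plin_diff: "plin F \<Longrightarrow> plin G \<Longrightarrow> plin (\<lambda>x. F x - G x)"
  using plin_add[OF _ plin_minus, of F G] by simp

lemma plin_sum: "(\<And>i. i \<in> S \<Longrightarrow> plin (F i)) \<Longrightarrow> plin (\<lambda>x. \<Sum>i\<in>S. F i x)"
  by (induction S rule: infinite_finite_induct) (simp_all add: plin_0 plin_add)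

lemma plin_power: "plin F \<Longrightarrow> plin (F ^^ r)"
  by (induction r) (simp_all add: plin_id[unfolded id_def[symmetric]] plin_comp comp_def id_def plin_id)

subsection \<open>Extension of scalars of subspaces\<close>

definition ksub :: "('n mon \<Rightarrow>\<^sub>0 'k::field) set \<Rightarrow> bool" where
  "ksub V \<longleftrightarrow> 0 \<in> V \<and> (\<forall>x\<in>V. \<forall>y\<in>V. x + y \<in> V) \<and> (\<forall>c. \<forall>x\<in>V. ks1 c x \<in> V)"

text \<open>This is the tensor product of P and V over k, as a submodule.\<close>

definition lift :: "('n mon \<Rightarrow>\<^sub>0 'k::field) set \<Rightarrow> ('n, 'k) xpol set" where
  "lift V = {f. \<forall>v. sl1 v f \<in> V}"

definition psub1 :: "('n, 'k::field) xpol set \<Rightarrow> bool" where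
  "psub1 V \<longleftrightarrow> 0 \<in> V \<and> (\<forall>x\<in>V. \<forall>y\<in>V. x + y \<in> V) \<and> (\<forall>p. \<forall>x\<in>V. xscale p x \<in> V)"

definition psub :: "('n, 'k::field) xform set \<Rightarrow> bool" where
  "psub V \<longleftrightarrow> 0 \<in> V \<and> (\<forall>x\<in>V. \<forall>y\<in>V. x + y \<in> V) \<and> (\<forall>p. \<forall>x\<in>V. pm p x \<in> V)"

lemma pm_m1: "pm (-1) x = - x"
  using additive_fn_minus[OF additive_pm_left, of 1 x] by simp

lemma xscale_m1: "xscale (-1) x = - x"
  by (rule poly_mapping_eqI) simp

lemma psub_0: "psub V \<Longrightarrow> 0 \<in> V" by (simp add: psub_def)
lemma psub_add: "psub V \<Longrightarrow> x \<in> V \<Longrightarrow> y \<in> V \<Longrightarrow> x + y \<in> V" by (simp add: psub_def)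
lemma psub_pm: "psub V \<Longrightarrow> x \<in> V \<Longrightarrow> pm p x \<in> V" by (simp add: psub_def)
lemma psub_minus: "psub V \<Longrightarrow> x \<in> V \<Longrightarrow> - x \<in> V" unfolding psub_def by (metis pm_m1)
lemma psub_diff: "psub V \<Longrightarrow> x \<in> V \<Longrightarrow> y \<in> V \<Longrightarrow> x - y \<in> V"
  using psub_add[of V x "- y"] psub_minus[of V y] by simp
lemma psub_sum: "psub V \<Longrightarrow> (\<And>i. i \<in> S \<Longrightarrow> f i \<in> V) \<Longrightarrow> sum f S \<in> V"
  by (induction S rule: infinite_finite_induct) (auto simp: psub_def)

lemma psub1_0: "psub1 V \<Longrightarrow> 0 \<in> V" by (simp add: psub1_def)
lemma psub1_add: "psub1 V \<Longrightarrow> x \<in> V \<Longrightarrow> y \<in> V \<Longrightarrow> x + y \<in> V" by (simp add: psub1_def)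
lemma psub1_minus: "psub1 V \<Longrightarrow> x \<in> V \<Longrightarrow> - x \<in> V" unfolding psub1_def by (metis xscale_m1)
lemma psub1_sum: "psub1 V \<Longrightarrow> (\<And>i. i \<in> S \<Longrightarrow> f i \<in> V) \<Longrightarrow> sum f S \<in> V"
  by (induction S rule: infinite_finite_induct) (auto simp: psub1_def)
lemma psub1_sg: "psub1 V \<Longrightarrow> x \<in> V \<Longrightarrow> sg n x \<in> V"
  by (simp add: sg_def psub1_minus)

lemma psub1_lift:
  assumes V: "ksub V"
  shows "psub1 (lift V)"
proof -
  have add: "x + y \<in> lift V" if "x \<in> lift V" "y \<in> lift V" for x y
    using that V by (auto simp: lift_def sl1_simps ksub_def)
  have z: "0 \<in> lift V" using V by (simp add: lift_def ksub_def)
  have mon: "xscale (Poly_Mapping.single u c) x \<in> lift V" if "x \<in> lift V" for u c x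
    using that V by (auto simp: lift_def sl1_xscale ksub_def)
  have "xscale p x \<in> lift V" if x: "x \<in> lift V" for p x
  proof -
    have s: "(\<Sum>u\<in>S. xscale (Poly_Mapping.single u (lk p u)) x) \<in> lift V" for S
      by (induction S rule: infinite_finite_induct) (auto simp: z mon x add)
    have "xscale (\<Sum>u\<in>Poly_Mapping.keys p. Poly_Mapping.single u (lk p u)) x = (\<Sum>u\<in>Poly_Mapping.keys p. xscale (Poly_Mapping.single u (lk p u)) x)"
      by (rule additive_fn_sum[OF additive_xscale_left])
    then show ?thesis using s by (simp add: sum_single_keys)
  qed
  then show ?thesis using add z by (simp add: psub1_def)
qed

lemma ext_iff: "0 \<in> V \<Longrightarrow> w \<in> ext a V \<longleftrightarrow> (\<forall>A. lk w A \<in> V \<and> (lk w A \<noteq> 0 \<longrightarrow> int (card A) = a))"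
  unfolding ext_def by (auto simp: in_keys_iff)

lemma psub_ext:
  assumes V: "psub1 V"
  shows "psub (ext a V)"
  unfolding psub_def
proof (intro conjI ballI allI)
  note 0 = psub1_0[OF V]
  show "0 \<in> ext a V" by (simp add: ext_def)
  show "x + y \<in> ext a V" if "x \<in> ext a V" "y \<in> ext a V" for x y
    using that V unfolding ext_iff[OF 0] by (auto simp: lookup_add psub1_add) (metis add_0)
  show "pm p x \<in> ext a V" if "x \<in> ext a V" for p x
    using that V unfolding ext_iff[OF 0] by (auto simp: psub1_def) (metis xscale_0(1))
qed

lemma koszul_ext:
  fixes act :: "'n::{finite,linorder} \<Rightarrow> ('n, 'k::field) xpol \<Rightarrow> ('n, 'k) xpol"
  assumes w: "w \<in> ext a V" and act0: "\<And>i. act i 0 = 0" and V: "0 \<in> V" and V': "psub1 V'" and act: "\<And>i x. x \<in> V \<Longrightarrow> act i x \<in> V'"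
  shows "koszul act w \<in> ext (a - 1) V'"
  unfolding ext_iff[OF psub1_0[OF V']]
proof (intro allI conjI impI)
  note w' = w[unfolded ext_iff[OF V]]
  fix A
  show "lk (koszul act w) A \<in> V'"
    unfolding lookup_koszul[where act = act, OF act0] kz_def
    using w' by (intro psub1_sum psub1_sg V' act) auto
  assume "lk (koszul act w) A \<noteq> 0"
  then obtain i where i: "i \<notin> A" "act i (lk w (insert i A)) \<noteq> 0"
    unfolding lookup_koszul[where act = act, OF act0] kz_def
    by (metis (no_types, lifting) ComplD sg_zero sum.neutral)
  then have "lk w (insert i A) \<noteq> 0" using act0 by metis
  then have "int (card (insert i A)) = a" using w' by blast
  then show "int (card A) = a - 1" using i(1) by simp
qed

section \<open>Contractions for the variables of P and for the X_i\<close>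

definition zb :: "'n::linorder \<Rightarrow> 'n mon \<Rightarrow> bool" where
  "zb i v \<longleftrightarrow> (\<forall>l<i. lk v l = 0)"

lemma hf_zb: "hf F A u = (if A \<noteq> {} \<and> zb (Min A) u then F (A - {Min A}) (u + evar (Min A)) else 0)"
  by (simp add: hf_def zb_def)

text \<open>Division by the i-th variable of the terms whose lowest variable is i; all other terms
  are dropped. Taking for i the minimum of the wedge gives \<open>hf\<close>.\<close>

definition divP :: "'n::linorder \<Rightarrow> ('n mon \<Rightarrow>\<^sub>0 'a::zero) \<Rightarrow> ('n mon \<Rightarrow>\<^sub>0 'a)" where
  "divP i p = Abs_poly_mapping (\<lambda>v. if zb i v then lk p (v + evar i) else 0)"

lemma lk_divP: "lk (divP i p) v = (if zb i v then lk p (v + evar i) else 0)"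
proof -
  have "finite {v. (if zb i v then lk p (v + evar i) else 0) \<noteq> 0}"
  proof (rule finite_subset)
    show "{v. (if zb i v then lk p (v + evar i) else 0) \<noteq> 0} \<subseteq> (\<lambda>v. v - evar i) ` Poly_Mapping.keys p"
    proof
      fix v assume "v \<in> {v. (if zb i v then lk p (v + evar i) else 0) \<noteq> 0}"
      then have "v + evar i \<in> Poly_Mapping.keys p" by (auto simp: in_keys_iff split: if_splits)
      then show "v \<in> (\<lambda>v. v - evar i) ` Poly_Mapping.keys p"
        by (metis evar_plus_minus image_eqI)
    qed
  qed auto
  then show ?thesis by (simp add: divP_def)
qed

lemma divP_0 [simp]: "divP i 0 = 0"
  by (rule poly_mapping_eqI) (simp add: lk_divP)

text \<open>Two contractions: \<open>hP\<close> of \<open>kos\<close>, acting on the $x_i$, and \<open>hX\<close> of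
\<open>kappa\<close>, acting on the $X_i$.\<close>

definition hP :: "('n::{finite,linorder}, 'k::field) xform \<Rightarrow> ('n, 'k) xform" where
  "hP w = Abs_poly_mapping (\<lambda>A. if A = {} then 0 else Poly_Mapping.map (divP (Min A)) (lk w (A - {Min A})))"

definition hX :: "('n::{finite,linorder}, 'k::field) xform \<Rightarrow> ('n, 'k) xform" where
  "hX w = Abs_poly_mapping (\<lambda>A. if A = {} then 0 else divP (Min A) (lk w (A - {Min A})))"

lemma lk_hP: "lk (hP w) A = (if A = {} then 0 else Poly_Mapping.map (divP (Min A)) (lk w (A - {Min A})))"
  by (simp add: hP_def)

lemma lk_hX: "lk (hX w) A = (if A = {} then 0 else divP (Min A) (lk w (A - {Min A})))"
  by (simp add: hX_def)

lemma lk_hP_hf: "lk (lk (lk (hP w) A) u) v = hf (\<lambda>A v. lk (lk (lk w A) u) v) A v"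
  by (simp add: lk_hP hf_zb lookup_map0 lk_divP)

lemma lk_hX_hf: "lk (lk (hX w) A) u = hf (\<lambda>A u. lk (lk w A) u) A u"
  by (simp add: lk_hX hf_zb lk_divP)

lemma additive_Xmult: "additive_fn (\<lambda>f. Xvar i * f)"
  by (rule additive_fnI) (simp add: algebra_simps)

lemma lk_kos: "lk (kos w) A = kz (\<lambda>i f. xscale (var i) f) (lk w) A"
  unfolding kos_def by (rule lookup_koszul) simp

lemma lk_kappa: "lk (kappa w) A = kz (\<lambda>i f. Xvar i * f) (lk w) A"
  unfolding kappa_def by (rule lookup_koszul) simp

lemma lk_kos_df: "lk (lk (lk (kos w) A) u) v = df (\<lambda>A v. lk (lk (lk w A) u) v) A v"
  unfolding lk_kos kz_def df_def
  by (simp add: lookup_sum lookup_sg lk_var_mult) (rule sum.cong, auto)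

lemma lk_kappa_df: "lk (lk (kappa w) A) u = df (\<lambda>A u. lk (lk w A) u) A u"
  unfolding lk_kappa kz_def df_def
  by (simp add: lookup_sum lookup_sg lk_Xvar_mult) (rule sum.cong, auto)

lemma df_empty_0: "df F A 0 = 0"
  by (simp add: df_def)

lemma hf_empty: "hf F {} u = 0"
  by (simp add: hf_def)

text \<open>The X-exponent is a mere parameter here. The defect comes from the empty wedge and the
  monomial 1 of P, the one place where \<open>hf_homotopy\<close> does not apply.\<close>

lemma kos_homotopy: "kos (hP w) + hP (kos w) = w - Poly_Mapping.single {} (in1 0 (sl1 0 (lk w {})))"
proof (rule poly_mapping_eqI, rule poly_mapping_eqI, rule poly_mapping_eqI)
  fix A u v
  let ?F = "\<lambda>A v. lk (lk (lk w A) u) v"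
  have "lk (lk (lk (kos (hP w) + hP (kos w)) A) u) v = df (hf ?F) A v + hf (df ?F) A v"
    by (simp add: lookup_add lk_kos_df lk_hP_hf)
  also have "\<dots> = lk (lk (lk (w - Poly_Mapping.single {} (in1 0 (sl1 0 (lk w {})))) A) u) v"
  proof (cases "A = {} \<and> v = 0")
    case True
    then show ?thesis by (simp add: df_empty_0 hf_empty lookup_minus)
  next
    case False
    then show ?thesis by (subst hf_homotopy) (auto simp: lookup_minus lookup_single when_def)
  qed
  finally show "lk (lk (lk (kos (hP w) + hP (kos w)) A) u) v =
      lk (lk (lk (w - Poly_Mapping.single {} (in1 0 (sl1 0 (lk w {})))) A) u) v" .
qed

text \<open>Here the coefficient in P is the parameter, and the defect is the constant term in the
  X_i at the empty wedge.\<close>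

lemma kappa_homotopy: "kappa (hX w) + hX (kappa w) = w - Poly_Mapping.single {} (Poly_Mapping.single 0 (lk (lk w {}) 0))"
proof (rule poly_mapping_eqI, rule poly_mapping_eqI)
  fix A u
  let ?F = "\<lambda>A u. lk (lk w A) u"
  have "lk (lk (kappa (hX w) + hX (kappa w)) A) u = df (hf ?F) A u + hf (df ?F) A u"
    by (simp add: lookup_add lk_kappa_df lk_hX_hf)
  also have "\<dots> = lk (lk (w - Poly_Mapping.single {} (Poly_Mapping.single 0 (lk (lk w {}) 0))) A) u"
  proof (cases "A = {} \<and> u = 0")
    case True
    then show ?thesis by (simp add: df_empty_0 hf_empty lookup_minus)
  next
    case False
    then show ?thesis by (subst hf_homotopy) (auto simp: lookup_minus lookup_single when_def)
  qed
  finally show "lk (lk (kappa (hX w) + hX (kappa w)) A) u =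
      lk (lk (w - Poly_Mapping.single {} (Poly_Mapping.single 0 (lk (lk w {}) 0))) A) u" .
qed

lemma hX_hX: "hX (hX w) = 0"
  by (rule poly_mapping_eqI, rule poly_mapping_eqI) (simp add: lk_hX_hf hf_hf)

lemma additive_hX: "additive_fn hX"
  by (rule additive_fnI, rule poly_mapping_eqI, rule poly_mapping_eqI)
     (simp add: lookup_add lk_hX lk_divP)

lemma additive_hP: "additive_fn hP"
  by (rule additive_fnI, rule poly_mapping_eqI, rule poly_mapping_eqI, rule poly_mapping_eqI)
     (simp add: lookup_add lk_hP lookup_map0 lk_divP)

lemma plin_koszul:
  fixes act :: "'n::{finite,linorder} \<Rightarrow> ('n, 'k::field) xpol \<Rightarrow> ('n, 'k) xpol"
  assumes a: "\<And>i. additive_fn (act i)" and p: "\<And>i p f. act i (xscale p f) = xscale p (act i f)"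
  shows "plin (koszul act)"
  unfolding plin_def
proof (intro conjI allI)
  have 0: "\<And>i. act i 0 = 0" using a by (simp add: additive_fn_0)
  show "additive_fn (koszul act)" using koszul_add[OF a] by (rule additive_fnI)
  show "koszul act (pm q x) = pm q (koszul act x)" for q x
    by (rule poly_mapping_eqI)
       (simp add: lookup_koszul[where act = act, OF 0] kz_def p additive_fn_sum[OF additive_xscale] additive_sg[OF additive_xscale])
qed

lemma xscale_xscale: "xscale p (xscale q f) = xscale (p * q) f"
  by (rule poly_mapping_eqI) (simp add: mult.assoc)

lemma plin_kos: "plin kos"
  unfolding kos_def by (rule plin_koszul) (auto simp: additive_xscale xscale_xscale mult.commute)

lemma Xvar_xscale: "Xvar i * xscale p f = xscale p (Xvar i * f)"
  by (rule poly_mapping_eqI) (simp add: lk_Xvar_mult)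

lemma plin_kappa: "plin kappa"
  unfolding kappa_def by (rule plin_koszul) (auto simp: additive_Xmult Xvar_xscale)

lemma kos_kos: "kos (kos w) = 0"
  unfolding kos_def by (rule koszul_square) (auto simp: additive_xscale xscale_xscale mult.commute)

lemma kappa_kappa: "kappa (kappa w) = 0"
  unfolding kappa_def by (rule koszul_square) (auto simp: additive_Xmult algebra_simps)

lemma kos_kappa: "kos (kappa w) + kappa (kos w) = 0"
  unfolding kos_def kappa_def
  by (rule koszul_anticommute) (auto simp: additive_xscale additive_Xmult Xvar_xscale)

lemma kos_ext: "psub1 V \<Longrightarrow> w \<in> ext a V \<Longrightarrow> kos w \<in> ext (a - 1) V"
  unfolding kos_def by (rule koszul_ext[where V = V]) (auto simp: psub1_def)

lemma sl1_map_divP: "sl1 v (Poly_Mapping.map (divP i) f) = (if zb i v then sl1 (v + evar i) f else 0)"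
  by (rule poly_mapping_eqI) (simp add: lookup_map0 lk_divP)

lemma hP_ext:
  assumes V: "ksub V" and w: "w \<in> ext a (lift V)"
  shows "hP w \<in> ext (a + 1) (lift V)"
proof -
  have 0: "0 \<in> lift V" using psub1_lift[OF V] by (rule psub1_0)
  note w' = w[unfolded ext_iff[OF 0]]
  show ?thesis
    unfolding ext_iff[OF 0]
  proof (intro allI conjI impI)
    fix A
    show "lk (hP w) A \<in> lift V"
    proof (cases "A = {}")
      case False
      have "lk w (A - {Min A}) \<in> lift V" using w' by blast
      then show ?thesis using False V by (auto simp: lk_hP lift_def sl1_map_divP ksub_def)
    qed (simp add: lk_hP 0)
    assume "lk (hP w) A \<noteq> 0"
    then have "A \<noteq> {}" and "lk w (A - {Min A}) \<noteq> 0"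
      by (auto simp: lk_hP map_eq_zero_iff split: if_splits)
    then have "int (card (A - {Min A})) = a" and "Min A \<in> A" using w' by (blast, simp)
    then show "int (card A) = a + 1" using card_Suc_Diff1[of A "Min A"] by simp
  qed
qed

section \<open>Total degrees, and exactness of the Koszul complex of the x_i - X_i\<close>

lemma mdeg_add: "mdeg (u + v) = mdeg u + mdeg v"
  by (simp add: mdeg_def lookup_add sum.distrib)

lemma mdeg_evar [simp]: "mdeg (evar i :: 'n::finite mon) = 1"
  by (simp add: mdeg_def lookup_evar sum.delta')

lemma mdeg_0 [simp]: "mdeg 0 = 0"
  by (simp add: mdeg_def)

lemma mdeg_eq_0: "mdeg u = 0 \<longleftrightarrow> u = 0"
  by (auto simp: mdeg_def intro: poly_mapping_eqI)

text \<open>A strict bound on the degree in the x_i: bound 0 forces w = 0, and bound 1 says that all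
  coefficients lie in k.\<close>

definition pdeg_lt :: "nat \<Rightarrow> ('n::finite, 'k::field) xform \<Rightarrow> bool" where
  "pdeg_lt D w \<longleftrightarrow> (\<forall>v. sl v w \<noteq> 0 \<longrightarrow> mdeg v < D)"

lemma pdeg_lt_ex: "\<exists>D. pdeg_lt D w"
proof -
  let ?S = "{v. sl v w \<noteq> 0}"
  have "mdeg v < Suc (sum mdeg ?S)" if "sl v w \<noteq> 0" for v
    using that finite_sl[of w] by (auto intro!: le_imp_less_Suc member_le_sum)
  then show ?thesis unfolding pdeg_lt_def by blast
qed

lemma pdeg_lt_hP: "pdeg_lt (Suc D) w \<Longrightarrow> pdeg_lt D (hP w)"
  unfolding pdeg_lt_def
proof (intro allI impI)
  fix v assume w: "\<forall>v. sl v w \<noteq> 0 \<longrightarrow> mdeg v < Suc D" and "sl v (hP w) \<noteq> 0"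
  then obtain A where "lk (sl v (hP w)) A \<noteq> 0" using lk_nonzero by blast
  then have "sl1 (v + evar (Min A)) (lk w (A - {Min A})) \<noteq> 0"
    by (auto simp: lk_hP sl1_map_divP split: if_splits)
  then have "sl (v + evar (Min A)) w \<noteq> 0" by (metis lk_sl lookup_zero)
  then show "mdeg v < D" using w by (fastforce simp: mdeg_add)
qed

lemma pdeg_lt_add: "pdeg_lt D x \<Longrightarrow> pdeg_lt D y \<Longrightarrow> pdeg_lt D (x + y)"
  unfolding pdeg_lt_def by (metis additive_fn_add[OF additive_sl] add_0)

lemma pdeg_lt_minus: "pdeg_lt D x \<Longrightarrow> pdeg_lt D (- x)"
  unfolding pdeg_lt_def by (simp add: sl_simps)

lemma pdeg_lt_0: "pdeg_lt 0 w \<Longrightarrow> w = 0"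
  by (rule xform_eqI) (auto simp: pdeg_lt_def)

text \<open>The operator \<open>e\<close> stands for $-\kappa$ or $-\eta$ on $P \otimes V$, and \<open>ek\<close> for the $k$-linear
map that it extends.\<close>

locale tot =
  fixes V :: "('n::{finite,linorder} mon \<Rightarrow>\<^sub>0 'k::field) set"
    and e :: "('n, 'k) xform \<Rightarrow> ('n, 'k) xform"
    and ek :: "('n, 'k) kform \<Rightarrow> ('n, 'k) kform"
  assumes V: "ksub V"
    and plin_e: "plin e"
    and ek_0: "ek 0 = 0"
    and sl_e: "sl v (e w) = ek (sl v w)"
    and kos_e: "kos (e w) = - e (kos w)"
    and e_e: "e (e w) = 0"
    and e_ext: "w \<in> ext a (lift V) \<Longrightarrow> e w \<in> ext (a - 1) (lift V)"
begin

definition T :: "int \<Rightarrow> ('n, 'k) xform set" where "T a = ext a (lift V)"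

definition d :: "('n, 'k) xform \<Rightarrow> ('n, 'k) xform" where "d w = kos w + e w"

lemma psub_T: "psub (T a)" unfolding T_def by (intro psub_ext psub1_lift V)
lemma plin_d: "plin d" unfolding d_def[abs_def] by (intro plin_add plin_kos plin_e)
lemma d_d: "d (d w) = 0"
  by (simp add: d_def plin_simps[OF plin_kos] plin_simps[OF plin_e] kos_kos e_e kos_e)
lemma d_T: "w \<in> T a \<Longrightarrow> d w \<in> T (a - 1)"
  unfolding d_def T_def using V by (intro psub_add psub_ext psub1_lift kos_ext e_ext) auto
lemma e_T: "w \<in> T a \<Longrightarrow> e w \<in> T (a - 1)" unfolding T_def by (rule e_ext)
lemma kos_T: "w \<in> T a \<Longrightarrow> kos w \<in> T (a - 1)" unfolding T_def using V by (intro kos_ext psub1_lift)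
lemma hP_T: "w \<in> T a \<Longrightarrow> hP w \<in> T (a + 1)" unfolding T_def using V by (rule hP_ext)

lemma pdeg_lt_e: "pdeg_lt D w \<Longrightarrow> pdeg_lt D (e w)"
  unfolding pdeg_lt_def sl_e using ek_0 by metis

lemma T_lk: "w \<in> T a \<Longrightarrow> lk w A \<noteq> 0 \<Longrightarrow> int (card A) = a"
  unfolding T_def ext_def by (simp add: in_keys_iff)

text \<open>\<open>hP\<close> lowers the degree in the x_i and \<open>e\<close> preserves it. So
  replacing a cycle w by \<open>w - d (hP w)\<close> lowers its bound, and induction on the bound
  applies.\<close>

lemma tot_exact:
  assumes a: "1 \<le> a" and w: "w \<in> T a" and dw: "d w = 0"
  shows "\<exists>x\<in>T (a + 1). d x = w"
proof -
  obtain D where "pdeg_lt D w" using pdeg_lt_ex by blast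
  then show ?thesis using w dw
  proof (induction D arbitrary: w)
    case 0
    then have "w = 0" using pdeg_lt_0 by blast
    then show ?case using psub_0[OF psub_T] plin_simps(5)[OF plin_d] by auto
  next
    case (Suc D)
    \<comment> \<open>A positive wedge degree excludes the defect of the homotopy at the empty
      wedge.\<close>
    have "lk w {} = 0" using T_lk[OF Suc.prems(2), of "{}"] a by auto
    then have h: "kos (hP w) + hP (kos w) = w" by (simp add: kos_homotopy)
    have k: "kos w = - e w" using Suc.prems(3) by (simp add: d_def eq_neg_iff_add_eq_0)
    let ?w = "w - d (hP w)"
    have eq: "?w = - hP (e w) + - e (hP w)"
      using h by (simp add: d_def k additive_fn_minus[OF additive_hP] algebra_simps)
    have "pdeg_lt D (hP (e w))" using Suc.prems(1) by (intro pdeg_lt_hP pdeg_lt_e)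
    moreover have "pdeg_lt D (e (hP w))" using Suc.prems(1) by (intro pdeg_lt_hP pdeg_lt_e)
    ultimately have "pdeg_lt D ?w" unfolding eq by (intro pdeg_lt_add pdeg_lt_minus)
    moreover have hT: "hP w \<in> T (a + 1)" by (rule hP_T, rule Suc.prems)
    then have "?w \<in> T a" using d_T[of "hP w" "a + 1"] Suc.prems(2) by (auto intro: psub_diff psub_T)
    moreover have "d ?w = 0" using Suc.prems(3) by (simp add: plin_simps[OF plin_d] d_d)
    ultimately obtain x where x: "x \<in> T (a + 1)" "d x = ?w" using Suc.IH by blast
    show ?case
      by (rule bexI[of _ "x + hP w"]) (use x hT in \<open>auto simp: plin_simps[OF plin_d] intro: psub_add psub_T\<close>)
  qed
qed

text \<open>The same descent, halted by the defect of the homotopy, which has bound 1. Modulo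
  boundaries every element of degree 0 thus has coefficients in k.\<close>

lemma tot_exact0:
  assumes w: "w \<in> T 0"
  shows "\<exists>x\<in>T 1. pdeg_lt 1 (w - d x)"
proof -
  obtain D where "pdeg_lt D w" using pdeg_lt_ex by blast
  then show ?thesis using w
  proof (induction D arbitrary: w)
    case 0
    then have "w = 0" using pdeg_lt_0 by blast
    then show ?case using psub_0[OF psub_T] plin_simps(5)[OF plin_d] by (auto simp: pdeg_lt_def intro!: bexI[of _ 0])
  next
    case (Suc D)
    show ?case
    proof (cases "D = 0")
      case True
      then show ?thesis using Suc.prems psub_0[OF psub_T] plin_simps(5)[OF plin_d] by (auto intro!: bexI[of _ 0])
    next
      case False
      let ?r = "Poly_Mapping.single {} (in1 0 (sl1 0 (lk w {}))) :: ('n, 'k) xform"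
      have "kos w \<in> T (-1)" using kos_T[OF Suc.prems(2)] by simp
      \<comment> \<open>No set has cardinality -1.\<close>
      then have "lk (kos w) A = 0" for A using T_lk[of "kos w" "-1" A] by auto
      then have k: "kos w = 0" by (intro poly_mapping_eqI) simp
      have h: "kos (hP w) = w - ?r"
        using kos_homotopy[of w] by (simp add: k additive_fn_0[OF additive_hP])
      let ?w = "w - d (hP w)"
      have eq: "?w = ?r + - e (hP w)"
        unfolding d_def h by (simp add: algebra_simps)
      have "pdeg_lt D (e (hP w))" using Suc.prems(1) by (intro pdeg_lt_hP pdeg_lt_e)
      moreover have "sl v ?r = 0" if "v \<noteq> 0" for v
        by (rule poly_mapping_eqI) (simp add: lookup_single when_def sl1_in1 that)
      then have "pdeg_lt D ?r" unfolding pdeg_lt_def using False by (metis mdeg_0 neq0_conv)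
      ultimately have "pdeg_lt D ?w" unfolding eq by (intro pdeg_lt_add pdeg_lt_minus)
      moreover have hT: "hP w \<in> T 1" using hP_T[OF Suc.prems(2)] by simp
      then have "?w \<in> T 0" using d_T[of "hP w" "1"] Suc.prems(2) by (auto intro: psub_diff psub_T)
      ultimately obtain x where x: "x \<in> T 1" "pdeg_lt 1 (?w - d x)" using Suc.IH by blast
      show ?thesis
        by (rule bexI[of _ "x + hP w"]) (use x hT in \<open>auto simp: plin_simps[OF plin_d] algebra_simps intro: psub_add psub_T\<close>)
    qed
  qed
qed

end

subsection \<open>Homological perturbation\<close>

text \<open>The identities for \<open>h\<close> make \<open>q\<close> below a projector whose image
  is the intersection of the kernels of \<open>e\<close> and \<open>h\<close>, with one
  representative for each homology class of \<open>e\<close>. Nilpotency is required pointwise: the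
  exponent may depend on w.\<close>

locale perturbation = tot V e ek
  for V :: "('n::{finite,linorder} mon \<Rightarrow>\<^sub>0 'k::field) set"
    and e :: "('n, 'k) xform \<Rightarrow> ('n, 'k) xform"
    and ek :: "('n, 'k) kform \<Rightarrow> ('n, 'k) kform" +
  fixes h :: "('n, 'k) xform \<Rightarrow> ('n, 'k) xform"
  assumes plin_h: "plin h"
    and h_T: "w \<in> T a \<Longrightarrow> h w \<in> T (a + 1)"
    and h_h: "h (h w) = 0"
    and heh: "h (e (h w)) = h w"
    and ehe: "w \<in> T a \<Longrightarrow> e (h (e w)) = e w"
    and nilpotent: "\<exists>M. ((\<lambda>w. - h (kos w)) ^^ M) w = 0"
begin

text \<open>The operator \<open>A\<close> is the inverse of $1 + h\,\mathit{kos}$, a geometric series cut off where it vanishes;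
\<open>q\<close> projects onto the representatives \<open>Hs\<close> of the homology of \<open>e\<close>.\<close>

definition nh :: "('n, 'k) xform \<Rightarrow> ('n, 'k) xform" where "nh w = - h (kos w)"

definition A :: "('n, 'k) xform \<Rightarrow> ('n, 'k) xform" where
  "A w = (\<Sum>r<(LEAST M. (nh ^^ M) w = 0). (nh ^^ r) w)"

definition q :: "('n, 'k) xform \<Rightarrow> ('n, 'k) xform" where
  "q w = w - e (h w) - h (e w)"

definition dH :: "('n, 'k) xform \<Rightarrow> ('n, 'k) xform" where
  "dH x = q (kos (A x))"

definition Hs :: "int \<Rightarrow> ('n, 'k) xform set" where
  "Hs a = {x \<in> T a. e x = 0 \<and> h x = 0}"

lemmas e_simps = plin_simps[OF plin_e] and h_simps = plin_simps[OF plin_h] and kos_simps = plin_simps[OF plin_kos]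
  and d_simps = plin_simps[OF plin_d]

lemma plin_nh: "plin nh"
  unfolding nh_def[abs_def] by (intro plin_minus plin_comp[OF plin_h plin_kos])

lemma nilpotent': "\<exists>M. (nh ^^ M) w = 0"
  using nilpotent[of w] by (simp add: nh_def[abs_def])

lemma nh_power_mono: "(nh ^^ M) w = 0 \<Longrightarrow> M \<le> M' \<Longrightarrow> (nh ^^ M') w = 0"
proof (induction M')
  case (Suc M')
  then show ?case by (cases "M = Suc M'") (auto simp: plin_simps[OF plin_nh])
qed simp

text \<open>Powers of \<open>nh\<close> that vanish at w stay 0, so the series may be cut at any of
  them. A common cut for two arguments is what additivity of \<open>A\<close> needs.\<close>

lemma A_eq:
  assumes "(nh ^^ M) w = 0"
  shows "A w = (\<Sum>r<M. (nh ^^ r) w)"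
  unfolding A_def
proof (rule sum.mono_neutral_left)
  show "{..<LEAST M. (nh ^^ M) w = 0} \<subseteq> {..<M}"
    using Least_le[of "\<lambda>M. (nh ^^ M) w = 0", OF assms] by auto
  show "\<forall>i\<in>{..<M} - {..<LEAST M. (nh ^^ M) w = 0}. (nh ^^ i) w = 0"
  proof
    fix i assume "i \<in> {..<M} - {..<LEAST M. (nh ^^ M) w = 0}"
    then have "(LEAST M. (nh ^^ M) w = 0) \<le> i" by (simp add: not_less)
    then show "(nh ^^ i) w = 0"
      by (rule nh_power_mono[OF LeastI[of "\<lambda>M. (nh ^^ M) w = 0", OF assms]])
  qed
qed simp

lemma plin_A: "plin A"
  unfolding plin_def
proof (intro conjI allI additive_fnI)
  note [simp] = plin_simps[OF plin_power[OF plin_nh]]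
  fix x y p
  obtain M1 M2 where M: "(nh ^^ M1) x = 0" "(nh ^^ M2) y = 0" using nilpotent' by metis
  have x: "(nh ^^ max M1 M2) x = 0" and y: "(nh ^^ max M1 M2) y = 0"
    using nh_power_mono[OF M(1)] nh_power_mono[OF M(2)] by auto
  show "A (x + y) = A x + A y"
    by (subst A_eq[of "max M1 M2"], simp add: x y, subst A_eq[OF x], subst A_eq[OF y]) (simp add: sum.distrib)
  show "A (pm p x) = pm p (A x)"
    by (subst A_eq[of "max M1 M2"], simp add: x, subst A_eq[OF x]) (simp add: additive_fn_sum[OF additive_pm])
qed

lemmas A_simps = plin_simps[OF plin_A]

lemma A_nh: "A (nh w) = A w - w" and nh_A: "nh (A w) = A w - w"
proof -
  obtain M where M: "(nh ^^ M) w = 0" using nilpotent' by metis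
  have M1: "(nh ^^ M) (nh w) = 0" using M by (metis funpow_swap1 plin_nh plin_simps(5))
  have "A w = (\<Sum>r<Suc M. (nh ^^ r) w)" by (rule A_eq) (simp add: M plin_simps[OF plin_nh])
  also have "\<dots> = w + (\<Sum>r<M. (nh ^^ r) (nh w))"
    unfolding sum.lessThan_Suc_shift by (simp add: funpow_swap1)
  also have "\<dots> = w + A (nh w)" by (simp add: A_eq[OF M1])
  finally show 1: "A (nh w) = A w - w" by simp
  have "A (nh w) = (\<Sum>r<M. nh ((nh ^^ r) w))" by (simp add: A_eq[OF M1] funpow_swap1)
  also have "\<dots> = nh (A w)" by (simp add: A_eq[OF M] plin_simps[OF plin_nh])
  finally show "nh (A w) = A w - w" using 1 by simp
qed

lemma A_fix: "A w + h (kos (A w)) = w"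
  using nh_A[of w] by (simp add: nh_def algebra_simps)

lemma A_cancel: "A (w + h (kos w)) = w"
  using A_nh[of w] by (simp add: nh_def A_simps algebra_simps)

lemma A_inj: "A x = A y \<Longrightarrow> x = y"
  using A_fix by metis

lemma nh_T: "w \<in> T a \<Longrightarrow> nh w \<in> T a"
  unfolding nh_def using h_T[OF kos_T[of w a]] by (auto intro: psub_minus psub_T)

lemma A_T: "w \<in> T a \<Longrightarrow> A w \<in> T a"
  unfolding A_def
proof (rule psub_sum[OF psub_T])
  show "(nh ^^ r) w \<in> T a" if "w \<in> T a" for r
    by (induction r) (use that in \<open>auto intro: nh_T\<close>)
qed

lemma h_A: "h w = 0 \<Longrightarrow> h (A w) = 0"
  using A_fix[of w] h_h by (metis h_simps(1) add.right_neutral)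

lemma plin_q: "plin q"
  unfolding q_def[abs_def]
  by (intro plin_diff plin_id plin_comp[OF plin_e plin_h] plin_comp[OF plin_h plin_e])

lemma plin_dH: "plin dH"
  unfolding dH_def[abs_def] by (intro plin_comp[OF plin_q] plin_comp[OF plin_kos] plin_A)

lemma psub_Hs: "psub (Hs a)"
  using psub_T[of a] by (auto simp: psub_def Hs_def e_simps h_simps)

lemma q_T: "w \<in> T a \<Longrightarrow> q w \<in> T a"
  unfolding q_def using h_T[of w a] e_T[of "h w" "a + 1"] e_T[of w a] h_T[of "e w" "a - 1"]
  by (auto intro!: psub_diff psub_T)

lemma q_Hs: "w \<in> T a \<Longrightarrow> q w \<in> Hs a"
  using q_T[of w a] by (auto simp: Hs_def q_def e_simps h_simps e_e h_h heh ehe)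

lemma q_id: "x \<in> Hs a \<Longrightarrow> q x = x"
  by (simp add: Hs_def q_def e_simps h_simps)

lemma q_e: "w \<in> T a \<Longrightarrow> q (e w) = 0"
  by (simp add: q_def e_e h_simps ehe)

lemma dH_Hs: "x \<in> Hs a \<Longrightarrow> dH x \<in> Hs (a - 1)"
  unfolding dH_def by (intro q_Hs kos_T A_T) (simp add: Hs_def)

text \<open>\<open>A x\<close> is the solution y of y + h(kos y) = x, so it suffices to apply 1 + h
  kos to d y. Since \<open>kos\<close> squares to 0 and anticommutes with \<open>e\<close>, the
  result is \<open>q (kos y)\<close>, which is \<open>dH x\<close>.\<close>

lemma d_A:
  assumes x: "x \<in> Hs a"
  shows "d (A x) = A (dH x)"
proof -
  define y where "y = A x"
  have y: "y + h (kos y) = x" unfolding y_def by (rule A_fix)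
  have ex: "e x = 0" and hx: "h x = 0" using x by (simp_all add: Hs_def)
  have ey: "e y = - e (h (kos y))"
    using y ex by (metis e_simps(1) eq_neg_iff_add_eq_0)
  have 1: "kos (d y) = kos (e y)" by (simp add: d_def kos_simps kos_kos)
  have 2: "d y = kos y - e (h (kos y))" by (simp add: d_def ey)
  have "d y + h (kos (d y)) = q (kos y)"
  proof -
    have "h (kos (d y)) = - h (e (kos y))" by (simp add: 1 kos_e h_simps)
    then show ?thesis by (simp add: 2 q_def)
  qed
  then have "A (d y + h (kos (d y))) = A (dH x)" by (simp add: dH_def y_def)
  then show ?thesis by (simp add: A_cancel y_def)
qed

lemma dH_dH: "x \<in> Hs a \<Longrightarrow> dH (dH x) = 0"
proof (rule A_inj)
  assume x: "x \<in> Hs a"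
  have "A (dH (dH x)) = d (d (A x))" by (simp add: d_A[OF x] d_A[OF dH_Hs[OF x]])
  then show "A (dH (dH x)) = A 0" by (simp add: d_d A_simps)
qed

text \<open>A chain w with boundary \<open>A x\<close> need not lie in the image of
  \<open>A\<close>. It does as soon as \<open>h w = 0\<close>, and adding a boundary
  \<open>d v\<close> arranges this.\<close>

lemma boundary_lift:
  assumes x: "x \<in> Hs a" and w: "w \<in> T (a + 1)" and eq: "d w = A x"
  shows "\<exists>x'\<in>Hs (a + 1). dH x' = x"
proof -
  \<comment> \<open>This v solves v + h(kos v) = - h w; applying h e to the equation gives h(d v) =
    - h w.\<close>
  define v where "v = - A (h w)"
  have vT: "v \<in> T (a + 2)"
    using A_T[OF h_T[OF w]] by (auto simp: v_def add.assoc intro: psub_minus psub_T)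
  have v: "v + h (kos v) = - h w"
  proof -
    have "v + h (kos v) = - (A (h w) + h (kos (A (h w))))" by (simp add: v_def kos_simps h_simps)
    then show ?thesis by (simp only: A_fix)
  qed
  have "h (e (v + h (kos v))) = h (e (- h w))" using v by simp
  then have "h (e v) + h (kos v) = - h w" by (simp add: e_simps h_simps heh)
  then have hdv: "h (d v) = - h w" by (simp add: d_def h_simps algebra_simps)
  define w' where "w' = w + d v"
  have w'T: "w' \<in> T (a + 1)" using w d_T[OF vT] psub_add[OF psub_T[of "a + 1"]] by (simp add: w'_def add.commute)
  have hw': "h w' = 0" by (simp add: w'_def h_simps hdv)
  have dw': "d w' = A x" by (simp add: w'_def d_simps d_d eq)
  have "h (d w') = 0" using x by (simp add: dw' h_A Hs_def)
  \<comment> \<open>With h w' = 0 this turns \<open>q w'\<close> into w' + h(kos w'), so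
    \<open>A\<close> recovers w' from its projection.\<close>
  then have "h (e w') = - h (kos w')" by (simp add: d_def h_simps eq_neg_iff_add_eq_0 add.commute)
  then have "q w' = w' + h (kos w')" by (simp add: q_def hw' e_simps)
  then have Aq: "A (q w') = w'" by (simp add: A_cancel)
  have q: "q w' \<in> Hs (a + 1)" by (rule q_Hs[OF w'T])
  have "A (dH (q w')) = A x" using d_A[OF q] by (simp add: Aq dw')
  then show ?thesis using q A_inj by blast
qed

lemma dH_exact:
  assumes "1 \<le> a" "x \<in> Hs a" "dH x = 0"
  shows "\<exists>x'\<in>Hs (a + 1). dH x' = x"
proof -
  have "d (A x) = 0" using assms(3) by (simp add: d_A[OF assms(2)] A_simps)
  moreover have "A x \<in> T a" using assms(2) by (intro A_T) (simp add: Hs_def)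
  ultimately obtain w where "w \<in> T (a + 1)" "d w = A x" using tot_exact[OF assms(1)] by blast
  then show ?thesis by (rule boundary_lift[OF assms(2)])
qed

end

subsection \<open>Koszul differentials on slices\<close>

definition kk :: "('n::{finite,linorder} \<Rightarrow> ('n mon \<Rightarrow>\<^sub>0 'k::field) \<Rightarrow> ('n mon \<Rightarrow>\<^sub>0 'k)) \<Rightarrow> ('n, 'k) kform \<Rightarrow> ('n, 'k) kform" where
  "kk act z = Abs_poly_mapping (kz act (lk z))"

lemma lk_kk: "lk (kk act z) A = kz act (lk z) A"
  by (simp add: kk_def)

lemma sl_koszul:
  assumes "\<And>i. act i 0 = 0" "\<And>i f. sl1 v (act i f) = actk i (sl1 v f)"
  shows "sl v (koszul act w) = kk actk (sl v w)"
  by (rule poly_mapping_eqI)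
     (simp add: lk_kk lookup_koszul[where act = act, OF assms(1)] kz_def additive_fn_sum[OF additive_sl1] additive_sg[OF additive_sl1] assms(2))

lemma kk_0: "(\<And>i. actk i 0 = 0) \<Longrightarrow> kk actk 0 = 0"
  by (rule poly_mapping_eqI) (simp add: lk_kk kz_def)

lemma additive_ks1: "additive_fn (ks1 c)"
  by (rule additive_fnI, rule poly_mapping_eqI) (simp add: lookup_add algebra_simps)

lemma klin_kk:
  assumes "\<And>i. additive_fn (actk i)" "\<And>i c x. actk i (ks1 c x) = ks1 c (actk i x)"
  shows "klin (kk actk)"
  unfolding klin_def
proof (intro conjI allI additive_fnI)
  show "kk actk (x + y) = kk actk x + kk actk y" for x y
    by (rule poly_mapping_eqI) (simp add: lk_kk kz_def lookup_add additive_fn_add[OF assms(1)] sg_add sum.distrib)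
  show "kk actk (ks c x) = ks c (kk actk x)" for c x
    by (rule poly_mapping_eqI)
       (simp add: lk_kk kz_def assms(2) additive_fn_sum[OF additive_ks1] additive_sg[OF additive_ks1])
qed

lemma sl1_Xvar_mult: "sl1 v (Xvar i * f) = var i * sl1 v f"
  by (rule poly_mapping_eqI) (simp add: lk_Xvar_mult lk_var_mult)

lemma sl_kappa: "sl v (kappa w) = kk (\<lambda>i f. var i * f) (sl v w)"
  unfolding kappa_def by (rule sl_koszul) (simp_all add: sl1_Xvar_mult)

text \<open>The set of keys varies with f; terms with coefficient 0 contribute nothing, so all sums
  can be taken over the union of the keys of both arguments.\<close>

lemma additive_keysum:
  fixes G :: "'a \<Rightarrow> 'b::ab_group_add \<Rightarrow> 'c::ab_group_add"
  assumes "\<And>k. additive_fn (G k)"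
  shows "additive_fn (\<lambda>f. \<Sum>k\<in>Poly_Mapping.keys f. G k (lk f k))"
proof (rule additive_fnI)
  fix x y :: "'a \<Rightarrow>\<^sub>0 'b"
  let ?S = "Poly_Mapping.keys x \<union> Poly_Mapping.keys y"
  note 0 = additive_fn_0[OF assms]
  have *: "(\<Sum>k\<in>Poly_Mapping.keys f. G k (lk f k)) = (\<Sum>k\<in>?S. G k (lk f k))" if "Poly_Mapping.keys f \<subseteq> ?S" for f
    by (rule sum.mono_neutral_left) (use that 0 in \<open>auto simp: in_keys_iff\<close>)
  show "(\<Sum>k\<in>Poly_Mapping.keys (x + y). G k (lk (x + y) k)) =
      (\<Sum>k\<in>Poly_Mapping.keys x. G k (lk x k)) + (\<Sum>k\<in>Poly_Mapping.keys y. G k (lk y k))"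
    unfolding *[OF keys_add] *[OF Un_upper1] *[OF Un_upper2]
    by (simp add: lookup_add additive_fn_add[OF assms] sum.distrib)
qed

section \<open>Evaluation of the X_i at the x_i\<close>

lemma additive_eps: "additive_fn eps"
  unfolding eps_def[abs_def] by (rule additive_keysum, rule additive_fnI) (simp add: algebra_simps)

lemma eps_single: "eps (Poly_Mapping.single u p) = p * Poly_Mapping.single u 1"
  by (simp add: eps_def)

lemma xscale_single: "xscale p (Poly_Mapping.single u r) = Poly_Mapping.single u (p * r)"
  by (rule poly_mapping_eqI) (simp add: lookup_single when_def)

lemma eps_xscale: "eps (xscale p f) = p * eps f"
  by (rule additive_fn_eqI[where p = f])
     (auto intro!: additive_fn_comp[OF additive_eps additive_xscale] additive_fnI
       simp: additive_fn_add[OF additive_eps] xscale_single eps_single algebra_simps)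

lemma eps_Xvar: "eps (Xvar i * f) = var i * eps f"
  by (rule additive_fn_eqI[where p = f])
     (auto intro!: additive_fn_comp[OF additive_eps additive_Xmult] additive_fnI
       simp: additive_fn_add[OF additive_eps] Xvar_def var_def mult_single eps_single algebra_simps)

text \<open>\<open>eps\<close> identifies multiplication by X_i with multiplication by x_i, so it
  vanishes on the boundaries of the complex of the x_i - X_i.\<close>

lemma eps_boundary: "eps (lk (kos w) {}) = eps (lk (kappa w) {})"
  by (simp add: lk_kos lk_kappa kz_def additive_fn_sum[OF additive_eps] additive_sg[OF additive_eps] eps_xscale eps_Xvar)

text \<open>If the coefficients lie in k, \<open>eps\<close> only renames the X_i and is
  injective.\<close>

lemma eps_pdeg1:
  assumes w: "pdeg_lt 1 w" and eq: "eps (lk w {}) = 0"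
  shows "lk w {} = 0"
proof (rule poly_mapping_eqI, rule poly_mapping_eqI)
  fix u v
  let ?f = "lk w {}"
  have c: "lk ?f u = Poly_Mapping.single 0 (lk (lk ?f u) 0)" for u
  proof (rule poly_mapping_eqI)
    fix v
    have "sl1 v ?f = 0" if "v \<noteq> 0"
    proof -
      have "sl v w = 0" using w that by (auto simp: pdeg_lt_def mdeg_eq_0)
      then have "lk (sl v w) {} = 0" by (simp del: lk_sl)
      then show ?thesis by simp
    qed
    then have "lk (sl1 v ?f) u = 0" if "v \<noteq> 0"
      using that by (simp del: lk_sl1)
    then have "lk (lk ?f u) v = 0" if "v \<noteq> 0"
      using that by simp
    then show "lk (lk ?f u) v = lk (Poly_Mapping.single 0 (lk (lk ?f u) 0)) v"
      by (auto simp: lookup_single when_def)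
  qed
  have "eps ?f = (\<Sum>u\<in>Poly_Mapping.keys ?f. Poly_Mapping.single u (lk (lk ?f u) 0))"
    unfolding eps_def
  proof (rule sum.cong[OF refl])
    fix x
    show "lk ?f x * Poly_Mapping.single x 1 = Poly_Mapping.single x (lk (lk ?f x) 0)"
      using arg_cong[OF c[of x], of "\<lambda>p. p * Poly_Mapping.single x 1"] by (simp add: mult_single)
  qed
  then have "lk (eps ?f) u = (if u \<in> Poly_Mapping.keys ?f then lk (lk ?f u) 0 else 0)"
    by (simp add: lookup_sum lookup_single when_def)
  then have "lk (lk ?f u) 0 = 0" using eq by (auto simp: in_keys_iff split: if_splits)
  then have "lk ?f u = 0" using c[of u] by simp
  then show "lk (lk ?f u) v = lk (lk 0 u) v" by simp
qed

section \<open>Selection of monomials by degree\<close>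

definition flt :: "('a \<Rightarrow> bool) \<Rightarrow> ('a \<Rightarrow>\<^sub>0 'b::zero) \<Rightarrow> ('a \<Rightarrow>\<^sub>0 'b)" where
  "flt P f = Abs_poly_mapping (\<lambda>u. if P u then lk f u else 0)"

lemma lk_flt [simp]: "lk (flt P f) u = (if P u then lk f u else 0)"
proof -
  have "finite {u. (if P u then lk f u else 0) \<noteq> 0}"
    by (rule finite_subset[OF _ finite_keys[of f]]) (auto simp: in_keys_iff split: if_splits)
  then show ?thesis by (simp add: flt_def)
qed

lemma flt_0 [simp]: "flt P 0 = 0"
  by (rule poly_mapping_eqI) simp

definition fx :: "('n mon \<Rightarrow> bool) \<Rightarrow> ('n set \<Rightarrow>\<^sub>0 'n mon \<Rightarrow>\<^sub>0 'b::zero) \<Rightarrow> ('n set \<Rightarrow>\<^sub>0 'n mon \<Rightarrow>\<^sub>0 'b)" where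
  "fx P w = Poly_Mapping.map (flt P) w"

lemma lk_fx [simp]: "lk (fx P w) A = flt P (lk w A)"
  by (simp add: fx_def lookup_map0)

lemma sl1_flt: "sl1 v (flt P f) = flt P (sl1 v f)"
  by (rule poly_mapping_eqI) simp

lemma sl_fx: "sl v (fx P w) = fx P (sl v w)"
  by (rule poly_mapping_eqI) (simp add: sl1_flt)

lemma klin_fx: "klin (fx P)"
  unfolding klin_def by (auto intro!: additive_fnI poly_mapping_eqI simp: lookup_add)

lemma plin_fx: "plin (fx P)"
  by (rule plin_sl[OF sl_fx klin_fx])

lemmas fx_simps = plin_simps[OF plin_fx]

lemma kos_fx: "kos (fx P w) = fx P (kos w)"
  by (rule poly_mapping_eqI, rule poly_mapping_eqI, rule poly_mapping_eqI)
     (simp add: lk_kos_df df_def cong: if_cong)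

lemma homog_iff: "f \<in> homog b \<longleftrightarrow> (\<forall>u. lk f u \<noteq> 0 \<longrightarrow> int (mdeg u) = b)"
  by (auto simp: homog_def in_keys_iff)

lemma ksub_homog: "ksub (homog b)"
  by (auto simp: ksub_def homog_iff lookup_add) (metis add_0)

text \<open>\<open>homog\<close> sees only the X-degree; the coefficients in P may have any
  degree.\<close>

lemma lift_homog: "lift (homog b) = (homog b :: ('n::finite, 'k::field) xpol set)"
proof (intro Set.set_eqI iffI)
  fix f :: "('n, 'k) xpol"
  assume "f \<in> lift (homog b)"
  then show "f \<in> homog b"
    unfolding lift_def homog_iff mem_Collect_eq lk_sl1 using lk_nonzero by blast
qed (auto simp: lift_def homog_iff, metis lookup_zero)

lemma psub1_homog: "psub1 (homog b :: ('n::finite, 'k::field) xpol set)"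
  using psub1_lift[OF ksub_homog] by (simp add: lift_homog)

lemma ext_homog_iff: "w \<in> ext a (homog b) \<longleftrightarrow> (\<forall>A u. lk (lk w A) u \<noteq> 0 \<longrightarrow> int (mdeg u) = b \<and> int (card A) = a)"
proof -
  have "w \<in> ext a (homog b) \<longleftrightarrow> (\<forall>A. lk w A \<in> homog b \<and> (lk w A \<noteq> 0 \<longrightarrow> int (card A) = a))"
    by (rule ext_iff[OF psub1_0[OF psub1_homog]])
  also have "\<dots> \<longleftrightarrow> (\<forall>A u. lk (lk w A) u \<noteq> 0 \<longrightarrow> int (mdeg u) = b \<and> int (card A) = a)"
    unfolding homog_iff using lk_nonzero by (metis lookup_zero)
  finally show ?thesis .
qed

section \<open>The splitting on polynomials of degree at least m\<close>

definition deg_ge :: "int \<Rightarrow> ('n::finite mon \<Rightarrow>\<^sub>0 'k::field) set" where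
  "deg_ge m = {f. \<forall>u. lk f u \<noteq> 0 \<longrightarrow> m \<le> int (mdeg u)}"

lemma ksub_deg_ge: "ksub (deg_ge m)"
  by (auto simp: ksub_def deg_ge_def lookup_add) (metis add_0)

lemma lift_deg_ge: "f \<in> lift (deg_ge m) \<longleftrightarrow> (\<forall>u. lk f u \<noteq> 0 \<longrightarrow> m \<le> int (mdeg u))"
  unfolding lift_def deg_ge_def mem_Collect_eq lk_sl1 using lk_nonzero by (metis lookup_zero)

lemma ext_deg_ge_iff: "w \<in> ext a (lift (deg_ge m)) \<longleftrightarrow> (\<forall>A u. lk (lk w A) u \<noteq> 0 \<longrightarrow> m \<le> int (mdeg u) \<and> int (card A) = a)"
proof -
  have "w \<in> ext a (lift (deg_ge m)) \<longleftrightarrow> (\<forall>A. lk w A \<in> lift (deg_ge m) \<and> (lk w A \<noteq> 0 \<longrightarrow> int (card A) = a))"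
    by (rule ext_iff[OF psub1_0[OF psub1_lift[OF ksub_deg_ge]]])
  also have "\<dots> \<longleftrightarrow> (\<forall>A u. lk (lk w A) u \<noteq> 0 \<longrightarrow> m \<le> int (mdeg u) \<and> int (card A) = a)"
    unfolding lift_deg_ge using lk_nonzero by (metis lookup_zero)
  finally show ?thesis .
qed

lemma mdeg_minus_evar: "0 < lk u i \<Longrightarrow> mdeg u = Suc (mdeg (u - evar i))"
  using mdeg_add[of "u - evar i" "evar i"] by (simp add: evar_minus_plus)

lemma kappa_coeff_0:
  assumes "\<And>B v. mdeg u = Suc (mdeg v) \<Longrightarrow> lk (lk w B) v = 0"
  shows "lk (lk (kappa w) A) u = 0"
  unfolding lk_kappa_df df_def
  by (rule sum.neutral) (auto simp: assms mdeg_minus_evar)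

lemma hX_coeff_0:
  assumes "\<And>B v. mdeg v = Suc (mdeg u) \<Longrightarrow> lk (lk w B) v = 0"
  shows "lk (lk (hX w) A) u = 0"
  unfolding lk_hX_hf hf_def by (auto simp: assms mdeg_add)

lemma kos_coeff_0:
  assumes "\<And>B. lk (lk w B) u = 0"
  shows "lk (lk (kos w) A) u = 0"
  unfolding lk_kos kz_def by (simp add: lookup_sum lookup_sg assms)

text \<open>\<open>hX\<close> lowers the X-degree, so on degrees at least m its values may have
  degree m - 1 and must be cut off. This spoils the homotopy in degree m only, where the homology
  L_{a,m} appears.\<close>

definition hS :: "int \<Rightarrow> ('n::{finite,linorder}, 'k::field) xform \<Rightarrow> ('n, 'k) xform" where
  "hS m w = fx (\<lambda>u. m \<le> int (mdeg u)) (hX w)"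

lemma lk_hS: "lk (lk (hS m w) A) u = (if m \<le> int (mdeg u) then lk (lk (hX w) A) u else 0)"
  by (simp add: hS_def)

lemma plin_hX: "plin hX"
  unfolding plin_def
proof (intro conjI allI additive_hX)
  show "hX (pm p x) = pm p (hX x)" for p x
    by (rule poly_mapping_eqI, rule poly_mapping_eqI) (simp add: lk_hX lk_divP)
qed

lemma plin_hS: "plin (hS m)"
  unfolding hS_def[abs_def] by (rule plin_comp[OF plin_fx plin_hX])

lemmas hX_simps = plin_simps[OF plin_hX]
lemmas kappa_simps = plin_simps[OF plin_kappa]

lemma hX_empty: "lk (hX w) {} = 0"
  by (simp add: lk_hX)

text \<open>What the inner cut removes has degree below m, and \<open>hX\<close> lowers it
  further.\<close>

lemma hS_hS: "hS m (hS m w) = 0"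
proof (rule poly_mapping_eqI, rule poly_mapping_eqI)
  fix A u
  have "lk (lk (hX (hX w - hS m w)) A) u = 0" if "m \<le> int (mdeg u)"
    by (rule hX_coeff_0) (use that in \<open>simp add: lookup_minus lk_hS\<close>)
  then show "lk (lk (hS m (hS m w)) A) u = lk (lk 0 A) u"
    by (simp add: lk_hS[of m "hS m w"] hX_simps hX_hX)
qed

lemma hX_kappa_hX: "hX (kappa (hX w)) = hX w"
  using kappa_homotopy[of "hX w"] kappa_homotopy[of w] hX_simps(1)[of "kappa (hX w)" "hX (kappa w)"]
  by (simp add: hX_empty hX_hX kappa_simps hX_simps kappa_kappa)

text \<open>The terms removed by the inner cut have degree below m; \<open>kappa\<close> and
  \<open>hX\<close> together preserve the degree, so these terms do not survive the outer
  cut.\<close>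

lemma hS_kappa_hS: "hS m (kappa (hS m w)) = hS m w"
proof (rule poly_mapping_eqI, rule poly_mapping_eqI)
  fix A u
  have "lk (lk (hX (kappa (hX w - hS m w))) A) u = 0" if m: "m \<le> int (mdeg u)"
  proof (rule hX_coeff_0, rule kappa_coeff_0)
    fix B B' :: "'a set" and v v' :: "'a mon"
    assume "mdeg v = Suc (mdeg u)" "mdeg v = Suc (mdeg v')"
    then show "lk (lk (hX w - hS m w) B') v' = 0" using m by (simp add: lookup_minus lk_hS)
  qed
  then show "lk (lk (hS m (kappa (hS m w))) A) u = lk (lk (hS m w) A) u"
    by (simp add: lk_hS[of m "kappa (hS m w)"] lk_hS[of m w] hX_simps kappa_simps hX_kappa_hX lookup_minus)
qed

text \<open>\<open>kappa w\<close> has degrees above m, so nothing is cut, and it has no constant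
  term to disturb the homotopy formula.\<close>

lemma kappa_hS_kappa:
  assumes w: "w \<in> ext a (lift (deg_ge m))"
  shows "kappa (hS m (kappa w)) = kappa w"
proof -
  have "hS m (kappa w) = hX (kappa w)"
  proof (rule poly_mapping_eqI, rule poly_mapping_eqI)
    fix A u
    have "lk (lk (hX (kappa w)) A) u = 0" if m: "\<not> m \<le> int (mdeg u)"
    proof (rule hX_coeff_0, rule kappa_coeff_0)
      fix B B' :: "'a set" and v v' :: "'a mon"
      assume "mdeg v = Suc (mdeg u)" "mdeg v = Suc (mdeg v')"
      then show "lk (lk w B') v' = 0" using m w unfolding ext_deg_ge_iff by fastforce
    qed
    then show "lk (lk (hS m (kappa w)) A) u = lk (lk (hX (kappa w)) A) u" by (simp add: lk_hS)
  qed
  moreover have "lk (lk (kappa w) {}) 0 = 0" by (simp add: lk_kappa_df df_empty_0)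
  ultimately show ?thesis using kappa_homotopy[of "kappa w"] by (simp add: kappa_kappa hX_simps)
qed

definition xdeg_lt :: "nat \<Rightarrow> ('n::finite, 'k::field) xform \<Rightarrow> bool" where
  "xdeg_lt D w \<longleftrightarrow> (\<forall>A u. lk (lk w A) u \<noteq> 0 \<longrightarrow> mdeg u < D)"

lemma xdeg_lt_ex: "\<exists>D. xdeg_lt D w"
proof -
  let ?S = "\<Union>A\<in>Poly_Mapping.keys w. Poly_Mapping.keys (lk w A)"
  have "mdeg u < Suc (sum mdeg ?S)" if "lk (lk w A) u \<noteq> 0" for A u
  proof -
    have "A \<in> Poly_Mapping.keys w" "u \<in> Poly_Mapping.keys (lk w A)" using that by (auto simp: in_keys_iff)
    then show ?thesis by (intro le_imp_less_Suc member_le_sum) auto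
  qed
  then show ?thesis unfolding xdeg_lt_def by blast
qed

text \<open>\<open>hS\<close> lowers the X-degree and \<open>kos\<close> preserves it. The double
  sign is that of the instance with \<open>h\<close> equal to \<open>- hS\<close>, which goes with
  \<open>e\<close> equal to \<open>- kappa\<close>.\<close>

lemma hS_nilpotent: "\<exists>M. ((\<lambda>w. - (- hS m (kos w))) ^^ M) w = 0"
proof -
  obtain D where "xdeg_lt D w" using xdeg_lt_ex by blast
  then have "((\<lambda>w. - (- hS m (kos w))) ^^ D) w = 0"
  proof (induction D arbitrary: w)
    case 0
    then show ?case by (auto simp: xdeg_lt_def intro!: poly_mapping_eqI)
  next
    case (Suc D)
    have "xdeg_lt D (hS m (kos w))"
      unfolding xdeg_lt_def
    proof (intro allI impI, rule ccontr)
      fix A u assume ne: "lk (lk (hS m (kos w)) A) u \<noteq> 0" and D: "\<not> mdeg u < D"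
      have "lk (lk (hX (kos w)) A) u = 0"
        by (rule hX_coeff_0, rule kos_coeff_0) (use D Suc.prems in \<open>fastforce simp: xdeg_lt_def\<close>)
      with ne show False unfolding lk_hS by presburger
    qed
    then show ?case using Suc.IH by (simp add: funpow_Suc_right del: funpow.simps)
  qed
  then show ?thesis by blast
qed

lemma hS_ext: "w \<in> ext a (lift (deg_ge m)) \<Longrightarrow> hS m w \<in> ext (a + 1) (lift (deg_ge m))"
  unfolding ext_deg_ge_iff
proof (intro allI impI)
  fix A u assume w: "\<forall>A u. lk (lk w A) u \<noteq> 0 \<longrightarrow> m \<le> int (mdeg u) \<and> int (card A) = a"
    and ne: "lk (lk (hS m w) A) u \<noteq> 0"
  then have m: "m \<le> int (mdeg u)" and "A \<noteq> {}" and "lk (lk w (A - {Min A})) (u + evar (Min A)) \<noteq> 0"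
    by (auto simp: lk_hS lk_hX lk_divP split: if_splits)
  then have "int (card (A - {Min A})) = a" and "Min A \<in> A" using w by (blast, simp)
  then show "m \<le> int (mdeg u) \<and> int (card A) = a + 1"
    using m card_Suc_Diff1[of A "Min A"] by simp
qed

lemma kappa_ext_deg_ge: "w \<in> ext a (lift (deg_ge m)) \<Longrightarrow> kappa w \<in> ext (a - 1) (lift (deg_ge m))"
  unfolding kappa_def
proof (rule koszul_ext[where V = "lift (deg_ge m)"])
  show "Xvar i * x \<in> lift (deg_ge m)" if "x \<in> lift (deg_ge m)" for i and x :: "('a, 'b) xpol"
    unfolding lift_deg_ge lk_Xvar_mult
  proof (intro allI impI)
    fix u assume "(if 0 < lk u i then lk x (u - evar i) else 0) \<noteq> 0"
    then have "0 < lk u i" "lk x (u - evar i) \<noteq> 0" by (auto split: if_splits)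
    then have "m \<le> int (mdeg (u - evar i))" "mdeg u = Suc (mdeg (u - evar i))"
      using that mdeg_minus_evar[of u i] unfolding lift_deg_ge by auto
    then show "m \<le> int (mdeg u)" by simp
  qed
qed (auto intro: psub1_lift ksub_deg_ge psub1_0)

lemma kos_kappa_eq: "kos (kappa w) = - kappa (kos w)"
  using kos_kappa[of w] by (simp add: eq_neg_iff_add_eq_0)

lemma sl_kappa_0: "kk (\<lambda>i f. var i * f) 0 = 0"
  by (rule kk_0) simp

lemma tot_kappa: "tot (deg_ge m) (\<lambda>w. - kappa w) (\<lambda>z. - kk (\<lambda>i f. var i * f) z)"
proof
  show "ksub (deg_ge m)" by (rule ksub_deg_ge)
qed (auto intro!: plin_minus plin_kappa psub_minus psub_ext psub1_lift ksub_deg_ge kappa_ext_deg_ge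
      simp: sl_simps sl_kappa sl_kappa_0 plin_simps[OF plin_kos] kos_kappa_eq kappa_simps kappa_kappa)

lemma perturbation_kappa:
  "perturbation (deg_ge m) (\<lambda>w. - kappa w) (\<lambda>z. - kk (\<lambda>i f. var i * f) z) (\<lambda>w. - hS m w)"
proof -
  interpret tot "deg_ge m" "\<lambda>w. - kappa w" "\<lambda>z. - kk (\<lambda>i f. var i * f) z" by (rule tot_kappa)
  note [simp] = plin_simps[OF plin_hS] kappa_simps
  show ?thesis
  proof
    show "plin (\<lambda>w. - hS m w)" by (rule plin_minus[OF plin_hS])
    show "- hS m w \<in> T (a + 1)" if "w \<in> T a" for w :: "('a, 'b) xform" and a
      using that hS_ext psub_minus[OF psub_T] unfolding T_def by blast
    show "- kappa (- hS m (- kappa w)) = - kappa w" if "w \<in> T a" for w :: "('a, 'b) xform" and a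
      using that kappa_hS_kappa unfolding T_def by auto
    show "\<exists>M. ((\<lambda>w. - (- hS m (kos w))) ^^ M) w = 0" for w :: "('a, 'b) xform" by (rule hS_nilpotent)
  qed (auto simp: hS_hS hS_kappa_hS)
qed

lemma L_iff: "w \<in> L a b \<longleftrightarrow> w \<in> ext a (homog b) \<and> kappa w = 0"
  by (simp add: L_def)

lemma psub_L: "psub (L a b)"
  using psub_ext[OF psub1_homog, of a b] by (auto simp: psub_def L_iff kappa_simps)

lemma kos_L: "w \<in> L a b \<Longrightarrow> kos w \<in> L (a - 1) b"
  using kos_ext[OF psub1_homog, of w a b] kos_kappa_eq[of w] by (auto simp: L_iff plin_simps[OF plin_kos])

lemma hS_homog: "w \<in> ext a (homog m) \<Longrightarrow> hS m w = 0"
proof (rule poly_mapping_eqI, rule poly_mapping_eqI)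
  fix A u assume w: "w \<in> ext a (homog m)"
  have "lk (lk (hX w) A) u = 0" if "m \<le> int (mdeg u)"
    by (rule hX_coeff_0) (use w that in \<open>fastforce simp: ext_homog_iff\<close>)
  then show "lk (lk (hS m w) A) u = lk (lk 0 A) u" by (simp add: lk_hS)
qed

text \<open>The representatives \<open>Hs\<close> are exactly the L_{a,m}. There \<open>kos\<close>
  leads again into L, on which \<open>hS\<close> vanishes, so the perturbation series is trivial and
  \<open>dH\<close> is \<open>kos\<close>.\<close>

lemma source_exactness:
  assumes m: "1 \<le> m"
  shows "\<And>a w. 1 \<le> a \<Longrightarrow> w \<in> L a m \<Longrightarrow> kos w = 0 \<Longrightarrow> \<exists>x\<in>L (a + 1) m. kos x = (w :: ('n::{finite,linorder}, 'k::field) xform)"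
    and "\<And>w. w \<in> L 0 m \<Longrightarrow> eps (lk w {}) = 0 \<Longrightarrow> \<exists>x\<in>L 1 m. kos x = (w :: ('n, 'k) xform)"
proof -
  interpret perturbation "deg_ge m" "\<lambda>w::('n, 'k) xform. - kappa w" "\<lambda>z. - kk (\<lambda>i f. var i * f) z" "\<lambda>w. - hS m w"
    by (rule perturbation_kappa)
  have Hs_L: "Hs a = L a m" for a
  proof (intro Set.set_eqI iffI)
    fix x :: "('n, 'k) xform"
    assume "x \<in> L a m"
    then show "x \<in> Hs a"
      using hS_homog[of x a m] by (auto simp: Hs_def L_iff T_def ext_deg_ge_iff ext_homog_iff)
  next
    fix x :: "('n, 'k) xform"
    assume x: "x \<in> Hs a"
    then have xT: "x \<in> ext a (lift (deg_ge m))" and k: "kappa x = 0" and h: "hS m x = 0"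
      by (auto simp: Hs_def T_def)
    \<comment> \<open>m \<ge> 1 rules out a constant term, the defect of the homotopy for
      \<open>kappa\<close>.\<close>
    have "lk (lk x {}) 0 = 0" using xT m by (fastforce simp: ext_deg_ge_iff)
    then have eq: "kappa (hX x) = x" using kappa_homotopy[of x] by (simp add: k hX_simps)
    \<comment> \<open>\<open>hX x\<close> has degrees below m, so x = kappa(hX x) has degrees at
      most m.\<close>
    have hx: "lk (lk (hX x) A) u = 0" if "m \<le> int (mdeg u)" for A u
      using that lk_hS[of m x A u] h by simp
    have "x \<in> ext a (homog m)"
      unfolding ext_homog_iff
    proof (intro allI impI)
      fix A u assume ne: "lk (lk x A) u \<noteq> 0"
      then have 1: "m \<le> int (mdeg u)" "int (card A) = a" using xT by (auto simp: ext_deg_ge_iff)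
      have "\<not> m < int (mdeg u)"
      proof
        assume "m < int (mdeg u)"
        then have "lk (lk (kappa (hX x)) A) u = 0" by (intro kappa_coeff_0 hx) auto
        with ne eq show False by simp
      qed
      then show "int (mdeg u) = m \<and> int (card A) = a" using 1 by simp
    qed
    then show "x \<in> L a m" using k by (simp add: L_iff)
  qed
  have A_L: "A x = x" if "x \<in> L a m" for a x
  proof -
    have "hS m (kos x) = 0" using that kos_L hS_homog by (metis L_iff)
    then have "(nh ^^ 1) x = 0" by (simp add: nh_def)
    from A_eq[OF this] show "A x = x" by simp
  qed
  have dH_L: "dH x = kos x" if "x \<in> L a m" for a x
    unfolding dH_def using that by (simp add: A_L q_id[of _ "a - 1"] Hs_L kos_L)
  show "\<exists>x\<in>L (a + 1) m. kos x = w" if "1 \<le> a" "w \<in> L a m" "kos w = 0" for a and w :: "('n, 'k) xform"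
    using dH_exact[of a w] that by (auto simp: Hs_L dH_L)
  show "\<exists>x\<in>L 1 m. kos x = w" if w: "w \<in> L 0 m" and eps: "eps (lk w {}) = 0" for w :: "('n, 'k) xform"
  proof -
    have wT: "w \<in> T 0" using w by (simp add: Hs_L[symmetric] Hs_def)
    obtain x where x: "x \<in> T 1" "pdeg_lt 1 (w - d x)" using tot_exact0[OF wT] by blast
    have "eps (lk (d x) {}) = 0"
      by (simp add: d_def lookup_minus additive_fn_diff[OF additive_eps] eps_boundary)
    then have "eps (lk (w - d x) {}) = 0"
      by (simp add: lookup_minus additive_fn_diff[OF additive_eps] eps)
    \<comment> \<open>The difference has coefficients in k, where \<open>eps\<close> is
      injective.\<close>
    then have 0: "lk (w - d x) {} = 0" by (rule eps_pdeg1[OF x(2)])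
    have "w - d x \<in> T 0" using psub_diff[OF psub_T wT, of "d x"] d_T[OF x(1)] by simp
    then have "lk (w - d x) B = 0" if "B \<noteq> {}" for B
      using T_lk[of "w - d x" 0 B] that by auto
    with 0 have "lk (w - d x) B = 0" for B by (cases "B = {}") auto
    then have "w - d x = 0" by (intro poly_mapping_eqI) simp
    then have "\<exists>x'\<in>Hs (0 + 1). dH x' = w"
      using w x by (intro boundary_lift[where w = x]) (auto simp: Hs_L A_L)
    then show ?thesis by (auto simp: Hs_L dH_L)
  qed
qed

subsection \<open>Contraction\<close>

text \<open>This removes the case distinction on divisibility: v - u = w with u dividing v means v =
  u + w.\<close>

lemma lk_contract: "lk (contract g f) w = (\<Sum>u\<in>Poly_Mapping.keys g. lk g u * lk f (u + w))"
proof -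
  have "lk (contract g f) w = (\<Sum>u\<in>Poly_Mapping.keys g. \<Sum>v\<in>Poly_Mapping.keys f.
      lk (if mle u v then Poly_Mapping.single (v - u) (lk g u * lk f v) else 0) w)"
    by (simp add: contract_def lookup_sum mle_def)
  also have "\<dots> = (\<Sum>u\<in>Poly_Mapping.keys g. lk g u * lk f (u + w))"
  proof (rule sum.cong[OF refl])
    fix u
    have "lk (if mle u v then Poly_Mapping.single (v - u) (lk g u * lk f v) else 0) w =
        (if v = u + w then lk g u * lk f v else 0)" for v
      using mle_minus_eq[of u v w] mle_add[of u w] by (auto simp: lookup_single when_def)
    then have "(\<Sum>v\<in>Poly_Mapping.keys f. lk (if mle u v then Poly_Mapping.single (v - u) (lk g u * lk f v) else 0) w) =
        (\<Sum>v\<in>Poly_Mapping.keys f. if v = u + w then lk g u * lk f v else 0)" by simp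
    also have "\<dots> = lk g u * lk f (u + w)"
      by (auto simp: sum.delta in_keys_iff)
    finally show "(\<Sum>v\<in>Poly_Mapping.keys f. lk (if mle u v then Poly_Mapping.single (v - u) (lk g u * lk f v) else 0) w) =
        lk g u * lk f (u + w)" .
  qed
  finally show ?thesis .
qed

lemma additive_contract_right: "additive_fn (contract g)"
  by (rule additive_fnI, rule poly_mapping_eqI) (simp add: lk_contract lookup_add algebra_simps sum.distrib)

lemma contract_alt: "contract g f = (\<Sum>u\<in>Poly_Mapping.keys g. contract (Poly_Mapping.single u (lk g u)) f)"
proof (rule poly_mapping_eqI)
  fix w
  have "lk (contract (Poly_Mapping.single u (lk g u)) f) w = lk g u * lk f (u + w)" for u
    by (cases "lk g u = 0") (simp_all add: lk_contract)
  then show "lk (contract g f) w = lk (\<Sum>u\<in>Poly_Mapping.keys g. contract (Poly_Mapping.single u (lk g u)) f) w"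
    by (simp add: lookup_sum) (simp add: lk_contract)
qed

lemma lk_contract_single: "lk (contract (Poly_Mapping.single u c) f) w = c * lk f (u + w)"
  by (cases "c = 0") (simp_all add: lk_contract)

lemma additive_contract_left: "additive_fn (\<lambda>g. contract g f)"
proof (rule additive_fnI)
  fix x y
  have *: "additive_fn (\<lambda>g. \<Sum>u\<in>Poly_Mapping.keys g. contract (Poly_Mapping.single u (lk g u)) f)"
    by (rule additive_keysum[where G = "\<lambda>u c. contract (Poly_Mapping.single u c) f"],
      rule additive_fnI, rule poly_mapping_eqI)
     (simp add: lk_contract_single lookup_add algebra_simps)
  show "contract (x + y) f = contract x f + contract y f"
    using additive_fn_add[OF *, of x y] by (simp only: contract_alt[symmetric])
qed

lemma contract_mult: "contract (g * h) f = contract g (contract h f)"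
proof (rule additive_fn_eqI[where p = g and f = "\<lambda>g. contract (g * h) f"])
  fix u c
  show "contract (Poly_Mapping.single u c * h) f = contract (Poly_Mapping.single u c) (contract h f)"
  proof (rule additive_fn_eqI[where p = h and f = "\<lambda>h. contract (Poly_Mapping.single u c * h) f"])
    fix v d
    show "contract (Poly_Mapping.single u c * Poly_Mapping.single v d) f =
        contract (Poly_Mapping.single u c) (contract (Poly_Mapping.single v d) f)"
      by (rule poly_mapping_eqI) (simp add: mult_single lk_contract_single add_ac mult_ac)
  qed (auto intro!: additive_fnI simp: algebra_simps additive_fn_add[OF additive_contract_left] additive_fn_add[OF additive_contract_right])
qed (auto intro!: additive_fnI simp: algebra_simps additive_fn_add[OF additive_contract_left])

lemma lk_contract_var: "lk (contract (var i) f) w = lk f (w + evar i)"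
  by (simp add: var_def lk_contract_single add.commute)

lemma lk_contract_Xvar: "lk (contract (Xvar i) f) w = lk f (w + evar i)"
  by (simp add: Xvar_def lk_contract_single add.commute)

lemma contract_0 [simp]: "contract g 0 = 0" "contract 0 f = 0"
  by (simp_all add: additive_fn_0[OF additive_contract_right] additive_fn_0[OF additive_contract_left])

lemma sl1_contract_Xvar: "sl1 v (contract (Xvar i) f) = contract (var i) (sl1 v f)"
  by (rule poly_mapping_eqI) (simp add: lk_contract_Xvar lk_contract_var)

lemma contract_Xvar_xscale: "contract (Xvar i) (xscale p f) = xscale p (contract (Xvar i) f)"
  by (rule poly_mapping_eqI) (simp add: lk_contract_Xvar)

lemma contract_Xvar_commute: "contract (Xvar i) (contract (Xvar j) f) = contract (Xvar j) (contract (Xvar i) f)"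
  by (rule poly_mapping_eqI) (simp add: lk_contract_Xvar add_ac)

lemma contract_var_ks1: "contract (var i) (ks1 c f) = ks1 c (contract (var i) f)"
  by (rule poly_mapping_eqI) (simp add: lk_contract_var)

lemma lk_inD: "lk (inD \<phi>) u = const (lk \<phi> u)"
  by (simp add: inD_def lookup_map0 const_def)

lemma lk_mult_const: "lk (p * const c) v = lk p v * c"
proof -
  have "lk (const c * p) v = lk p v * c" by (simp add: const_def lk_monomial_mult mle_def)
  then show ?thesis by (simp only: mult.commute[of p "const c"])
qed

text \<open>\<open>inD \<phi>\<close> has coefficients in k, so \<Phi> is the extension of scalars
  of g \<mapsto> g \<phi>.\<close>

lemma sl1_Phi: "sl1 v (\<Phi> \<phi> g) = contract (sl1 v g) \<phi>"
proof (rule poly_mapping_eqI)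
  fix w
  have "lk (contract (sl1 v g) \<phi>) w = (\<Sum>u\<in>Poly_Mapping.keys g. lk (sl1 v g) u * lk \<phi> (u + w))"
    unfolding lk_contract by (rule sum.mono_neutral_left) (auto simp: in_keys_iff)
  then show "lk (sl1 v (\<Phi> \<phi> g)) w = lk (contract (sl1 v g) \<phi>) w"
    by (simp add: \<Phi>_def lk_contract lk_inD lookup_sum lk_mult_const)
qed

definition Dk :: "('n::finite mon \<Rightarrow>\<^sub>0 'k::field) \<Rightarrow> int \<Rightarrow> int \<Rightarrow> ('n mon \<Rightarrow>\<^sub>0 'k) set" where
  "Dk \<phi> s b = (\<lambda>g. contract g \<phi>) ` homog (s - b)"

lemma contract_ks1: "contract (ks1 c g) \<phi> = ks1 c (contract g \<phi>)"
proof -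
  have 1: "ks1 c g = Poly_Mapping.single 0 c * g"
    by (rule poly_mapping_eqI) (simp add: lk_monomial_mult mle_def)
  have 2: "contract (Poly_Mapping.single 0 c) f = ks1 c f" for f
    by (rule poly_mapping_eqI) (simp add: lk_contract_single)
  show ?thesis unfolding 1 contract_mult 2 ..
qed

lemma ksub_Dk: "ksub (Dk \<phi> s b)"
  unfolding ksub_def
proof (intro conjI ballI allI)
  note H = ksub_homog[of "s - b", unfolded ksub_def]
  show "0 \<in> Dk \<phi> s b" unfolding Dk_def using H by (auto intro!: image_eqI[of _ _ 0])
  show "x + y \<in> Dk \<phi> s b" if "x \<in> Dk \<phi> s b" "y \<in> Dk \<phi> s b" for x y
    using that H unfolding Dk_def by (auto simp: additive_fn_add[OF additive_contract_left, symmetric])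
  show "ks1 c x \<in> Dk \<phi> s b" if "x \<in> Dk \<phi> s b" for c x
    using that H unfolding Dk_def by (auto simp: contract_ks1[symmetric])
qed

lemma D'_eq_lift: "D' \<phi> s b = lift (Dk \<phi> s b)"
proof (intro Set.set_eqI iffI)
  fix f assume "f \<in> D' \<phi> s b"
  then obtain g where g: "g \<in> homog (s - b)" "f = \<Phi> \<phi> g" by (auto simp: D'_def)
  have "g \<in> lift (homog (s - b))" using g(1) by (simp add: lift_homog)
  then have "sl1 v g \<in> homog (s - b)" for v by (simp add: lift_def)
  then show "f \<in> lift (Dk \<phi> s b)"
    using g(2) by (simp add: lift_def sl1_Phi Dk_def)
next
  fix f assume f: "f \<in> lift (Dk \<phi> s b)"
  \<comment> \<open>Preimages are taken slice by slice; choosing 0 for zero slices keeps the nonzero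
    ones finite in number, so that they can be glued.\<close>
  have "\<exists>g. sl1 v f = contract g \<phi> \<and> g \<in> homog (s - b) \<and> (sl1 v f = 0 \<longrightarrow> g = 0)" for v
  proof (cases "sl1 v f = 0")
    case True
    then show ?thesis by (intro exI[of _ 0]) (simp add: homog_def)
  next
    case False
    moreover have "sl1 v f \<in> Dk \<phi> s b" using f by (simp add: lift_def)
    ultimately show ?thesis unfolding Dk_def by blast
  qed
  then obtain Z where Z: "\<And>v. sl1 v f = contract (Z v) \<phi>" "\<And>v. Z v \<in> homog (s - b)" "\<And>v. sl1 v f = 0 \<Longrightarrow> Z v = 0"
    by metis
  have "finite {v. Z v \<noteq> 0}" by (rule finite_subset[OF _ finite_sl1[of f]]) (use Z(3) in auto)
  define g where "g = (\<Sum>v\<in>{v. Z v \<noteq> 0}. in1 v (Z v))"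
  have g: "sl1 v g = Z v" for v unfolding g_def by (rule glue1[where Z = Z, OF \<open>finite {v. Z v \<noteq> 0}\<close>])
  have "g \<in> homog (s - b)"
  proof -
    have "g \<in> lift (homog (s - b))" by (simp add: lift_def g Z(2))
    then show ?thesis by (simp add: lift_homog)
  qed
  moreover have "f = \<Phi> \<phi> g" by (rule xpol_eqI) (simp add: sl1_Phi g Z(1))
  ultimately show "f \<in> D' \<phi> s b" by (auto simp: D'_def)
qed

lemma psub1_D': "psub1 (D' \<phi> s b)"
  unfolding D'_eq_lift by (intro psub1_lift ksub_Dk)

lemma Dk_homog:
  assumes phi: "\<phi> \<in> homog s" and f: "f \<in> Dk \<phi> s b"
  shows "f \<in> homog b"
  unfolding homog_iff
proof (intro allI impI)
  fix w assume ne: "lk f w \<noteq> 0"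
  from f obtain g where g: "f = contract g \<phi>" "g \<in> homog (s - b)" unfolding Dk_def by (rule imageE)
  have "(\<Sum>u\<in>Poly_Mapping.keys g. lk g u * lk \<phi> (u + w)) \<noteq> 0"
    using ne by (simp only: g(1) lk_contract not_False_eq_True)
  then obtain u where "lk g u * lk \<phi> (u + w) \<noteq> 0"
    by (rule sum.not_neutral_contains_not_neutral)
  then have "lk g u \<noteq> 0" "lk \<phi> (u + w) \<noteq> 0" by auto
  then have "int (mdeg u) = s - b" "int (mdeg (u + w)) = s"
    using g(2) phi unfolding homog_iff by blast+
  then show "int (mdeg w) = b" by (simp add: mdeg_add)
qed

lemma D'_homog: "\<phi> \<in> homog s \<Longrightarrow> f \<in> D' \<phi> s b \<Longrightarrow> f \<in> homog b"
proof -
  assume phi: "\<phi> \<in> homog s" and f: "f \<in> D' \<phi> s b"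
  have "sl1 v f \<in> homog b" for v
    using f by (intro Dk_homog[OF phi]) (simp add: D'_eq_lift lift_def)
  then have "f \<in> lift (homog b)" by (simp add: lift_def)
  then show ?thesis by (simp add: lift_homog)
qed

lemma var_mult_homog: "g \<in> homog b \<Longrightarrow> var i * g \<in> homog (b + 1)"
  unfolding homog_iff lk_var_mult by (auto simp: mdeg_minus_evar split: if_splits)

lemma Dk_contract: "f \<in> Dk \<phi> s (b + 1) \<Longrightarrow> contract (var i) f \<in> Dk \<phi> s b"
proof -
  assume "f \<in> Dk \<phi> s (b + 1)"
  then obtain g where g: "g \<in> homog (s - (b + 1))" "f = contract g \<phi>" unfolding Dk_def by blast
  have "var i * g \<in> homog (s - (b + 1) + 1)" by (rule var_mult_homog[OF g(1)])
  then show ?thesis unfolding Dk_def g(2) contract_mult[symmetric] by (intro imageI) simp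
qed

text \<open>A monomial of \<phi>, divided by its coefficient, contracts \<phi> to 1, since all
  monomials of \<phi> have the same degree.\<close>

lemma Dk_one:
  assumes "\<phi> \<noteq> 0" "\<phi> \<in> homog s"
  shows "Poly_Mapping.single 0 1 \<in> Dk \<phi> s 0"
proof -
  obtain u where u: "lk \<phi> u \<noteq> 0" using lk_nonzero[OF assms(1)] by blast
  let ?g = "Poly_Mapping.single u (1 / lk \<phi> u)"
  have us: "int (mdeg u) = s" using u assms(2) by (auto simp: homog_iff)
  have "contract ?g \<phi> = Poly_Mapping.single 0 1"
  proof (rule poly_mapping_eqI)
    fix w
    have "lk \<phi> (u + w) = 0" if "w \<noteq> 0"
    proof (rule ccontr)
      assume "lk \<phi> (u + w) \<noteq> 0"
      then have "int (mdeg (u + w)) = s" using assms(2) unfolding homog_iff by blast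
      then have "mdeg w = 0" using us by (simp add: mdeg_add)
      with that show False by (simp add: mdeg_eq_0)
    qed
    then show "lk (contract ?g \<phi>) w = lk (Poly_Mapping.single 0 1) w"
      using u by (auto simp: lk_contract_single lookup_one when_def)
  qed
  moreover have "?g \<in> homog (s - 0)" using us by (auto simp: homog_iff lookup_single when_def)
  ultimately show ?thesis unfolding Dk_def by (metis image_eqI)
qed

subsection \<open>The truncation of the inverse system\<close>

abbreviation hc :: "int \<Rightarrow> ('n::finite mon \<Rightarrow>\<^sub>0 'b::zero) \<Rightarrow> ('n mon \<Rightarrow>\<^sub>0 'b)" where
  "hc b \<equiv> flt (\<lambda>u. int (mdeg u) = b)"

abbreviation cp :: "int \<Rightarrow> ('n::finite set \<Rightarrow>\<^sub>0 'n mon \<Rightarrow>\<^sub>0 'b::zero) \<Rightarrow> ('n set \<Rightarrow>\<^sub>0 'n mon \<Rightarrow>\<^sub>0 'b)" where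
  "cp b \<equiv> fx (\<lambda>u. int (mdeg u) = b)"

text \<open>With t = s - m these are the elements r \<phi> for r in P_{>=m}: a part of degree b
  \<le> t is contracted from a polynomial of degree s - b \<ge> m.\<close>

definition VD :: "('n::finite mon \<Rightarrow>\<^sub>0 'k::field) \<Rightarrow> int \<Rightarrow> int \<Rightarrow> ('n mon \<Rightarrow>\<^sub>0 'k) set" where
  "VD \<phi> s t = {f. \<forall>b. hc b f \<in> (if b \<le> t then Dk \<phi> s b else {0})}"

lemma additive_flt: "additive_fn (flt P)"
  by (rule additive_fnI, rule poly_mapping_eqI) (simp add: lookup_add)

lemma flt_ks1: "flt P (ks1 c f) = ks1 c (flt P f)"
  by (rule poly_mapping_eqI) simp

lemma ksub_VD: "ksub (VD \<phi> s t)"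
  using ksub_Dk[of \<phi> s] unfolding ksub_def VD_def
  by (auto simp: additive_fn_add[OF additive_flt] flt_ks1)

lemma hc_homog: "f \<in> homog b \<Longrightarrow> hc b' f = (if b = b' then f else 0)"
  by (rule poly_mapping_eqI) (auto simp: homog_iff)

lemma Dk_VD: "\<phi> \<in> homog s \<Longrightarrow> b \<le> t \<Longrightarrow> f \<in> Dk \<phi> s b \<Longrightarrow> f \<in> VD \<phi> s t"
  using Dk_homog[of \<phi> s f b] ksub_Dk[of \<phi> s] by (auto simp: VD_def hc_homog ksub_def)

lemma hc_contract: "hc b (contract (var i) f) = contract (var i) (hc (b + 1) f)"
  by (rule poly_mapping_eqI) (simp add: lk_contract_var mdeg_add)

lemma VD_contract: "f \<in> VD \<phi> s t \<Longrightarrow> contract (var i) f \<in> VD \<phi> s t"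
  unfolding VD_def mem_Collect_eq hc_contract
proof (intro allI)
  fix b assume f: "\<forall>b. hc b f \<in> (if b \<le> t then Dk \<phi> s b else {0})"
  show "contract (var i) (hc (b + 1) f) \<in> (if b \<le> t then Dk \<phi> s b else {0})"
  proof (cases "b + 1 \<le> t")
    case True
    then show ?thesis using f[rule_format, of "b + 1"] Dk_contract[of "hc (b + 1) f" \<phi> s b i] by simp
  next
    case False
    then have "hc (b + 1) f = 0" using f[rule_format, of "b + 1"] by simp
    then show ?thesis using ksub_Dk[of \<phi> s b] by (simp add: ksub_def)
  qed
qed

lemma VD_coeff:
  assumes "\<phi> \<in> homog s" "f \<in> VD \<phi> s t" "lk f u \<noteq> 0"
  shows "int (mdeg u) \<le> t"
proof (rule ccontr)
  assume "\<not> int (mdeg u) \<le> t"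
  then have "hc (int (mdeg u)) f = 0" using assms(2) unfolding VD_def by (auto split: if_splits)
  then have "lk (hc (int (mdeg u)) f) u = 0" by (simp del: lk_flt)
  then show False using assms(3) by simp
qed

lemma lk_eta: "lk (eta w) A = kz (\<lambda>i f. contract (Xvar i) f) (lk w) A"
  unfolding eta_def by (rule lookup_koszul) simp

lemma plin_eta: "plin eta"
  unfolding eta_def by (rule plin_koszul) (auto simp: additive_contract_right contract_Xvar_xscale)

lemmas eta_simps = plin_simps[OF plin_eta]

lemma eta_eta: "eta (eta w) = 0"
  unfolding eta_def by (rule koszul_square) (auto simp: additive_contract_right intro: contract_Xvar_commute)

lemma kos_eta: "kos (eta w) = - eta (kos w)"
proof -
  have "kos (eta w) + eta (kos w) = 0"
    unfolding kos_def eta_def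
    by (rule koszul_anticommute) (auto simp: additive_xscale additive_contract_right contract_Xvar_xscale)
  then show ?thesis by (simp add: eq_neg_iff_add_eq_0)
qed

abbreviation etak :: "('n::{finite,linorder}, 'k::field) kform \<Rightarrow> ('n, 'k) kform" where
  "etak \<equiv> kk (\<lambda>i f. contract (var i) f)"

lemma sl_eta: "sl v (eta w) = etak (sl v w)"
  unfolding eta_def by (rule sl_koszul) (simp_all add: sl1_contract_Xvar)

lemma klin_etak: "klin etak"
  by (rule klin_kk) (auto simp: additive_contract_right contract_var_ks1)

lemma etak_etak: "etak (etak z) = 0"
proof -
  have "etak (etak z) = sl 0 (eta (eta (ins 0 z)))" by (simp add: sl_eta sl_ins)
  then show ?thesis by (simp add: eta_eta)
qed

lemma eta_ext:
  assumes "w \<in> ext a V" "psub1 V" "psub1 V'" "\<And>i x. x \<in> V \<Longrightarrow> contract (Xvar i) x \<in> V'"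
  shows "eta w \<in> ext (a - 1) V'"
  unfolding eta_def by (rule koszul_ext[where V = V]) (use assms in \<open>auto intro: psub1_0\<close>)

lemma lift_contract:
  assumes "\<And>f. f \<in> V \<Longrightarrow> contract (var i) f \<in> V'" "x \<in> lift V"
  shows "contract (Xvar i) x \<in> lift V'"
  using assms by (simp add: lift_def sl1_contract_Xvar)

lemma tot_eta: "tot (VD \<phi> s t) (\<lambda>w. - eta w) (\<lambda>z. - etak z)"
proof
  show "ksub (VD \<phi> s t)" by (rule ksub_VD)
  show "- eta w \<in> ext (a - 1) (lift (VD \<phi> s t))" if "w \<in> ext a (lift (VD \<phi> s t))" for w a
    using that by (intro psub_minus psub_ext psub1_lift ksub_VD eta_ext[where V = "lift (VD \<phi> s t)"]
        lift_contract[where V = "VD \<phi> s t"] VD_contract)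
qed (auto intro!: plin_minus plin_eta
      simp: sl_simps sl_eta klin_0[OF klin_etak] plin_simps[OF plin_kos] kos_eta eta_simps eta_eta)

subsection \<open>Splitting the Koszul complex of the inverse system\<close>

text \<open>Linear sections exist over the field k, while over P they need not. They are therefore
  taken here and extended slicewise.\<close>

interpretation kform: vector_space "ks :: 'k::field \<Rightarrow> ('n, 'k) kform \<Rightarrow> ('n, 'k) kform"
  by unfold_locales (auto intro!: poly_mapping_eqI simp: lookup_add algebra_simps)

interpretation kforms: vector_space_pair "ks :: 'k::field \<Rightarrow> ('n, 'k) kform \<Rightarrow> ('n, 'k) kform" "ks :: 'k \<Rightarrow> ('n, 'k) kform \<Rightarrow> ('n, 'k) kform"
  by unfold_locales

lemma linear_iff_klin: "Vector_Spaces.linear ks ks F \<longleftrightarrow> klin F"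
  unfolding klin_def additive_fn_def Vector_Spaces.linear_iff_module_hom module_hom_def module_hom_axioms_def
  using kform.module_axioms by auto

lemma klin_right_inverse:
  assumes "klin F" "kform.subspace V"
  obtains g where "\<And>z. g z \<in> V" "klin g" "\<And>v. v \<in> V \<Longrightarrow> F (g (F v)) = F v"
proof -
  obtain g where "range g \<subseteq> V" "klin g" "\<forall>v\<in>F ` V. F (g v) = v"
    using kforms.linear_exists_right_inverse_on[of F V] assms unfolding linear_iff_klin by blast
  then show ?thesis by (intro that[of g]) auto
qed

lemma klin_projection:
  assumes "kform.subspace V"
  obtains g where "\<And>z. g z \<in> V" "klin g" "\<And>v. v \<in> V \<Longrightarrow> g v = v"
  by (rule klin_right_inverse[of "\<lambda>x. x" V]) (use assms in \<open>auto simp: klin_def additive_fn_def\<close>)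

definition kext :: "int \<Rightarrow> ('n mon \<Rightarrow>\<^sub>0 'k::field) set \<Rightarrow> ('n, 'k) kform set" where
  "kext a V = {z. \<forall>A. lk z A \<in> V \<and> (lk z A \<noteq> 0 \<longrightarrow> int (card A) = a)}"

lemma subspace_kext: "ksub V \<Longrightarrow> kform.subspace (kext a V)"
  unfolding kform.subspace_def kext_def ksub_def by (auto simp: lookup_add) (metis add_0, metis ks1_0)

lemma lift_iff: "f \<in> lift V \<longleftrightarrow> (\<forall>v. sl1 v f \<in> V)"
  by (simp add: lift_def)

lemma ext_lift_iff:
  assumes V: "ksub V"
  shows "w \<in> ext a (lift V) \<longleftrightarrow> (\<forall>v. sl v w \<in> kext a V)"
proof -
  have "(\<forall>v. sl1 v f = 0) \<longleftrightarrow> f = 0" for f :: "('a, 'b) xpol"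
    using xpol_eqI[of f 0] by auto
  then show ?thesis
    unfolding ext_iff[OF psub1_0[OF psub1_lift[OF V]]] kext_def lift_iff mem_Collect_eq lk_sl by metis
qed

lemma klin_comp: "klin F \<Longrightarrow> klin G \<Longrightarrow> klin (\<lambda>x. F (G x))"
  by (simp add: klin_def additive_fn_comp)

lemma additive_ks: "additive_fn (ks c)"
  by (rule additive_fnI, rule poly_mapping_eqI) (simp add: lookup_add additive_fn_add[OF additive_ks1])

lemma klin_diff: "klin F \<Longrightarrow> klin G \<Longrightarrow> klin (\<lambda>x. F x - G x)"
  unfolding klin_def by (simp add: additive_fn_diff[OF additive_ks]) (simp add: additive_fn_def)

lemma klin_id: "klin (\<lambda>x. x)"
  by (simp add: klin_def additive_fn_def)

lemma klin_sum: "(\<And>i. i \<in> S \<Longrightarrow> klin (F i)) \<Longrightarrow> klin (\<lambda>x. \<Sum>i\<in>S. F i x)"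
  by (auto simp: klin_def additive_fn_def sum.distrib additive_fn_sum[OF additive_ks])

lemmas klin_simps = additive_fn_add[OF klin_additive] additive_fn_diff[OF klin_additive] additive_fn_minus[OF klin_additive]
  additive_fn_sum[OF klin_additive] klin_0

text \<open>The component of wedge degree a and D-degree b. Sections are chosen in each bidegree
  separately, which makes them homogeneous.\<close>

definition ck :: "int \<Rightarrow> int \<Rightarrow> ('n::finite, 'k::field) kform \<Rightarrow> ('n, 'k) kform" where
  "ck a b z = flt (\<lambda>A. int (card A) = a) (cp b z)"

lemma lk_ck: "lk (ck a b z) A = (if int (card A) = a then hc b (lk z A) else 0)"
  by (simp add: ck_def)

lemma klin_ck: "klin (ck a b)"
  unfolding klin_def
proof (intro conjI allI additive_fnI)
  show "ck a b (x + y) = ck a b x + ck a b y" for x y :: "('n::finite, 'k::field) kform"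
    by (rule poly_mapping_eqI) (simp add: lk_ck lookup_add additive_fn_add[OF additive_flt])
  show "ck a b (ks c x) = ks c (ck a b x)" for c and x :: "('n::finite, 'k::field) kform"
    by (rule poly_mapping_eqI) (simp add: lk_ck flt_ks1)
qed

lemma lk_ck_self: "lk (lk z A) u = lk (lk (ck (int (card A)) (int (mdeg u)) z) A) u"
  by (simp add: lk_ck)

lemma ck_eqI:
  assumes "\<And>a b. ck a b x = ck a b y"
  shows "x = y"
proof (rule poly_mapping_eqI, rule poly_mapping_eqI)
  show "lk (lk x A) u = lk (lk y A) u" for A u
    unfolding lk_ck_self[of x A u] lk_ck_self[of y A u] assms ..
qed

lemma ck_ck: "ck a' b' (ck a b z) = (if a' = a \<and> b' = b then ck a b z else 0)"
  by (rule poly_mapping_eqI, rule poly_mapping_eqI) (simp add: lk_ck)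

lemma ck_cp: "ck a b' (cp b z) = (if b' = b then ck a b z else 0)"
  by (rule poly_mapping_eqI, rule poly_mapping_eqI) (simp add: lk_ck)

lemma etak_ck: "etak (ck a b z) = ck (a - 1) (b - 1) (etak z)"
proof (rule poly_mapping_eqI)
  fix A
  show "lk (etak (ck a b z)) A = lk (ck (a - 1) (b - 1) (etak z)) A"
    unfolding lk_ck lk_kk kz_def
    by (auto simp: additive_fn_sum[OF additive_flt] additive_sg[OF additive_flt] hc_contract intro!: sum.cong)
qed

lemma kext_ck:
  assumes "\<phi> \<in> homog s" "z \<in> kext a (Dk \<phi> s b)"
  shows "ck a' b' z = (if a' = a \<and> b' = b then z else 0)"
proof (rule poly_mapping_eqI)
  fix A
  have "hc b' (lk z A) = (if b = b' then lk z A else 0)"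
  proof (rule hc_homog)
    show "lk z A \<in> homog b" using assms(2) Dk_homog[OF assms(1)] unfolding kext_def by blast
  qed
  then show "lk (ck a' b' z) A = lk (if a' = a \<and> b' = b then z else 0) A"
    using assms(2) by (auto simp: lk_ck kext_def)
qed

text \<open>Sections of \<open>etak\<close> in the single bidegrees add up to a homogeneous g with e
  g e = e, and an algebraic correction of g gives the remaining identities. Nilpotency holds because
  h raises the D-degree within the bounded range 0..t.\<close>

lemma splitting_exists:
  fixes \<phi> :: "'n::{finite,linorder} mon \<Rightarrow>\<^sub>0 'k::field"
  assumes phi: "\<phi> \<in> homog s"
  obtains h :: "('n, 'k) xform \<Rightarrow> ('n, 'k) xform"
  where "perturbation (VD \<phi> s t) (\<lambda>w. - eta w) (\<lambda>z. - etak z) h"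
    and "\<And>b w. cp b (h w) = h (cp (b - 1) w)"
    and "\<And>v w. h (ins 0 (sl v w)) = ins 0 (sl v (h w))"
proof -
  define N where "N = int CARD('n)"
  define XX :: "('n, 'k) kform set" where "XX = {z. \<forall>A. lk z A \<in> VD \<phi> s t}"
  define Q :: "int \<Rightarrow> int \<Rightarrow> ('n, 'k) kform set" where "Q a b = kext a (Dk \<phi> s b)" for a b
  note VDs = ksub_VD[of \<phi> s t]
  have X_add: "x + y \<in> XX" if "x \<in> XX" "y \<in> XX" for x y
    using that VDs by (auto simp: XX_def lookup_add ksub_def)
  have X_0: "0 \<in> XX" using VDs by (auto simp: XX_def ksub_def)
  have X_sum: "(\<Sum>i\<in>S. f i) \<in> XX" if "\<And>i. i \<in> S \<Longrightarrow> f i \<in> XX" for S :: "int set" and f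
    using that by (induction S rule: infinite_finite_induct) (auto simp: X_0 X_add)
  have Q_X: "z \<in> XX" if "z \<in> Q a b" "b \<le> t" for a b z
    using that Dk_VD[OF phi] by (auto simp: XX_def Q_def kext_def)
  have X_ck: "ck a b z \<in> Q a b" if "z \<in> XX" "b \<le> t" for a b z
  proof -
    have "lk z A \<in> VD \<phi> s t" for A using that by (simp add: XX_def)
    then have "hc b (lk z A) \<in> Dk \<phi> s b" for A using that(2) unfolding VD_def by (metis (mono_tags, lifting) mem_Collect_eq)
    then show ?thesis using ksub_Dk[of \<phi> s b] by (auto simp: Q_def kext_def lk_ck ksub_def)
  qed
  have X_sum_ck: "(\<Sum>a\<in>{0..N}. \<Sum>b\<in>{0..t}. ck a b z) = z" if "z \<in> XX" for z
  proof (rule poly_mapping_eqI, rule poly_mapping_eqI)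
    fix A :: "'n set" and u
    have "int (card A) \<le> N" unfolding N_def using card_mono[of UNIV A] by simp
    moreover have "lk (lk z A) u = 0" if "\<not> int (mdeg u) \<le> t"
      using VD_coeff[OF phi, of "lk z A" t u] \<open>z \<in> XX\<close> that unfolding XX_def by blast
    moreover have "lk (lk (\<Sum>a\<in>{0..N}. \<Sum>b\<in>{0..t}. ck a b z) A) u =
        (\<Sum>a\<in>{0..N}. if int (card A) = a then (\<Sum>b\<in>{0..t}. if int (mdeg u) = b then lk (lk z A) u else 0) else 0)"
      unfolding lookup_sum by (intro sum.cong refl) (auto simp: lk_ck)
    ultimately show "lk (lk (\<Sum>a\<in>{0..N}. \<Sum>b\<in>{0..t}. ck a b z) A) u = lk (lk z A) u"
      by (auto simp: sum.delta')
  qed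
  have "\<exists>g. (\<forall>z. g z \<in> Q a b) \<and> klin g \<and> (\<forall>v\<in>Q a b. etak (g (etak v)) = etak v)" for a b
  proof -
    obtain g where "\<And>z. g z \<in> kext a (Dk \<phi> s b)" "klin g" "\<And>v. v \<in> kext a (Dk \<phi> s b) \<Longrightarrow> etak (g (etak v)) = etak v"
      by (rule klin_right_inverse[OF klin_etak subspace_kext[OF ksub_Dk[of \<phi> s b]], of a]) blast
    then show ?thesis unfolding Q_def by blast
  qed
  then obtain G where G: "\<And>a b z. G a b z \<in> Q a b" "\<And>a b. klin (G a b)"
      "\<And>a b v. v \<in> Q a b \<Longrightarrow> etak (G a b (etak v)) = etak v"
    by metis
  \<comment> \<open>\<open>etak\<close> lowers both degrees by one, so the value in bidegree (a, b)
    is computed from the component in (a - 1, b - 1).\<close>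
  define g where "g z = (\<Sum>a\<in>{0..N}. \<Sum>b\<in>{0..t}. G a b (ck (a - 1) (b - 1) z))" for z
  have klin_g: "klin g"
    unfolding g_def[abs_def] by (intro klin_sum klin_comp[OF G(2) klin_ck])
  note [simp] = klin_simps[OF klin_g] klin_simps[OF klin_etak] klin_simps[OF klin_ck] klin_simps[OF G(2)]
  have g_X: "g z \<in> XX" for z
    unfolding g_def by (intro X_sum Q_X[OF G(1)]) auto
  have ck_G: "ck a' b' (G a b z) = (if a' = a \<and> b' = b then G a b z else 0)" for a b a' b' z
    using kext_ck[OF phi G(1)[unfolded Q_def]] .
  have ck_g: "ck a b (g z) = (if a \<in> {0..N} \<and> b \<in> {0..t} then G a b (ck (a - 1) (b - 1) z) else 0)" for a b z
  proof -
    have "ck a b (g z) = (\<Sum>a'\<in>{0..N}. \<Sum>b'\<in>{0..t}. if a = a' then if b = b' then G a' b' (ck (a' - 1) (b' - 1) z) else 0 else 0)"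
      unfolding g_def by (simp add: ck_G) (intro sum.cong refl, auto)
    also have "\<dots> = (\<Sum>a'\<in>{0..N}. if a = a' then (\<Sum>b'\<in>{0..t}. if b = b' then G a' b' (ck (a' - 1) (b' - 1) z) else 0) else 0)"
      by (intro sum.cong refl) auto
    also have "\<dots> = (if a \<in> {0..N} \<and> b \<in> {0..t} then G a b (ck (a - 1) (b - 1) z) else 0)"
      by (simp add: sum.delta')
    finally show ?thesis .
  qed
  have g_ck: "g (ck (a - 1) (b - 1) z) = ck a b (g z)" for a b z
    by (rule ck_eqI) (auto simp: ck_g ck_ck ck_G)
  have ege: "etak (g (etak z)) = etak z" if z: "z \<in> XX" for z
  proof -
    have "etak (g (etak z)) = (\<Sum>a\<in>{0..N}. \<Sum>b\<in>{0..t}. etak (ck a b z))"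
      unfolding g_def using X_ck[OF z] by (simp add: etak_ck[symmetric] G(3))
    also have "\<dots> = etak (\<Sum>a\<in>{0..N}. \<Sum>b\<in>{0..t}. ck a b z)" by simp
    finally show ?thesis by (simp only: X_sum_ck[OF z])
  qed
  \<comment> \<open>Writing e for \<open>etak\<close>: the factor 1 - g e annihilates g e y for y in
    \<open>XX\<close>, which gives H H = 0; the outer g e gives H e H = H.\<close>
  define H where "H z = g (etak (g (z - g (etak z))))" for z
  have klin_H: "klin H"
    unfolding H_def[abs_def]
    by (intro klin_comp[OF klin_g] klin_comp[OF klin_etak] klin_diff klin_id klin_comp[OF klin_g klin_etak])
  note [simp] = klin_simps[OF klin_H]
  have eH: "etak (H z) = etak (g (z - g (etak z)))" for z
    unfolding H_def by (rule ege[OF g_X])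
  have HeX: "H (etak x) = g (etak x)" if "x \<in> XX" for x
    using ege[OF that] by (simp add: H_def etak_etak)
  have HeH: "H (etak (H z)) = H z" for z
    unfolding eH HeX[OF g_X] by (simp add: H_def)
  have eHe: "etak (H (etak z)) = etak z" if "z \<in> XX" for z
    by (simp add: HeX[OF that] ege[OF that])
  have HH: "H (H z) = 0" for z
  proof -
    define y where "y = g (z - g (etak z))"
    have y: "etak (g (etak y)) = etak y" unfolding y_def by (rule ege[OF g_X])
    have "H (g (etak y)) = 0" by (simp add: H_def y)
    then show ?thesis by (simp add: H_def[of z] y_def)
  qed
  have H_ck: "ck a b (H z) = H (ck (a - 1) (b - 1) z)" for a b z
    unfolding H_def by (simp add: g_ck[symmetric] etak_ck[symmetric] etak_ck[of "a - 1" "b - 1", symmetric]) (simp add: g_ck etak_ck)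
  have H_X: "H z \<in> XX" for z unfolding H_def by (rule g_X)
  have H_kext: "H z \<in> kext (a + 1) (VD \<phi> s t)" if z: "z \<in> kext a (VD \<phi> s t)" for a z
    unfolding kext_def mem_Collect_eq
  proof (intro allI conjI impI)
    fix A
    show "lk (H z) A \<in> VD \<phi> s t" using H_X[of z] by (simp add: XX_def)
    assume "lk (H z) A \<noteq> 0"
    then obtain u where "lk (lk (H z) A) u \<noteq> 0" using lk_nonzero by blast
    then have "ck (int (card A)) (int (mdeg u)) (H z) \<noteq> 0" by (metis lk_ck_self lookup_zero)
    then have "ck (int (card A) - 1) (int (mdeg u) - 1) z \<noteq> 0" unfolding H_ck by (metis klin_0[OF klin_H])
    then obtain B where "lk (ck (int (card A) - 1) (int (mdeg u) - 1) z) B \<noteq> 0" using lk_nonzero by blast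
    then have "int (card B) = int (card A) - 1" "lk z B \<noteq> 0" by (auto simp: lk_ck split: if_splits)
    then show "int (card A) = a + 1" using z by (auto simp: kext_def)
  qed
  have H_cp: "cp b (H z) = H (cp (b - 1) z)" for b z
    by (rule ck_eqI) (auto simp: ck_cp H_ck)
  \<comment> \<open>The sign matches the differential, which is \<open>- eta\<close>.\<close>
  define h where "h w = - Pext H w" for w
  have sl_h: "sl v (h w) = - H (sl v w)" for v w
    by (simp add: h_def sl_simps sl_Pext)
  have plin_h: "plin h"
    unfolding h_def[abs_def] by (intro plin_minus plin_Pext klin_H)
  have h_cp: "cp b (h w) = h (cp (b - 1) w)" for b w
    by (rule xform_eqI) (simp add: sl_fx sl_h klin_simps[OF klin_fx] H_cp)
  have h_range: "cp b (h w) = 0" if "b < 0 \<or> t < b" for b w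
  proof (rule xform_eqI)
    fix v
    have "cp b z = 0" if "z \<in> XX" for z
    proof (rule poly_mapping_eqI, rule poly_mapping_eqI)
      fix A u
      have "lk z A \<in> VD \<phi> s t" using \<open>z \<in> XX\<close> by (simp add: XX_def)
      then have "lk (lk z A) u = 0" if "int (mdeg u) = b"
        using that \<open>b < 0 \<or> t < b\<close> VD_coeff[OF phi, of "lk z A" t u] by (cases "lk (lk z A) u = 0") auto
      then show "lk (lk (cp b z) A) u = lk (lk 0 A) u" by simp
    qed
    from this[OF H_X] show "sl v (cp b (h w)) = sl v 0"
      by (simp add: sl_fx sl_h klin_simps[OF klin_fx])
  qed
  interpret tot "VD \<phi> s t" "\<lambda>w. - eta w" "\<lambda>z. - etak z" by (rule tot_eta)
  note [simp] = plin_simps[OF plin_h] plin_simps[OF plin_kos]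
  have "perturbation (VD \<phi> s t) (\<lambda>w. - eta w) (\<lambda>z. - etak z) h"
  proof
    show "plin h" by (rule plin_h)
    show "h w \<in> T (a + 1)" if "w \<in> T a" for a w
    proof -
      have "sl v (h w) = H (- sl v w)" for v by (simp add: sl_h)
      moreover have "H (- sl v w) \<in> kext (a + 1) (VD \<phi> s t)" for v
      proof (rule H_kext)
        have "sl v (- w) \<in> kext a (VD \<phi> s t)"
          using psub_minus[OF psub_T that] unfolding T_def ext_lift_iff[OF VDs] by blast
        then show "- sl v w \<in> kext a (VD \<phi> s t)" by (simp add: sl_simps)
      qed
      ultimately show ?thesis unfolding T_def ext_lift_iff[OF VDs] by simp
    qed
    show "h (h w) = 0" for w by (rule xform_eqI) (simp add: sl_h HH)
    show "h (- eta (h w)) = h w" for w by (rule xform_eqI) (simp add: sl_h sl_simps sl_eta HeH)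
    show "- eta (h (- eta w)) = - eta w" if w: "w \<in> T a" for a w
    proof -
      have "sl v w \<in> XX" for v using w unfolding T_def ext_lift_iff[OF VDs] by (auto simp: kext_def XX_def)
      then show ?thesis by (intro xform_eqI) (simp add: sl_h sl_simps sl_eta eHe)
    qed
    show "\<exists>M. ((\<lambda>w. - h (kos w)) ^^ M) w = 0" for w
    proof -
      let ?f = "\<lambda>w. - h (kos w)"
      have f_cp: "cp b (?f x) = ?f (cp (b - 1) x)" for b x
        by (simp add: fx_simps h_cp kos_fx)
      have fr_cp: "cp b ((?f ^^ r) x) = (?f ^^ r) (cp (b - int r) x)" for b r x
      proof (induction r arbitrary: b)
        case (Suc r)
        have "cp b (?f ((?f ^^ r) x)) = ?f (cp (b - 1) ((?f ^^ r) x))" by (rule f_cp)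
        also have "cp (b - 1) ((?f ^^ r) x) = (?f ^^ r) (cp (b - 1 - int r) x)" by (rule Suc.IH)
        also have "b - 1 - int r = b - int (Suc r)" by simp
        finally show ?case by (simp only: funpow.simps o_apply)
      qed simp
      have fr_0: "(?f ^^ r) 0 = 0" for r by (induction r) simp_all
      have range: "cp b (?f x) = 0" if "b < 0 \<or> t < b" for b x using that by (simp add: fx_simps h_range)
      \<comment> \<open>The first application lands in degrees 0..t, and t + 1 more push everything
        above t.\<close>
      define r where "r = nat (t + 1)"
      have "cp b ((?f ^^ r) (?f w)) = 0" for b
      proof (cases "b \<le> t")
        case True
        then have "b - int r < 0" by (simp add: r_def)
        then have "cp (b - int r) (?f w) = 0" by (intro range disjI1)
        then show ?thesis by (simp only: fr_cp fr_0)
      next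
        case False
        then have "cp b (?f ((?f ^^ r) w)) = 0" by (intro range disjI2) simp
        then show ?thesis using funpow_swap1[of ?f r w] by (simp only:)
      qed
      then have "lk (lk ((?f ^^ r) (?f w)) A) u = 0" for A u
      proof -
        have "lk (lk (cp (int (mdeg u)) ((?f ^^ r) (?f w))) A) u = 0"
          using \<open>\<And>b. cp b ((?f ^^ r) (?f w)) = 0\<close> by (simp only: lookup_zero)
        then show ?thesis by simp
      qed
      then have "(?f ^^ r) (?f w) = 0" by (intro poly_mapping_eqI) simp
      then have "(?f ^^ Suc r) w = 0" by (simp only: funpow_Suc_right o_apply)
      then show ?thesis by blast
    qed
  qed
  \<comment> \<open>H acts on each slice separately; this will make the kernel of h generated by
    forms with coefficients in k.\<close>
  moreover have "h (ins 0 (sl v w)) = ins 0 (sl v (h w))" for v w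
    by (rule xform_eqI) (simp add: sl_h sl_ins)
  ultimately show thesis by (rule that[OF _ h_cp])
qed

subsection \<open>Evaluation in the inverse system\<close>

text \<open>The counterpart of \<open>eps\<close> for D: p tensor f goes to p f, where x_i acts by
  contraction. In degree 0 of the complex it is the augmentation to V.\<close>

definition ev1 :: "('n, 'k::field) xpol \<Rightarrow> ('n mon \<Rightarrow>\<^sub>0 'k)" where
  "ev1 f = (\<Sum>u\<in>Poly_Mapping.keys f. contract (lk f u) (Poly_Mapping.single u 1))"

lemma additive_ev1: "additive_fn ev1"
  unfolding ev1_def[abs_def]
  by (rule additive_keysum[where G = "\<lambda>u p. contract p (Poly_Mapping.single u 1)"], rule additive_contract_left)

lemma ev1_single: "ev1 (Poly_Mapping.single u p) = contract p (Poly_Mapping.single u 1)"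
  by (simp add: ev1_def)

lemma ev1_xscale: "ev1 (xscale p f) = contract p (ev1 f)"
proof (rule additive_fn_eqI[where p = f])
  show "additive_fn (\<lambda>f. ev1 (xscale p f))" by (rule additive_fn_comp[OF additive_ev1 additive_xscale])
  show "additive_fn (\<lambda>f. contract p (ev1 f))" by (rule additive_fn_comp[OF additive_contract_right additive_ev1])
qed (simp add: xscale_single ev1_single contract_mult)

lemma contract_var_single: "contract (var i) (Poly_Mapping.single u c) = (if 0 < lk u i then Poly_Mapping.single (u - evar i) c else 0)"
proof (rule poly_mapping_eqI)
  fix w
  show "lk (contract (var i) (Poly_Mapping.single u c)) w = lk (if 0 < lk u i then Poly_Mapping.single (u - evar i) c else 0) w"
    using mle_minus_eq[of "evar i" u w] mle_add[of "evar i" w]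
    by (auto simp: lk_contract_var lookup_single when_def mle_evar add.commute)
qed

lemma contract_Xvar_single: "contract (Xvar i) (Poly_Mapping.single u c) = (if 0 < lk u i then Poly_Mapping.single (u - evar i) c else 0)"
proof (rule poly_mapping_eqI)
  fix w
  show "lk (contract (Xvar i) (Poly_Mapping.single u c)) w = lk (if 0 < lk u i then Poly_Mapping.single (u - evar i) c else 0) w"
    using mle_minus_eq[of "evar i" u w] mle_add[of "evar i" w]
    by (auto simp: lk_contract_Xvar lookup_single when_def mle_evar add.commute)
qed

lemma contract_commute: "contract g (contract h f) = contract h (contract g f)"
  unfolding contract_mult[symmetric] by (simp only: mult.commute)

lemma ev1_contract: "ev1 (contract (Xvar i) f) = contract (var i) (ev1 f)"
proof (rule additive_fn_eqI[where p = f])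
  show "additive_fn (\<lambda>f. ev1 (contract (Xvar i) f))" by (rule additive_fn_comp[OF additive_ev1 additive_contract_right])
  show "additive_fn (\<lambda>f. contract (var i) (ev1 f))" by (rule additive_fn_comp[OF additive_contract_right additive_ev1])
  fix u p
  have "contract (var i) (contract p (Poly_Mapping.single u 1)) = contract p (contract (var i) (Poly_Mapping.single u 1))"
    by (rule contract_commute)
  then show "ev1 (contract (Xvar i) (Poly_Mapping.single u p)) = contract (var i) (ev1 (Poly_Mapping.single u p))"
    by (simp add: contract_Xvar_single ev1_single contract_var_single additive_fn_0[OF additive_ev1])
qed

text \<open>After evaluation x_i and X_i act in the same way, so boundaries of the complex of the
  x_i - X_i evaluate to 0.\<close>

lemma ev1_boundary: "ev1 (lk (kos w) {}) = ev1 (lk (eta w) {})"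
  by (simp add: lk_kos lk_eta kz_def additive_fn_sum[OF additive_ev1] additive_sg[OF additive_ev1] ev1_xscale ev1_contract)

lemma const_add: "const (a + b) = const a + const b"
  by (simp add: const_def single_add)

lemma const_0 [simp]: "const 0 = 0"
  by (simp add: const_def)

lemma additive_inD: "additive_fn inD"
  by (rule additive_fnI, rule poly_mapping_eqI) (simp add: lk_inD lookup_add const_add)

lemma inD_single: "inD (Poly_Mapping.single u c) = Poly_Mapping.single u (const c)"
  by (rule poly_mapping_eqI) (simp add: lk_inD lookup_single when_def)

lemma ev1_inD: "ev1 (inD f) = f"
proof (rule additive_fn_eqI[where p = f and g = "\<lambda>f. f"])
  show "additive_fn (\<lambda>f. ev1 (inD f))" by (rule additive_fn_comp[OF additive_ev1 additive_inD])
  show "ev1 (inD (Poly_Mapping.single u c)) = Poly_Mapping.single u c" for u c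
    by (rule poly_mapping_eqI) (simp add: inD_single ev1_single const_def lk_contract_single lookup_single when_def)
qed (simp add: additive_fn_def)

lemma additive_Phi: "additive_fn (\<Phi> \<phi>)"
  unfolding \<Phi>_def[abs_def] by (rule additive_contract_left)

text \<open>The augmentations of source and target are linked by this: \<Phi> followed by evaluation
  in D is \<open>eps\<close> followed by the action on \<phi>.\<close>

lemma ev1_Phi: "ev1 (\<Phi> \<phi> g) = contract (eps g) \<phi>"
proof (rule additive_fn_eqI[where p = g])
  show "additive_fn (\<lambda>g. ev1 (\<Phi> \<phi> g))" by (rule additive_fn_comp[OF additive_ev1 additive_Phi])
  show "additive_fn (\<lambda>g. contract (eps g) \<phi>)" by (rule additive_fn_comp[OF additive_contract_left additive_eps])
  fix u p
  have "\<Phi> \<phi> (Poly_Mapping.single u p) = xscale p (inD (contract (Poly_Mapping.single u 1) \<phi>))"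
    by (rule poly_mapping_eqI) (simp add: \<Phi>_def lk_contract_single lk_inD)
  then show "ev1 (\<Phi> \<phi> (Poly_Mapping.single u p)) = contract (eps (Poly_Mapping.single u p)) \<phi>"
    by (simp add: ev1_xscale ev1_inD eps_single contract_mult)
qed

lemma pdeg1_inD:
  assumes w: "pdeg_lt 1 w"
  shows "lk w S = inD (sl1 0 (lk w S))"
proof (rule xpol_eqI)
  fix v
  have "sl1 v (lk w S) = 0" if "v \<noteq> 0"
  proof -
    have "sl v w = 0" using w that by (auto simp: pdeg_lt_def mdeg_eq_0)
    then have "lk (sl v w) S = 0" by (simp del: lk_sl)
    then show ?thesis by simp
  qed
  moreover have "sl1 v (inD f) = (if v = 0 then f else 0)" for f :: "'a mon \<Rightarrow>\<^sub>0 'b"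
    by (rule poly_mapping_eqI) (simp add: lk_inD const_def lookup_single when_def)
  ultimately show "sl1 v (lk w S) = sl1 v (inD (sl1 0 (lk w S)))" by simp
qed

lemma ev1_pdeg1:
  assumes w: "pdeg_lt 1 w" and eq: "ev1 (lk w S) = 0"
  shows "lk w S = 0"
proof -
  have "sl1 0 (lk w S) = 0" using eq ev1_inD[of "sl1 0 (lk w S)"] by (simp only: pdeg1_inD[OF w, symmetric])
  then show ?thesis using pdeg1_inD[OF w, of S] additive_fn_0[OF additive_inD] by simp
qed

lemma cp_eta: "cp b (eta w) = eta (cp (b + 1) w)"
  by (rule xform_eqI, rule poly_mapping_eqI)
     (simp add: lk_eta kz_def sl1_simps additive_sg[OF additive_sl1] sl1_flt additive_fn_sum[OF additive_flt]
       additive_sg[OF additive_flt] sl1_contract_Xvar hc_contract)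

subsection \<open>The monomials of a power of the maximal ideal\<close>

lemma deg_ge_add: "x \<in> deg_ge m \<Longrightarrow> y \<in> deg_ge m \<Longrightarrow> x + y \<in> deg_ge m"
  unfolding deg_ge_def mem_Collect_eq lookup_add by (metis add_0)

lemma deg_ge_0: "0 \<in> deg_ge m" by (simp add: deg_ge_def)

lemma deg_ge_sum: "(\<And>i. i \<in> S \<Longrightarrow> f i \<in> deg_ge m) \<Longrightarrow> sum f S \<in> deg_ge m"
  by (induction S rule: infinite_finite_induct) (auto simp: deg_ge_0 deg_ge_add)

lemma deg_ge_mult: "r \<in> deg_ge m \<Longrightarrow> p * r \<in> deg_ge m"
proof -
  assume r: "r \<in> deg_ge m"
  have mon: "Poly_Mapping.single u c * r \<in> deg_ge m" for u c
    unfolding deg_ge_def mem_Collect_eq lk_monomial_mult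
  proof (intro allI impI)
    fix v assume "(if mle u v then c * lk r (v - u) else 0) \<noteq> 0"
    then have "mle u v" "lk r (v - u) \<noteq> 0" by (auto split: if_splits)
    then have "m \<le> int (mdeg (v - u))" "v = u + (v - u)"
      using r mle_minus_eq[of u v "v - u"] by (auto simp: deg_ge_def)
    then show "m \<le> int (mdeg v)" by (metis mdeg_add of_nat_add of_nat_0_le_iff add_increasing)
  qed
  have "(\<Sum>u\<in>Poly_Mapping.keys p. Poly_Mapping.single u (lk p u)) * r \<in> deg_ge m"
    unfolding sum_distrib_right by (intro deg_ge_sum mon)
  then show ?thesis by (simp only: sum_single_keys)
qed

lemma eps_homog_deg_ge: "g \<in> homog c \<Longrightarrow> m \<le> c \<Longrightarrow> eps g \<in> deg_ge m"
  unfolding eps_def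
proof (intro deg_ge_sum deg_ge_mult)
  fix u assume "g \<in> homog c" "m \<le> c" "u \<in> Poly_Mapping.keys g"
  then have "m \<le> int (mdeg u)" by (auto simp: homog_def)
  then show "Poly_Mapping.single u 1 \<in> deg_ge m" by (simp add: deg_ge_def lookup_single when_def)
qed

lemma submonomial:
  "k \<le> mdeg u \<Longrightarrow> \<exists>v. mle v u \<and> mdeg v = k"
proof (induction k)
  case 0
  show ?case by (rule exI[of _ 0]) (simp add: mle_def)
next
  case (Suc k)
  then obtain v where v: "mle v u" "mdeg v = k" by auto
  have "\<exists>i. lk v i < lk u i"
  proof (rule ccontr)
    assume "\<nexists>i. lk v i < lk u i"
    then have "v = u" using v(1) by (intro poly_mapping_eqI) (simp add: mle_def le_antisym not_less)
    then show False using v Suc.prems by simp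
  qed
  then obtain i where "lk v i < lk u i" by blast
  then have "mle (v + evar i) u" using v(1) by (auto simp: mle_def lookup_add lookup_evar)
  then show ?case using v(2) by (intro exI[of _ "v + evar i"]) (simp add: mdeg_add)
qed

text \<open>Every monomial of degree at least m has a divisor of degree m, which can be written in
  the X_i. Thus \<open>eps\<close> maps S_m onto the m-th power of the maximal ideal.\<close>

lemma eps_surj:
  fixes r :: "('n::finite, 'k::field) pol"
  assumes m: "0 \<le> m" and r: "r \<in> deg_ge m"
  shows "\<exists>f\<in>homog m. eps f = r"
proof -
  have "\<exists>v. lk r u \<noteq> 0 \<longrightarrow> mle v u \<and> int (mdeg v) = m" for u
  proof (cases "lk r u = 0")
    case False
    then have "m \<le> int (mdeg u)" using r by (simp add: deg_ge_def)
    then have "nat m \<le> mdeg u" by simp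
    from submonomial[OF this] m show ?thesis by auto
  qed simp
  then obtain V where V: "\<And>u. lk r u \<noteq> 0 \<Longrightarrow> mle (V u) u \<and> int (mdeg (V u)) = m" by metis
  define f :: "('n, 'k) xpol" where "f = (\<Sum>u\<in>Poly_Mapping.keys r. Poly_Mapping.single (V u) (Poly_Mapping.single (u - V u) (lk r u)))"
  have "eps f = (\<Sum>u\<in>Poly_Mapping.keys r. Poly_Mapping.single u (lk r u))"
    unfolding f_def additive_fn_sum[OF additive_eps]
  proof (rule sum.cong[OF refl])
    fix u assume "u \<in> Poly_Mapping.keys r"
    then have "u = V u + (u - V u)" using V[of u] mle_minus_eq[of "V u" u "u - V u"] by (simp add: in_keys_iff)
    then have "u - V u + V u = u" by (metis add.commute)
    then show "eps (Poly_Mapping.single (V u) (Poly_Mapping.single (u - V u) (lk r u))) = Poly_Mapping.single u (lk r u)"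
      by (simp add: eps_single mult_single)
  qed
  then have "eps f = r" by (simp only: sum_single_keys)
  moreover have "f \<in> homog m"
    unfolding f_def using V by (intro psub1_sum psub1_homog) (auto simp: homog_iff lookup_single when_def in_keys_iff)
  ultimately show ?thesis by blast
qed

subsection \<open>The reduced complex of the inverse system\<close>

locale inverse_system =
  fixes \<phi> :: "'n::{finite,linorder} mon \<Rightarrow>\<^sub>0 'k::field" and s t :: int
    and h :: "('n, 'k) xform \<Rightarrow> ('n, 'k) xform"
  assumes phi: "\<phi> \<in> homog s" and phi_nz: "\<phi> \<noteq> 0"
    and pert: "perturbation (VD \<phi> s t) (\<lambda>w. - eta w) (\<lambda>z. - etak z) h"
    and cp_h: "cp b (h w) = h (cp (b - 1) w)"
    and h_slice: "h (ins 0 (sl v w)) = ins 0 (sl v (h w))"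
begin

sublocale perturbation "VD \<phi> s t" "\<lambda>w. - eta w" "\<lambda>z. - etak z" h
  by (rule pert)

lemma D'_lift_VD: "b \<le> t \<Longrightarrow> f \<in> D' \<phi> s b \<Longrightarrow> f \<in> lift (VD \<phi> s t)"
  using Dk_VD[OF phi] by (auto simp: D'_eq_lift lift_def)

lemma hc_VD: "f \<in> lift (VD \<phi> s t) \<Longrightarrow> b \<le> t \<Longrightarrow> hc b f \<in> D' \<phi> s b"
proof -
  assume f: "f \<in> lift (VD \<phi> s t)" and b: "b \<le> t"
  have "hc b (sl1 v f) \<in> (if b \<le> t then Dk \<phi> s b else {0})" for v
    using f unfolding lift_iff VD_def by blast
  then show ?thesis using b by (simp add: D'_eq_lift lift_iff sl1_flt)
qed

lemma hc_VD_0: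
  assumes f: "f \<in> lift (VD \<phi> s t)" and b: "b < 0 \<or> t < b"
  shows "hc b f = 0"
proof (rule xpol_eqI)
  fix v
  have "hc b (sl1 v f) = 0" if "t < b"
  proof -
    have "sl1 v f \<in> VD \<phi> s t" using f by (simp add: lift_def)
    then have "hc b (sl1 v f) \<in> (if b \<le> t then Dk \<phi> s b else {0})" unfolding VD_def by blast
    then show ?thesis using that by simp
  qed
  moreover have "hc b (sl1 v f) = 0" if "b < 0"
    by (rule poly_mapping_eqI) (use that in auto)
  ultimately show "sl1 v (hc b f) = sl1 v 0" using b by (auto simp: sl1_flt)
qed

lemma T_iff: "w \<in> T a \<longleftrightarrow> (\<forall>S. lk w S \<in> lift (VD \<phi> s t) \<and> (lk w S \<noteq> 0 \<longrightarrow> int (card S) = a))"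
  unfolding T_def by (rule ext_iff[OF psub1_0[OF psub1_lift[OF ksub_VD]]])

lemma ext_D'_iff: "w \<in> ext a (D' \<phi> s b) \<longleftrightarrow> (\<forall>S. lk w S \<in> D' \<phi> s b \<and> (lk w S \<noteq> 0 \<longrightarrow> int (card S) = a))"
  by (rule ext_iff[OF psub1_0[OF psub1_D']])

lemma cp_ext_D': "w \<in> ext a (D' \<phi> s b) \<Longrightarrow> cp b' w = (if b' = b then w else 0)"
proof (rule poly_mapping_eqI)
  fix S assume w: "w \<in> ext a (D' \<phi> s b)"
  have "lk w S \<in> homog b" using w by (intro D'_homog[OF phi]) (simp add: ext_D'_iff)
  then show "lk (cp b' w) S = lk (if b' = b then w else 0) S" by (simp add: hc_homog)
qed

lemma ext_D'_T: "b \<le> t \<Longrightarrow> w \<in> ext a (D' \<phi> s b) \<Longrightarrow> w \<in> T a"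
  by (simp add: T_iff ext_D'_iff D'_lift_VD)

lemma cp_T: "w \<in> T a \<Longrightarrow> b \<le> t \<Longrightarrow> cp b w \<in> ext a (D' \<phi> s b)"
  unfolding T_iff ext_D'_iff lk_fx by (metis flt_0 hc_VD)

lemma cp_T_0: "w \<in> T a \<Longrightarrow> b < 0 \<or> t < b \<Longrightarrow> cp b w = 0"
  by (rule poly_mapping_eqI) (simp add: T_iff hc_VD_0)

lemma cp_in_T: "w \<in> T a \<Longrightarrow> cp b w \<in> T a"
proof (cases "b \<le> t")
  case True
  assume "w \<in> T a"
  then show ?thesis by (rule ext_D'_T[OF True cp_T[OF _ True]])
next
  case False
  assume "w \<in> T a"
  then show ?thesis using False cp_T_0[of w a b] by (simp add: psub_0[OF psub_T])
qed

lemma ext_D'_T_iff: "b \<le> t \<Longrightarrow> w \<in> ext a (D' \<phi> s b) \<longleftrightarrow> w \<in> T a \<and> cp b w = w"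
  using cp_T[of w a b] ext_D'_T[of b w a] cp_ext_D'[of w a b b] by auto

lemma sum_cp: 
  assumes w: "w \<in> T a"
  shows "(\<Sum>b\<in>{0..t}. cp b w) = w"
proof (rule poly_mapping_eqI, rule poly_mapping_eqI)
  fix S u
  have "lk (lk w S) u = 0" if "t < int (mdeg u)"
  proof -
    have "lk (lk (cp (int (mdeg u)) w) S) u = 0" using cp_T_0[OF w, of "int (mdeg u)"] that by (simp only: lookup_zero disjI2)
    then show ?thesis by simp
  qed
  then show "lk (lk (\<Sum>b\<in>{0..t}. cp b w) S) u = lk (lk w S) u"
    by (auto simp: lookup_sum)
qed

lemma cp_kos: "cp b (kos w) = kos (cp b w)"
  by (rule kos_fx[symmetric])

lemma cp_cp: "cp b (cp b' w) = (if b = b' then cp b w else 0)"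
  by (rule poly_mapping_eqI, rule poly_mapping_eqI) simp

lemma cp_q: "cp b (q w) = q (cp b w)"
  by (simp add: q_def fx_simps cp_h cp_eta)

lemma cp_A: "cp b (A x) = cp b x - h (kos (cp (b - 1) (A x)))"
proof -
  have "cp b (A x + h (kos (A x))) = cp b x" by (simp only: A_fix)
  then have "cp b (A x) + h (kos (cp (b - 1) (A x))) = cp b x" by (simp only: fx_simps cp_h cp_kos)
  then show ?thesis by (simp add: eq_diff_eq)
qed

lemma Hs_iff: "x \<in> Hs a \<longleftrightarrow> x \<in> T a \<and> eta x = 0 \<and> h x = 0"
  by (simp add: Hs_def)

lemma cp_Hs: "x \<in> Hs a \<Longrightarrow> cp b x \<in> Hs a"
proof -
  assume x: "x \<in> Hs a"
  have "eta (cp b x) = cp (b - 1) (eta x)" "h (cp b x) = cp (b + 1) (h x)" by (simp_all add: cp_eta cp_h)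
  then show ?thesis using x cp_in_T by (simp add: Hs_iff fx_simps)
qed

lemma Hs_T: "x \<in> Hs a \<Longrightarrow> x \<in> T a" by (simp add: Hs_def)

lemma K'_iff: "b \<le> t \<Longrightarrow> w \<in> K' \<phi> s a b \<longleftrightarrow> w \<in> T a \<and> cp b w = w \<and> eta w = 0"
  by (auto simp: K'_def ext_D'_T_iff)

lemma Hs_cp_K': "x \<in> Hs a \<Longrightarrow> b \<le> t \<Longrightarrow> cp b x \<in> K' \<phi> s a b"
  using cp_Hs[of x a b] by (simp add: K'_iff Hs_iff cp_cp)

text \<open>\<open>h\<close> raises the D-degree and t is the largest one, so every cycle of degree
  t is a representative and no quotient has to be taken there.\<close>

lemma K't_Hs: "w \<in> K' \<phi> s a t \<Longrightarrow> w \<in> Hs a"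
proof -
  assume w: "w \<in> K' \<phi> s a t"
  then have wT: "w \<in> T a" "cp t w = w" "eta w = 0" by (simp_all add: K'_iff)
  have "h w = cp (t + 1) (h w)" using wT(2) by (simp add: cp_h)
  also have "\<dots> = 0" by (rule cp_T_0[OF h_T[OF wT(1)]]) simp
  finally show ?thesis using wT by (simp add: Hs_iff)
qed

lemma kos_K': "w \<in> K' \<phi> s a b \<Longrightarrow> kos w \<in> K' \<phi> s (a - 1) b"
  using kos_ext[OF psub1_D', of w a \<phi> s b] kos_eta[of w] by (auto simp: K'_def kos_simps)

text \<open>\<open>h\<close> vanishes on K'_{a-1,t}, so the perturbation series stops after its
  first term.\<close>

lemma A_K't: "w \<in> K' \<phi> s a t \<Longrightarrow> A w = w"
proof -
  assume "w \<in> K' \<phi> s a t"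
  then have "h (kos w) = 0" using K't_Hs[OF kos_K'] by (auto simp: Hs_iff)
  then have "(nh ^^ 1) w = 0" by (simp add: nh_def)
  from A_eq[OF this] show ?thesis by simp
qed

lemma dH_K't: "w \<in> K' \<phi> s a t \<Longrightarrow> dH w = kos w"
  unfolding dH_def by (simp add: A_K't q_id[OF K't_Hs[OF kos_K']])

text \<open>Each further term of the series for \<open>A\<close> has larger D-degree. The recursion
  \<open>cp_A\<close> yields this degree by degree, starting from the empty negative
  degrees.\<close>

lemma cp_A_below:
  assumes x: "x \<in> Hs a" "cp b x = x" and b': "b' < b"
  shows "cp b' (A x) = 0"
proof -
  have neg: "cp c (A x) = 0" if "c < 0" for c
    using cp_T_0[OF A_T[OF Hs_T[OF x(1)]], of c] that by simp
  have 0: "cp c x = 0" if "c < b" for c using x(2) that cp_cp[of c b x] by simp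
  have "int k < b \<Longrightarrow> cp (int k) (A x) = 0" for k
  proof (induction k)
    case 0
    have "cp (int 0) (A x) = cp (int 0) x - h (kos (cp (int 0 - 1) (A x)))" by (rule cp_A)
    then show ?case using 0(1) \<open>\<And>c. c < b \<Longrightarrow> cp c x = 0\<close>[of 0] neg[of "-1"] by (simp add: kos_simps h_simps)
  next
    case (Suc k)
    have "cp (int (Suc k)) (A x) = cp (int (Suc k)) x - h (kos (cp (int (Suc k) - 1) (A x)))" by (rule cp_A)
    moreover have "int (Suc k) - 1 = int k" by simp
    moreover have "cp (int (Suc k)) x = 0" by (rule 0[OF Suc.prems])
    moreover have "cp (int k) (A x) = 0" using Suc by simp
    ultimately show ?case by (simp only: kos_simps h_simps diff_0_right)
  qed
  then show ?thesis using b' neg[of b'] by (cases "0 \<le> b'") (metis nonneg_int_cases, simp)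
qed

lemma cp_A_self: "x \<in> Hs a \<Longrightarrow> cp b x = x \<Longrightarrow> cp b (A x) = x"
  by (subst cp_A) (simp add: cp_A_below kos_simps h_simps)

lemma cp_dH: "cp b (dH x) = q (kos (cp b (A x)))"
  by (simp add: dH_def cp_q cp_kos)

lemma cp_dH_below: "x \<in> Hs a \<Longrightarrow> cp b x = x \<Longrightarrow> b' < b \<Longrightarrow> cp b' (dH x) = 0"
  by (simp add: cp_dH cp_A_below kos_simps plin_simps[OF plin_q])

text \<open>So the diagonal entries of \<open>dH\<close> are the maps that \<open>kos\<close>
  induces on homology.\<close>

lemma cp_dH_self: "x \<in> Hs a \<Longrightarrow> cp b x = x \<Longrightarrow> cp b (dH x) = q (kos x)"
  by (simp add: cp_dH cp_A_self)

text \<open>For b < t, the chains whose boundaries have degree b are of degree b + 1 \<le> t and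
  survive the truncation.\<close>

lemma B'_T: "b < t \<Longrightarrow> y \<in> B' \<phi> s a b \<Longrightarrow> \<exists>v\<in>T (a + 1). y = eta v"
  unfolding B'_def using ext_D'_T[of "b + 1"] by auto

lemma q_B': "b < t \<Longrightarrow> y \<in> B' \<phi> s a b \<Longrightarrow> q y = 0"
proof -
  assume "b < t" "y \<in> B' \<phi> s a b"
  then obtain v where "v \<in> T (a + 1)" "y = eta v" using B'_T by blast
  then show ?thesis using q_e[of v "a + 1"] by (simp add: plin_simps[OF plin_q])
qed

text \<open>Together with \<open>q_B'\<close> this shows that \<open>q\<close> selects one
  representative in each class of C_{a,b}.\<close>

lemma diff_q_B': "b < t \<Longrightarrow> x \<in> K' \<phi> s a b \<Longrightarrow> x - q x \<in> B' \<phi> s a b"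
proof -
  assume b: "b < t" and x: "x \<in> K' \<phi> s a b"
  then have xT: "x \<in> T a" "cp b x = x" "eta x = 0" by (simp_all add: K'_iff)
  have "x - q x = eta (- h x)" by (simp add: q_def xT eta_simps h_simps)
  moreover have "- h x \<in> ext (a + 1) (D' \<phi> s (b + 1))"
    using b xT psub_minus[OF psub_T h_T[OF xT(1)]] by (simp add: ext_D'_T_iff fx_simps cp_h)
  ultimately show ?thesis unfolding B'_def by blast
qed

lemma q_K': "b \<le> t \<Longrightarrow> x \<in> K' \<phi> s a b \<Longrightarrow> q x \<in> Hs a \<and> cp b (q x) = q x"
  using q_Hs[of x a] by (simp add: K'_iff cp_q)

text \<open>As for the source, with \<open>ev1\<close> in place of \<open>eps\<close>: modulo a
  boundary, \<open>A x\<close> has coefficients in k, where the evaluation is injective.\<close>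

lemma exact0:
  assumes x: "x \<in> Hs 0" and ev: "ev1 (lk (A x) {}) = 0"
  shows "\<exists>x'\<in>Hs 1. dH x' = x"
proof -
  have AT: "A x \<in> T 0" by (rule A_T[OF Hs_T[OF x]])
  obtain y where y: "y \<in> T 1" "pdeg_lt 1 (A x - d y)" using tot_exact0[OF AT] by blast
  have "ev1 (lk (A x - d y) {}) = 0"
    by (simp add: ev d_def lookup_minus additive_fn_diff[OF additive_ev1] ev1_boundary)
  then have 0: "lk (A x - d y) {} = 0" by (rule ev1_pdeg1[OF y(2)])
  have "A x - d y \<in> T 0" using psub_diff[OF psub_T AT, of "d y"] d_T[OF y(1)] by simp
  then have "lk (A x - d y) B = 0" if "B \<noteq> {}" for B
    using T_lk[of "A x - d y" 0 B] that by auto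
  with 0 have "lk (A x - d y) B = 0" for B by (cases "B = {}") auto
  then have "A x - d y = 0" by (intro poly_mapping_eqI) simp
  then show ?thesis using boundary_lift[OF x, of y] y(1) by simp
qed

lemma ev_dH: "x \<in> Hs a \<Longrightarrow> ev1 (lk (A (dH x)) {}) = 0"
  by (simp add: d_A[symmetric] d_def lookup_minus additive_fn_diff[OF additive_ev1] ev1_boundary)

text \<open>In D-degree b \<le> t the coefficients are images under \<Phi> of elements of S of
  degree s - b, which is at least s - t.\<close>

lemma ev_T:
  assumes w: "w \<in> T 0"
  shows "\<exists>r\<in>deg_ge (s - t). ev1 (lk w {}) = contract r \<phi>"
proof -
  have "\<exists>r\<in>deg_ge (s - t). ev1 (lk (cp b w) {}) = contract r \<phi>" if "b \<in> {0..t}" for b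
  proof -
    have "lk (cp b w) {} \<in> D' \<phi> s b" using cp_T[OF w, of b] that by (simp add: ext_D'_iff)
    then obtain g where "g \<in> homog (s - b)" "lk (cp b w) {} = \<Phi> \<phi> g" unfolding D'_def by blast
    then show ?thesis using eps_homog_deg_ge[of g "s - b" "s - t"] that by (auto simp: ev1_Phi)
  qed
  then obtain r where r: "\<And>b. b \<in> {0..t} \<Longrightarrow> r b \<in> deg_ge (s - t) \<and> ev1 (lk (cp b w) {}) = contract (r b) \<phi>" by metis
  have "ev1 (lk w {}) = ev1 (lk (\<Sum>b\<in>{0..t}. cp b w) {})" by (simp only: sum_cp[OF w])
  also have "\<dots> = contract (\<Sum>b\<in>{0..t}. r b) \<phi>"
    using r by (simp add: lookup_sum additive_fn_sum[OF additive_ev1] additive_fn_sum[OF additive_contract_left])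
  finally show ?thesis using r by (intro bexI[of _ "\<Sum>b\<in>{0..t}. r b"] deg_ge_sum) auto
qed

end

section \<open>Projections onto kernels of \<open>eta\<close>\<close>

text \<open>Over k the kernel has a complement; the projection along it is extended
  slicewise.\<close>

lemma plin_projection:
  fixes V :: "('n::{finite,linorder} mon \<Rightarrow>\<^sub>0 'k::field) set"
  assumes V: "ksub V"
  shows "\<exists>F :: ('n, 'k) xform \<Rightarrow> ('n, 'k) xform. plin F \<and> (\<forall>w. F w \<in> ext a (lift V) \<and> eta (F w) = 0) \<and>
    (\<forall>w\<in>ext a (lift V). eta w = 0 \<longrightarrow> F w = w)"
proof -
  let ?Z = "{z \<in> kext a V. etak z = 0}"
  have sub: "kform.subspace ?Z"
  proof -
    have "etak (ks c x) = ks c (etak x)" for c and x :: "('n, 'k) kform"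
      by (rule klin_etak[unfolded klin_def, THEN conjunct2, rule_format])
    then show ?thesis
      using subspace_kext[OF V, of a] unfolding kform.subspace_def
      by (auto simp: klin_simps[OF klin_etak] additive_fn_0[OF additive_ks])
  qed
  obtain g where g: "\<And>z. g z \<in> ?Z" "klin g" "\<And>z. z \<in> ?Z \<Longrightarrow> g z = z"
    using klin_projection[OF sub] by blast
  have sl_g: "sl v (Pext g w) = g (sl v w)" for v w by (simp add: sl_Pext klin_0[OF g(2)])
  show ?thesis
  proof (intro exI[of _ "Pext g"] conjI allI ballI impI)
    show "plin (Pext g)" by (rule plin_Pext[OF g(2)])
    show "Pext g w \<in> ext a (lift V)" for w unfolding ext_lift_iff[OF V] sl_g using g(1) by blast
    show "eta (Pext g w) = 0" for w by (rule xform_eqI) (use g(1) in \<open>simp add: sl_eta sl_g\<close>)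
    show "Pext g w = w" if "w \<in> ext a (lift V)" "eta w = 0" for w
    proof (rule xform_eqI)
      fix v
      have "etak (sl v w) = 0" using that(2) by (simp add: sl_eta[symmetric])
      then have "sl v w \<in> ?Z" using that(1) unfolding ext_lift_iff[OF V] by blast
      then show "sl v (Pext g w) = sl v w" by (simp add: sl_g g(3))
    qed
  qed
qed

section \<open>The dual of \<open>eps\<close>, and linear functionals on forms\<close>

lemma finite_mons: "finite {u :: 'n::finite mon. int (mdeg u) = b}"
proof -
  let ?F = "PiE (UNIV :: 'n set) (\<lambda>_. {0..nat b})"
  have "finite ?F" by (rule finite_PiE) auto
  moreover have "Poly_Mapping.lookup ` {u :: 'n mon. int (mdeg u) = b} \<subseteq> ?F"
  proof clarify
    fix u :: "'n mon"
    have "lk u l \<le> mdeg u" for l unfolding mdeg_def by (rule member_le_sum) auto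
    then show "lk u \<in> PiE UNIV (\<lambda>_. {0..nat (int (mdeg u))})" by auto
  qed
  ultimately have "finite (Poly_Mapping.lookup ` {u :: 'n mon. int (mdeg u) = b})" by (rule finite_subset[rotated])
  then show ?thesis by (rule finite_imageD) (rule inj_onI, rule poly_mapping_eqI, simp)
qed

lemma lk_dual_to_D: "lk (dual_to_D b l) u = (if int (mdeg u) = b then l (Poly_Mapping.single u 1) else 0)"
  unfolding dual_to_D_def lookup_sum
  by (simp add: lookup_single when_def finite_mons)

lemma kz_top: "kz act F (UNIV - {i}) = sg (below i (UNIV - {i})) (act i (F UNIV))"
proof -
  have "- (UNIV - {i}) = {i}" "insert i (UNIV - {i}) = UNIV" by auto
  then show ?thesis by (simp add: kz_def)
qed

lemma card_coatom:
  fixes S :: "'n::finite set"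
  assumes "int (card S) = int CARD('n) - 1"
  obtains i where "S = UNIV - {i}"
proof -
  have "card (- S) = 1" using assms by (simp add: Compl_eq_Diff_UNIV card_Diff_subset)
  then obtain i where "- S = {i}" by (auto simp: card_1_singleton_iff)
  then show thesis by (intro that[of i]) auto
qed

lemma eps_dual_K:
  fixes p :: "('n::{finite,linorder}, 'k::field) pol"
  shows "eps_dual t p \<in> K (int CARD('n) - 1) t"
proof -
  define f where "f = dual_to_D (t + 1) (\<lambda>f. p * eps f)"
  have f: "int (mdeg u) = t + 1" if "lk f u \<noteq> 0" for u
    using that unfolding f_def lk_dual_to_D by (cases "int (mdeg u) = t + 1") simp_all
  have "Poly_Mapping.single UNIV f \<in> ext (int CARD('n)) (homog (t + 1))"
    unfolding ext_homog_iff
  proof (intro allI impI)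
    fix S :: "'n set" and u assume "lk (lk (Poly_Mapping.single UNIV f) S) u \<noteq> 0"
    then show "int (mdeg u) = t + 1 \<and> int (card S) = int CARD('n)"
    proof (cases "S = UNIV")
      case True
      then show ?thesis using f[of u] \<open>lk (lk (Poly_Mapping.single UNIV f) S) u \<noteq> 0\<close> by simp
    next
      case False
      then show ?thesis using \<open>lk (lk (Poly_Mapping.single UNIV f) S) u \<noteq> 0\<close> by (simp add: lookup_single_not_eq)
    qed
  qed
  then have "eps_dual t p \<in> ext (int CARD('n) - 1) (homog t)"
    unfolding eps_dual_def f_def[symmetric]
    by (rule eta_ext[OF _ psub1_homog psub1_homog]) (auto simp: homog_iff lk_contract_Xvar mdeg_add)
  then show ?thesis by (simp add: K_def eps_dual_def eta_eta)
qed

lemma psub_K: "psub (K a b)"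
  using psub_ext[OF psub1_homog, of a b] by (auto simp: psub_def K_def eta_simps)

lemma lk_eps_dual:
  "lk (lk (eps_dual t p) (UNIV - {i})) u =
     (if int (mdeg u) = t then sg (below i (UNIV - {i})) (p * Poly_Mapping.single (u + evar i) 1) else 0)"
  by (simp add: eps_dual_def lk_eta kz_top lookup_sg lk_contract_Xvar lk_dual_to_D mdeg_add eps_single)

lemma eps_dual_pm: "eps_dual t p = pm p (eps_dual t 1)"
proof -
  have "Poly_Mapping.single UNIV (dual_to_D (t + 1) (\<lambda>f. p * eps f)) =
      pm p (Poly_Mapping.single UNIV (dual_to_D (t + 1) (\<lambda>f. 1 * eps f)))"
    by (rule poly_mapping_eqI, rule poly_mapping_eqI) (auto simp: lookup_single when_def lk_dual_to_D)
  then show ?thesis unfolding eps_dual_def by (simp only: eta_simps)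
qed

text \<open>P-linear functionals on forms; their values at one form make up the ideal generated by
  its coordinates.\<close>

definition plinf :: "(('n, 'k::field) xform \<Rightarrow> ('n, 'k) pol) \<Rightarrow> bool" where
  "plinf l \<longleftrightarrow> additive_fn l \<and> (\<forall>p x. l (pm p x) = p * l x)"

lemma plinf_coeff: "plin F \<Longrightarrow> plinf (\<lambda>x. lk (lk (F x) S) u)"
  by (simp add: plinf_def plin_def additive_fn_def lookup_add)

lemma plinf_add: "plinf l \<Longrightarrow> plinf l' \<Longrightarrow> plinf (\<lambda>x. l x + l' x)"
  by (simp add: plinf_def additive_fn_def algebra_simps)

lemma plinf_mult: "plinf l \<Longrightarrow> plinf (\<lambda>x. p * l x)"
  by (simp add: plinf_def additive_fn_def algebra_simps)

lemma plinf_0: "plinf (\<lambda>x. 0)"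
  by (simp add: plinf_def additive_fn_def)

lemma plin_plinf: "plinf l \<Longrightarrow> plin (\<lambda>x. pm (l x) w)"
  by (simp add: plinf_def plin_def additive_fn_def additive_fn_add[OF additive_pm_left] pm_pm)

context inverse_system
begin

text \<open>The reduced complex has the single generator \<open>e1\<close> in degree $n$; its boundary \<open>z0\<close> plays the role of
$\varepsilon^*(1)$.\<close>

definition e1 :: "('n, 'k) xform" where "e1 = Poly_Mapping.single UNIV 1"

definition z0 :: "('n, 'k) xform" where "z0 = (if 0 \<le> t then dH e1 else 0)"

lemma T_gt: "w \<in> T a \<Longrightarrow> (int CARD('n)) < a \<Longrightarrow> w = 0"
proof (rule poly_mapping_eqI)
  fix S :: "'n set" assume w: "w \<in> T a" "(int CARD('n)) < a"
  have "card S \<le> CARD('n)" using card_mono[of UNIV S] by simp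
  then show "lk w S = lk 0 S" using T_lk[OF w(1), of S] w(2) by (cases "lk w S = 0") auto
qed

lemma T_neg_t: "w \<in> T a \<Longrightarrow> t < 0 \<Longrightarrow> w = 0"
  using sum_cp[of w a] by simp

lemma e1_ext: "e1 \<in> ext (int CARD('n)) (D' \<phi> s 0)"
proof -
  have "(1 :: ('n, 'k) xpol) \<in> D' \<phi> s 0"
    unfolding D'_eq_lift lift_iff
  proof
    fix v
    have "sl1 v 1 = (if v = 0 then 1 else 0 :: 'n mon \<Rightarrow>\<^sub>0 'k)"
      by (rule poly_mapping_eqI) (simp add: lookup_one when_def)
    then show "sl1 v 1 \<in> Dk \<phi> s 0" using Dk_one[OF phi_nz phi] ksub_Dk[of \<phi> s 0] by (simp add: ksub_def)
  qed
  then show ?thesis by (auto simp: e1_def ext_def)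
qed

lemma e1_Hs: "0 \<le> t \<Longrightarrow> e1 \<in> Hs (int CARD('n))"
proof -
  assume t: "0 \<le> t"
  have T: "e1 \<in> T (int CARD('n))" by (rule ext_D'_T[OF t e1_ext])
  have "h e1 = 0" by (rule T_gt[OF h_T[OF T]]) simp
  moreover have "contract (Xvar i) (1 :: ('n, 'k) xpol) = 0" for i
    using contract_Xvar_single[of i 0 1] by simp
  then have "contract (Xvar i) (lk e1 S) = 0" for i S
    by (cases "S = UNIV") (simp_all add: e1_def lookup_single_not_eq)
  then have "eta e1 = 0"
    by (intro poly_mapping_eqI) (simp add: lk_eta kz_def)
  ultimately show ?thesis using T by (simp add: Hs_iff)
qed

lemma cp_e1: "cp 0 e1 = e1"
  using cp_ext_D'[OF e1_ext, of 0] by simp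

lemma lk_pm_e1: "lk (lk (pm p e1) UNIV) 0 = p"
  by (simp add: e1_def)

text \<open>A cycle of wedge degree n is annihilated by contraction with every X_i, hence constant
  in the divided powers.\<close>

lemma Hs_top:
  assumes x: "x \<in> Hs (int CARD('n))"
  shows "x = pm (lk (lk x UNIV) 0) e1"
proof (rule poly_mapping_eqI, rule poly_mapping_eqI)
  fix S u
  show "lk (lk x S) u = lk (lk (pm (lk (lk x UNIV) 0) e1) S) u"
  proof (cases "S = UNIV")
    case False
    then have "card S < CARD('n)" by (intro psubset_card_mono) auto
    then have "lk x S = 0" using T_lk[OF Hs_T[OF x], of S] by auto
    then show ?thesis using False by (auto simp: e1_def lookup_single when_def)
  next
    case True
    show ?thesis
    proof (cases "u = 0")
      case False
      then obtain i where i: "lk u i \<noteq> 0" using lk_nonzero by blast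
      have "lk (lk (eta x) (UNIV - {i})) (u - evar i) = 0" using x by (simp add: Hs_iff)
      then have "lk (lk x UNIV) u = 0"
        using i by (simp add: lk_eta kz_top lookup_sg lk_contract_Xvar evar_minus_plus)
      then show ?thesis using True False by (simp add: e1_def lookup_one)
    qed (simp add: True e1_def)
  qed
qed

lemma z0_Hs: "z0 \<in> Hs (int CARD('n) - 1)"
  using dH_Hs[OF e1_Hs] psub_0[OF psub_Hs] by (simp add: z0_def)

text \<open>The ideal generated by the coordinates of the components of \<open>z0\<close> of $D$-degree other than \<open>t\<close>, that
is, of its component in $W$.\<close>

definition inI :: "('n, 'k) pol \<Rightarrow> bool" where
  "inI r \<longleftrightarrow> (\<exists>l. plinf l \<and> l (z0 - cp t z0) = r)"

lemma inI_add: "inI x \<Longrightarrow> inI y \<Longrightarrow> inI (x + y)"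
  unfolding inI_def using plinf_add by blast

lemma inI_mult: "inI x \<Longrightarrow> inI (p * x)"
  unfolding inI_def using plinf_mult by blast

lemma inI_minus: "inI x \<Longrightarrow> inI (- x)"
  using inI_mult[of x "-1"] by simp

lemma inI_diff: "inI x \<Longrightarrow> inI y \<Longrightarrow> inI (x - y)"
  using inI_add[of x "- y"] inI_minus[of y] by simp

lemma inI_sg: "inI (sg k x) \<Longrightarrow> inI x"
  using inI_minus[of "- x"] by (auto simp: sg_def split: if_splits)

lemma inI_sg': "inI x \<Longrightarrow> inI (sg k x)"
  using inI_minus[of "x"] by (auto simp: sg_def)

lemma inI_0: "inI 0"
  unfolding inI_def using plinf_0 by blast

lemma A_z0: "A z0 = A (z0 - cp t z0) + cp t z0"
  using A_K't[OF Hs_cp_K'[OF z0_Hs, of t]] by (simp add: A_simps)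

lemma inI_coeff_A: "inI (lk (lk (A (z0 - cp t z0)) S) u)"
  unfolding inI_def using plinf_coeff[OF plin_A] by blast

context
  assumes t0: "0 \<le> t"
begin

text \<open>This is A z0 = d(A e1), read at a set missing one index, where each Koszul differential
  has a single term.\<close>

lemma coeff_A_z0:
  "lk (lk (A z0) (UNIV - {i})) u =
     sg (below i (UNIV - {i})) (var i * lk (lk (A e1) UNIV) u - lk (lk (A e1) UNIV) (u + evar i))"
proof -
  have "A z0 = kos (A e1) - eta (A e1)"
    using d_A[OF e1_Hs[OF t0]] t0 by (simp add: z0_def d_def)
  then show ?thesis
    by (simp add: lookup_minus lk_kos lk_eta kz_top lookup_sg lk_contract_Xvar sg_def)
qed

text \<open>Modulo the ideal, the coefficients a_u of \<open>A e1\<close> satisfy a_0 = 1 and a_{u +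
  e_i} = x_i a_u in degrees up to t, so they are the monomials x^u, the values of \<open>eps\<close>
  on the X-monomials. This is how the dual of \<open>eps\<close> enters.\<close>

lemma zeta_cong: "int (mdeg u) \<le> t \<Longrightarrow> inI (lk (lk (A e1) UNIV) u - Poly_Mapping.single u 1)"
proof (induction "mdeg u" arbitrary: u)
  case 0
  then have u: "u = 0" by (metis mdeg_eq_0)
  have "lk (lk (cp 0 (A e1)) UNIV) 0 = 1"
    unfolding cp_A_self[OF e1_Hs[OF t0] cp_e1] by (simp add: e1_def)
  then show ?case by (simp add: u inI_0)
next
  case (Suc j)
  then have "u \<noteq> 0" by (metis mdeg_0 nat.distinct(1))
  then obtain i where i: "0 < lk u i" using lk_nonzero by blast
  define v where "v = u - evar i"
  have u: "u = v + evar i" using i by (simp add: v_def evar_minus_plus)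
  have v: "j = mdeg v" "int (mdeg v) < t" using Suc.hyps(2) Suc.prems by (simp_all add: u mdeg_add)
  \<comment> \<open>In degrees below t only the part of \<open>z0\<close> in W contributes, and its
    coefficients under \<open>A\<close> lie in the ideal.\<close>
  have "lk (lk (A z0) (UNIV - {i})) v = lk (lk (A (z0 - cp t z0)) (UNIV - {i})) v"
    unfolding A_z0 lookup_add using v(2) by simp
  then have "inI (lk (lk (A z0) (UNIV - {i})) v)" by (simp add: inI_coeff_A)
  then have 1: "inI (var i * lk (lk (A e1) UNIV) v - lk (lk (A e1) UNIV) u)"
    unfolding coeff_A_z0 u by (rule inI_sg)
  have "inI (var i * (lk (lk (A e1) UNIV) v - Poly_Mapping.single v 1))"
    by (rule inI_mult, rule Suc.hyps(1)) (use v in auto)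
  moreover have "var i * Poly_Mapping.single v (1::'k) = Poly_Mapping.single u 1"
    by (simp add: var_def mult_single u add.commute)
  ultimately have 2: "inI (var i * lk (lk (A e1) UNIV) v - Poly_Mapping.single u 1)"
    by (simp add: algebra_simps)
  show ?case using inI_diff[OF 2 1] by simp
qed

lemma eps_dual_supp: "lk (lk (eps_dual t (1 :: ('n, 'k) pol)) S) u \<noteq> 0 \<Longrightarrow> int (mdeg u) = t \<and> int (card S) = int CARD('n) - 1"
proof -
  have "eps_dual t (1 :: ('n, 'k) pol) \<in> ext (int CARD('n) - 1) (homog t)" using eps_dual_K[of t "1 :: ('n, 'k) pol"] by (simp add: K_def)
  then show "lk (lk (eps_dual t (1 :: ('n, 'k) pol)) S) u \<noteq> 0 \<Longrightarrow> ?thesis" unfolding ext_homog_iff by blast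
qed

text \<open>In degree t the recursion ends: \<open>A e1\<close> has no term of degree t + 1, so the
  coefficients of \<open>A z0\<close> are x_i a_u up to sign, congruent to those of
  \<open>eps_dual t 1\<close>.\<close>

lemma eps_dual_cong: "inI (lk (lk (eps_dual t 1 - cp t z0) S) u)"
proof (cases "int (card S) = (int CARD('n)) - 1 \<and> int (mdeg u) = t")
  case True
  then obtain i where S: "S = UNIV - {i}" using card_coatom by blast
  have "lk (lk (A e1) UNIV) (u + evar i) = 0"
  proof -
    have "lk (lk (cp (t + 1) (A e1)) UNIV) (u + evar i) = 0"
      using cp_T_0[OF A_T[OF Hs_T[OF e1_Hs[OF t0]]], of "t + 1"] by (simp del: lk_fx)
    then show ?thesis using True by (simp add: mdeg_add)
  qed
  then have "lk (lk (A z0) S) u = sg (below i S) (var i * lk (lk (A e1) UNIV) u)"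
    unfolding S coeff_A_z0 by simp
  moreover have "lk (lk (A z0) S) u = lk (lk (A (z0 - cp t z0)) S) u + lk (lk (cp t z0) S) u"
    by (subst A_z0) (simp add: lookup_add)
  ultimately have "lk (lk (eps_dual t 1 - cp t z0) S) u = lk (lk (A (z0 - cp t z0)) S) u -
     sg (below i S) (var i * (lk (lk (A e1) UNIV) u - Poly_Mapping.single u 1))"
    using True unfolding lookup_minus S lk_eps_dual
    by (simp add: var_def mult_single algebra_simps sg_def)
  then show ?thesis using True by (simp add: inI_diff inI_coeff_A inI_sg' inI_mult zeta_cong)
next
  case False
  have "lk (lk (eps_dual t (1 :: ('n, 'k) pol)) S) u = 0"
    using False eps_dual_supp[of S u] by (cases "lk (lk (eps_dual t (1 :: ('n, 'k) pol)) S) u = 0") auto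
  moreover have "lk (lk (cp t z0) S) u = 0"
  proof (cases "int (mdeg u) = t")
    case True
    then have "int (card S) \<noteq> int CARD('n) - 1" using False by simp
    then have "lk (cp t z0) S = 0" using T_lk[OF cp_in_T[OF Hs_T[OF z0_Hs]], of t S] by blast
    then show ?thesis by (simp del: lk_fx)
  qed simp
  ultimately show ?thesis by (simp add: lookup_minus inI_0)
qed

text \<open>Each coefficient of the difference is the value of a functional. Only the finitely many
  monomials of degree t occur, so these functionals combine to one linear map.\<close>

lemma eps_dual_factor: "\<exists>\<Theta>. plin \<Theta> \<and> \<Theta> (z0 - cp t z0) = eps_dual t 1 - cp t z0"
proof -
  let ?U = "{u :: 'n mon. int (mdeg u) = t}" and ?a = "eps_dual t 1 - cp t z0"
  have "\<exists>l. plinf l \<and> l (z0 - cp t z0) = lk (lk ?a S) u" for S u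
    using eps_dual_cong[of S u] unfolding inI_def .
  then obtain l where l: "\<And>S u. plinf (l S u)" "\<And>S u. l S u (z0 - cp t z0) = lk (lk ?a S) u" by metis
  define \<Theta> where "\<Theta> x = (\<Sum>S\<in>UNIV. \<Sum>u\<in>?U. pm (l S u x) (Poly_Mapping.single S (Poly_Mapping.single u 1)))" for x
  have "plin \<Theta>" unfolding \<Theta>_def[abs_def] by (intro plin_sum plin_plinf l(1))
  moreover have "\<Theta> (z0 - cp t z0) = ?a"
  proof (rule poly_mapping_eqI, rule poly_mapping_eqI)
    fix S u
    have "lk (lk (\<Theta> (z0 - cp t z0)) S) u = (\<Sum>S'\<in>UNIV. if S' = S then (\<Sum>u'\<in>?U. if u' = u then lk (lk ?a S) u else 0) else 0)"
      unfolding \<Theta>_def lookup_sum l(2)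
      by (intro sum.cong refl) (auto simp: lookup_single when_def intro!: sum.cong)
    also have "\<dots> = (if u \<in> ?U then lk (lk ?a S) u else 0)"
      by (simp add: finite_mons)
    also have "\<dots> = lk (lk ?a S) u"
      using eps_dual_supp[of S u] by (auto simp: lookup_minus)
    finally show "lk (lk (\<Theta> (z0 - cp t z0)) S) u = lk (lk ?a S) u" .
  qed
  ultimately show ?thesis by (intro exI[of _ \<Theta>] conjI)
qed

end

text \<open>\<theta> sees only the components in W, so adding it to the component of degree t is a
  unipotent change of basis; it carries the top component of \<open>z0\<close> to the value that
  \<pi> prescribes.\<close>

lemma theta_exists:
  assumes add: "\<And>x y. x \<in> K (int CARD('n) - 1) t \<Longrightarrow> y \<in> K (int CARD('n) - 1) t \<Longrightarrow> \<pi> (x + y) = \<pi> x + \<pi> y"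
    and sm: "\<And>p x. x \<in> K (int CARD('n) - 1) t \<Longrightarrow> \<pi> (pm p x) = pm p (\<pi> x)"
    and rng: "\<And>x. x \<in> K (int CARD('n) - 1) t \<Longrightarrow> \<pi> x \<in> K' \<phi> s (int CARD('n) - 1) t"
    and idem: "\<And>x. x \<in> K' \<phi> s (int CARD('n) - 1) t \<Longrightarrow> \<pi> x = x"
  shows "\<exists>\<theta>. plin \<theta> \<and> (\<forall>x. \<theta> x \<in> K' \<phi> s (int CARD('n) - 1) t) \<and> (\<forall>x. \<theta> (cp t x) = 0) \<and>
      (0 \<le> t \<longrightarrow> cp t z0 + \<theta> z0 = \<pi> (eps_dual t 1))"
proof (cases "0 \<le> t")
  case False
  have "0 \<in> K' \<phi> s (int CARD('n) - 1) t"
    unfolding K'_def mem_Collect_eq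
    by (intro conjI psub_0[OF psub_ext[OF psub1_D']] eta_simps(5))
  then show ?thesis using False by (intro exI[of _ "\<lambda>x. 0"]) (simp add: plin_0)
next
  case True
  obtain \<Theta> where \<Theta>: "plin \<Theta>" "\<Theta> (z0 - cp t z0) = eps_dual t 1 - cp t z0"
    using eps_dual_factor[OF True] by (elim exE conjE)
  obtain F :: "('n, 'k) xform \<Rightarrow> ('n, 'k) xform" where F: "plin F"
    "\<forall>w. F w \<in> ext (int CARD('n) - 1) (lift (homog t)) \<and> eta (F w) = 0"
    "\<forall>w\<in>ext (int CARD('n) - 1) (lift (homog t)). eta w = 0 \<longrightarrow> F w = w"
    using plin_projection[OF ksub_homog[of t], where a = "int CARD('n) - 1"] by (elim exE conjE)
  have FK: "F w \<in> K (int CARD('n) - 1) t" for w using F(2) by (simp add: K_def lift_homog)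
  have FK': "F w = w" if "w \<in> K (int CARD('n) - 1) t" for w using F(3) that by (simp add: K_def lift_homog)
  \<comment> \<open>Subtracting \<open>cp t x\<close> makes \<theta> vanish on components of degree
    t; F moves the value into K_{n-1,t}, where \<pi> is known to be linear.\<close>
  define \<theta> where "\<theta> x = \<pi> (F (\<Theta> (x - cp t x)))" for x
  have K'K: "x \<in> K (int CARD('n) - 1) t" if "x \<in> K' \<phi> s (int CARD('n) - 1) t" for x
    using that D'_homog[OF phi] by (auto simp: K'_def K_def ext_def)
  have pi0: "\<pi> 0 = 0" using sm[OF FK, of 0 0] by simp
  note sim = plin_simps[OF F(1)] plin_simps[OF \<Theta>(1)]
  have "plin \<theta>"
    unfolding plin_def
  proof (intro conjI allI additive_fnI)
    show "\<theta> (x + y) = \<theta> x + \<theta> y" for x y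
    proof -
      have "F (\<Theta> (x + y - cp t (x + y))) = F (\<Theta> (x - cp t x)) + F (\<Theta> (y - cp t y))"
        by (simp add: fx_simps sim algebra_simps)
      then show ?thesis by (simp add: \<theta>_def add[OF FK FK])
    qed
    show "\<theta> (pm p x) = pm p (\<theta> x)" for p x
    proof -
      have "F (\<Theta> (pm p x - cp t (pm p x))) = pm p (F (\<Theta> (x - cp t x)))"
        by (simp add: fx_simps sim additive_fn_diff[OF additive_pm])
      then show ?thesis by (simp add: \<theta>_def sm[OF FK])
    qed
  qed
  moreover have "\<theta> x \<in> K' \<phi> s (int CARD('n) - 1) t" for x unfolding \<theta>_def by (rule rng[OF FK])
  moreover have "\<theta> (cp t x) = 0" for x by (simp add: \<theta>_def cp_cp sim pi0)
  moreover have "cp t z0 + \<theta> z0 = \<pi> (eps_dual t 1)"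
  proof -
    have z: "cp t z0 \<in> K' \<phi> s (int CARD('n) - 1) t" by (rule Hs_cp_K'[OF z0_Hs]) simp
    have "\<theta> z0 = \<pi> (F (eps_dual t 1) - F (cp t z0))" by (simp only: \<theta>_def \<Theta>(2) plin_simps(2)[OF F(1)])
    also have "\<dots> = \<pi> (eps_dual t 1 + pm (-1) (cp t z0))"
      by (simp add: FK' eps_dual_K K'K[OF z] pm_m1)
    also have "\<dots> = \<pi> (eps_dual t 1) + pm (-1) (\<pi> (cp t z0))"
    proof -
      have "pm (-1) (cp t z0) \<in> K (int CARD('n) - 1) t"
        by (rule psub_pm[OF psub_K K'K[OF z]])
      then show ?thesis by (simp add: add[OF eps_dual_K] sm[OF K'K[OF z]])
    qed
    finally show ?thesis by (simp add: idem[OF z] pm_m1)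
  qed
  ultimately show ?thesis by (intro exI[of _ \<theta>] conjI allI impI)
qed

end

subsection \<open>Modules over the polynomial ring\<close>

lemma PR_simps [simp]: "carrier PR = UNIV" "x \<otimes>\<^bsub>PR\<^esub> y = x * y" "x \<oplus>\<^bsub>PR\<^esub> y = x + y" "\<one>\<^bsub>PR\<^esub> = 1" "\<zero>\<^bsub>PR\<^esub> = 0"
  by (simp_all add: PR_def ring_of_type_algebra_def)

lemma cring_PR: "cring (PR :: ('n, 'k::field) pol ring)"
  unfolding PR_def by (rule cring_from_type_algebra)

lemma xmod_simps [simp]: "carrier (xmod V) = V" "x \<oplus>\<^bsub>xmod V\<^esub> y = x + y" "\<zero>\<^bsub>xmod V\<^esub> = 0" "p \<odot>\<^bsub>xmod V\<^esub> x = pm p x"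
  by (simp_all add: xmod_def)

lemma pol_mod_simps [simp]: "carrier pol_mod = UNIV" "x \<oplus>\<^bsub>pol_mod\<^esub> y = x + y" "\<zero>\<^bsub>pol_mod\<^esub> = 0" "p \<odot>\<^bsub>pol_mod\<^esub> x = p * x"
  by (simp_all add: pol_mod_def)

lemma dsum_simps [simp]: "carrier (dsum M N) = carrier M \<times> carrier N"
  "x \<oplus>\<^bsub>dsum M N\<^esub> y = (fst x \<oplus>\<^bsub>M\<^esub> fst y, snd x \<oplus>\<^bsub>N\<^esub> snd y)"
  "\<zero>\<^bsub>dsum M N\<^esub> = (\<zero>\<^bsub>M\<^esub>, \<zero>\<^bsub>N\<^esub>)" "p \<odot>\<^bsub>dsum M N\<^esub> x = (p \<odot>\<^bsub>M\<^esub> fst x, p \<odot>\<^bsub>N\<^esub> snd x)"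
  by (simp_all add: dsum_def)

lemma Dsum_simps [simp]: "carrier (Dsum I M) = (\<Pi>\<^sub>E i\<in>I. carrier (M i))"
  "x \<oplus>\<^bsub>Dsum I M\<^esub> y = (\<lambda>i\<in>I. x i \<oplus>\<^bsub>M i\<^esub> y i)"
  "\<zero>\<^bsub>Dsum I M\<^esub> = (\<lambda>i\<in>I. \<zero>\<^bsub>M i\<^esub>)" "p \<odot>\<^bsub>Dsum I M\<^esub> x = (\<lambda>i\<in>I. p \<odot>\<^bsub>M i\<^esub> x i)"
  by (simp_all add: Dsum_def)

lemma if_module_simps [simp]: "carrier (if_module c M) = (if c then carrier M else {\<zero>\<^bsub>M\<^esub>})"
  "x \<oplus>\<^bsub>if_module c M\<^esub> y = x \<oplus>\<^bsub>M\<^esub> y" "\<zero>\<^bsub>if_module c M\<^esub> = \<zero>\<^bsub>M\<^esub>" "p \<odot>\<^bsub>if_module c M\<^esub> x = p \<odot>\<^bsub>M\<^esub> x"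
  by (simp_all add: if_module_def)

lemma module_xmod:
  fixes V :: "('n, 'k::field) xform set"
  assumes V: "psub V"
  shows "module PR (xmod V)"
proof (rule moduleI)
  show "cring (PR :: ('n, 'k) pol ring)" by (rule cring_PR)
  show "abelian_group (xmod V)"
  proof (rule abelian_groupI)
    show "\<exists>y\<in>carrier (xmod V). y \<oplus>\<^bsub>xmod V\<^esub> x = \<zero>\<^bsub>xmod V\<^esub>" if "x \<in> carrier (xmod V)" for x
      using that by (intro bexI[of _ "- x"]) (simp_all add: psub_minus[OF V])
  qed (use V in \<open>simp_all add: psub_0 psub_add add_ac\<close>)
qed (use V in \<open>simp_all add: psub_pm additive_fn_add[OF additive_pm] additive_fn_add[OF additive_pm_left] pm_pm\<close>)

lemma module_pol_mod: "module PR (pol_mod :: (('n, 'k::field) pol, ('n, 'k) pol) module)"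
proof (rule moduleI)
  show "cring (PR :: ('n, 'k) pol ring)" by (rule cring_PR)
  show "abelian_group (pol_mod :: (('n, 'k) pol, ('n, 'k) pol) module)"
  proof (rule abelian_groupI)
    show "\<exists>y\<in>carrier pol_mod. y \<oplus>\<^bsub>pol_mod\<^esub> x = \<zero>\<^bsub>pol_mod\<^esub>" for x :: "('n, 'k) pol"
      by (intro bexI[of _ "- x"]) simp_all
  qed (simp_all add: add_ac)
qed (simp_all add: algebra_simps)

text \<open>Carriers built from cosets and extensional functions are awkward; their module axioms
  are transported from a submodule of forms instead.\<close>

lemma module_surj:
  fixes N :: "('r, 'a) module" and M :: "('r, 'b) module"
  assumes N: "module R N" and surj: "j ` carrier N = carrier M"
    and add: "\<And>x y. x \<in> carrier N \<Longrightarrow> y \<in> carrier N \<Longrightarrow> j (x \<oplus>\<^bsub>N\<^esub> y) = j x \<oplus>\<^bsub>M\<^esub> j y"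
    and sm: "\<And>r x. r \<in> carrier R \<Longrightarrow> x \<in> carrier N \<Longrightarrow> j (r \<odot>\<^bsub>N\<^esub> x) = r \<odot>\<^bsub>M\<^esub> j x"
    and z: "j \<zero>\<^bsub>N\<^esub> = \<zero>\<^bsub>M\<^esub>"
  shows "module R M"
proof -
  interpret N: module R N by (rule N)
  have ex: "\<exists>x'\<in>carrier N. x = j x'" if "x \<in> carrier M" for x using that surj by auto
  have cl: "j x \<in> carrier M" if "x \<in> carrier N" for x using that surj by auto
  show ?thesis
  proof (rule moduleI)
    show "cring R" by (rule module.axioms(1)[OF N])
    show "abelian_group M"
    proof (rule abelian_groupI)
      show "x \<oplus>\<^bsub>M\<^esub> y \<in> carrier M" if "x \<in> carrier M" "y \<in> carrier M" for x y
        using ex[OF that(1)] ex[OF that(2)] cl by (auto simp: add[symmetric])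
      show "\<zero>\<^bsub>M\<^esub> \<in> carrier M" unfolding z[symmetric] by (rule cl) simp
      show "x \<oplus>\<^bsub>M\<^esub> y \<oplus>\<^bsub>M\<^esub> w = x \<oplus>\<^bsub>M\<^esub> (y \<oplus>\<^bsub>M\<^esub> w)" if "x \<in> carrier M" "y \<in> carrier M" "w \<in> carrier M" for x y w
        using ex[OF that(1)] ex[OF that(2)] ex[OF that(3)] by (auto simp: add[symmetric] N.a_assoc)
      show "x \<oplus>\<^bsub>M\<^esub> y = y \<oplus>\<^bsub>M\<^esub> x" if "x \<in> carrier M" "y \<in> carrier M" for x y
        using ex[OF that(1)] ex[OF that(2)] by (auto simp: add[symmetric] N.a_comm)
      show "\<zero>\<^bsub>M\<^esub> \<oplus>\<^bsub>M\<^esub> x = x" if "x \<in> carrier M" for x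
        using ex[OF that] by (auto simp: add[symmetric] z[symmetric])
      show "\<exists>y\<in>carrier M. y \<oplus>\<^bsub>M\<^esub> x = \<zero>\<^bsub>M\<^esub>" if "x \<in> carrier M" for x
      proof -
        obtain x' where x': "x' \<in> carrier N" "x = j x'" using ex[OF \<open>x \<in> carrier M\<close>] by blast
        have "j (\<ominus>\<^bsub>N\<^esub> x') \<oplus>\<^bsub>M\<^esub> x = \<zero>\<^bsub>M\<^esub>"
          using x' by (simp add: add[symmetric] z[symmetric] N.l_neg)
        then show ?thesis using cl[of "\<ominus>\<^bsub>N\<^esub> x'"] x'(1) by auto
      qed
    qed
    show "r \<odot>\<^bsub>M\<^esub> x \<in> carrier M" if "r \<in> carrier R" "x \<in> carrier M" for r x
      using ex[OF that(2)] that(1) cl by (auto simp: sm[symmetric])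
    show "(r \<oplus>\<^bsub>R\<^esub> r') \<odot>\<^bsub>M\<^esub> x = r \<odot>\<^bsub>M\<^esub> x \<oplus>\<^bsub>M\<^esub> r' \<odot>\<^bsub>M\<^esub> x" if "r \<in> carrier R" "r' \<in> carrier R" "x \<in> carrier M" for r r' x
      using ex[OF that(3)] that(1,2) by (auto simp: sm[symmetric] add[symmetric] N.smult_l_distr)
    show "r \<odot>\<^bsub>M\<^esub> (x \<oplus>\<^bsub>M\<^esub> y) = r \<odot>\<^bsub>M\<^esub> x \<oplus>\<^bsub>M\<^esub> r \<odot>\<^bsub>M\<^esub> y" if "r \<in> carrier R" "x \<in> carrier M" "y \<in> carrier M" for r x y
      using ex[OF that(2)] ex[OF that(3)] that(1) by (auto simp: sm[symmetric] add[symmetric] N.smult_r_distr)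
    show "(r \<otimes>\<^bsub>R\<^esub> r') \<odot>\<^bsub>M\<^esub> x = r \<odot>\<^bsub>M\<^esub> (r' \<odot>\<^bsub>M\<^esub> x)" if "r \<in> carrier R" "r' \<in> carrier R" "x \<in> carrier M" for r r' x
      using ex[OF that(3)] that(1,2) by (auto simp: sm[symmetric] N.smult_assoc1)
    show "\<one>\<^bsub>R\<^esub> \<odot>\<^bsub>M\<^esub> x = x" if "x \<in> carrier M" for x
      using ex[OF that] by (auto simp: sm[symmetric])
  qed
qed

lemma module_dsum:
  assumes M: "module R M" and N: "module R N"
  shows "module R (dsum M N)"
proof -
  interpret M: module R M by (rule M)
  interpret N: module R N by (rule N)
  show ?thesis
  proof (rule moduleI)
    show "cring R" by (rule module.axioms(1)[OF N])
    show "abelian_group (dsum M N)"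
    proof (rule abelian_groupI)
      show "\<exists>y\<in>carrier (dsum M N). y \<oplus>\<^bsub>dsum M N\<^esub> x = \<zero>\<^bsub>dsum M N\<^esub>" if "x \<in> carrier (dsum M N)" for x
        using that by (intro bexI[of _ "(\<ominus>\<^bsub>M\<^esub> fst x, \<ominus>\<^bsub>N\<^esub> snd x)"]) (auto simp: M.l_neg N.l_neg)
    qed (auto simp: M.a_ac N.a_ac)
  qed (auto simp: M.smult_l_distr N.smult_l_distr M.smult_r_distr N.smult_r_distr M.smult_assoc1 N.smult_assoc1)
qed

lemma module_if:
  assumes M: "module R M"
  shows "module R (if_module c M)"
proof (cases c)
  case True
  then show ?thesis using M by (simp add: if_module_def)
next
  case False
  interpret M: module R M by (rule M)
  show ?thesis
  proof (rule moduleI)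
    show "cring R" by (rule module.axioms(1)[OF M])
    show "abelian_group (if_module c M)"
      by (rule abelian_groupI) (auto simp: False)
  qed (auto simp: False)
qed

lemma mod_homD:
  assumes "f \<in> mod_hom R M N"
  shows "x \<in> carrier M \<Longrightarrow> f x \<in> carrier N"
    and "x \<in> carrier M \<Longrightarrow> y \<in> carrier M \<Longrightarrow> f (x \<oplus>\<^bsub>M\<^esub> y) = f x \<oplus>\<^bsub>N\<^esub> f y"
    and "r \<in> carrier R \<Longrightarrow> x \<in> carrier M \<Longrightarrow> f (r \<odot>\<^bsub>M\<^esub> x) = r \<odot>\<^bsub>N\<^esub> f x"
  using assms by (auto simp: mod_hom_def)

lemma mod_homI:
  assumes "\<And>x. x \<in> carrier M \<Longrightarrow> f x \<in> carrier N"
    and "\<And>x y. x \<in> carrier M \<Longrightarrow> y \<in> carrier M \<Longrightarrow> f (x \<oplus>\<^bsub>M\<^esub> y) = f x \<oplus>\<^bsub>N\<^esub> f y"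
    and "\<And>r x. r \<in> carrier R \<Longrightarrow> x \<in> carrier M \<Longrightarrow> f (r \<odot>\<^bsub>M\<^esub> x) = r \<odot>\<^bsub>N\<^esub> f x"
  shows "f \<in> mod_hom R M N"
  using assms by (auto simp: mod_hom_def)

lemma mod_hom_zero:
  assumes "f \<in> mod_hom R M N" "module R M" "module R N"
  shows "f \<zero>\<^bsub>M\<^esub> = \<zero>\<^bsub>N\<^esub>"
proof -
  interpret M: module R M by fact
  interpret N: module R N by fact
  have "f \<zero>\<^bsub>M\<^esub> \<oplus>\<^bsub>N\<^esub> f \<zero>\<^bsub>M\<^esub> = f \<zero>\<^bsub>M\<^esub>"
    using mod_homD(2)[OF assms(1), of "\<zero>\<^bsub>M\<^esub>" "\<zero>\<^bsub>M\<^esub>"] by simp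
  then show ?thesis using mod_homD(1)[OF assms(1), of "\<zero>\<^bsub>M\<^esub>"]
    by (metis M.zero_closed N.add.l_cancel_one N.zero_closed)
qed

lemma mod_hom_minus:
  assumes f: "f \<in> mod_hom R M N" "module R M" "module R N" and x: "x \<in> carrier M"
  shows "f (\<ominus>\<^bsub>M\<^esub> x) = \<ominus>\<^bsub>N\<^esub> f x"
proof -
  interpret M: module R M by fact
  interpret N: module R N by fact
  have "f (\<ominus>\<^bsub>M\<^esub> x) \<oplus>\<^bsub>N\<^esub> f x = \<zero>\<^bsub>N\<^esub>"
    using mod_homD(2)[OF f(1), of "\<ominus>\<^bsub>M\<^esub> x" x] x by (simp add: M.l_neg mod_hom_zero[OF f])
  then show ?thesis using mod_homD(1)[OF f(1)] x by (metis M.a_inv_closed N.minus_equality)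
qed

subsection \<open>Mapping cones\<close>

lemma cone_is_complex:
  assumes S: "is_complex R S d" and S': "is_complex R S' d'" and f: "is_chain_map R S d S' d' f"
  shows "is_complex R (cone S S') (cone_diff S d S' d' f)"
  unfolding is_complex_def
proof (intro allI conjI ballI)
  fix i :: int
  have m: "module R (S i)" "module R (S' i)" for i using S S' by (auto simp: is_complex_def)
  have d: "d i \<in> mod_hom R (S i) (S (i - 1))" "d' i \<in> mod_hom R (S' i) (S' (i - 1))" "f i \<in> mod_hom R (S i) (S' i)" for i
    using S S' f by (auto simp: is_complex_def is_chain_map_def)
  have dd: "x \<in> carrier (S i) \<Longrightarrow> d (i - 1) (d i x) = \<zero>\<^bsub>S (i - 2)\<^esub>"
    "y \<in> carrier (S' i) \<Longrightarrow> d' (i - 1) (d' i y) = \<zero>\<^bsub>S' (i - 2)\<^esub>"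
    "x \<in> carrier (S i) \<Longrightarrow> f (i - 1) (d i x) = d' i (f i x)" for i x y
    using S S' f by (auto simp: is_complex_def is_chain_map_def)
  interpret A: module R "S (i - 1)" by (rule m)
  interpret A1: module R "S (i - 2)" by (rule m)
  interpret A2: module R "S (i - 3)" by (rule m)
  interpret B: module R "S' i" by (rule m)
  interpret B1: module R "S' (i - 1)" by (rule m)
  interpret B2: module R "S' (i - 2)" by (rule m)
  have dA: "d (i - 1) \<in> mod_hom R (S (i - 1)) (S (i - 2))" using d(1)[of "i - 1"] by simp
  have dA1: "d (i - 2) \<in> mod_hom R (S (i - 2)) (S (i - 3))" using d(1)[of "i - 2"] by simp
  have dB1: "d' (i - 1) \<in> mod_hom R (S' (i - 1)) (S' (i - 2))" using d(2)[of "i - 1"] by simp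
  note [simp] = mod_homD[OF dA] mod_homD[OF dA1] mod_homD[OF d(2)[of i]] mod_homD[OF dB1] mod_homD[OF d(3)[of "i - 1"]] mod_homD[OF d(3)[of "i - 2"]]
  show "module R (cone S S' i)" unfolding cone_def by (intro module_dsum m)
  show "cone_diff S d S' d' f i \<in> mod_hom R (cone S S' i) (cone S S' (i - 1))"
    by (rule mod_homI)
       (auto simp: cone_def cone_diff_def A1.minus_add A1.smult_r_minus B1.smult_r_distr B1.a_ac)
  fix x assume "x \<in> carrier (cone S S' i)"
  then obtain x1 x2 where x: "x = (x1, x2)" "x1 \<in> carrier (S (i - 1))" "x2 \<in> carrier (S' i)"
    by (auto simp: cone_def)
  have 1: "d (i - 2) (\<ominus>\<^bsub>S (i - 2)\<^esub> d (i - 1) x1) = \<ominus>\<^bsub>S (i - 3)\<^esub> \<zero>\<^bsub>S (i - 3)\<^esub>"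
    using x dd(1)[of x1 "i - 1"] by (simp add: mod_hom_minus[OF dA1 m(1) m(1)])
  have 2: "f (i - 2) (\<ominus>\<^bsub>S (i - 2)\<^esub> d (i - 1) x1) = \<ominus>\<^bsub>S' (i - 2)\<^esub> d' (i - 1) (f (i - 1) x1)"
    using x dd(3)[of x1 "i - 1"] by (simp add: mod_hom_minus[OF d(3)[of "i - 2"] m])
  have 3: "d' (i - 1) (f (i - 1) x1 \<oplus>\<^bsub>S' (i - 1)\<^esub> d' i x2) = d' (i - 1) (f (i - 1) x1)"
    using x dd(2)[of x2 "i"] by simp
  show "cone_diff S d S' d' f (i - 1) (cone_diff S d S' d' f i x) = \<zero>\<^bsub>cone S S' (i - 2)\<^esub>"
    using x by (simp add: cone_def cone_diff_def 1 2 3 B2.l_neg)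
qed

text \<open>Only the source in degree i - 1 and the target in degree i enter. For i > 0 this avoids
  degree -1 of the source and degree 0 of the target, where homology remains.\<close>

lemma cone_exact:
  assumes S: "is_complex R S d" and S': "is_complex R S' d'" and f: "is_chain_map R S d S' d' f"
    and exC: "\<And>x. x \<in> carrier (S (i - 1)) \<Longrightarrow> d (i - 1) x = \<zero>\<^bsub>S (i - 2)\<^esub> \<Longrightarrow> \<exists>y\<in>carrier (S i). d i y = x"
    and exC': "\<And>x. x \<in> carrier (S' i) \<Longrightarrow> d' i x = \<zero>\<^bsub>S' (i - 1)\<^esub> \<Longrightarrow> \<exists>y\<in>carrier (S' (i + 1)). d' (i + 1) y = x"
  shows "{x \<in> carrier (cone S S' i). cone_diff S d S' d' f i x = \<zero>\<^bsub>cone S S' (i - 1)\<^esub>} =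
      cone_diff S d S' d' f (i + 1) ` carrier (cone S S' (i + 1))"
proof (rule subset_antisym; rule subsetI)
  fix x
  have cpl: "is_complex R (cone S S') (cone_diff S d S' d' f)" by (rule cone_is_complex[OF S S' f])
  {
    assume "x \<in> cone_diff S d S' d' f (i + 1) ` carrier (cone S S' (i + 1))"
    then obtain y where y: "y \<in> carrier (cone S S' (i + 1))" "x = cone_diff S d S' d' f (i + 1) y" by blast
    have cplD: "cone_diff S d S' d' f (i + 1) \<in> mod_hom R (cone S S' (i + 1)) (cone S S' (i + 1 - 1)) \<and>
      (\<forall>x\<in>carrier (cone S S' (i + 1)). cone_diff S d S' d' f (i + 1 - 1) (cone_diff S d S' d' f (i + 1) x) = \<zero>\<^bsub>cone S S' (i + 1 - 2)\<^esub>)"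
      using cpl unfolding is_complex_def by blast
    then show "x \<in> {x \<in> carrier (cone S S' i). cone_diff S d S' d' f i x = \<zero>\<^bsub>cone S S' (i - 1)\<^esub>}"
      using y mod_homD(1)[OF conjunct1[OF cplD] y(1)] by simp
  next
    assume "x \<in> {x \<in> carrier (cone S S' i). cone_diff S d S' d' f i x = \<zero>\<^bsub>cone S S' (i - 1)\<^esub>}"
    then obtain x1 x2 where x: "x = (x1, x2)" "x1 \<in> carrier (S (i - 1))" "x2 \<in> carrier (S' i)"
      and e1: "\<ominus>\<^bsub>S (i - 2)\<^esub> d (i - 1) x1 = \<zero>\<^bsub>S (i - 2)\<^esub>"
      and e2: "f (i - 1) x1 \<oplus>\<^bsub>S' (i - 1)\<^esub> d' i x2 = \<zero>\<^bsub>S' (i - 1)\<^esub>"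
      by (auto simp: cone_def cone_diff_def)
    have m: "module R (S i)" "module R (S' i)" for i using S S' by (auto simp: is_complex_def)
    have d: "d i \<in> mod_hom R (S i) (S (i - 1))" "d' i \<in> mod_hom R (S' i) (S' (i - 1))" "f i \<in> mod_hom R (S i) (S' i)"
      and fd: "\<And>x. x \<in> carrier (S i) \<Longrightarrow> f (i - 1) (d i x) = d' i (f i x)" for i
      using S S' f by (auto simp: is_complex_def is_chain_map_def)
    interpret A0: module R "S i" by (rule m)
    interpret A: module R "S (i - 1)" by (rule m)
    interpret A1: module R "S (i - 2)" by (rule m)
    interpret B: module R "S' i" by (rule m)
    interpret B1: module R "S' (i - 1)" by (rule m)
    have dA: "d (i - 1) x1 \<in> carrier (S (i - 2))" using mod_homD(1)[OF d(1)[of "i - 1"] x(2)] by simp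
    have "d (i - 1) x1 = \<zero>\<^bsub>S (i - 2)\<^esub>" using A1.r_neg[OF dA] by (simp only: e1 A1.r_zero[OF dA])
    from exC[OF x(2) this] obtain y where y: "y \<in> carrier (S i)" "d i y = x1" by (rule bexE)
    \<comment> \<open>The cone carries the differential of the source with a minus sign, so the
      preimage is negated.\<close>
    let ?x' = "\<ominus>\<^bsub>S i\<^esub> y"
    have x': "?x' \<in> carrier (S i)" by (rule A0.a_inv_closed[OF y(1)])
    have dx': "\<ominus>\<^bsub>S (i - 1)\<^esub> d i ?x' = x1"
      unfolding mod_hom_minus[OF d(1)[of i] m(1) m(1) y(1)] y(2) by (rule A.minus_minus[OF x(2)])
    have fx': "f i ?x' \<in> carrier (S' i)" by (rule mod_homD(1)[OF d(3) x'])
    have "d' i (f i ?x') = f (i - 1) (d i ?x')" using fd[OF x'] by simp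
    also have "\<dots> = f (i - 1) (\<ominus>\<^bsub>S (i - 1)\<^esub> x1)"
      unfolding mod_hom_minus[OF d(1)[of i] m(1) m(1) y(1)] y(2) ..
    also have "\<dots> = \<ominus>\<^bsub>S' (i - 1)\<^esub> f (i - 1) x1" by (rule mod_hom_minus[OF d(3) m x(2)])
    also have "\<dots> = d' i x2"
    proof (rule B1.minus_equality)
      show "f (i - 1) x1 \<in> carrier (S' (i - 1))" by (rule mod_homD(1)[OF d(3) x(2)])
      show "d' i x2 \<in> carrier (S' (i - 1))" by (rule mod_homD(1)[OF d(2) x(3)])
      then show "d' i x2 \<oplus>\<^bsub>S' (i - 1)\<^esub> f (i - 1) x1 = \<zero>\<^bsub>S' (i - 1)\<^esub>"
        using e2 B1.a_comm[OF \<open>f (i - 1) x1 \<in> carrier (S' (i - 1))\<close>] by simp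
    qed
    finally have eq: "d' i (f i ?x') = d' i x2" .
    \<comment> \<open>What the chosen preimage leaves over is a cycle of the target.\<close>
    let ?z = "x2 \<oplus>\<^bsub>S' i\<^esub> \<ominus>\<^bsub>S' i\<^esub> f i ?x'"
    have z: "?z \<in> carrier (S' i)" using x fx' by simp
    have "d' i ?z = d' i x2 \<oplus>\<^bsub>S' (i - 1)\<^esub> \<ominus>\<^bsub>S' (i - 1)\<^esub> d' i (f i ?x')"
      unfolding mod_hom_minus[OF d(2)[of i] m(2) m(2) fx', symmetric]
      by (rule mod_homD(2)[OF d(2)[of i] x(3) B.a_inv_closed[OF fx']])
    also have "\<dots> = \<zero>\<^bsub>S' (i - 1)\<^esub>" using mod_homD(1)[OF d(2) x(3)] by (simp add: eq B1.r_neg)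
    finally obtain w where w: "w \<in> carrier (S' (i + 1))" "d' (i + 1) w = ?z" using exC'[OF z] by blast
    have "f i ?x' \<oplus>\<^bsub>S' i\<^esub> ?z = ?z \<oplus>\<^bsub>S' i\<^esub> f i ?x'" by (rule B.a_comm[OF fx' z])
    also have "\<dots> = x2" by (simp only: B.a_assoc[OF x(3) B.a_inv_closed[OF fx'] fx'] B.l_neg[OF fx'] B.r_zero[OF x(3)])
    finally have "f i ?x' \<oplus>\<^bsub>S' i\<^esub> ?z = x2" .
    then have "x = cone_diff S d S' d' f (i + 1) (?x', w)"
      using x dx' w by (simp add: cone_diff_def)
    moreover have "(?x', w) \<in> carrier (cone S S' (i + 1))" using x' w by (simp add: cone_def)
    ultimately show "x \<in> cone_diff S d S' d' f (i + 1) ` carrier (cone S S' (i + 1))" by blast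
  }
qed

subsection \<open>Bases over the polynomial ring from bases over the field\<close>

text \<open>Such a submodule is generated by its elements with coefficients in $k$, so that a $k$-basis of these is a basis over $P$.\<close>

definition sgen :: "('n, 'k::field) xform set \<Rightarrow> bool" where
  "sgen V \<longleftrightarrow> psub V \<and> (\<forall>w\<in>V. \<forall>v. ins 0 (sl v w) \<in> V)"

lemma sl_pm_ins: "sl v (pm p (ins 0 z)) = ks (lk p v) z"
proof (rule poly_mapping_eqI, rule poly_mapping_eqI)
  fix S u
  show "lk (lk (sl v (pm p (ins 0 z))) S) u = lk (lk (ks (lk p v) z) S) u"
    using lk_mult_const[of p "lk (lk z S) u" v] by (simp add: const_def)
qed

lemma ins_ks: "ins 0 (ks c z) = pm (Poly_Mapping.single 0 c) (ins 0 z)"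
  by (rule xform_eqI) (auto simp: sl_pm_ins sl_ins lookup_single when_def intro!: poly_mapping_eqI)

lemma finsum_xmod:
  fixes f :: "'i \<Rightarrow> ('n, 'k::field) xform"
  assumes V: "psub V" and F: "finite F" "f \<in> F \<rightarrow> V"
  shows "finsum (xmod V) f F = sum f F"
proof -
  interpret module PR "xmod V" by (rule module_xmod[OF V])
  show ?thesis using F
  proof (induction F rule: finite_induct)
    case (insert x F)
    then show ?case by (subst finsum_insert) (auto simp: Pi_def)
  qed simp
qed

lemma mod_hom_finsum:
  assumes f: "f \<in> mod_hom R M N" "module R M" "module R N" and F: "finite F" "g \<in> F \<rightarrow> carrier M"
  shows "f (finsum M g F) = finsum N (\<lambda>b. f (g b)) F"
proof -
  interpret M: module R M by fact
  interpret N: module R N by fact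
  show ?thesis using F
  proof (induction F rule: finite_induct)
    case empty
    then show ?case by (simp add: mod_hom_zero[OF f])
  next
    case (insert x F)
    then have "g \<in> F \<rightarrow> carrier M" "g x \<in> carrier M" by auto
    moreover from this have "(\<lambda>b. f (g b)) \<in> F \<rightarrow> carrier N" using mod_homD(1)[OF f(1)] by (auto simp: Pi_def)
    ultimately show ?case using insert mod_homD[OF f(1)] by simp
  qed
qed

lemma free_module_iso_xmod:
  fixes V :: "('n, 'k::field) xform set" and M :: "(('n, 'k) pol, 'a) module"
  assumes V: "sgen V" and M: "module PR M" and f: "f \<in> mod_hom PR M (xmod V)"
    and inj: "inj_on f (carrier M)" and surj: "f ` carrier M = V"
  shows "free_module PR M"
proof -
  have pV: "psub V" using V by (simp add: sgen_def)
  note mV = module_xmod[OF pV]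
  interpret M: module PR M by (rule M)
  \<comment> \<open>These are the elements of V with coefficients in k; a k-basis of them, moved to
    M along f, will be the P-basis.\<close>
  define Z where "Z = {z. ins 0 z \<in> V}"
  obtain Bk where Bk: "Bk \<subseteq> Z" "kform.independent Bk" "Z \<subseteq> kform.span Bk"
    using kform.maximal_independent_subset[of Z] by blast
  have sub: "kform.subspace Z"
    unfolding kform.subspace_def Z_def
  proof (intro conjI ballI allI, goal_cases)
    case 1 show ?case by (simp add: psub_0[OF pV])
  next
    case (2 x y) then show ?case by (simp add: additive_fn_add[OF additive_ins] psub_add[OF pV])
  next
    case (3 c x)
    then show ?case by (simp add: ins_ks psub_pm[OF pV])
  qed
  have slZ: "sl v w \<in> Z" if "w \<in> V" for v w using V that by (auto simp: sgen_def Z_def)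
  define g where "g z = inv_into (carrier M) f (ins 0 z)" for z
  have g: "g z \<in> carrier M" "f (g z) = ins 0 z" if "z \<in> Z" for z
    using that surj unfolding g_def Z_def by (auto intro: inv_into_into f_inv_into_f)
  define \<beta> where "\<beta> b = sl 0 (f b)" for b
  have \<beta>g: "\<beta> (g z) = z" if "z \<in> Z" for z using g(2)[OF that] by (simp add: \<beta>_def sl_ins)
  define B where "B = g ` Bk"
  have BM: "B \<subseteq> carrier M" using g(1) Bk(1) by (auto simp: B_def)
  have \<beta>B: "\<beta> b \<in> Bk" "f b = ins 0 (\<beta> b)" "g (\<beta> b) = b" if "b \<in> B" for b
    using that Bk(1) \<beta>g g(2) by (auto simp: B_def)
  have comb: "f (\<Oplus>\<^bsub>M\<^esub>b\<in>{b\<in>B. c b \<noteq> \<zero>\<^bsub>PR\<^esub>}. c b \<odot>\<^bsub>M\<^esub> b) = (\<Sum>b\<in>{b\<in>B. c b \<noteq> 0}. pm (c b) (ins 0 (\<beta> b)))"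
    if fin: "finite {b\<in>B. c b \<noteq> 0}" for c
  proof -
    have cl: "(\<lambda>b. c b \<odot>\<^bsub>M\<^esub> b) \<in> {b\<in>B. c b \<noteq> 0} \<rightarrow> carrier M" using BM by (auto intro: M.smult_closed)
    have "f (\<Oplus>\<^bsub>M\<^esub>b\<in>{b\<in>B. c b \<noteq> 0}. c b \<odot>\<^bsub>M\<^esub> b) = finsum (xmod V) (\<lambda>b. f (c b \<odot>\<^bsub>M\<^esub> b)) {b\<in>B. c b \<noteq> 0}"
      by (rule mod_hom_finsum[OF f M mV fin cl])
    also have "\<dots> = (\<Sum>b\<in>{b\<in>B. c b \<noteq> 0}. f (c b \<odot>\<^bsub>M\<^esub> b))"
      by (rule finsum_xmod[OF pV fin]) (use cl mod_homD(1)[OF f] in \<open>auto simp: Pi_def\<close>)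
    also have "\<dots> = (\<Sum>b\<in>{b\<in>B. c b \<noteq> 0}. pm (c b) (ins 0 (\<beta> b)))"
      using BM mod_homD(3)[OF f] \<beta>B(2) by (intro sum.cong) auto
    finally show ?thesis by simp
  qed
  \<comment> \<open>The slice at v of a P-combination is the k-combination of the coefficients at v,
    so independence over k gives uniqueness over P.\<close>
  have ks_sum: "kform.representation Bk (sl v w) = (\<lambda>z. if z \<in> Bk then lk (c (g z)) v else 0)"
    if fin: "finite {b\<in>B. c b \<noteq> 0}" and w: "w \<in> V" "w = (\<Sum>b\<in>{b\<in>B. c b \<noteq> 0}. pm (c b) (ins 0 (\<beta> b)))" for c v w
  proof (rule kform.representation_eqI)
    let ?F = "\<lambda>z. if z \<in> Bk then lk (c (g z)) v else 0"
    show "kform.independent Bk" by (rule Bk(2))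
    show "sl v w \<in> kform.span Bk" using slZ[OF w(1)] Bk(3) by blast
    show "z \<in> Bk" if "?F z \<noteq> 0" for z using that by (auto split: if_splits)
    have sub: "{z. ?F z \<noteq> 0} \<subseteq> \<beta> ` {b\<in>B. c b \<noteq> 0}"
    proof
      fix z assume z: "z \<in> {z. ?F z \<noteq> 0}"
      then have "z \<in> Bk" "c (g z) \<noteq> 0" by (auto split: if_splits)
      then have "g z \<in> {b\<in>B. c b \<noteq> 0}" "\<beta> (g z) = z" using \<beta>g Bk(1) by (auto simp: B_def)
      then show "z \<in> \<beta> ` {b\<in>B. c b \<noteq> 0}" by (intro image_eqI[where x = "g z"]) simp_all
    qed
    show "finite {z. ?F z \<noteq> 0}" by (rule finite_subset[OF sub]) (use fin in simp)
    have injb: "inj_on \<beta> {b\<in>B. c b \<noteq> 0}" by (rule inj_onI) (metis (no_types, lifting) \<beta>B(3) mem_Collect_eq)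
    have "(\<Sum>z | ?F z \<noteq> 0. ks (?F z) z) = (\<Sum>z\<in>\<beta> ` {b\<in>B. c b \<noteq> 0}. ks (?F z) z)"
      by (rule sum.mono_neutral_left) (use fin sub in auto)
    also have "\<dots> = (\<Sum>b\<in>{b\<in>B. c b \<noteq> 0}. ks (?F (\<beta> b)) (\<beta> b))"
      by (simp add: sum.reindex[OF injb])
    also have "\<dots> = (\<Sum>b\<in>{b\<in>B. c b \<noteq> 0}. ks (lk (c b) v) (\<beta> b))"
      using \<beta>B by (intro sum.cong) auto
    also have "\<dots> = sl v w" unfolding w(2) by (simp add: sl_simps sl_pm_ins)
    finally show "(\<Sum>z | ?F z \<noteq> 0. ks (?F z) z) = sl v w" .
  qed
  \<comment> \<open>Coordinates over P are assembled from the k-coordinates of all slices.\<close>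
  define crd where "crd z w = Abs_poly_mapping (\<lambda>v. kform.representation Bk (sl v w) z)" for z w
  have lk_crd: "lk (crd z w) v = kform.representation Bk (sl v w) z" for z w v
  proof -
    have "finite {v. kform.representation Bk (sl v w) z \<noteq> 0}"
      by (rule finite_subset[OF _ finite_sl[of w]]) (auto simp: kform.representation_zero)
    then show ?thesis by (simp add: crd_def)
  qed
  have fin_crd: "finite {b\<in>B. crd (\<beta> b) w \<noteq> 0}" for w
  proof -
    let ?U = "\<Union>v\<in>{v. sl v w \<noteq> 0}. {z. kform.representation Bk (sl v w) z \<noteq> 0}"
    have "finite ?U" using finite_sl[of w] kform.finite_representation by blast
    moreover have "{b\<in>B. crd (\<beta> b) w \<noteq> 0} \<subseteq> g ` ?U"
    proof
      fix b assume b: "b \<in> {b\<in>B. crd (\<beta> b) w \<noteq> 0}"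
      then have bB: "b \<in> B" and "crd (\<beta> b) w \<noteq> 0" by simp_all
      then obtain v where "lk (crd (\<beta> b) w) v \<noteq> 0" using lk_nonzero by blast
      then have v: "kform.representation Bk (sl v w) (\<beta> b) \<noteq> 0" by (simp add: lk_crd)
      then have "sl v w \<noteq> 0" by (auto simp: kform.representation_zero)
      then have "\<beta> b \<in> ?U" using v by blast
      then have "g (\<beta> b) \<in> g ` ?U" by (rule imageI)
      then show "b \<in> g ` ?U" by (simp only: \<beta>B(3)[OF bB])
    qed
    ultimately show ?thesis by (meson finite_imageI finite_subset)
  qed
  have crd_sum: "w = (\<Sum>b\<in>{b\<in>B. crd (\<beta> b) w \<noteq> 0}. pm (crd (\<beta> b) w) (ins 0 (\<beta> b)))" if w: "w \<in> V" for w
  proof (rule xform_eqI)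
    fix v
    let ?F = "kform.representation Bk (sl v w)"
    have injb: "inj_on \<beta> {b\<in>B. crd (\<beta> b) w \<noteq> 0}" by (rule inj_onI) (metis (no_types, lifting) \<beta>B(3) mem_Collect_eq)
    have sub: "{z. ?F z \<noteq> 0} \<subseteq> \<beta> ` {b\<in>B. crd (\<beta> b) w \<noteq> 0}"
    proof
      fix z assume "z \<in> {z. ?F z \<noteq> 0}"
      then have z: "?F z \<noteq> 0" by simp
      then have zB: "z \<in> Bk" by (rule kform.representation_ne_zero)
      have "crd z w \<noteq> 0" using z lk_crd[of z w v] by auto
      then have "g z \<in> {b\<in>B. crd (\<beta> b) w \<noteq> 0}" "\<beta> (g z) = z" using \<beta>g Bk(1) zB by (auto simp: B_def)
      then show "z \<in> \<beta> ` {b\<in>B. crd (\<beta> b) w \<noteq> 0}" by (intro image_eqI[where x = "g z"]) simp_all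
    qed
    have "sl v w = (\<Sum>z | ?F z \<noteq> 0. ks (?F z) z)"
      by (rule kform.sum_nonzero_representation_eq[OF Bk(2), symmetric]) (use slZ[OF w] Bk(3) in blast)
    also have "\<dots> = (\<Sum>z\<in>\<beta> ` {b\<in>B. crd (\<beta> b) w \<noteq> 0}. ks (?F z) z)"
      by (rule sum.mono_neutral_left) (use fin_crd sub in auto)
    also have "\<dots> = (\<Sum>b\<in>{b\<in>B. crd (\<beta> b) w \<noteq> 0}. ks (lk (crd (\<beta> b) w) v) (\<beta> b))"
      by (simp add: sum.reindex[OF injb] lk_crd)
    also have "\<dots> = sl v (\<Sum>b\<in>{b\<in>B. crd (\<beta> b) w \<noteq> 0}. pm (crd (\<beta> b) w) (ins 0 (\<beta> b)))"
      by (simp add: sl_simps sl_pm_ins)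
    finally show "sl v w = sl v (\<Sum>b\<in>{b\<in>B. crd (\<beta> b) w \<noteq> 0}. pm (crd (\<beta> b) w) (ins 0 (\<beta> b)))" .
  qed
  have "\<exists>!c. c \<in> B \<rightarrow>\<^sub>E carrier PR \<and> finite {b\<in>B. c b \<noteq> \<zero>\<^bsub>PR\<^esub>} \<and>
      x = (\<Oplus>\<^bsub>M\<^esub>b\<in>{b\<in>B. c b \<noteq> \<zero>\<^bsub>PR\<^esub>}. c b \<odot>\<^bsub>M\<^esub> b)" if x: "x \<in> carrier M" for x
  proof (rule ex1I)
    let ?c = "\<lambda>b\<in>B. crd (\<beta> b) (f x)"
    have fx: "f x \<in> V" using x surj by blast
    have S: "{b\<in>B. ?c b \<noteq> 0} = {b\<in>B. crd (\<beta> b) (f x) \<noteq> 0}" by auto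
    have fin: "finite {b\<in>B. ?c b \<noteq> 0}" unfolding S by (rule fin_crd)
    have cl: "(\<Oplus>\<^bsub>M\<^esub>b\<in>{b\<in>B. c b \<noteq> \<zero>\<^bsub>PR\<^esub>}. c b \<odot>\<^bsub>M\<^esub> b) \<in> carrier M" for c
      using BM by (intro M.finsum_closed) (auto intro: M.smult_closed)
    have "f x = (\<Sum>b\<in>{b\<in>B. ?c b \<noteq> 0}. pm (?c b) (ins 0 (\<beta> b)))"
      unfolding S by (subst crd_sum[OF fx]) (intro sum.cong refl, simp)
    also have "\<dots> = f (\<Oplus>\<^bsub>M\<^esub>b\<in>{b\<in>B. ?c b \<noteq> \<zero>\<^bsub>PR\<^esub>}. ?c b \<odot>\<^bsub>M\<^esub> b)"
      by (rule comb[OF fin, symmetric])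
    finally have "x = (\<Oplus>\<^bsub>M\<^esub>b\<in>{b\<in>B. ?c b \<noteq> \<zero>\<^bsub>PR\<^esub>}. ?c b \<odot>\<^bsub>M\<^esub> b)"
      by (rule inj_onD[OF inj _ x cl])
    then show "?c \<in> B \<rightarrow>\<^sub>E carrier PR \<and> finite {b\<in>B. ?c b \<noteq> \<zero>\<^bsub>PR\<^esub>} \<and>
      x = (\<Oplus>\<^bsub>M\<^esub>b\<in>{b\<in>B. ?c b \<noteq> \<zero>\<^bsub>PR\<^esub>}. ?c b \<odot>\<^bsub>M\<^esub> b)"
      using fin by simp
    fix c assume c: "c \<in> B \<rightarrow>\<^sub>E carrier PR \<and> finite {b\<in>B. c b \<noteq> \<zero>\<^bsub>PR\<^esub>} \<and>
      x = (\<Oplus>\<^bsub>M\<^esub>b\<in>{b\<in>B. c b \<noteq> \<zero>\<^bsub>PR\<^esub>}. c b \<odot>\<^bsub>M\<^esub> b)"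
    then have finc: "finite {b\<in>B. c b \<noteq> 0}" by simp
    have "f x = (\<Sum>b\<in>{b\<in>B. c b \<noteq> 0}. pm (c b) (ins 0 (\<beta> b)))"
      using c comb[OF finc] by simp
    note rep = ks_sum[OF finc fx this]
    show "c = ?c"
    proof
      fix b
      show "c b = ?c b"
      proof (cases "b \<in> B")
        case True
        have "lk (crd (\<beta> b) (f x)) v = lk (c b) v" for v
          unfolding lk_crd rep using True \<beta>B by simp
        then show ?thesis using True by (simp add: poly_mapping_eqI)
      next
        case False
        then show ?thesis using c by (auto simp: PiE_def extensional_def)
      qed
    qed
  qed
  note ex1 = this
  show ?thesis unfolding free_module_def by (intro conjI M exI[of _ B] BM ballI ex1)
qed

subsection \<open>Quotient modules\<close>

definition cls :: "'a::ab_group_add set \<Rightarrow> 'a \<Rightarrow> 'a set" where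
  "cls B x = (\<lambda>b. b + x) ` B"

definition asub :: "'a::ab_group_add set \<Rightarrow> bool" where
  "asub B \<longleftrightarrow> 0 \<in> B \<and> (\<forall>x\<in>B. \<forall>y\<in>B. x - y \<in> B)"

lemma mem_cls: "z \<in> cls B x \<longleftrightarrow> z - x \<in> B"
proof
  assume "z - x \<in> B"
  then show "z \<in> cls B x" unfolding cls_def by (rule image_eqI[rotated]) simp
qed (auto simp: cls_def)

lemma asub_minus: "asub B \<Longrightarrow> x \<in> B \<Longrightarrow> - x \<in> B"
  unfolding asub_def by (metis diff_0)

lemma asub_add: "asub B \<Longrightarrow> x \<in> B \<Longrightarrow> y \<in> B \<Longrightarrow> x + y \<in> B"
  using asub_minus[of B y] unfolding asub_def by (metis diff_minus_eq_add)

lemma cls_eq_iff: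
  assumes B: "asub B"
  shows "cls B x = cls B y \<longleftrightarrow> x - y \<in> B"
proof
  assume "cls B x = cls B y"
  moreover have "x \<in> cls B x" using B by (simp add: mem_cls asub_def)
  ultimately show "x - y \<in> B" by (simp add: mem_cls)
next
  assume xy: "x - y \<in> B"
  show "cls B x = cls B y"
  proof (intro Set.set_eqI iffI)
    fix z assume "z \<in> cls B x"
    then have "(z - x) + (x - y) \<in> B" by (intro asub_add[OF B] xy) (simp add: mem_cls)
    then show "z \<in> cls B y" by (simp add: mem_cls)
  next
    fix z assume "z \<in> cls B y"
    then have "(z - y) + - (x - y) \<in> B" by (intro asub_add[OF B] asub_minus[OF B] xy) (simp add: mem_cls)
    then show "z \<in> cls B x" by (simp add: mem_cls)
  qed
qed

lemma set_add_cls: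
  assumes B: "asub B"
  shows "{x' + y' | x' y'. x' \<in> cls B x \<and> y' \<in> cls B y} = cls B (x + y)"
proof (intro Set.set_eqI iffI)
  fix z assume "z \<in> {x' + y' | x' y'. x' \<in> cls B x \<and> y' \<in> cls B y}"
  then obtain x' y' where z: "z = x' + y'" "x' - x \<in> B" "y' - y \<in> B" by (auto simp: mem_cls)
  have "(x' - x) + (y' - y) \<in> B" by (rule asub_add[OF B z(2,3)])
  then show "z \<in> cls B (x + y)" by (simp add: mem_cls z(1) algebra_simps)
next
  fix z assume "z \<in> cls B (x + y)"
  then have "(z - y) - x \<in> B" by (simp add: mem_cls algebra_simps)
  then have "z - y \<in> cls B x" "y \<in> cls B y" using B by (simp_all add: mem_cls asub_def)
  then show "z \<in> {x' + y' | x' y'. x' \<in> cls B x \<and> y' \<in> cls B y}"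
    by (intro CollectI exI[of _ "z - y"] exI[of _ y]) simp
qed

text \<open>Operations on quotients are unions over representatives; all members of the union agree
  when f respects the subgroups.\<close>

lemma UN_cls:
  assumes B: "asub B" and add: "additive_fn f" and f: "\<And>x. x \<in> B0 \<Longrightarrow> f x \<in> B" and B0: "asub B0"
  shows "(\<Union>z\<in>cls B0 x. cls B (f z)) = cls B (f x)"
proof -
  have "cls B (f z) = cls B (f x)" if "z \<in> cls B0 x" for z
    unfolding cls_eq_iff[OF B] additive_fn_diff[OF add, symmetric] using that f by (simp add: mem_cls)
  moreover have "x \<in> cls B0 x" using B0 by (simp add: mem_cls asub_def)
  ultimately show ?thesis by blast
qed

lemma psub_asub: "psub B \<Longrightarrow> asub B"
  by (simp add: asub_def psub_0 psub_diff)

lemma coset_xmod: "B +>\<^bsub>xmod V\<^esub> x = cls B x"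
  by (auto simp: a_r_coset_def r_coset_def cls_def)

lemma coset_pol_mod: "B +>\<^bsub>pol_mod\<^esub> x = cls B x"
  by (auto simp: a_r_coset_def r_coset_def cls_def)

lemma quot_xmod_simps:
  "carrier (quot_module (xmod V) B) = cls B ` V"
  "\<zero>\<^bsub>quot_module (xmod V) B\<^esub> = B"
  "psub B \<Longrightarrow> cls B x \<oplus>\<^bsub>quot_module (xmod V) B\<^esub> cls B y = cls B (x + y)"
  "psub B \<Longrightarrow> p \<odot>\<^bsub>quot_module (xmod V) B\<^esub> cls B x = cls B (pm p x)"
proof -
  show "carrier (quot_module (xmod V) B) = cls B ` V"
    by (auto simp: quot_module_def A_RCOSETS_def RCOSETS_def r_coset_def cls_def)
  show "\<zero>\<^bsub>quot_module (xmod V) B\<^esub> = B" by (simp add: quot_module_def)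
  show "cls B x \<oplus>\<^bsub>quot_module (xmod V) B\<^esub> cls B y = cls B (x + y)" if "psub B"
  proof -
    have "cls B x \<oplus>\<^bsub>quot_module (xmod V) B\<^esub> cls B y = {x' + y' | x' y'. x' \<in> cls B x \<and> y' \<in> cls B y}"
      by (auto simp: quot_module_def set_add_def set_mult_def)
    then show ?thesis by (simp add: set_add_cls[OF psub_asub[OF that]])
  qed
  show "p \<odot>\<^bsub>quot_module (xmod V) B\<^esub> cls B x = cls B (pm p x)" if "psub B"
    using UN_cls[OF psub_asub[OF that] additive_pm _ psub_asub[OF that], of p x] psub_pm[OF that]
    by (simp add: quot_module_def coset_xmod)
qed

lemma quot_map_cls:
  assumes "psub B" "psub B0" "additive_fn f" "\<And>x. x \<in> B0 \<Longrightarrow> f x \<in> B"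
  shows "quot_map (xmod V) B f (cls B0 x) = cls B (f x)"
  unfolding quot_map_def coset_xmod by (rule UN_cls) (use assms in \<open>auto intro: psub_asub\<close>)

lemma cls_0: "cls B 0 = B"
  by (simp add: cls_def)

lemma psub_B': "psub (B' \<phi> s a b)"
proof -
  have E: "psub (ext (a + 1) (D' \<phi> s (b + 1)))" by (rule psub_ext[OF psub1_D'])
  show ?thesis
    unfolding psub_def B'_def
  proof (intro conjI ballI allI)
    show "0 \<in> eta ` ext (a + 1) (D' \<phi> s (b + 1))"
      by (rule image_eqI[of _ _ 0]) (simp_all add: eta_simps psub_0[OF E])
  next
    fix x y assume "x \<in> eta ` ext (a + 1) (D' \<phi> s (b + 1))" "y \<in> eta ` ext (a + 1) (D' \<phi> s (b + 1))"
    then obtain x' y' where "x = eta x'" "y = eta y'" "x' \<in> ext (a + 1) (D' \<phi> s (b + 1))" "y' \<in> ext (a + 1) (D' \<phi> s (b + 1))"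
      by blast
    then show "x + y \<in> eta ` ext (a + 1) (D' \<phi> s (b + 1))"
      by (intro image_eqI[of _ _ "x' + y'"]) (simp_all add: eta_simps psub_add[OF E])
  next
    fix p x assume "x \<in> eta ` ext (a + 1) (D' \<phi> s (b + 1))"
    then obtain x' where "x = eta x'" "x' \<in> ext (a + 1) (D' \<phi> s (b + 1))" by blast
    then show "pm p x \<in> eta ` ext (a + 1) (D' \<phi> s (b + 1))"
      by (intro image_eqI[of _ _ "pm p x'"]) (simp_all add: eta_simps psub_pm[OF E])
  qed
qed

lemma psub_K': "psub (K' \<phi> s a b)"
  using psub_ext[OF psub1_D', of a \<phi> s b] by (simp add: psub_def K'_def eta_simps)

lemma kos_B': "x \<in> B' \<phi> s a b \<Longrightarrow> kos x \<in> B' \<phi> s (a - 1) b"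
proof -
  assume "x \<in> B' \<phi> s a b"
  then obtain v where v: "v \<in> ext (a + 1) (D' \<phi> s (b + 1))" "x = eta v" unfolding B'_def by blast
  have "kos x = eta (- kos v)" by (simp add: v(2) kos_eta eta_simps)
  moreover have "- kos v \<in> ext (a - 1 + 1) (D' \<phi> s (b + 1))"
    using psub_minus[OF psub_ext[OF psub1_D'] kos_ext[OF psub1_D' v(1)]] by simp
  ultimately show ?thesis unfolding B'_def by blast
qed

abbreviation cl :: "('n mon \<Rightarrow>\<^sub>0 'k) \<Rightarrow> int \<Rightarrow> int \<Rightarrow> int \<Rightarrow> ('n::{finite,linorder}, 'k::field) xform \<Rightarrow> ('n, 'k) xform set" where
  "cl \<phi> s a b \<equiv> cls (B' \<phi> s a b)"

lemma C_simps:
  "carrier (C \<phi> s a b) = cl \<phi> s a b ` K' \<phi> s a b"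
  "\<zero>\<^bsub>C \<phi> s a b\<^esub> = B' \<phi> s a b"
  "cl \<phi> s a b x \<oplus>\<^bsub>C \<phi> s a b\<^esub> cl \<phi> s a b y = cl \<phi> s a b (x + y)"
  "p \<odot>\<^bsub>C \<phi> s a b\<^esub> cl \<phi> s a b x = cl \<phi> s a b (pm p x)"
  by (simp_all add: C_def quot_xmod_simps psub_B')

lemma module_C: "module PR (C \<phi> s a b)"
  by (rule module_surj[OF module_xmod[OF psub_K'[of \<phi> s a b]], where j = "cl \<phi> s a b"])
     (simp_all add: C_simps cls_0)

lemma cl_hom: "cl \<phi> s a b \<in> mod_hom PR (xmod (K' \<phi> s a b)) (C \<phi> s a b)"
  by (rule mod_homI) (simp_all add: C_simps)

lemma finsum_cl:
  assumes "finite F" "\<And>j. j \<in> F \<Longrightarrow> g j \<in> K' \<phi> s a b"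
  shows "finsum (C \<phi> s a b) (\<lambda>j. cl \<phi> s a b (g j)) F = cl \<phi> s a b (\<Sum>j\<in>F. g j)"
proof -
  have "g \<in> F \<rightarrow> K' \<phi> s a b" using assms(2) by blast
  then show ?thesis
    using mod_hom_finsum[OF cl_hom[of \<phi> s a b] module_xmod[OF psub_K'] module_C assms(1), of g]
    by (simp add: finsum_xmod[OF psub_K' assms(1)])
qed

lemma kosC_cl: "kosC \<phi> s a b (cl \<phi> s a b x) = cl \<phi> s (a - 1) b (kos x)"
  unfolding kosC_def
  by (rule quot_map_cls[OF psub_B' psub_B' plin_additive[OF plin_kos] kos_B'])

lemma W_simps:
  "carrier (W \<phi> s a b) = (\<Pi>\<^sub>E j\<in>{0..b}. carrier (C \<phi> s a j))"
  "\<zero>\<^bsub>W \<phi> s a b\<^esub> = (\<lambda>j\<in>{0..b}. B' \<phi> s a j)"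
  "x \<oplus>\<^bsub>W \<phi> s a b\<^esub> y = (\<lambda>j\<in>{0..b}. x j \<oplus>\<^bsub>C \<phi> s a j\<^esub> y j)"
  "p \<odot>\<^bsub>W \<phi> s a b\<^esub> x = (\<lambda>j\<in>{0..b}. p \<odot>\<^bsub>C \<phi> s a j\<^esub> x j)"
  by (simp_all add: W_def C_simps(2))

subsection \<open>The target complex\<close>

locale target_system = inverse_system \<phi> s t h
  for \<phi> :: "'n::{finite,linorder} mon \<Rightarrow>\<^sub>0 'k::field" and s t :: int
    and h :: "('n, 'k) xform \<Rightarrow> ('n, 'k) xform" +
  fixes \<pi> :: "('n, 'k) xform \<Rightarrow> ('n, 'k) xform" and \<theta> :: "('n, 'k) xform \<Rightarrow> ('n, 'k) xform"
  assumes pi_eps: "\<pi> (eps_dual t p) = pm p (\<pi> (eps_dual t 1))"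
    and plin_theta: "plin \<theta>"
    and theta_K': "\<theta> x \<in> K' \<phi> s (int CARD('n) - 1) t"
    and theta_cp: "\<theta> (cp t x) = 0"
    and theta_z0: "0 \<le> t \<Longrightarrow> cp t z0 + \<theta> z0 = \<pi> (eps_dual t 1)"
begin

text \<open>The representative in \<open>Hs\<close> of a class in $C_{a,b}$.\<close>

definition rr :: "int \<Rightarrow> int \<Rightarrow> ('n, 'k) xform set \<Rightarrow> ('n, 'k) xform" where
  "rr a b Y = q (SOME x. x \<in> K' \<phi> s a b \<and> Y = cl \<phi> s a b x)"

lemmas q_simps = plin_simps[OF plin_q] and theta_simps = plin_simps[OF plin_theta] and dH_simps = plin_simps[OF plin_dH]

text \<open>The choice inside \<open>rr\<close> does not matter: two representatives differ by a
  boundary, and \<open>q\<close> kills boundaries.\<close>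

lemma rr_cl:
  assumes b: "b < t" and x: "x \<in> K' \<phi> s a b"
  shows "rr a b (cl \<phi> s a b x) = q x"
proof -
  let ?P = "\<lambda>x'. x' \<in> K' \<phi> s a b \<and> cl \<phi> s a b x = cl \<phi> s a b x'"
  have "?P (SOME x'. ?P x')" by (rule someI[of ?P x]) (use x in simp)
  then have "x - (SOME x'. ?P x') \<in> B' \<phi> s a b" by (simp add: cls_eq_iff[OF psub_asub[OF psub_B']])
  then have "q (x - (SOME x'. ?P x')) = 0" by (rule q_B'[OF b])
  then show ?thesis unfolding rr_def by (simp add: q_simps)
qed

lemma cl_q: "b < t \<Longrightarrow> x \<in> K' \<phi> s a b \<Longrightarrow> cl \<phi> s a b (q x) = cl \<phi> s a b x"
proof -
  assume "b < t" "x \<in> K' \<phi> s a b"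
  then have "x - q x \<in> B' \<phi> s a b" by (rule diff_q_B')
  then have "cl \<phi> s a b x = cl \<phi> s a b (q x)" unfolding cls_eq_iff[OF psub_asub[OF psub_B']] .
  then show ?thesis ..
qed

lemma rr_cl_cp: "b < t \<Longrightarrow> x \<in> Hs a \<Longrightarrow> rr a b (cl \<phi> s a b (cp b x)) = cp b x"
  using rr_cl[of b "cp b x" a] Hs_cp_K'[of x a b] q_id[OF cp_Hs[of x a b]] by simp

lemma rr_props:
  assumes b: "b < t" and Y: "Y \<in> carrier (C \<phi> s a b)"
  shows "rr a b Y \<in> Hs a" "cp b (rr a b Y) = rr a b Y" "cl \<phi> s a b (rr a b Y) = Y"
proof -
  obtain x where x: "x \<in> K' \<phi> s a b" "Y = cl \<phi> s a b x" using Y unfolding C_simps by blast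
  have r: "rr a b Y = q x" unfolding x(2) by (rule rr_cl[OF b x(1)])
  show "rr a b Y \<in> Hs a" "cp b (rr a b Y) = rr a b Y" using q_K'[OF _ x(1)] b by (simp_all add: r)
  have "cl \<phi> s a b (rr a b Y) = cl \<phi> s a b x" unfolding r by (rule cl_q[OF b x(1)])
  then show "cl \<phi> s a b (rr a b Y) = Y" by (simp only: x(2))
qed

lemma rr_add:
  assumes b: "b < t" and Y: "Y \<in> carrier (C \<phi> s a b)" "Y' \<in> carrier (C \<phi> s a b)"
  shows "rr a b (Y \<oplus>\<^bsub>C \<phi> s a b\<^esub> Y') = rr a b Y + rr a b Y'"
proof -
  obtain x x' where x: "x \<in> K' \<phi> s a b" "Y = cl \<phi> s a b x" "x' \<in> K' \<phi> s a b" "Y' = cl \<phi> s a b x'"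
    using Y unfolding C_simps by blast
  show ?thesis
    unfolding x(2,4) C_simps rr_cl[OF b x(1)] rr_cl[OF b x(3)] rr_cl[OF b psub_add[OF psub_K' x(1,3)]]
    by (rule q_simps(1))
qed

lemma rr_smult:
  assumes b: "b < t" and Y: "Y \<in> carrier (C \<phi> s a b)"
  shows "rr a b (p \<odot>\<^bsub>C \<phi> s a b\<^esub> Y) = pm p (rr a b Y)"
proof -
  obtain x where x: "x \<in> K' \<phi> s a b" "Y = cl \<phi> s a b x"
    using Y unfolding C_simps by blast
  show ?thesis
    unfolding x(2) C_simps rr_cl[OF b x(1)] rr_cl[OF b psub_pm[OF psub_K' x(1)]]
    by (rule q_simps(6))
qed

text \<open>The representative of a family of classes that has no component of degree t; in this way
  W_{a,t-1} embeds into \<open>Hs a\<close>.\<close>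

definition hat :: "int \<Rightarrow> (int \<Rightarrow> ('n, 'k) xform set) \<Rightarrow> ('n, 'k) xform" where
  "hat a w = (\<Sum>j\<in>{0..t - 1}. rr a j (w j))"

lemma W_mem: "w \<in> carrier (W \<phi> s a (t - 1)) \<Longrightarrow> j \<in> {0..t - 1} \<Longrightarrow> w j \<in> carrier (C \<phi> s a j)"
  unfolding W_simps by (rule PiE_mem)

lemma hat_Hs: "w \<in> carrier (W \<phi> s a (t - 1)) \<Longrightarrow> hat a w \<in> Hs a"
  unfolding hat_def
proof (rule psub_sum[OF psub_Hs])
  fix j assume w: "w \<in> carrier (W \<phi> s a (t - 1))" "j \<in> {0..t - 1}"
  show "rr a j (w j) \<in> Hs a" by (rule rr_props(1)[OF _ W_mem[OF w]]) (use w in simp)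
qed

lemma cp_hat:
  assumes w: "w \<in> carrier (W \<phi> s a (t - 1))"
  shows "cp b (hat a w) = (if b \<in> {0..t - 1} then rr a b (w b) else 0)"
proof -
  have "cp b (hat a w) = (\<Sum>j\<in>{0..t - 1}. if j = b then rr a b (w b) else 0)"
    unfolding hat_def fx_simps
  proof (rule sum.cong[OF refl])
    fix j assume j: "j \<in> {0..t - 1}"
    have "cp j (rr a j (w j)) = rr a j (w j)" by (rule rr_props(2)[OF _ W_mem[OF w j]]) (use j in simp)
    note c = this
    show "cp b (rr a j (w j)) = (if j = b then rr a b (w b) else 0)"
    proof (cases "j = b")
      case True
      then show ?thesis using c by simp
    next
      case False
      have "cp b (cp j (rr a j (w j))) = 0" using False by (subst cp_cp) simp
      then show ?thesis using False by (simp only: c if_False)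
    qed
  qed
  then show ?thesis by simp
qed

lemma hat_add:
  assumes w: "w \<in> carrier (W \<phi> s a (t - 1))" "w' \<in> carrier (W \<phi> s a (t - 1))"
  shows "hat a (w \<oplus>\<^bsub>W \<phi> s a (t - 1)\<^esub> w') = hat a w + hat a w'"
  unfolding hat_def sum.distrib[symmetric]
proof (rule sum.cong[OF refl])
  fix j assume j: "j \<in> {0..t - 1}"
  show "rr a j ((w \<oplus>\<^bsub>W \<phi> s a (t - 1)\<^esub> w') j) = rr a j (w j) + rr a j (w' j)"
    using rr_add[OF _ W_mem[OF w(1) j] W_mem[OF w(2) j]] j by (simp add: W_simps)
qed

lemma hat_smult:
  assumes w: "w \<in> carrier (W \<phi> s a (t - 1))"
  shows "hat a (p \<odot>\<^bsub>W \<phi> s a (t - 1)\<^esub> w) = pm p (hat a w)"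
  unfolding hat_def additive_fn_sum[OF additive_pm]
proof (rule sum.cong[OF refl])
  fix j assume j: "j \<in> {0..t - 1}"
  show "rr a j ((p \<odot>\<^bsub>W \<phi> s a (t - 1)\<^esub> w) j) = pm p (rr a j (w j))"
    using rr_smult[OF _ W_mem[OF w j]] j by (simp add: W_simps)
qed

text \<open>Only the boundary of the top generator has to be adjusted, so the twist is confined to
  wedge degree n - 1.\<close>

definition th :: "int \<Rightarrow> ('n, 'k) xform \<Rightarrow> ('n, 'k) xform" where
  "th a x = (if a = int CARD('n) - 1 then \<theta> x else 0)"

lemma plin_th: "plin (th a)"
  unfolding th_def[abs_def] by (cases "a = int CARD('n) - 1") (simp_all add: plin_theta plin_0)

lemmas th_simps = plin_simps[OF plin_th]

lemma th_K': "th a x \<in> K' \<phi> s a t"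
  unfolding th_def using theta_K' psub_0[OF psub_K'] by auto

lemma th_cp: "th a (cp t x) = 0"
  by (simp add: th_def theta_cp)

lemma th_K'_0: "y \<in> K' \<phi> s b t \<Longrightarrow> th a y = 0"
  using th_cp[of a y] by (simp add: K'_iff)

text \<open>The identification of \<open>Hs a\<close> with $K'_{a,t} \oplus W_{a,t-1}$, twisted by \<open>\<theta>\<close> in the top degree.\<close>

definition J :: "int \<Rightarrow> ('n, 'k) xform \<Rightarrow> ('n, 'k) xform \<times> (int \<Rightarrow> ('n, 'k) xform set)" where
  "J a x = (cp t x + th a x, \<lambda>j\<in>{0..t - 1}. cl \<phi> s a j (cp j x))"

abbreviation U :: "int \<Rightarrow> (('n, 'k) pol, ('n, 'k) xform \<times> (int \<Rightarrow> ('n, 'k) xform set)) module" where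
  "U a \<equiv> dsum (xmod (K' \<phi> s a t)) (W \<phi> s a (t - 1))"

lemma J_U: "x \<in> Hs a \<Longrightarrow> J a x \<in> carrier (U a)"
  unfolding J_def dsum_simps W_simps C_simps xmod_simps
  by (auto intro!: psub_add[OF psub_K'] th_K' imageI Hs_cp_K')

lemma J_add: "J a (x + y) = J a x \<oplus>\<^bsub>U a\<^esub> J a y"
  unfolding J_def dsum_simps xmod_simps W_simps by (auto simp: fx_simps th_simps C_simps intro!: restrict_ext)

lemma J_smult: "J a (pm p x) = p \<odot>\<^bsub>U a\<^esub> J a x"
  unfolding J_def dsum_simps xmod_simps W_simps by (auto simp: fx_simps th_simps C_simps additive_fn_add[OF additive_pm] intro!: restrict_ext)

lemma J_0: "J a 0 = \<zero>\<^bsub>U a\<^esub>"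
  unfolding J_def dsum_simps xmod_simps W_simps by (simp add: fx_simps th_simps cls_0)

lemma sum_cp_below:
  assumes x: "x \<in> T a"
  shows "(\<Sum>j\<in>{0..t - 1}. cp j x) = x - cp t x"
proof (cases "0 \<le> t")
  case True
  then have "{0..t} = insert t {0..t - 1}" by auto
  then have "(\<Sum>j\<in>{0..t}. cp j x) = cp t x + (\<Sum>j\<in>{0..t - 1}. cp j x)" by simp
  then have "x = cp t x + (\<Sum>j\<in>{0..t - 1}. cp j x)" by (simp only: sum_cp[OF x])
  from this[symmetric] show ?thesis by (simp add: eq_diff_eq add.commute)
next
  case False
  then have "x = 0" using T_neg_t[OF x] by simp
  then show ?thesis using False by (simp add: fx_simps)
qed

lemma hat_J: "x \<in> Hs a \<Longrightarrow> hat a (snd (J a x)) = x - cp t x"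
proof -
  assume x: "x \<in> Hs a"
  have "hat a (snd (J a x)) = (\<Sum>j\<in>{0..t - 1}. cp j x)"
    unfolding hat_def J_def by (rule sum.cong[OF refl]) (simp add: rr_cl_cp[OF _ x])
  then show ?thesis by (simp add: sum_cp_below[OF Hs_T[OF x]])
qed

text \<open>\<theta> vanishes on K'_{a,t}, so the twist is determined by the component in W and can
  be subtracted again.\<close>

definition Ji :: "int \<Rightarrow> ('n, 'k) xform \<times> (int \<Rightarrow> ('n, 'k) xform set) \<Rightarrow> ('n, 'k) xform" where
  "Ji a u = fst u - th a (hat a (snd u)) + hat a (snd u)"

lemma Ji_J: "x \<in> Hs a \<Longrightarrow> Ji a (J a x) = x"
  unfolding Ji_def hat_J by (simp add: J_def th_simps th_cp)

lemma J_Ji: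
  assumes u: "u \<in> carrier (U a)"
  shows "Ji a u \<in> Hs a" "J a (Ji a u) = u"
proof -
  obtain y w where yw: "u = (y, w)" "y \<in> K' \<phi> s a t" "w \<in> carrier (W \<phi> s a (t - 1))"
    using u by auto
  define z where "z = y - th a (hat a w)"
  have z: "z \<in> K' \<phi> s a t" unfolding z_def by (rule psub_diff[OF psub_K' yw(2) th_K'])
  have eq: "Ji a u = z + hat a w" by (simp add: Ji_def yw(1) z_def)
  show "Ji a u \<in> Hs a" unfolding eq by (rule psub_add[OF psub_Hs K't_Hs[OF z] hat_Hs[OF yw(3)]])
  have cz: "cp j z = (if j = t then z else 0)" for j
    using z by (intro cp_ext_D'[of _ a]) (simp add: K'_def)
  have "cp t (Ji a u) + th a (Ji a u) = y"
    by (simp add: eq fx_simps cz cp_hat[OF yw(3)] th_simps th_K'_0[OF z]) (simp add: z_def)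
  moreover have "(\<lambda>j\<in>{0..t - 1}. cl \<phi> s a j (cp j (Ji a u))) = w"
  proof
    fix j
    show "(\<lambda>j\<in>{0..t - 1}. cl \<phi> s a j (cp j (Ji a u))) j = w j"
    proof (cases "j \<in> {0..t - 1}")
      case True
      then have "j \<noteq> t" "j < t" by auto
      then have "cp j (Ji a u) = rr a j (w j)" using True by (simp add: eq fx_simps cz cp_hat[OF yw(3)])
      then show ?thesis using True rr_props(3)[OF \<open>j < t\<close> W_mem[OF yw(3) True]] by simp
    next
      case False
      then have "w j = undefined" using yw(3) unfolding W_simps by (rule PiE_arb[rotated])
      then show ?thesis using False by (simp only: restrict_apply if_False)
    qed
  qed
  ultimately show "J a (Ji a u) = u" by (simp add: J_def yw(1))
qed

lemma J_image: "J a ` Hs a = carrier (U a)"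
proof (intro Set.set_eqI iffI)
  fix u assume "u \<in> carrier (U a)"
  then show "u \<in> J a ` Hs a" using J_Ji[of u a] by (metis imageI)
next
  fix u assume "u \<in> J a ` Hs a"
  then show "u \<in> carrier (U a)" using J_U by blast
qed

lemma module_U: "module PR (U a)"
  by (rule module_surj[OF module_xmod[OF psub_Hs[of a]], where j = "J a"])
     (simp_all only: J_image J_add J_smult J_0 xmod_simps)

text \<open>The entries left open in the statement are the blocks of \<open>dH\<close> transported
  along \<open>J\<close>. The last term of \<sigma> compensates the twist of its source; it is 0
  except in degree n - 1.\<close>

definition \<sigma> :: "int \<Rightarrow> (int \<Rightarrow> ('n, 'k) xform set) \<Rightarrow> ('n, 'k) xform" where
  "\<sigma> a w = cp t (dH (hat a w)) - kos (th a (hat a w))"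

definition \<tau> :: "int \<Rightarrow> int \<Rightarrow> int \<Rightarrow> ('n, 'k) xform set \<Rightarrow> ('n, 'k) xform set" where
  "\<tau> a j j' Y = cl \<phi> s (a - 1) j' (cp j' (dH (rr a j Y)))"

definition \<omega> :: "('n, 'k) pol \<Rightarrow> int \<Rightarrow> ('n, 'k) xform set" where
  "\<omega> p = snd (J (int CARD('n) - 1) (pm p z0))"

lemma star_maps_target: "star_maps \<phi> s t \<omega> \<sigma> \<tau>"
  unfolding star_maps_def
proof (intro conjI ballI impI)
  have JU: "J a (pm p z0) \<in> carrier (U a)" if "a = int CARD('n) - 1" for a p
    unfolding that by (rule J_U[OF psub_pm[OF psub_Hs z0_Hs]])
  show "\<omega> \<in> mod_hom PR pol_mod (W \<phi> s (int CARD('n) - 1) (t - 1))"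
  proof (rule mod_homI)
    show "\<omega> p \<in> carrier (W \<phi> s (int CARD('n) - 1) (t - 1))" for p
      using JU[OF refl, of p] unfolding \<omega>_def dsum_simps by (rule mem_Times_iff[THEN iffD1, THEN conjunct2])
    show "\<omega> (x \<oplus>\<^bsub>pol_mod\<^esub> y) = \<omega> x \<oplus>\<^bsub>W \<phi> s (int CARD('n) - 1) (t - 1)\<^esub> \<omega> y" for x y
      unfolding \<omega>_def pol_mod_simps additive_fn_add[OF additive_pm_left] J_add dsum_simps by simp
    show "\<omega> (r \<odot>\<^bsub>pol_mod\<^esub> x) = r \<odot>\<^bsub>W \<phi> s (int CARD('n) - 1) (t - 1)\<^esub> \<omega> x" for r x
      unfolding \<omega>_def pol_mod_simps pm_pm[symmetric] J_smult dsum_simps by simp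
  qed
next
  fix i assume "i \<in> {1..int CARD('n) - 1}"
  show "\<sigma> i \<in> mod_hom PR (W \<phi> s i (t - 1)) (xmod (K' \<phi> s (i - 1) t))"
  proof (rule mod_homI)
    fix w assume w: "w \<in> carrier (W \<phi> s i (t - 1))"
    show "\<sigma> i w \<in> carrier (xmod (K' \<phi> s (i - 1) t))"
      unfolding \<sigma>_def xmod_simps
      by (rule psub_diff[OF psub_K' Hs_cp_K'[OF dH_Hs[OF hat_Hs[OF w]] order_refl] kos_K'[OF th_K']])
    show "\<sigma> i (r \<odot>\<^bsub>W \<phi> s i (t - 1)\<^esub> w) = r \<odot>\<^bsub>xmod (K' \<phi> s (i - 1) t)\<^esub> \<sigma> i w" for r
      unfolding \<sigma>_def hat_smult[OF w] xmod_simps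
      by (simp add: dH_simps fx_simps th_simps kos_simps additive_fn_diff[OF additive_pm])
    fix w' assume w': "w' \<in> carrier (W \<phi> s i (t - 1))"
    show "\<sigma> i (w \<oplus>\<^bsub>W \<phi> s i (t - 1)\<^esub> w') = \<sigma> i w \<oplus>\<^bsub>xmod (K' \<phi> s (i - 1) t)\<^esub> \<sigma> i w'"
      unfolding \<sigma>_def hat_add[OF w w'] xmod_simps
      by (simp add: dH_simps fx_simps th_simps kos_simps)
  qed
next
  fix i j j' assume ij: "i \<in> {1..int CARD('n) - 1}" "j \<in> {0..t - 1}" "j' \<in> {0..t - 1}" "j < j'"
  then have jt: "j < t" "j' \<le> t" by auto
  show "\<tau> i j j' \<in> mod_hom PR (C \<phi> s i j) (C \<phi> s (i - 1) j')"
  proof (rule mod_homI)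
    fix Y assume Y: "Y \<in> carrier (C \<phi> s i j)"
    show "\<tau> i j j' Y \<in> carrier (C \<phi> s (i - 1) j')"
      unfolding \<tau>_def C_simps(1)
      by (intro imageI Hs_cp_K'[OF dH_Hs[OF rr_props(1)[OF jt(1) Y]] jt(2)])
    show "\<tau> i j j' (r \<odot>\<^bsub>C \<phi> s i j\<^esub> Y) = r \<odot>\<^bsub>C \<phi> s (i - 1) j'\<^esub> \<tau> i j j' Y" for r
      unfolding \<tau>_def rr_smult[OF jt(1) Y] C_simps by (simp add: dH_simps fx_simps)
    fix Y' assume Y': "Y' \<in> carrier (C \<phi> s i j)"
    show "\<tau> i j j' (Y \<oplus>\<^bsub>C \<phi> s i j\<^esub> Y') = \<tau> i j j' Y \<oplus>\<^bsub>C \<phi> s (i - 1) j'\<^esub> \<tau> i j j' Y'"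
      unfolding \<tau>_def rr_add[OF jt(1) Y Y'] C_simps by (simp add: dH_simps fx_simps)
  qed
qed

text \<open>By triangularity, components of degree above j' contribute nothing to degree j'; the
  component of degree j' gives the map induced by \<open>kos\<close>, and the lower ones give
  \<tau>.\<close>

lemma W_diff_J:
  assumes x: "x \<in> Hs a"
  shows "W_diff \<phi> s t \<tau> a (snd (J a x)) = snd (J (a - 1) (dH x))"
proof
  fix j'
  show "W_diff \<phi> s t \<tau> a (snd (J a x)) j' = snd (J (a - 1) (dH x)) j'"
  proof (cases "j' \<in> {0..t - 1}")
    case False
    then show ?thesis by (simp only: W_diff_def J_def snd_conv restrict_apply if_False)
  next
    case True
    then have j': "j' < t" "0 \<le> j'" by auto
    have K: "cp j' (dH (cp j x)) \<in> K' \<phi> s (a - 1) j'" for j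
      using j' by (intro Hs_cp_K'[OF dH_Hs[OF cp_Hs[OF x]]]) simp
    have "finsum (C \<phi> s (a - 1) j') (\<lambda>j. \<tau> a j j' (snd (J a x) j)) {0..<j'} =
        finsum (C \<phi> s (a - 1) j') (\<lambda>j. cl \<phi> s (a - 1) j' (cp j' (dH (cp j x)))) {0..<j'}"
    proof (rule abelian_monoid.finsum_cong'[OF _ refl])
      show "abelian_monoid (C \<phi> s (a - 1) j')"
        using module_C[of \<phi> s "a - 1" j'] by (simp add: module_def abelian_group_def)
      show "(\<lambda>j. cl \<phi> s (a - 1) j' (cp j' (dH (cp j x)))) \<in> {0..<j'} \<rightarrow> carrier (C \<phi> s (a - 1) j')"
        unfolding C_simps using K by blast
      fix j assume "j \<in> {0..<j'}"
      then have "j \<in> {0..t - 1}" "j < t" using j' by auto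
      then show "\<tau> a j j' (snd (J a x) j) = cl \<phi> s (a - 1) j' (cp j' (dH (cp j x)))"
        by (simp add: \<tau>_def J_def rr_cl_cp[OF _ x])
    qed
    also have "\<dots> = cl \<phi> s (a - 1) j' (\<Sum>j\<in>{0..<j'}. cp j' (dH (cp j x)))"
      by (rule finsum_cl) (simp_all add: K)
    finally have "W_diff \<phi> s t \<tau> a (snd (J a x)) j' =
        cl \<phi> s (a - 1) j' (kos (cp j' x) + (\<Sum>j\<in>{0..<j'}. cp j' (dH (cp j x))))"
      using True by (simp add: W_diff_def J_def kosC_cl C_simps)
    \<comment> \<open>Since j' < t, applying \<open>q\<close> does not change the class.\<close>
    also have "\<dots> = cl \<phi> s (a - 1) j' (q (kos (cp j' x)) + (\<Sum>j\<in>{0..<j'}. cp j' (dH (cp j x))))"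
    proof -
      have "cp j' x \<in> K' \<phi> s a j'" using j' by (intro Hs_cp_K'[OF x]) simp
      then show ?thesis
        using cl_q[OF j'(1) kos_K'] by (simp only: C_simps(3)[symmetric])
    qed
    also have "q (kos (cp j' x)) + (\<Sum>j\<in>{0..<j'}. cp j' (dH (cp j x))) = cp j' (dH x)"
    proof -
      have split: "{0..t} = {0..<j'} \<union> {j'} \<union> {j'<..t}" using j' by auto
      have "cp j' (dH x) = cp j' (dH (\<Sum>j\<in>{0..t}. cp j x))" by (simp only: sum_cp[OF Hs_T[OF x]])
      also have "\<dots> = (\<Sum>j\<in>{0..t}. cp j' (dH (cp j x)))" by (simp add: dH_simps fx_simps)
      also have "\<dots> = (\<Sum>j\<in>{0..<j'}. cp j' (dH (cp j x))) + cp j' (dH (cp j' x)) + (\<Sum>j\<in>{j'<..t}. cp j' (dH (cp j x)))"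
        unfolding split by (subst sum.union_disjoint, simp, simp, force)+ simp
      also have "cp j' (dH (cp j' x)) = q (kos (cp j' x))"
        by (rule cp_dH_self[OF cp_Hs[OF x]]) (simp add: cp_cp)
      also have "(\<Sum>j\<in>{j'<..t}. cp j' (dH (cp j x))) = 0"
        by (rule sum.neutral) (auto intro!: cp_dH_below[OF cp_Hs[OF x]] simp: cp_cp)
      finally show ?thesis by (simp add: add.commute)
    qed
    also have "cl \<phi> s (a - 1) j' (cp j' (dH x)) = snd (J (a - 1) (dH x)) j'"
      using True by (simp add: J_def)
    finally show ?thesis .
  qed
qed

text \<open>The bound on a keeps the value of the differential below the twisted degree n -
  1.\<close>

lemma K'_diff_J:
  assumes x: "x \<in> Hs a" and a: "a \<le> int CARD('n) - 1"
  shows "kos (fst (J a x)) + \<sigma> a (snd (J a x)) = fst (J (a - 1) (dH x))"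
proof -
  have t: "th (a - 1) (dH x) = 0" using a by (simp add: th_def)
  have "dH (cp t x) = kos (cp t x)" by (rule dH_K't[OF Hs_cp_K'[OF x order_refl]])
  then have "cp t (dH (cp t x)) = kos (cp t x)" by (simp add: cp_kos cp_cp)
  then show ?thesis
    unfolding \<sigma>_def hat_J[OF x]
    by (simp add: J_def t th_simps th_cp kos_simps dH_simps fx_simps)
qed

text \<open>In degree n the representatives are the multiples of \<open>e1\<close>, and the
  multiplier is the coordinate. The module structure, the complex property and exactness of the
  target are all transported along \<open>JT\<close>.\<close>

definition JT :: "int \<Rightarrow> ('n, 'k) xform \<Rightarrow> ('n, 'k) tgt" where
  "JT i x = (if i \<le> int CARD('n) - 1 then (J i x, 0) else (\<zero>\<^bsub>U i\<^esub>, lk (lk x UNIV) 0))"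

abbreviation Tg :: "int \<Rightarrow> (('n, 'k) pol, ('n, 'k) tgt) module" where
  "Tg \<equiv> target \<phi> s t"

abbreviation Td :: "int \<Rightarrow> ('n, 'k) tgt \<Rightarrow> ('n, 'k) tgt" where
  "Td \<equiv> target_diff \<phi> s t \<pi> \<omega> \<sigma> \<tau>"

lemma Hs_trivial: "i < 0 \<or> int CARD('n) < i \<or> t < 0 \<Longrightarrow> x \<in> Hs i \<Longrightarrow> x = 0"
proof -
  assume i: "i < 0 \<or> int CARD('n) < i \<or> t < 0" and x: "x \<in> Hs i"
  have "x = 0" if "i < 0"
  proof (rule poly_mapping_eqI)
    fix S
    show "lk x S = lk 0 S" using T_lk[OF Hs_T[OF x], of S] that by (cases "lk x S = 0") simp_all
  qed
  then show "x = 0" using i T_gt[OF Hs_T[OF x]] T_neg_t[OF Hs_T[OF x]] by blast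
qed

lemma JT_0: "JT i 0 = \<zero>\<^bsub>Tg i\<^esub>"
  unfolding JT_def J_0 by (simp add: target_def)

lemma JT_add: "JT i (x + y) = JT i x \<oplus>\<^bsub>Tg i\<^esub> JT i y"
proof -
  interpret U: module PR "U i" by (rule module_U)
  have "\<zero>\<^bsub>U i\<^esub> \<oplus>\<^bsub>U i\<^esub> \<zero>\<^bsub>U i\<^esub> = \<zero>\<^bsub>U i\<^esub>" by (rule U.r_zero) (rule U.zero_closed)
  then show ?thesis
    unfolding JT_def J_add target_def dsum_simps(2) if_module_simps pol_mod_simps by (simp add: lookup_add)
qed

lemma JT_smult: "JT i (pm p x) = p \<odot>\<^bsub>Tg i\<^esub> JT i x"
proof -
  interpret U: module PR "U i" by (rule module_U)
  have "p \<odot>\<^bsub>U i\<^esub> \<zero>\<^bsub>U i\<^esub> = \<zero>\<^bsub>U i\<^esub>" by (rule U.smult_r_null) simp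
  then show ?thesis
    unfolding JT_def J_smult target_def dsum_simps(4) if_module_simps pol_mod_simps by simp
qed

lemma JT_image: "JT i ` Hs i = carrier (Tg i)"
proof -
  consider "0 \<le> i \<and> i \<le> int CARD('n) - 1" | "i = int CARD('n) \<and> 0 \<le> t" | "i < 0 \<or> int CARD('n) < i \<or> (i = int CARD('n) \<and> t < 0)"
    by linarith
  then show ?thesis
  proof cases
    case 1
    then have "carrier (Tg i) = carrier (U i) \<times> {0}" by (simp add: target_def)
    moreover have "JT i = (\<lambda>x. (J i x, 0))" using 1 by (simp add: JT_def fun_eq_iff)
    ultimately show ?thesis unfolding J_image[symmetric] by auto
  next
    case 2
    then have c: "carrier (Tg i) = {\<zero>\<^bsub>U i\<^esub>} \<times> UNIV" by (simp add: target_def)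
    have JT: "JT i x = (\<zero>\<^bsub>U i\<^esub>, lk (lk x UNIV) 0)" for x using 2 by (simp add: JT_def)
    have "(\<zero>\<^bsub>U i\<^esub>, p) \<in> JT i ` Hs i" for p
    proof (rule image_eqI)
      show "(\<zero>\<^bsub>U i\<^esub>, p) = JT i (pm p e1)" unfolding JT lk_pm_e1 ..
      show "pm p e1 \<in> Hs i" using 2 psub_pm[OF psub_Hs e1_Hs] by simp
    qed
    then show ?thesis unfolding c using JT by auto
  next
    case 3
    then have "Hs i = {0}" using Hs_trivial[of i] psub_0[OF psub_Hs] by blast
    moreover have "carrier (Tg i) = {\<zero>\<^bsub>Tg i\<^esub>}" using 3 by (auto simp: target_def)
    ultimately show ?thesis by (simp add: JT_0)
  qed
qed

lemma JT_inj: "inj_on (JT i) (Hs i)"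
proof (rule inj_onI)
  fix x y assume x: "x \<in> Hs i" and y: "y \<in> Hs i" and eq: "JT i x = JT i y"
  show "x = y"
  proof (cases "i \<le> int CARD('n) - 1")
    case True
    then have "J i x = J i y" using eq by (simp add: JT_def)
    then show ?thesis using Ji_J[OF x] Ji_J[OF y] by metis
  next
    case False
    then have l: "lk (lk x UNIV) 0 = lk (lk y UNIV) 0" using eq by (simp add: JT_def)
    show ?thesis
    proof (cases "i = int CARD('n)")
      case True
      have "x = pm (lk (lk x UNIV) 0) e1" "y = pm (lk (lk y UNIV) 0) e1"
        using Hs_top x y unfolding True by blast+
      then show ?thesis using l by metis
    next
      case False
      then have "int CARD('n) < i" using \<open>\<not> i \<le> int CARD('n) - 1\<close> by simp
      then show ?thesis using Hs_trivial x y by metis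
    qed
  qed
qed

text \<open>In degrees 1 to n - 1 the blocks are assembled; in degree n the choice of \<theta> makes
  the boundary of the generator the one that \<pi> prescribes.\<close>

lemma Td_JT:
  assumes x: "x \<in> Hs i"
  shows "Td i (JT i x) = JT (i - 1) (dH x)"
proof -
  consider "1 \<le> i \<and> i \<le> int CARD('n) - 1" | "i = int CARD('n)" | "i < 1 \<or> int CARD('n) < i"
    by linarith
  then show ?thesis
  proof cases
    case 1
    obtain y w where yw: "J i x = (y, w)" by (cases "J i x")
    have "Td i (JT i x) = ((kos y + \<sigma> i w, W_diff \<phi> s t \<tau> i w), 0)"
      using 1 by (simp add: target_diff_def JT_def yw)
    also have "\<dots> = (J (i - 1) (dH x), 0)"
      using K'_diff_J[OF x] W_diff_J[OF x] 1 by (simp add: yw prod_eq_iff)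
    finally show ?thesis using 1 by (simp add: JT_def)
  next
    case 2
    define p where "p = lk (lk x UNIV) 0"
    have xp: "x = pm p e1" unfolding p_def using Hs_top x unfolding 2 by blast
    have dx: "dH x = pm p z0"
    proof (cases "0 \<le> t")
      case True
      then show ?thesis by (simp add: xp dH_simps z0_def)
    next
      case False
      then have "x = 0" using Hs_trivial[OF _ x] by simp
      then show ?thesis using False by (simp add: z0_def dH_simps)
    qed
    have "\<pi> (eps_dual t p) = cp t (pm p z0) + \<theta> (pm p z0)"
    proof (cases "0 \<le> t")
      case True
      show ?thesis
        unfolding pi_eps[of p] theta_z0[OF True, symmetric] by (simp add: fx_simps theta_simps additive_fn_add[OF additive_pm])
    next
      case False
      then have "p = 0" using Hs_trivial[OF _ x] by (simp add: p_def)
      then show ?thesis using pi_eps[of 0] by (simp add: fx_simps theta_simps)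
    qed
    then have "(\<pi> (eps_dual t p), \<omega> p) = J (int CARD('n) - 1) (pm p z0)"
      by (simp add: \<omega>_def J_def th_def)
    moreover have "JT i x = (\<zero>\<^bsub>U i\<^esub>, p)" using 2 by (simp add: JT_def p_def)
    ultimately have "Td i (JT i x) = (J (int CARD('n) - 1) (pm p z0), 0)"
      using 2 by (simp add: target_diff_def)
    then show ?thesis using 2 by (simp add: JT_def dx)
  next
    case 3
    have "dH x = 0"
    proof (cases "int CARD('n) < i")
      case True
      then have "x = 0" using Hs_trivial[OF _ x] by simp
      then show ?thesis by (simp add: dH_simps)
    next
      case False
      then show ?thesis using 3 Hs_trivial[OF _ dH_Hs[OF x]] by simp
    qed
    moreover have "Td i u = \<zero>\<^bsub>Tg (i - 1)\<^esub>" for u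
      using 3 by (auto simp: target_diff_def case_prod_unfold)
    ultimately show ?thesis by (simp only: JT_0)
  qed
qed

lemma module_Tg: "module PR (Tg i)"
  by (rule module_surj[OF module_xmod[OF psub_Hs[of i]], where j = "JT i"])
     (simp_all only: JT_image JT_add JT_smult JT_0 xmod_simps)

lemma Tg_cases:
  assumes "u \<in> carrier (Tg i)"
  obtains x where "x \<in> Hs i" "u = JT i x"
  using assms unfolding JT_image[symmetric] by blast

lemma JT_Tg: "x \<in> Hs i \<Longrightarrow> JT i x \<in> carrier (Tg i)"
  unfolding JT_image[symmetric] by (rule imageI)

lemma JT_eq_0: "x \<in> Hs i \<Longrightarrow> JT i x = \<zero>\<^bsub>Tg i\<^esub> \<Longrightarrow> x = 0"
  unfolding JT_0[symmetric] by (rule inj_onD[OF JT_inj _ _ psub_0[OF psub_Hs]])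

lemma target_complex: "is_complex PR Tg Td"
  unfolding is_complex_def
proof (intro allI conjI ballI)
  fix i
  show "module PR (Tg i)" by (rule module_Tg)
  show "Td i \<in> mod_hom PR (Tg i) (Tg (i - 1))"
  proof (rule mod_homI)
    fix u assume "u \<in> carrier (Tg i)"
    then obtain x where x: "x \<in> Hs i" "u = JT i x" by (rule Tg_cases)
    show "Td i u \<in> carrier (Tg (i - 1))" unfolding x(2) Td_JT[OF x(1)] by (rule JT_Tg[OF dH_Hs[OF x(1)]])
    show "Td i (r \<odot>\<^bsub>Tg i\<^esub> u) = r \<odot>\<^bsub>Tg (i - 1)\<^esub> Td i u" for r
      unfolding x(2) JT_smult[symmetric] Td_JT[OF x(1)] Td_JT[OF psub_pm[OF psub_Hs x(1)]] dH_simps ..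
    fix u' assume "u' \<in> carrier (Tg i)"
    then obtain x' where x': "x' \<in> Hs i" "u' = JT i x'" by (rule Tg_cases)
    show "Td i (u \<oplus>\<^bsub>Tg i\<^esub> u') = Td i u \<oplus>\<^bsub>Tg (i - 1)\<^esub> Td i u'"
      unfolding x(2) x'(2) JT_add[symmetric] Td_JT[OF x(1)] Td_JT[OF x'(1)] Td_JT[OF psub_add[OF psub_Hs x(1) x'(1)]] dH_simps ..
  qed
  fix u assume "u \<in> carrier (Tg i)"
  then obtain x where x: "x \<in> Hs i" "u = JT i x" by (rule Tg_cases)
  show "Td (i - 1) (Td i u) = \<zero>\<^bsub>Tg (i - 2)\<^esub>"
    unfolding x(2) Td_JT[OF x(1)] Td_JT[OF dH_Hs[OF x(1)]] dH_dH[OF x(1)] JT_0 by simp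
qed

lemma target_exact:
  assumes i: "1 \<le> i" and u: "u \<in> carrier (Tg i)" and du: "Td i u = \<zero>\<^bsub>Tg (i - 1)\<^esub>"
  shows "\<exists>v\<in>carrier (Tg (i + 1)). Td (i + 1) v = u"
proof -
  obtain x where x: "x \<in> Hs i" "u = JT i x" using u by (rule Tg_cases)
  have "dH x = 0" using du unfolding x(2) Td_JT[OF x(1)] by (rule JT_eq_0[OF dH_Hs[OF x(1)]])
  then obtain y where y: "y \<in> Hs (i + 1)" "dH y = x" using dH_exact[OF i x(1)] by blast
  have "Td (i + 1) (JT (i + 1) y) = u" using Td_JT[OF y(1)] y(2) x(2) by simp
  then show ?thesis using JT_Tg[OF y(1)] by blast
qed

end

subsection \<open>The source complex\<close>

lemma mem_source:
  fixes x :: "('n::{finite,linorder}, 'k::field) pol \<times> ('n, 'k) xform"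
  shows "x \<in> carrier (source m i) \<longleftrightarrow>
    (i \<noteq> -1 \<longrightarrow> fst x = 0) \<and> (if 0 \<le> i \<and> i \<le> int CARD('n) - 1 then snd x \<in> L i m else snd x = 0)"
  by (cases x) (auto simp: source_def)

lemma source_simps:
  "x \<oplus>\<^bsub>source m i\<^esub> y = (fst x + fst y, snd x + snd y)" "\<zero>\<^bsub>source m i\<^esub> = (0, 0)"
  "p \<odot>\<^bsub>source m i\<^esub> x = (p * fst x, pm p (snd x))"
  by (simp_all add: source_def)

lemma module_source: "module PR (source m i)"
  unfolding source_def by (intro module_dsum module_if module_pol_mod module_xmod psub_L)

lemma source_L: "x \<in> carrier (source m i) \<Longrightarrow> snd x \<in> L i m"
  unfolding mem_source by (auto simp: psub_0[OF psub_L] split: if_splits)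

lemma L_below:
  fixes w :: "('n::{finite,linorder}, 'k::field) xform"
  assumes "w \<in> L i m" "i < 0"
  shows "w = 0"
proof (rule poly_mapping_eqI, rule poly_mapping_eqI)
  fix S :: "'n set" and u :: "'n mon"
  have "\<not> (int (mdeg u) = m \<and> int (card S) = i)" using assms by simp
  then show "lk (lk w S) u = lk (lk 0 S) u"
    using assms(1) unfolding L_iff ext_homog_iff lookup_zero by blast
qed

text \<open>In wedge degree n a single term of \<open>kappa\<close> reaches a set missing one index,
  and multiplication by a variable is injective.\<close>

lemma L_top:
  fixes w :: "('n::{finite,linorder}, 'k::field) xform"
  assumes w: "w \<in> L i m" and i: "int CARD('n) \<le> i"
  shows "w = 0"
proof (rule poly_mapping_eqI, rule poly_mapping_eqI)
  fix S :: "'n set" and u :: "'n mon"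
  have supp: "lk (lk w S) u \<noteq> 0 \<Longrightarrow> int (card S) = i" using w unfolding L_iff ext_homog_iff by blast
  show "lk (lk w S) u = lk (lk 0 S) u"
  proof (cases "S = UNIV")
    case True
    \<comment> \<open>Types are nonempty, so there is at least one variable.\<close>
    obtain l :: 'n where True by blast
    have "lk (lk (kappa w) (UNIV - {l})) (u + evar l) = 0" using w by (simp add: L_iff)
    then have "lk (lk w UNIV) u = 0"
      by (simp add: lk_kappa kz_top lookup_sg lk_Xvar_mult lookup_add lookup_evar evar_plus_minus)
    then show ?thesis using True by simp
  next
    case False
    then have "card S < CARD('n)" by (intro psubset_card_mono) auto
    then have "int (card S) \<noteq> i" using i by simp
    then show ?thesis using supp by auto
  qed
qed

lemma source_complex: "is_complex PR (source m) (source_diff :: int \<Rightarrow> ('n::{finite,linorder}, 'k::field) pol \<times> ('n, 'k) xform \<Rightarrow> _)"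
  unfolding is_complex_def
proof (intro allI conjI ballI)
  fix i
  show "module PR (source m i :: (('n, 'k) pol, _) module)" by (rule module_source)
  have sd: "source_diff i x = (if i = 0 then eps (lk (snd x) {}) else 0, kos (snd x))" for i and x :: "('n, 'k) pol \<times> ('n, 'k) xform"
    by (simp add: source_diff_def case_prod_unfold)
  have mem: "source_diff i x \<in> carrier (source m (i - 1))" if x: "x \<in> carrier (source m i)" for i and x :: "('n, 'k) pol \<times> ('n, 'k) xform"
  proof -
    have k: "kos (snd x) \<in> L (i - 1) m" by (rule kos_L[OF source_L[OF x]])
    have "kos (snd x) = 0" if "\<not> (0 \<le> i - 1 \<and> i - 1 \<le> int CARD('n) - 1)"
    proof (cases "i - 1 < 0")
      case True
      then show ?thesis using L_below[OF k] by simp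
    next
      case False
      then have "int CARD('n) \<le> i - 1" using that by simp
      then show ?thesis by (rule L_top[OF k])
    qed
    then show ?thesis using k unfolding mem_source sd by simp
  qed
  show "source_diff i \<in> mod_hom PR (source m i) (source m (i - 1) :: (('n, 'k) pol, _) module)"
  proof (rule mod_homI)
    show "source_diff i x \<in> carrier (source m (i - 1))" if "x \<in> carrier (source m i)" for x :: "('n, 'k) pol \<times> ('n, 'k) xform"
      by (rule mem[OF that])
  qed (simp_all add: sd source_simps lookup_add additive_fn_add[OF additive_eps] eps_xscale plin_simps[OF plin_kos])
  fix x :: "('n, 'k) pol \<times> ('n, 'k) xform" assume x: "x \<in> carrier (source m i)"
  have "eps (lk (kos (snd x)) {}) = 0"
    using source_L[OF x] by (simp add: eps_boundary L_iff additive_fn_0[OF additive_eps])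
  then show "source_diff (i - 1) (source_diff i x) = \<zero>\<^bsub>source m (i - 2)\<^esub>"
    by (simp add: sd source_simps kos_kos)
qed

lemma source_complex_exact:
  fixes x :: "('n::{finite,linorder}, 'k::field) pol \<times> ('n, 'k) xform"
  assumes m: "1 \<le> m" and i: "0 \<le> i" and x: "x \<in> carrier (source m i)" and dx: "source_diff i x = \<zero>\<^bsub>source m (i - 1)\<^esub>"
  shows "\<exists>y\<in>carrier (source m (i + 1)). source_diff (i + 1) y = x"
proof -
  have x0: "fst x = 0" using x i by (simp add: mem_source)
  have L: "snd x \<in> L i m" by (rule source_L[OF x])
  have k: "kos (snd x) = 0" and e: "i = 0 \<Longrightarrow> eps (lk (snd x) {}) = 0"
    using dx by (simp_all add: source_diff_def case_prod_unfold source_simps)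
  obtain w where w: "w \<in> L (i + 1) m" "kos w = snd x"
  proof (cases "i = 0")
    case True
    then show ?thesis using source_exactness(2)[OF m, of "snd x"] L e that by auto
  next
    case False
    then show ?thesis using source_exactness(1)[OF m, of i "snd x"] L k i that by auto
  qed
  have "w = 0" if "\<not> i + 1 \<le> int CARD('n) - 1" using L_top[OF w(1)] that by simp
  then have "(0, w) \<in> carrier (source m (i + 1))" using w(1) i by (auto simp: mem_source)
  moreover have "source_diff (i + 1) (0, w) = x" using w(2) x0 i by (simp add: source_diff_def prod_eq_iff)
  ultimately show ?thesis by blast
qed

lemma source_minus:
  assumes x: "x \<in> carrier (source m i)"
  shows "\<ominus>\<^bsub>source m i\<^esub> x = (- fst x, - snd x)"
proof -
  interpret module PR "source m i" by (rule module_source)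
  show ?thesis
  proof (rule minus_equality)
    show "x \<in> carrier (source m i)" by (rule x)
    show "(- fst x, - snd x) \<in> carrier (source m i)"
      using x psub_minus[OF psub_L] by (auto simp: mem_source)
    show "(- fst x, - snd x) \<oplus>\<^bsub>source m i\<^esub> x = \<zero>\<^bsub>source m i\<^esub>"
      by (simp add: source_simps)
  qed
qed

subsection \<open>The comparison map\<close>

lemma Phi_0: "\<Phi> \<phi> 0 = 0"
  by (rule additive_fn_0[OF additive_Phi])

lemma Phi_xscale: "\<Phi> \<phi> (xscale p f) = xscale p (\<Phi> \<phi> f)"
proof (rule additive_fn_eqI[where p = f])
  show "additive_fn (\<lambda>f. \<Phi> \<phi> (xscale p f))" by (rule additive_fn_comp[OF additive_Phi additive_xscale])
  show "additive_fn (\<lambda>f. xscale p (\<Phi> \<phi> f))" by (rule additive_fn_comp[OF additive_xscale additive_Phi])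
  show "\<Phi> \<phi> (xscale p (Poly_Mapping.single k c)) = xscale p (\<Phi> \<phi> (Poly_Mapping.single k c))" for k c
    by (rule poly_mapping_eqI) (simp add: xscale_single \<Phi>_def lk_contract_single mult.assoc)
qed

lemma Phi_Xvar: "\<Phi> \<phi> (Xvar i * f) = contract (Xvar i) (\<Phi> \<phi> f)"
  by (simp add: \<Phi>_def contract_mult)

abbreviation mPhi :: "('n mon \<Rightarrow>\<^sub>0 'k::field) \<Rightarrow> ('n, 'k) xform \<Rightarrow> ('n, 'k) xform" where
  "mPhi \<phi> w \<equiv> Poly_Mapping.map (\<Phi> \<phi>) w"

lemma lk_mPhi: "lk (mPhi \<phi> w) S = \<Phi> \<phi> (lk w S)"
  by (rule lookup_map0) (rule Phi_0)

lemma plin_mPhi: "plin (mPhi \<phi>)"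
  unfolding plin_def
proof (intro conjI allI additive_fnI)
  show "mPhi \<phi> (x + y) = mPhi \<phi> x + mPhi \<phi> y" for x y
    by (rule poly_mapping_eqI) (simp add: lk_mPhi lookup_add additive_fn_add[OF additive_Phi])
  show "mPhi \<phi> (pm p x) = pm p (mPhi \<phi> x)" for p x
    by (rule poly_mapping_eqI) (simp add: lk_mPhi Phi_xscale)
qed

lemma mPhi_kos: "mPhi \<phi> (kos w) = kos (mPhi \<phi> w)"
  by (rule poly_mapping_eqI)
     (simp add: lk_mPhi lk_kos kz_def additive_fn_sum[OF additive_Phi] additive_sg[OF additive_Phi] Phi_xscale)

lemma mPhi_kappa: "mPhi \<phi> (kappa w) = eta (mPhi \<phi> w)"
  by (rule poly_mapping_eqI)
     (simp add: lk_mPhi lk_kappa lk_eta kz_def additive_fn_sum[OF additive_Phi] additive_sg[OF additive_Phi] Phi_Xvar)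

lemma mPhi_K':
  assumes w: "w \<in> L i m" and m: "m = s - t"
  shows "mPhi \<phi> w \<in> K' \<phi> s i t"
proof -
  have "0 \<in> homog m" by (simp add: homog_def)
  then have w': "lk w S \<in> homog m" "lk w S \<noteq> 0 \<Longrightarrow> int (card S) = i" for S
    using w psub1_0[OF psub1_homog, of m] by (auto simp: L_iff ext_iff[OF psub1_0[OF psub1_homog]])
  have "mPhi \<phi> w \<in> ext i (D' \<phi> s t)"
    unfolding ext_iff[OF psub1_0[OF psub1_D']] lk_mPhi
  proof (intro allI conjI impI)
    fix S
    show "\<Phi> \<phi> (lk w S) \<in> D' \<phi> s t" unfolding D'_def using w'(1) m by (intro imageI) simp
    assume "\<Phi> \<phi> (lk w S) \<noteq> 0"
    then have "lk w S \<noteq> 0" using Phi_0 by metis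
    then show "int (card S) = i" by (rule w'(2))
  qed
  moreover have "eta (mPhi \<phi> w) = 0"
  proof -
    have "eta (mPhi \<phi> w) = mPhi \<phi> 0" using w mPhi_kappa[of \<phi> w] by (simp add: L_iff)
    then show ?thesis by (simp only: plin_simps(5)[OF plin_mPhi])
  qed
  ultimately show ?thesis by (simp add: K'_def)
qed

subsection \<open>Submodules generated by constant forms\<close>

lemma sgen_ext_ker:
  assumes V: "ksub V" and e: "plin e" "\<And>v w. e (ins 0 (sl v w)) = ins 0 (sl v (e w))"
  shows "sgen {w \<in> ext a (lift V). e w = 0}"
  unfolding sgen_def
proof (intro conjI ballI allI)
  show "psub {w \<in> ext a (lift V). e w = 0}"
    using psub_ext[OF psub1_lift[OF V], of a] by (simp add: psub_def plin_simps[OF e(1)])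
  fix w v assume w: "w \<in> {w \<in> ext a (lift V). e w = 0}"
  have "sl v' (ins 0 (sl v w)) \<in> kext a V" for v'
    using w V unfolding ext_lift_iff[OF V] by (simp add: sl_ins) (simp add: kext_def ksub_def ext_lift_iff[OF V])
  then show "ins 0 (sl v w) \<in> {w \<in> ext a (lift V). e w = 0}"
    using w by (simp add: ext_lift_iff[OF V] e(2))
qed

lemma slice_comm:
  assumes "\<And>v w. sl v (e w) = H (sl v w)" "H 0 = 0"
  shows "e (ins 0 (sl v w)) = ins 0 (sl v (e w))"
  by (rule xform_eqI) (simp add: assms sl_ins)

lemma sgen_L: "sgen (L a m)"
proof -
  have "sgen {w \<in> ext a (lift (homog m)). kappa w = 0}"
    by (rule sgen_ext_ker[OF ksub_homog plin_kappa slice_comm[OF sl_kappa sl_kappa_0]])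
  then show ?thesis by (simp add: lift_homog L_def)
qed

lemma sgen_plus:
  assumes "sgen X1" "sgen X2"
  shows "sgen {x + y | x y. x \<in> X1 \<and> y \<in> X2}"
proof -
  note p = assms[unfolded sgen_def]
  note p1 = p(1)[THEN conjunct1] and p2 = p(2)[THEN conjunct1]
  show ?thesis
    unfolding sgen_def psub_def
  proof (intro conjI ballI allI)
    show "0 \<in> {x + y | x y. x \<in> X1 \<and> y \<in> X2}"
      by (intro CollectI exI[of _ 0]) (simp add: psub_0[OF p1] psub_0[OF p2])
  next
    fix a b assume "a \<in> {x + y | x y. x \<in> X1 \<and> y \<in> X2}" "b \<in> {x + y | x y. x \<in> X1 \<and> y \<in> X2}"
    then obtain x y x' y' where e: "a = x + y" "x \<in> X1" "y \<in> X2" "b = x' + y'" "x' \<in> X1" "y' \<in> X2" by blast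
    show "a + b \<in> {x + y | x y. x \<in> X1 \<and> y \<in> X2}"
      by (intro CollectI exI[of _ "x + x'"] exI[of _ "y + y'"])
         (simp add: e psub_add[OF p1] psub_add[OF p2] add_ac)
  next
    fix c a assume "a \<in> {x + y | x y. x \<in> X1 \<and> y \<in> X2}"
    then obtain x y where e: "a = x + y" "x \<in> X1" "y \<in> X2" by blast
    show "pm c a \<in> {x + y | x y. x \<in> X1 \<and> y \<in> X2}"
      by (intro CollectI exI[of _ "pm c x"] exI[of _ "pm c y"])
         (simp add: e psub_pm[OF p1] psub_pm[OF p2] additive_fn_add[OF additive_pm])
  next
    fix a v assume "a \<in> {x + y | x y. x \<in> X1 \<and> y \<in> X2}"
    then obtain x y where e: "a = x + y" "x \<in> X1" "y \<in> X2" by blast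
    have "ins 0 (sl v x) \<in> X1" "ins 0 (sl v y) \<in> X2" using p e by blast+
    then show "ins 0 (sl v a) \<in> {x + y | x y. x \<in> X1 \<and> y \<in> X2}"
      by (intro CollectI exI[of _ "ins 0 (sl v x)"] exI[of _ "ins 0 (sl v y)"])
         (simp add: e sl_simps additive_fn_add[OF additive_ins])
  qed
qed

context inverse_system
begin

text \<open>Both \<open>eta\<close> and \<open>h\<close> act slicewise, and so does membership in
  the extended space.\<close>

lemma sgen_Hs: "sgen (Hs a)"
  unfolding sgen_def
proof (intro conjI ballI allI psub_Hs)
  fix w v assume w: "w \<in> Hs a"
  have "sgen {w \<in> ext a (lift (VD \<phi> s t)). eta w = 0}"
    by (rule sgen_ext_ker[OF ksub_VD plin_eta slice_comm[OF sl_eta klin_0[OF klin_etak]]])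
  moreover have "w \<in> {w \<in> ext a (lift (VD \<phi> s t)). eta w = 0}" using w by (simp add: Hs_iff T_def)
  ultimately have "ins 0 (sl v w) \<in> {w \<in> ext a (lift (VD \<phi> s t)). eta w = 0}" unfolding sgen_def by blast
  moreover have "h (ins 0 (sl v w)) = 0" using w by (simp add: h_slice Hs_iff)
  ultimately show "ins 0 (sl v w) \<in> Hs a" by (simp add: Hs_iff T_def)
qed

lemma sgen_e1: "sgen {pm p e1 | p. True}"
  unfolding sgen_def psub_def
proof (intro conjI ballI allI)
  show "0 \<in> {pm p e1 | p. True}" by (intro CollectI exI[of _ 0]) simp
  show "x + y \<in> {pm p e1 | p. True}" if xy: "x \<in> {pm p e1 | p. True}" "y \<in> {pm p e1 | p. True}" for x y
  proof -
    obtain p q where "x = pm p e1" "y = pm q e1" using xy by blast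
    then show ?thesis by (intro CollectI exI[of _ "p + q"]) (simp add: additive_fn_add[OF additive_pm_left])
  qed
  show "pm r x \<in> {pm p e1 | p. True}" if x: "x \<in> {pm p e1 | p. True}" for r x
  proof -
    obtain p where "x = pm p e1" using x by blast
    then show ?thesis by (intro CollectI exI[of _ "r * p"]) (simp add: pm_pm)
  qed
  show "ins 0 (sl v x) \<in> {pm p e1 | p. True}" if x: "x \<in> {pm p e1 | p. True}" for v x
  proof -
    obtain p where p: "x = pm p e1" using x by blast
    have "e1 = ins 0 (sl 0 e1)"
      by (rule poly_mapping_eqI, rule poly_mapping_eqI, rule poly_mapping_eqI)
         (auto simp: e1_def lookup_single lookup_one when_def)
    then have "ins 0 (sl v x) = pm (Poly_Mapping.single 0 (lk p v)) e1"
      using sl_pm_ins[of v p "sl 0 e1"] ins_ks[of "lk p v" "sl 0 e1"] by (simp only: p)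
    then show ?thesis by blast
  qed
qed

end

context target_system
begin

abbreviation Sr :: "int \<Rightarrow> (('n, 'k) pol, ('n, 'k) pol \<times> ('n, 'k) xform) module" where
  "Sr \<equiv> source (s - t)"

abbreviation cmp :: "int \<Rightarrow> ('n, 'k) pol \<times> ('n, 'k) xform \<Rightarrow> ('n, 'k) tgt" where
  "cmp \<equiv> comparison \<phi> s t"

text \<open>The image has only a component of degree t, so it has no part in W and \<theta> vanishes
  on it.\<close>

lemma cmp_JT:
  assumes x: "x \<in> carrier (Sr i)"
  shows "cmp i x = JT i (mPhi \<phi> (snd x))"
proof (cases "i \<le> int CARD('n) - 1")
  case True
  have K: "mPhi \<phi> (snd x) \<in> K' \<phi> s i t" by (rule mPhi_K'[OF source_L[OF x] refl])
  have c: "cp j (mPhi \<phi> (snd x)) = (if j = t then mPhi \<phi> (snd x) else 0)" for j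
    using K by (intro cp_ext_D'[of _ i]) (simp add: K'_def)
  have "J i (mPhi \<phi> (snd x)) = (mPhi \<phi> (snd x), \<zero>\<^bsub>W \<phi> s i (t - 1)\<^esub>)"
    unfolding J_def W_simps th_K'_0[OF K] by (auto simp: c cls_0 intro!: restrict_ext)
  then show ?thesis using True by (simp add: comparison_def case_prod_unfold JT_def)
next
  case False
  then have "snd x = 0" using x by (simp add: mem_source)
  then show ?thesis using False by (simp add: comparison_def case_prod_unfold JT_def plin_simps[OF plin_mPhi])
qed

lemma mPhi_Hs: "x \<in> carrier (Sr i) \<Longrightarrow> mPhi \<phi> (snd x) \<in> Hs i"
  by (rule K't_Hs[OF mPhi_K'[OF source_L refl]])

lemma comparison_chain_map: "is_chain_map PR Sr source_diff Tg Td cmp"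
  unfolding is_chain_map_def
proof (intro allI conjI ballI)
  fix i
  show "cmp i \<in> mod_hom PR (Sr i) (Tg i)"
  proof (rule mod_homI)
    fix x assume x: "x \<in> carrier (Sr i)"
    show "cmp i x \<in> carrier (Tg i)" unfolding cmp_JT[OF x] by (rule JT_Tg[OF mPhi_Hs[OF x]])
    interpret S: module PR "Sr i" by (rule module_source)
    show "cmp i (r \<odot>\<^bsub>Sr i\<^esub> x) = r \<odot>\<^bsub>Tg i\<^esub> cmp i x" for r
    proof -
      have rx: "r \<odot>\<^bsub>Sr i\<^esub> x \<in> carrier (Sr i)" by (rule S.smult_closed) (simp_all add: x)
      show ?thesis
        using cmp_JT[OF rx] by (simp only: cmp_JT[OF x] JT_smult source_simps snd_conv plin_simps(6)[OF plin_mPhi])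
    qed
    fix y assume y: "y \<in> carrier (Sr i)"
    show "cmp i (x \<oplus>\<^bsub>Sr i\<^esub> y) = cmp i x \<oplus>\<^bsub>Tg i\<^esub> cmp i y"
      using cmp_JT[OF S.a_closed[OF x y]]
      by (simp only: cmp_JT[OF x] cmp_JT[OF y] JT_add source_simps snd_conv plin_simps(1)[OF plin_mPhi])
  qed
  fix x assume x: "x \<in> carrier (Sr i)"
  have dx: "source_diff i x \<in> carrier (Sr (i - 1))"
    using source_complex[of "s - t"] x unfolding is_complex_def mod_hom_def by blast
  have "cmp (i - 1) (source_diff i x) = JT (i - 1) (mPhi \<phi> (kos (snd x)))"
    unfolding cmp_JT[OF dx] by (simp add: source_diff_def case_prod_unfold)
  also have "\<dots> = JT (i - 1) (dH (mPhi \<phi> (snd x)))"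
    by (simp add: mPhi_kos dH_K't[OF mPhi_K'[OF source_L[OF x] refl]])
  also have "\<dots> = Td i (cmp i x)"
    unfolding cmp_JT[OF x] Td_JT[OF mPhi_Hs[OF x]] ..
  finally show "cmp (i - 1) (source_diff i x) = Td i (cmp i x)" .
qed

subsection \<open>The augmentation\<close>

definition Jm :: "('n, 'k) pol set" where
  "Jm = {r. contract r \<phi> = 0 \<and> r \<in> deg_ge (s - t)}"

definition evH :: "('n, 'k) xform \<Rightarrow> ('n mon \<Rightarrow>\<^sub>0 'k)" where
  "evH x = ev1 (lk (A x) {})"

text \<open>The choice is unique up to elements of P_{>=m} annihilating \<phi>, that is, up to
  \<open>Jm\<close>, so its class in the quotient is well defined.\<close>

definition \<rho> :: "('n, 'k) xform \<Rightarrow> ('n, 'k) pol" where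
  "\<rho> x = (SOME r. r \<in> deg_ge (s - t) \<and> evH x = contract r \<phi>)"

definition aug :: "(('n, 'k) pol \<times> ('n, 'k) xform) \<times> ('n, 'k) tgt \<Rightarrow> ('n, 'k) pol set" where
  "aug x = cls Jm (fst (fst x) + \<rho> (inv_into (Hs 0) (JT 0) (snd x)))"

lemma evH_add: "evH (x + y) = evH x + evH y"
  by (simp add: evH_def A_simps lookup_add additive_fn_add[OF additive_ev1])

lemma evH_diff: "evH (x - y) = evH x - evH y"
  by (simp add: evH_def A_simps lookup_minus additive_fn_diff[OF additive_ev1])

lemma evH_pm: "evH (pm p x) = contract p (evH x)"
  by (simp add: evH_def A_simps ev1_xscale)

lemma rho:
  assumes "x \<in> Hs 0"
  shows "\<rho> x \<in> deg_ge (s - t)" "evH x = contract (\<rho> x) \<phi>"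
proof -
  have "\<exists>r. r \<in> deg_ge (s - t) \<and> evH x = contract r \<phi>"
    using ev_T[OF A_T[OF Hs_T[OF assms]]] unfolding evH_def by blast
  from someI_ex[OF this] show "\<rho> x \<in> deg_ge (s - t)" "evH x = contract (\<rho> x) \<phi>" unfolding \<rho>_def by blast+
qed

lemma deg_ge_minus: "r \<in> deg_ge c \<Longrightarrow> - r \<in> deg_ge c"
  using deg_ge_mult[of r c "-1"] by simp

lemma deg_ge_diff: "r \<in> deg_ge c \<Longrightarrow> r' \<in> deg_ge c \<Longrightarrow> r - r' \<in> deg_ge c"
  using deg_ge_add[of r c "- r'"] deg_ge_minus[of r' c] by simp

lemma asub_Jm: "asub Jm"
  by (simp add: asub_def Jm_def deg_ge_0 deg_ge_diff additive_fn_diff[OF additive_contract_left])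

lemma Jm_mult: "r \<in> Jm \<Longrightarrow> p * r \<in> Jm"
  by (simp add: Jm_def deg_ge_mult contract_mult)

lemma quot_Jm_simps:
  "carrier (quot_module pol_mod Jm) = range (cls Jm)"
  "\<zero>\<^bsub>quot_module pol_mod Jm\<^esub> = Jm"
  "cls Jm x \<oplus>\<^bsub>quot_module pol_mod Jm\<^esub> cls Jm y = cls Jm (x + y)"
  "p \<odot>\<^bsub>quot_module pol_mod Jm\<^esub> cls Jm x = cls Jm (p * x)"
proof -
  show "carrier (quot_module pol_mod Jm) = range (cls Jm)"
    by (auto simp: quot_module_def A_RCOSETS_def RCOSETS_def r_coset_def cls_def)
  show "\<zero>\<^bsub>quot_module pol_mod Jm\<^esub> = Jm" by (simp add: quot_module_def)
  have "cls Jm x \<oplus>\<^bsub>quot_module pol_mod Jm\<^esub> cls Jm y = {x' + y' | x' y'. x' \<in> cls Jm x \<and> y' \<in> cls Jm y}"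
    by (auto simp: quot_module_def set_add_def set_mult_def)
  then show "cls Jm x \<oplus>\<^bsub>quot_module pol_mod Jm\<^esub> cls Jm y = cls Jm (x + y)" by (simp add: set_add_cls[OF asub_Jm])
  have "additive_fn ((*) p)" by (rule additive_fnI) (simp add: algebra_simps)
  from UN_cls[OF asub_Jm this Jm_mult asub_Jm]
  show "p \<odot>\<^bsub>quot_module pol_mod Jm\<^esub> cls Jm x = cls Jm (p * x)"
    by (simp add: quot_module_def coset_pol_mod)
qed

lemma module_quot_Jm: "module PR (quot_module pol_mod Jm)"
  by (rule module_surj[OF module_pol_mod, where j = "cls Jm"])
     (simp_all add: quot_Jm_simps cls_0)

abbreviation Cn :: "int \<Rightarrow> (('n, 'k) pol, (('n, 'k) pol \<times> ('n, 'k) xform) \<times> ('n, 'k) tgt) module" where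
  "Cn \<equiv> cone Sr Tg"

abbreviation Cd :: "int \<Rightarrow> (('n, 'k) pol \<times> ('n, 'k) xform) \<times> ('n, 'k) tgt \<Rightarrow> (('n, 'k) pol \<times> ('n, 'k) xform) \<times> ('n, 'k) tgt" where
  "Cd \<equiv> cone_diff Sr source_diff Tg Td cmp"

lemma inv_JT: "x \<in> Hs i \<Longrightarrow> inv_into (Hs i) (JT i) (JT i x) = x"
  by (rule inv_into_f_f[OF JT_inj])

lemma Cn0_cases:
  assumes "z \<in> carrier (Cn 0)"
  obtains p x where "x \<in> Hs 0" "z = ((p, 0), JT 0 x)"
proof -
  have "fst z \<in> carrier (Sr (-1))" "snd z \<in> carrier (Tg 0)" using assms by (auto simp: cone_def)
  then have s: "snd (fst z) = 0" and tg: "snd z \<in> carrier (Tg 0)" by (simp_all add: mem_source)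
  obtain x where x: "x \<in> Hs 0" "snd z = JT 0 x" using tg by (rule Tg_cases)
  show thesis by (rule that[OF x(1), of "fst (fst z)"]) (simp add: prod_eq_iff s x(2))
qed

lemma Cn0_mem: "x \<in> Hs 0 \<Longrightarrow> ((p, 0), JT 0 x) \<in> carrier (Cn 0)"
  by (simp add: cone_def mem_source JT_Tg)

lemma aug_eq: "x \<in> Hs 0 \<Longrightarrow> aug ((p, w), JT 0 x) = cls Jm (p + \<rho> x)"
  by (simp add: aug_def inv_JT)

text \<open>Any admissible r may replace the chosen \<open>\<rho> x\<close>, so linearity of
  \<open>aug\<close> amounts to exhibiting a suitable r.\<close>

lemma aug_cong:
  assumes "x \<in> Hs 0" "r \<in> deg_ge (s - t)" "evH x = contract r \<phi>"
  shows "aug ((p, w), JT 0 x) = cls Jm (p + r)"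
  unfolding aug_eq[OF assms(1)] cls_eq_iff[OF asub_Jm]
  using rho[OF assms(1)] assms by (simp add: Jm_def deg_ge_diff additive_fn_diff[OF additive_contract_left])

lemma aug_hom: "aug \<in> mod_hom PR (Cn 0) (quot_module pol_mod Jm)"
proof (rule mod_homI)
  fix z assume z: "z \<in> carrier (Cn 0)"
  then obtain p x where x: "x \<in> Hs 0" "z = ((p, 0), JT 0 x)" by (rule Cn0_cases)
  show "aug z \<in> carrier (quot_module pol_mod Jm)" unfolding quot_Jm_simps x(2) aug_eq[OF x(1)] by (rule rangeI)
  show "aug (r \<odot>\<^bsub>Cn 0\<^esub> z) = r \<odot>\<^bsub>quot_module pol_mod Jm\<^esub> aug z" for r
  proof -
    have "r \<odot>\<^bsub>Cn 0\<^esub> z = ((r * p, 0), JT 0 (pm r x))"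
      by (simp add: cone_def x(2) source_simps JT_smult)
    moreover have "aug ((r * p, 0), JT 0 (pm r x)) = cls Jm (r * p + r * \<rho> x)"
      by (rule aug_cong[OF psub_pm[OF psub_Hs x(1)] deg_ge_mult[OF rho(1)[OF x(1)]]])
         (simp add: evH_pm rho(2)[OF x(1)] contract_mult)
    ultimately show ?thesis by (simp add: x(2) aug_eq[OF x(1)] quot_Jm_simps algebra_simps)
  qed
  fix Y assume Y: "Y \<in> carrier (Cn 0)"
  then obtain p' y where y: "y \<in> Hs 0" "Y = ((p', 0), JT 0 y)" by (rule Cn0_cases)
  have "z \<oplus>\<^bsub>Cn 0\<^esub> Y = ((p + p', 0), JT 0 (x + y))"
    by (simp add: cone_def x(2) y(2) source_simps JT_add)
  moreover have "aug ((p + p', 0), JT 0 (x + y)) = cls Jm ((p + p') + (\<rho> x + \<rho> y))"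
    by (rule aug_cong[OF psub_add[OF psub_Hs x(1) y(1)] deg_ge_add[OF rho(1)[OF x(1)] rho(1)[OF y(1)]]])
       (simp add: evH_add rho(2)[OF x(1)] rho(2)[OF y(1)] additive_fn_add[OF additive_contract_left])
  ultimately show "aug (z \<oplus>\<^bsub>Cn 0\<^esub> Y) = aug z \<oplus>\<^bsub>quot_module pol_mod Jm\<^esub> aug Y"
    by (simp add: x(2) y(2) aug_eq[OF x(1)] aug_eq[OF y(1)] quot_Jm_simps algebra_simps)
qed

lemma aug_unit: "aug ((p, 0), \<zero>\<^bsub>Tg 0\<^esub>) = cls Jm p"
proof -
  have "aug ((p, 0), JT 0 0) = cls Jm (p + 0)"
    by (rule aug_cong[OF psub_0[OF psub_Hs] deg_ge_0]) (use evH_diff[of 0 0] in simp)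
  then show ?thesis by (simp add: JT_0)
qed

lemma aug_surj: "aug ` carrier (Cn 0) = carrier (quot_module pol_mod Jm)"
proof (intro subset_antisym subsetI)
  fix Y assume "Y \<in> aug ` carrier (Cn 0)"
  then show "Y \<in> carrier (quot_module pol_mod Jm)" using mod_homD(1)[OF aug_hom] by blast
next
  fix Y assume "Y \<in> carrier (quot_module pol_mod Jm)"
  then obtain p where "Y = cls Jm p" unfolding quot_Jm_simps by blast
  then have "Y = aug ((p, 0), JT 0 0)" using aug_unit[of p] by (simp add: JT_0)
  then show "Y \<in> aug ` carrier (Cn 0)" using Cn0_mem[OF psub_0[OF psub_Hs]] by blast
qed

text \<open>The sign of \<open>eps\<close> comes from the cone; it makes the two contributions to
  \<open>aug\<close> cancel.\<close>

lemma Cd_1: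
  assumes f: "f \<in> L 0 (s - t)" and y: "y \<in> Hs 1"
  shows "((0, f), JT 1 y) \<in> carrier (Cn 1)"
    and "Cd 1 ((0, f), JT 1 y) = ((- eps (lk f {}), 0), JT 0 (mPhi \<phi> f + dH y))"
proof -
  have F: "(0, f) \<in> carrier (Sr 0)" using f by (simp add: mem_source)
  then show "((0, f), JT 1 y) \<in> carrier (Cn 1)" by (simp add: cone_def JT_Tg[OF y])
  have k: "kos f = 0" using L_below[OF kos_L[OF f]] by simp
  have d: "source_diff 0 (0, f) = (eps (lk f {}), 0)" by (simp add: source_diff_def k)
  have dm: "(eps (lk f {}), 0) \<in> carrier (Sr (-1))" by (simp add: mem_source)
  have "cmp 0 (0, f) \<oplus>\<^bsub>Tg 0\<^esub> Td 1 (JT 1 y) = JT 0 (mPhi \<phi> f + dH y)"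
    unfolding cmp_JT[OF F] Td_JT[OF y] JT_add by simp
  then show "Cd 1 ((0, f), JT 1 y) = ((- eps (lk f {}), 0), JT 0 (mPhi \<phi> f + dH y))"
    by (simp add: cone_diff_def d source_minus[OF dm])
qed

lemma L0_eq: "f \<in> L 0 c \<Longrightarrow> lk f {} \<in> homog c"
  by (simp add: L_iff ext_homog_iff homog_iff)

lemma evH_mPhi:
  assumes f: "f \<in> L 0 (s - t)"
  shows "evH (mPhi \<phi> f) = contract (eps (lk f {})) \<phi>"
  unfolding evH_def A_K't[OF mPhi_K'[OF f refl]] by (simp add: lk_mPhi ev1_Phi)

text \<open>If p + \<rho>(x) lies in \<open>Jm\<close>, then p has no terms of degree below m and
  can be removed by an element of S_m. The rest in \<open>Hs 0\<close> evaluates to (p + \<rho>(x))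
  \<phi> = 0 and is therefore a boundary.\<close>

lemma aug_kernel:
  assumes m1: "1 \<le> s - t"
  shows "{z \<in> carrier (Cn 0). aug z = \<zero>\<^bsub>quot_module pol_mod Jm\<^esub>} = Cd 1 ` carrier (Cn 1)"
proof (intro subset_antisym subsetI)
  fix z assume "z \<in> {z \<in> carrier (Cn 0). aug z = \<zero>\<^bsub>quot_module pol_mod Jm\<^esub>}"
  then have z: "z \<in> carrier (Cn 0)" and aX: "aug z = Jm" by (simp_all add: quot_Jm_simps)
  obtain p x where x: "x \<in> Hs 0" "z = ((p, 0), JT 0 x)" using z by (rule Cn0_cases)
  have "cls Jm (p + \<rho> x) = cls Jm 0" using aX by (simp add: x(2) aug_eq[OF x(1)] cls_0)
  then have pr: "p + \<rho> x \<in> Jm" by (simp add: cls_eq_iff[OF asub_Jm])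
  then have "(p + \<rho> x) - \<rho> x \<in> deg_ge (s - t)" by (intro deg_ge_diff rho(1)[OF x(1)]) (simp add: Jm_def)
  then have "- p \<in> deg_ge (s - t)" using deg_ge_minus by simp
  then obtain g where g: "g \<in> homog (s - t)" "eps g = - p" using eps_surj[of "s - t" "- p"] m1 by auto
  define f :: "('n, 'k) xform" where "f = Poly_Mapping.single {} g"
  have lf: "lk f {} = g" by (simp add: f_def)
  have f: "f \<in> L 0 (s - t)"
  proof -
    have "f \<in> ext 0 (homog (s - t))"
      using g(1) by (auto simp: f_def ext_homog_iff homog_iff lookup_single when_def split: if_splits)
    moreover have "kappa f = 0"
      by (rule poly_mapping_eqI) (simp add: lk_kappa kz_def f_def lookup_single_not_eq)
    ultimately show ?thesis by (simp add: L_iff)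
  qed
  define x' where "x' = x - mPhi \<phi> f"
  have x': "x' \<in> Hs 0" unfolding x'_def by (rule psub_diff[OF psub_Hs x(1) K't_Hs[OF mPhi_K'[OF f refl]]])
  have "evH x' = contract (\<rho> x) \<phi> - contract (- p) \<phi>"
    by (simp add: x'_def evH_diff rho(2)[OF x(1)] evH_mPhi[OF f] lf g(2))
  also have "\<dots> = contract (p + \<rho> x) \<phi>"
    by (simp add: additive_fn_add[OF additive_contract_left] additive_fn_minus[OF additive_contract_left])
  also have "\<dots> = 0" using pr by (simp add: Jm_def)
  finally obtain y where y: "y \<in> Hs 1" "dH y = x'" using exact0[OF x'] unfolding evH_def by blast
  have "Cd 1 ((0, f), JT 1 y) = z"
    unfolding Cd_1(2)[OF f y(1)] x(2) by (simp add: lf g(2) y(2) x'_def)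
  then show "z \<in> Cd 1 ` carrier (Cn 1)" using Cd_1(1)[OF f y(1)] by blast
next
  fix z assume "z \<in> Cd 1 ` carrier (Cn 1)"
  then obtain Z where Z: "Z \<in> carrier (Cn 1)" "z = Cd 1 Z" by blast
  have "fst Z \<in> carrier (Sr 0)" "snd Z \<in> carrier (Tg 1)" using Z(1) by (auto simp: cone_def)
  then have z: "fst (fst Z) = 0" "snd (fst Z) \<in> L 0 (s - t)" and tg: "snd Z \<in> carrier (Tg 1)" by (simp_all add: mem_source)
  obtain y where y: "y \<in> Hs 1" "snd Z = JT 1 y" using tg by (rule Tg_cases)
  define f where "f = snd (fst Z)"
  have f: "f \<in> L 0 (s - t)" using z by (simp add: f_def)
  have "Z = ((0, f), JT 1 y)" by (simp add: prod_eq_iff z f_def y(2))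
  then have z: "z = ((- eps (lk f {}), 0), JT 0 (mPhi \<phi> f + dH y))" using Z(2) Cd_1(2)[OF f y(1)] by simp
  have dy: "dH y \<in> Hs 0" using dH_Hs[OF y(1)] by simp
  have H: "mPhi \<phi> f + dH y \<in> Hs 0"
    by (rule psub_add[OF psub_Hs K't_Hs[OF mPhi_K'[OF f refl]] dy])
  have ev: "evH (mPhi \<phi> f + dH y) = contract (eps (lk f {})) \<phi>"
    using ev_dH[OF y(1)] by (simp add: evH_add evH_mPhi[OF f]) (simp add: evH_def)
  have "aug z = cls Jm (- eps (lk f {}) + eps (lk f {}))"
    unfolding z by (rule aug_cong[OF H eps_homog_deg_ge[OF L0_eq[OF f] order_refl] ev])
  then show "z \<in> {z \<in> carrier (Cn 0). aug z = \<zero>\<^bsub>quot_module pol_mod Jm\<^esub>}"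
    using Cn0_mem[OF H] by (simp add: cls_0 quot_Jm_simps z)
qed

lemma cone_complex: "is_complex PR Cn Cd"
  by (rule cone_is_complex[OF source_complex target_complex comparison_chain_map])

subsection \<open>Freeness of the cone\<close>

text \<open>A whole degree of the cone is to fit into one module of forms. The P in degree -1 is
  placed at the full set, away from the empty set that carries \<open>Hs 0\<close>; in the other
  degrees L_{i-1,m} and \<open>Hs i\<close> differ in wedge degree.\<close>

definition Src_form :: "('n, 'k) pol \<times> ('n, 'k) xform \<Rightarrow> ('n, 'k) xform" where
  "Src_form x = pm (fst x) e1 + snd x"

lemma lk_Src_form:
  assumes x: "x \<in> carrier (Sr (i - 1))" and i: "int (card S) = i"
  shows "lk (Src_form x) S = 0"
proof -
  have "lk (snd x) S = 0"
  proof (rule poly_mapping_eqI)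
    fix u
    show "lk (lk (snd x) S) u = lk 0 u"
      using source_L[OF x] i unfolding L_iff ext_homog_iff by (cases "lk (lk (snd x) S) u = 0") auto
  qed
  moreover have "lk (pm (fst x) e1) S = 0"
  proof (cases "i = 0")
    case True
    then have "S = {}" using i by simp
    then show ?thesis by (simp add: e1_def lookup_single_not_eq)
  next
    case False
    then show ?thesis using x by (simp add: mem_source)
  qed
  ultimately show ?thesis by (simp add: Src_form_def lookup_add)
qed

lemma Src_form_image: "sgen (Src_form ` carrier (Sr i))"
proof -
  consider "i = -1" | "0 \<le> i \<and> i \<le> int CARD('n) - 1" | "i < -1 \<or> int CARD('n) - 1 < i" by linarith
  then show ?thesis
  proof cases
    case 1
    have "Src_form ` carrier (Sr i) = {pm p e1 | p. True}"
    proof (intro Set.set_eqI iffI)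
      fix w :: "('n, 'k) xform" assume "w \<in> {pm p e1 | p. True}"
      then obtain p where "w = pm p e1" by blast
      then show "w \<in> Src_form ` carrier (Sr i)"
        using 1 by (intro image_eqI[of _ _ "(p, 0)"]) (simp_all add: Src_form_def mem_source)
    qed (use 1 in \<open>auto simp: Src_form_def mem_source\<close>)
    then show ?thesis using sgen_e1 by simp
  next
    case 2
    have "Src_form ` carrier (Sr i) = L i (s - t)"
    proof (intro Set.set_eqI iffI)
      fix w :: "('n, 'k) xform" assume "w \<in> L i (s - t)"
      then show "w \<in> Src_form ` carrier (Sr i)"
        using 2 by (intro image_eqI[of _ _ "(0, w)"]) (simp_all add: Src_form_def mem_source)
    qed (use 2 in \<open>auto simp: Src_form_def mem_source\<close>)
    then show ?thesis using sgen_L by simp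
  next
    case 3
    have "Src_form ` carrier (Sr i) = {0}"
    proof (intro Set.set_eqI iffI)
      fix w :: "('n, 'k) xform" assume "w \<in> {0}"
      then show "w \<in> Src_form ` carrier (Sr i)"
        using 3 by (intro image_eqI[of _ _ "(0, 0)"]) (auto simp: Src_form_def mem_source)
    qed (use 3 in \<open>auto simp: Src_form_def mem_source\<close>)
    then show ?thesis by (simp add: sgen_def psub_def additive_fn_0[OF additive_sl] )
  qed
qed

lemma Src_form_inj: "inj_on Src_form (carrier (Sr i))"
proof (rule inj_onI)
  fix x y assume x: "x \<in> carrier (Sr i)" and y: "y \<in> carrier (Sr i)" and eq: "Src_form x = Src_form y"
  show "x = y"
  proof (cases "i = -1")
    case True
    then have s: "snd x = 0" "snd y = 0" using x y by (simp_all add: mem_source)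
    then have "pm (fst x) e1 = pm (fst y) e1" using eq by (simp add: Src_form_def)
    then have "fst x = fst y" using lk_pm_e1 by metis
    then show ?thesis using s by (simp add: prod_eq_iff)
  next
    case False
    then have "fst x = 0" "fst y = 0" using x y by (simp_all add: mem_source)
    then show ?thesis using eq by (simp add: Src_form_def prod_eq_iff)
  qed
qed

definition cone_form :: "int \<Rightarrow> (('n, 'k) pol \<times> ('n, 'k) xform) \<times> ('n, 'k) tgt \<Rightarrow> ('n, 'k) xform" where
  "cone_form i z = Src_form (fst z) + inv_into (Hs i) (JT i) (snd z)"

lemma Cn_cases:
  assumes "z \<in> carrier (Cn i)"
  obtains a x where "a \<in> carrier (Sr (i - 1))" "x \<in> Hs i" "z = (a, JT i x)"
proof -
  have a: "fst z \<in> carrier (Sr (i - 1))" and tg: "snd z \<in> carrier (Tg i)" using assms by (auto simp: cone_def)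
  obtain x where x: "x \<in> Hs i" "snd z = JT i x" using tg by (rule Tg_cases)
  show thesis by (rule that[OF a x(1)]) (simp add: prod_eq_iff x(2))
qed

lemma cone_form_eq: "x \<in> Hs i \<Longrightarrow> cone_form i (a, JT i x) = Src_form a + x"
  by (simp add: cone_form_def inv_JT)

text \<open>The two summands have coefficients at different sets, so their sum inside the forms is
  direct, and it is generated by forms over k.\<close>

lemma free_cone: "free_module PR (Cn i)"
proof (rule free_module_iso_xmod)
  show "sgen {x + y | x y. x \<in> Src_form ` carrier (Sr (i - 1)) \<and> y \<in> Hs i}"
    by (rule sgen_plus[OF Src_form_image sgen_Hs])
  show "module PR (Cn i)" using cone_complex unfolding is_complex_def by blast
  let ?V = "{x + y | x y. x \<in> Src_form ` carrier (Sr (i - 1)) \<and> y \<in> Hs i}"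
  show "cone_form i \<in> mod_hom PR (Cn i) (xmod ?V)"
  proof (rule mod_homI)
    fix z assume "z \<in> carrier (Cn i)"
    then obtain a x where x: "a \<in> carrier (Sr (i - 1))" "x \<in> Hs i" "z = (a, JT i x)" by (rule Cn_cases)
    show "cone_form i z \<in> carrier (xmod ?V)"
      unfolding x(3) cone_form_eq[OF x(2)] xmod_simps using x(1,2) by blast
    show "cone_form i (r \<odot>\<^bsub>Cn i\<^esub> z) = r \<odot>\<^bsub>xmod ?V\<^esub> cone_form i z" for r
    proof -
      have "r \<odot>\<^bsub>Cn i\<^esub> z = ((r * fst a, pm r (snd a)), JT i (pm r x))"
        by (simp add: cone_def x(3) source_simps JT_smult)
      then show ?thesis
        by (simp add: x(3) cone_form_eq[OF x(2)] cone_form_eq[OF psub_pm[OF psub_Hs x(2)]] Src_form_def additive_fn_add[OF additive_pm] pm_pm)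
    qed
    fix Y assume "Y \<in> carrier (Cn i)"
    then obtain b y where y: "b \<in> carrier (Sr (i - 1))" "y \<in> Hs i" "Y = (b, JT i y)" by (rule Cn_cases)
    have "z \<oplus>\<^bsub>Cn i\<^esub> Y = ((fst a + fst b, snd a + snd b), JT i (x + y))"
      by (simp add: cone_def x(3) y(3) source_simps JT_add)
    then show "cone_form i (z \<oplus>\<^bsub>Cn i\<^esub> Y) = cone_form i z \<oplus>\<^bsub>xmod ?V\<^esub> cone_form i Y"
      by (simp add: x(3) y(3) cone_form_eq[OF x(2)] cone_form_eq[OF y(2)] cone_form_eq[OF psub_add[OF psub_Hs x(2) y(2)]]
          Src_form_def additive_fn_add[OF additive_pm_left] algebra_simps)
  qed
  show "inj_on (cone_form i) (carrier (Cn i))"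
  proof (rule inj_onI)
    fix z Y assume "z \<in> carrier (Cn i)" "Y \<in> carrier (Cn i)" and eq: "cone_form i z = cone_form i Y"
    obtain a x where x: "a \<in> carrier (Sr (i - 1))" "x \<in> Hs i" "z = (a, JT i x)" using \<open>z \<in> carrier (Cn i)\<close> by (rule Cn_cases)
    obtain b y where y: "b \<in> carrier (Sr (i - 1))" "y \<in> Hs i" "Y = (b, JT i y)" using \<open>Y \<in> carrier (Cn i)\<close> by (rule Cn_cases)
    have e: "Src_form a + x = Src_form b + y"
      using eq by (simp add: x(3) y(3) cone_form_eq[OF x(2)] cone_form_eq[OF y(2)])
    have "lk x S = lk y S" for S
    proof (cases "int (card S) = i")
      case True
      have "lk (Src_form a + x) S = lk (Src_form b + y) S" by (simp only: e)
      then show ?thesis by (simp add: lookup_add lk_Src_form[OF x(1) True] lk_Src_form[OF y(1) True])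
    next
      case False
      have "lk x S = 0" "lk y S = 0" using False T_lk[OF Hs_T[OF x(2)], of S] T_lk[OF Hs_T[OF y(2)], of S] by blast+
      then show ?thesis by simp
    qed
    then have xy: "x = y" by (rule poly_mapping_eqI)
    then have "Src_form a = Src_form b" using e by simp
    then have "a = b" by (rule inj_onD[OF Src_form_inj _ x(1) y(1)])
    then show "z = Y" by (simp only: x(3) y(3) xy)
  qed
  show "cone_form i ` carrier (Cn i) = ?V"
  proof (intro Set.set_eqI iffI)
    fix w assume "w \<in> cone_form i ` carrier (Cn i)"
    then obtain z where z: "z \<in> carrier (Cn i)" "w = cone_form i z" by blast
    obtain a x where x: "a \<in> carrier (Sr (i - 1))" "x \<in> Hs i" "z = (a, JT i x)" using z(1) by (rule Cn_cases)
    show "w \<in> ?V" unfolding z(2) x(3) cone_form_eq[OF x(2)] using x(1,2) by blast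
  next
    fix w assume "w \<in> ?V"
    then obtain a x where x: "a \<in> carrier (Sr (i - 1))" "x \<in> Hs i" "w = Src_form a + x" by blast
    show "w \<in> cone_form i ` carrier (Cn i)"
    proof (rule image_eqI)
      show "w = cone_form i (a, JT i x)" unfolding cone_form_eq[OF x(2)] by (rule x(3))
      show "(a, JT i x) \<in> carrier (Cn i)" using x(1) JT_Tg[OF x(2)] by (simp add: cone_def)
    qed
  qed
qed

lemma cone_neg: "i < 0 \<Longrightarrow> carrier (Cn i) = {\<zero>\<^bsub>Cn i\<^esub>}"
proof -
  assume i: "i < 0"
  have "carrier (Tg i) = {\<zero>\<^bsub>Tg i\<^esub>}" using i by (auto simp: target_def)
  moreover have "carrier (Sr (i - 1)) = {\<zero>\<^bsub>Sr (i - 1)\<^esub>}" using i by (auto simp: mem_source source_simps prod_eq_iff)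
  ultimately show ?thesis by (simp add: cone_def)
qed

lemma cone_resolution:
  assumes m1: "1 \<le> s - t"
  shows "free_resolution PR Cn Cd (quot_module pol_mod Jm) aug"
  unfolding free_resolution_def
proof (intro conjI allI impI)
  show "is_complex PR Cn Cd" by (rule cone_complex)
  show "module PR (quot_module pol_mod Jm)" by (rule module_quot_Jm)
  show "free_module PR (Cn i)" for i by (rule free_cone)
  show "carrier (Cn i) = {\<zero>\<^bsub>Cn i\<^esub>}" if "i < 0" for i by (rule cone_neg[OF that])
  show "aug \<in> mod_hom PR (Cn 0) (quot_module pol_mod Jm)" by (rule aug_hom)
  show "aug ` carrier (Cn 0) = carrier (quot_module pol_mod Jm)" by (rule aug_surj)
  show "{x \<in> carrier (Cn 0). aug x = \<zero>\<^bsub>quot_module pol_mod Jm\<^esub>} = Cd 1 ` carrier (Cn 1)" by (rule aug_kernel[OF m1])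
  show "{x \<in> carrier (Cn i). Cd i x = \<zero>\<^bsub>Cn (i - 1)\<^esub>} = Cd (i + 1) ` carrier (Cn (i + 1))" if i: "0 < i" for i
  proof (rule cone_exact[OF source_complex target_complex comparison_chain_map])
    show "\<exists>y\<in>carrier (Sr i). source_diff i y = x"
      if "x \<in> carrier (Sr (i - 1))" "source_diff (i - 1) x = \<zero>\<^bsub>Sr (i - 2)\<^esub>" for x
      using source_complex_exact[OF m1 _ that(1)] that(2) i by simp
    show "\<exists>y\<in>carrier (Tg (i + 1)). Td (i + 1) y = x"
      if "x \<in> carrier (Tg i)" "Td i x = \<zero>\<^bsub>Tg (i - 1)\<^esub>" for x
      using target_exact[OF _ that] i by simp
  qed
qed

end

text \<open>The unspecified entries may depend on \<pi>, so they are quantified after it, and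
  existence of some \<pi> is stated so that the quantifier over projections is not vacuous. The last
  conjunct makes the augmentation on the P in degree 0 the quotient map.\<close>

theorem theorem3p6:
  fixes J :: "('n::{finite,linorder}, 'k::field) pol set"
    and \<phi> :: "'n mon \<Rightarrow>\<^sub>0 'k"
    and s m t :: int
  assumes "artinian_gorenstein J"
    and "inverse_polynomial J \<phi> s"
    and "1 \<le> m"
    and "t = s - m"
  shows "(\<exists>\<pi>. is_projection \<phi> s t \<pi>) \<and>
    (\<forall>\<pi>. is_projection \<phi> s t \<pi> \<longrightarrow>
      (\<exists>\<omega> \<sigma> \<tau>. star_maps \<phi> s t \<omega> \<sigma> \<tau> \<and>
        is_complex PR (source m) source_diff \<and>
        is_complex PR (target \<phi> s t) (target_diff \<phi> s t \<pi> \<omega> \<sigma> \<tau>) \<and>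
        is_chain_map PR (source m) source_diff
          (target \<phi> s t) (target_diff \<phi> s t \<pi> \<omega> \<sigma> \<tau>) (comparison \<phi> s t) \<and>
        (\<exists>aug. free_resolution PR
            (cone (source m) (target \<phi> s t))
            (cone_diff (source m) source_diff
              (target \<phi> s t) (target_diff \<phi> s t \<pi> \<omega> \<sigma> \<tau>) (comparison \<phi> s t))
            (quot_module pol_mod (truncation J m)) aug \<and>
          (\<forall>p. aug ((p, 0), \<zero>\<^bsub>target \<phi> s t 0\<^esub>) = truncation J m +>\<^bsub>pol_mod\<^esub> p))))"
proof (intro conjI allI impI)
  have phi: "\<phi> \<noteq> 0" "\<phi> \<in> homog s" and J: "J = {r. contract r \<phi> = 0}"
    using assms(2) by (simp_all add: inverse_polynomial_def)
  \<comment> \<open>D'_t is extended from a k-space, so a projection onto K'_{n-1,t} comes from one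
    over k.\<close>
  obtain F :: "('n, 'k) xform \<Rightarrow> ('n, 'k) xform" where F: "plin F"
    "\<forall>w. F w \<in> ext (int CARD('n) - 1) (lift (Dk \<phi> s t)) \<and> eta (F w) = 0"
    "\<forall>w\<in>ext (int CARD('n) - 1) (lift (Dk \<phi> s t)). eta w = 0 \<longrightarrow> F w = w"
    using plin_projection[OF ksub_Dk[of \<phi> s t], where a = "int CARD('n) - 1"] by (elim exE conjE)
  have "is_projection \<phi> s t F"
    unfolding is_projection_def
  proof (intro conjI ballI mod_homI)
    show "F x \<in> carrier (xmod (K' \<phi> s (int CARD('n) - 1) t))" for x
      using F(2) by (simp add: K'_def D'_eq_lift)
    show "F y = y" if "y \<in> K' \<phi> s (int CARD('n) - 1) t" for y
      using F(3) that by (simp add: K'_def D'_eq_lift)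
  qed (simp_all add: plin_simps[OF F(1)])
  then show "\<exists>\<pi>. is_projection \<phi> s t \<pi>" by blast
  fix \<pi> :: "('n, 'k) xform \<Rightarrow> ('n, 'k) xform"
  assume pi: "is_projection \<phi> s t \<pi>"
  have pi_hom: "\<pi> \<in> mod_hom PR (xmod (K (int CARD('n) - 1) t)) (xmod (K' \<phi> s (int CARD('n) - 1) t))"
    and pi_id: "\<And>y. y \<in> K' \<phi> s (int CARD('n) - 1) t \<Longrightarrow> \<pi> y = y"
    using pi by (simp_all add: is_projection_def)
  note pi_simps = mod_homD[OF pi_hom, unfolded xmod_simps PR_simps]
  obtain h where h: "perturbation (VD \<phi> s t) (\<lambda>w. - eta w) (\<lambda>z. - etak z) h"
    "\<And>b w. cp b (h w) = h (cp (b - 1) w)" "\<And>v w. h (ins 0 (sl v w)) = ins 0 (sl v (h w))"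
    using splitting_exists[OF phi(2), of t] by metis
  interpret I: inverse_system \<phi> s t h
    by (rule inverse_system.intro[OF phi(2,1) h])
  \<comment> \<open>The splitting h is independent of \<pi>; the dependence on \<pi> enters through
    this base change alone.\<close>
  have "\<exists>\<theta>. plin \<theta> \<and> (\<forall>x. \<theta> x \<in> K' \<phi> s (int CARD('n) - 1) t) \<and> (\<forall>x. \<theta> (cp t x) = 0) \<and>
      (0 \<le> t \<longrightarrow> cp t I.z0 + \<theta> I.z0 = \<pi> (eps_dual t 1))"
    by (rule I.theta_exists) (simp_all add: pi_simps pi_id)
  then obtain \<theta> where \<theta>: "plin \<theta>" "\<forall>x. \<theta> x \<in> K' \<phi> s (int CARD('n) - 1) t" "\<forall>x. \<theta> (cp t x) = 0"
    "0 \<le> t \<longrightarrow> cp t I.z0 + \<theta> I.z0 = \<pi> (eps_dual t 1)" by (elim exE conjE)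
  interpret S: target_system \<phi> s t h \<pi> \<theta>
  proof
    show "\<pi> (eps_dual t p) = pm p (\<pi> (eps_dual t 1))" for p
      by (subst eps_dual_pm) (rule pi_simps(3)[OF UNIV_I eps_dual_K])
  qed (use \<theta> in blast)+
  have m: "m = s - t" using assms(4) by simp
  have trunc: "truncation J m = S.Jm"
    by (auto simp: truncation_def S.Jm_def J m deg_ge_def in_keys_iff)
  have res: "free_resolution PR
            (cone (source m) (target \<phi> s t))
            (cone_diff (source m) source_diff
              (target \<phi> s t) (target_diff \<phi> s t \<pi> S.\<omega> S.\<sigma> S.\<tau>) (comparison \<phi> s t))
            (quot_module pol_mod (truncation J m)) S.aug"
    unfolding trunc unfolding m by (rule S.cone_resolution) (use assms(3) m in simp)
  have unit: "\<forall>p. S.aug ((p, 0), \<zero>\<^bsub>target \<phi> s t 0\<^esub>) = truncation J m +>\<^bsub>pol_mod\<^esub> p"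
    unfolding trunc coset_pol_mod by (intro allI S.aug_unit)
  have chain: "is_chain_map PR (source m) source_diff
          (target \<phi> s t) (target_diff \<phi> s t \<pi> S.\<omega> S.\<sigma> S.\<tau>) (comparison \<phi> s t)"
    unfolding m by (rule S.comparison_chain_map)
  show "\<exists>\<omega> \<sigma> \<tau>. star_maps \<phi> s t \<omega> \<sigma> \<tau> \<and>
        is_complex PR (source m) source_diff \<and>
        is_complex PR (target \<phi> s t) (target_diff \<phi> s t \<pi> \<omega> \<sigma> \<tau>) \<and>
        is_chain_map PR (source m) source_diff
          (target \<phi> s t) (target_diff \<phi> s t \<pi> \<omega> \<sigma> \<tau>) (comparison \<phi> s t) \<and>
        (\<exists>aug. free_resolution PR
            (cone (source m) (target \<phi> s t))
            (cone_diff (source m) source_diff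
              (target \<phi> s t) (target_diff \<phi> s t \<pi> \<omega> \<sigma> \<tau>) (comparison \<phi> s t))
            (quot_module pol_mod (truncation J m)) aug \<and>
          (\<forall>p. aug ((p, 0), \<zero>\<^bsub>target \<phi> s t 0\<^esub>) = truncation J m +>\<^bsub>pol_mod\<^esub> p))"
    by (intro exI[of _ S.\<omega>] exI[of _ S.\<sigma>] exI[of _ S.\<tau>] exI[of _ S.aug] conjI
        S.star_maps_target source_complex S.target_complex chain res unit)
qed

end
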